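(* Let $p$ be a prime. A non-trivial cyclic $p$-group $G$ is uniquely determined, up to isomorphism, among all non-trivial cyclic $p$-groups by its smallest genus $\mu^+(G)\geq2$, with the single exception of the groups $\{\mathbb{Z}_2,\mathbb{Z}_4,\mathbb{Z}_8\}$, which have the same spectrum $\mathrm{sp}(\mathbb{Z}_2)=\mathrm{sp}(\mathbb{Z}_4)=\mathrm{sp}(\mathbb{Z}_8)=\mathbb{N}_0$.
   Context: A finite group $G$ acts on a compact Riemann surface $X$ if $G$ embeds into the group of biholomorphic self-maps of $X$. The spectrum $\mathrm{sp}(G)$ is the set of all $g\geq0$ such that $G$ acts on some compact Riemann surface of genus $g$. $\mu^+(G)$ denotes the smallest element of $\mathrm{sp}(G)$ that is at least $2$. $\mathbb{N}_0=\{0,1,2,\dots\}$. The prime $p$ is fixed in the comparison. *)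

theory Defs
  imports "HOL-Complex_Analysis.Complex_Analysis" "HOL-Homology.Homology" "HOL-Algebra.Bij"
begin

section \<open>Compact Riemann surfaces\<close>

type_synonym 'a chart = "'a set \<times> ('a \<Rightarrow> complex)"

definition complex_chart :: "'a topology \<Rightarrow> 'a chart \<Rightarrow> bool" where
  "complex_chart X = (\<lambda>(U, \<phi>).
     openin X U \<and> open (\<phi> ` U) \<and> homeomorphic_map (subtopology X U) (top_of_set (\<phi> ` U)) \<phi>)"

definition complex_atlas :: "'a topology \<Rightarrow> 'a chart set \<Rightarrow> bool" where
  "complex_atlas X A \<longleftrightarrow>
     (\<forall>c\<in>A. complex_chart X c) \<and> (\<Union>(U, \<phi>)\<in>A. U) = topspace X \<and>
     (\<forall>(U, \<phi>)\<in>A. \<forall>(V, \<psi>)\<in>A. (\<psi> \<circ> inv_into U \<phi>) holomorphic_on \<phi> ` (U \<inter> V))"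

definition compact_riemann_surface :: "'a topology \<Rightarrow> 'a chart set \<Rightarrow> bool" where
  "compact_riemann_surface X A \<longleftrightarrow>
     topspace X \<noteq> {} \<and> connected_space X \<and> Hausdorff_space X \<and> compact_space X \<and> complex_atlas X A"

definition holomorphic_map ::
  "'a topology \<Rightarrow> 'a chart set \<Rightarrow> 'b topology \<Rightarrow> 'b chart set \<Rightarrow> ('a \<Rightarrow> 'b) \<Rightarrow> bool" where
  "holomorphic_map X A Y B f \<longleftrightarrow>
     continuous_map X Y f \<and>
     (\<forall>(U, \<phi>)\<in>A. \<forall>(V, \<psi>)\<in>B. (\<psi> \<circ> f \<circ> inv_into U \<phi>) holomorphic_on \<phi> ` {x \<in> U. f x \<in> V})"

definition biholomorphism_group :: "'a topology \<Rightarrow> 'a chart set \<Rightarrow> ('a \<Rightarrow> 'a) monoid" where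
  "biholomorphism_group X A =
     (BijGroup (topspace X))
       \<lparr>carrier := {f \<in> Bij (topspace X).
          holomorphic_map X A X A f \<and> holomorphic_map X A X A (inv_into (topspace X) f)}\<rparr>"

definition has_genus :: "'a topology \<Rightarrow> nat \<Rightarrow> bool" where
  "has_genus X g \<longleftrightarrow> homology_group 1 X \<cong> free_Abelian_group {..<2 * g}"


section \<open>Group actions and genus spectra\<close>

definition acts_on_surface :: "'g monoid \<Rightarrow> 'a topology \<Rightarrow> 'a chart set \<Rightarrow> bool" where
  "acts_on_surface G X A \<longleftrightarrow> mon G (biholomorphism_group X A) \<noteq> {}"

(* A compact Riemann surface has at most continuum many points, so its points may be taken
   to be complex numbers; the topology on them is arbitrary.  Lemma spectrumI shows that
   surfaces over other types give no further genera. *)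
definition spectrum :: "'g monoid \<Rightarrow> nat set" where
  "spectrum G = {g. \<exists>(X :: complex topology) A.
     compact_riemann_surface X A \<and> has_genus X g \<and> acts_on_surface G X A}"

definition min_genus :: "'g monoid \<Rightarrow> nat" where
  "min_genus G = (LEAST g. g \<in> spectrum G \<and> g \<ge> 2)"

definition nontrivial_cyclic_p_group :: "nat \<Rightarrow> 'g monoid \<Rightarrow> bool" where
  "nontrivial_cyclic_p_group p G \<longleftrightarrow>
     group G \<and> cyclic_group G \<and> \<not> trivial_group G \<and> (\<exists>n. order G = p ^ n)"



section \<open>Independence of the point type\<close>

lemma inv_into_image_chart:
  assumes "inj_on \<phi> U" "\<And>x. x \<in> U \<Longrightarrow> g (f x) = x" "z \<in> \<phi> ` U"
  shows "inv_into (f ` U) (\<phi> \<circ> g) z = f (inv_into U \<phi> z)"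
proof -
  have "inj_on (\<phi> \<circ> g) (f ` U)"
    using assms(1,2) by (auto simp: inj_on_def)
  moreover have "f (inv_into U \<phi> z) \<in> f ` U" "(\<phi> \<circ> g) (f (inv_into U \<phi> z)) = z"
    using assms by (auto simp: inv_into_into f_inv_into_f)
  ultimately show ?thesis
    by (metis inv_into_f_f)
qed

definition image_atlas :: "('a \<Rightarrow> 'b) \<Rightarrow> ('b \<Rightarrow> 'a) \<Rightarrow> 'a chart set \<Rightarrow> 'b chart set" where
  "image_atlas f g A = (\<lambda>(U, \<phi>). (f ` U, \<phi> \<circ> g)) ` A"

lemma complex_atlasD:
  assumes "complex_atlas X A" "(U, \<phi>) \<in> A"
  shows "openin X U" "open (\<phi> ` U)" "inj_on \<phi> U" "U \<subseteq> topspace X"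
    "homeomorphic_map (subtopology X U) (top_of_set (\<phi> ` U)) \<phi>"
proof -
  have c: "complex_chart X (U, \<phi>)"
    using assms unfolding complex_atlas_def by blast
  then show 1: "openin X U" "open (\<phi> ` U)"
    "homeomorphic_map (subtopology X U) (top_of_set (\<phi> ` U)) \<phi>"
    by (auto simp: complex_chart_def)
  show 2: "U \<subseteq> topspace X"
    using 1(1) by (rule openin_subset)
  show "inj_on \<phi> U"
    using homeomorphic_imp_injective_map[OF 1(3)] 2 by (simp add: Int_absorb1)
qed

lemma complex_atlas_image:
  assumes fg: "homeomorphic_maps X Y f g" and A: "complex_atlas X A"
  shows "complex_atlas Y (image_atlas f g A)"
proof -
  have gf: "g (f x) = x" if "x \<in> topspace X" for x
    using fg that by (simp add: homeomorphic_maps_def)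
  have f: "homeomorphic_map X Y f" and g: "homeomorphic_map Y X g"
    using fg by (simp_all add: homeomorphic_maps_map)
  note D = complex_atlasD[OF A]
  have "complex_chart Y (f ` U, \<phi> \<circ> g)" if U: "(U, \<phi>) \<in> A" for U \<phi>
  proof -
    have im: "g ` f ` U = U" "(\<phi> \<circ> g) ` f ` U = \<phi> ` U"
      using gf D(4)[OF U] by (force simp: image_iff)+
    have "homeomorphic_map (subtopology Y (f ` U)) (subtopology X U) g"
      using homeomorphic_map_subtopologies[OF g, of "f ` U" U] D(4)[OF U] im(1)
        homeomorphic_imp_surjective_map[OF f]
      by (metis Int_absorb1 image_mono)
    then have "homeomorphic_map (subtopology Y (f ` U)) (top_of_set (\<phi> ` U)) (\<phi> \<circ> g)"
      using D(5)[OF U] homeomorphic_map_compose by blast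
    moreover have "openin Y (f ` U)"
      using homeomorphic_map_openness[OF f D(4)[OF U]] D(1)[OF U] by simp
    ultimately show ?thesis
      using D(2)[OF U] by (simp add: complex_chart_def flip: im(2))
  qed
  moreover have "(\<Union>(U, \<phi>)\<in>image_atlas f g A. U) = topspace Y"
  proof -
    have "(\<Union>(U, \<phi>)\<in>image_atlas f g A. U) = f ` (\<Union>(U, \<phi>)\<in>A. U)"
      by (force simp: image_atlas_def)
    then show ?thesis
      using A homeomorphic_imp_surjective_map[OF f] by (simp add: complex_atlas_def)
  qed
  moreover have "((\<psi> \<circ> g) \<circ> inv_into (f ` U) (\<phi> \<circ> g)) holomorphic_on (\<phi> \<circ> g) ` (f ` U \<inter> f ` V)"
    if U: "(U, \<phi>) \<in> A" and V: "(V, \<psi>) \<in> A" for U \<phi> V \<psi>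
  proof -
    have dom: "(\<phi> \<circ> g) ` (f ` U \<inter> f ` V) = \<phi> ` (U \<inter> V)"
    proof -
      have "f ` U \<inter> f ` V = f ` (U \<inter> V)"
        using D(4)[OF U] D(4)[OF V] homeomorphic_imp_injective_map[OF f]
        by (metis inj_on_image_Int)
      moreover have "g ` f ` (U \<inter> V) = U \<inter> V"
        using gf D(4)[OF U] by (force simp: image_iff)
      ultimately show ?thesis by (metis image_comp)
    qed
    have eq: "((\<psi> \<circ> g) \<circ> inv_into (f ` U) (\<phi> \<circ> g)) z = (\<psi> \<circ> inv_into U \<phi>) z"
      if "z \<in> \<phi> ` (U \<inter> V)" for z
    proof -
      have z: "z \<in> \<phi> ` U" using that by blast
      then have "inv_into U \<phi> z \<in> topspace X"
        using D(4)[OF U] by (meson inv_into_into subsetD)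
      moreover have "inv_into (f ` U) (\<phi> \<circ> g) z = f (inv_into U \<phi> z)"
        using z D(4)[OF U] by (intro inv_into_image_chart D(3)[OF U]) (auto simp: gf)
      ultimately show ?thesis by (simp add: gf)
    qed
    have "(\<psi> \<circ> inv_into U \<phi>) holomorphic_on \<phi> ` (U \<inter> V)"
    proof -
      have "\<forall>(U, \<phi>)\<in>A. \<forall>(V, \<psi>)\<in>A. (\<psi> \<circ> inv_into U \<phi>) holomorphic_on \<phi> ` (U \<inter> V)"
        using A unfolding complex_atlas_def by (elim conjE)
      from bspec[OF this U] show ?thesis
        using V by (auto dest: bspec)
    qed
    then show ?thesis
      unfolding dom by (rule holomorphic_transform) (rule eq[symmetric])
  qed
  ultimately show ?thesis
    unfolding complex_atlas_def by (simp add: image_atlas_def split_beta)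
qed

lemma holomorphic_map_image:
  assumes fg: "homeomorphic_maps X Y f g" and A: "complex_atlas X A"
    and h: "holomorphic_map X A X A h"
    and h': "\<And>y. y \<in> topspace Y \<Longrightarrow> h' y = f (h (g y))"
  shows "holomorphic_map Y (image_atlas f g A) Y (image_atlas f g A) h'"
proof -
  have gf: "g (f x) = x" "f x \<in> topspace Y" if "x \<in> topspace X" for x
    using fg that by (auto simp: homeomorphic_maps_def continuous_map_def)
  have inj: "inj_on f (topspace X)"
    using gf(1) by (rule inj_on_inverseI)
  have hX: "h x \<in> topspace X" if "x \<in> topspace X" for x
    using h that by (auto simp: holomorphic_map_def continuous_map_def)
  note D = complex_atlasD[OF A]
  have "continuous_map Y Y (f \<circ> h \<circ> g)"
    using fg h unfolding holomorphic_map_def homeomorphic_maps_def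
    by (meson continuous_map_compose)
  then have "continuous_map Y Y h'"
    by (rule continuous_map_eq) (simp add: h')
  moreover have "((\<psi> \<circ> g) \<circ> h' \<circ> inv_into (f ` U) (\<phi> \<circ> g)) holomorphic_on
      (\<phi> \<circ> g) ` {y \<in> f ` U. h' y \<in> f ` V}"
    if U: "(U, \<phi>) \<in> A" and V: "(V, \<psi>) \<in> A" for U \<phi> V \<psi>
  proof -
    have "{y \<in> f ` U. h' y \<in> f ` V} = f ` {x \<in> U. h x \<in> V}"
    proof -
      have "h' (f x) \<in> f ` V \<longleftrightarrow> h x \<in> V" if "x \<in> U" for x
        using D(4)[OF U] D(4)[OF V] that gf hX inj_on_image_mem_iff[OF inj, of "h x" V]
        by (simp add: h' subset_iff)
      then show ?thesis by blast
    qed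
    moreover have "g ` f ` {x \<in> U. h x \<in> V} = {x \<in> U. h x \<in> V}"
      using gf D(4)[OF U] by (force simp: image_iff)
    ultimately have dom: "(\<phi> \<circ> g) ` {y \<in> f ` U. h' y \<in> f ` V} = \<phi> ` {x \<in> U. h x \<in> V}"
      by (metis image_comp)
    have eq: "((\<psi> \<circ> g) \<circ> h' \<circ> inv_into (f ` U) (\<phi> \<circ> g)) z = (\<psi> \<circ> h \<circ> inv_into U \<phi>) z"
      if "z \<in> \<phi> ` {x \<in> U. h x \<in> V}" for z
    proof -
      have z: "z \<in> \<phi> ` U" using that by blast
      then have "inv_into U \<phi> z \<in> topspace X"
        using D(4)[OF U] by (meson inv_into_into subsetD)
      moreover have "inv_into (f ` U) (\<phi> \<circ> g) z = f (inv_into U \<phi> z)"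
        using z D(4)[OF U] by (intro inv_into_image_chart D(3)[OF U]) (auto simp: gf)
      ultimately show ?thesis by (simp add: gf h' hX)
    qed
    have "(\<psi> \<circ> h \<circ> inv_into U \<phi>) holomorphic_on \<phi> ` {x \<in> U. h x \<in> V}"
      using h U V unfolding holomorphic_map_def by blast
    then show ?thesis
      unfolding dom by (rule holomorphic_transform) (rule eq[symmetric])
  qed
  ultimately show ?thesis
    by (auto simp: holomorphic_map_def image_atlas_def)
qed

lemma acts_on_surface_image:
  assumes fg: "homeomorphic_maps X Y f g" and A: "complex_atlas X A" and G: "acts_on_surface G X A"
  shows "acts_on_surface G Y (image_atlas f g A)"
proof -
  let ?S = "topspace X" and ?T = "topspace Y" and ?B = "image_atlas f g A"
  have gf: "g (f x) = x" "f x \<in> ?T" if "x \<in> ?S" for x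
    using fg that by (auto simp: homeomorphic_maps_def continuous_map_def)
  have fgy: "f (g y) = y" "g y \<in> ?S" if "y \<in> ?T" for y
    using fg that by (auto simp: homeomorphic_maps_def continuous_map_def)
  have bij: "bij_betw f ?S ?T" "bij_betw g ?T ?S"
    by (rule bij_betwI[of _ _ _ g] bij_betwI[of _ _ _ f]; auto simp: gf fgy)+
  define c where "c h = restrict (f \<circ> h \<circ> g) ?T" for h
  have cBij: "c h \<in> Bij ?T" if "h \<in> Bij ?S" for h
  proof -
    have "bij_betw (f \<circ> h \<circ> g) ?T ?T"
      using that bij by (auto simp: Bij_def intro!: bij_betw_trans)
    then show ?thesis by (auto simp: Bij_def c_def cong: bij_betw_cong)
  qed
  have cinv: "inv_into ?T (c h) y = f (inv_into ?S h (g y))" if h: "h \<in> Bij ?S" and y: "y \<in> ?T" for h y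
  proof -
    have hS: "bij_betw h ?S ?S" using h by (simp add: Bij_def)
    have "inv_into ?S h (g y) \<in> ?S" "h (inv_into ?S h (g y)) = g y"
      using hS fgy(2)[OF y] by (auto simp: bij_betw_def inv_into_into f_inv_into_f)
    then have "f (inv_into ?S h (g y)) \<in> ?T" "c h (f (inv_into ?S h (g y))) = y"
      using y by (auto simp: c_def gf fgy)
    moreover have "inj_on (c h) ?T"
      using cBij[OF h] by (simp add: Bij_def bij_betw_def)
    ultimately show ?thesis by (metis inv_into_f_f)
  qed
  have carr: "c h \<in> carrier (biholomorphism_group Y ?B)"
    if "h \<in> carrier (biholomorphism_group X A)" for h
  proof -
    have h: "h \<in> Bij ?S" "holomorphic_map X A X A h" "holomorphic_map X A X A (inv_into ?S h)"
      using that by (auto simp: biholomorphism_group_def)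
    have "holomorphic_map Y ?B Y ?B (c h)"
      by (rule holomorphic_map_image[OF fg A h(2)]) (simp add: c_def)
    moreover have "holomorphic_map Y ?B Y ?B (inv_into ?T (c h))"
      by (rule holomorphic_map_image[OF fg A h(3)]) (rule cinv[OF h(1)])
    ultimately show ?thesis
      using cBij[OF h(1)] by (simp add: biholomorphism_group_def)
  qed
  have mult: "c (h \<otimes>\<^bsub>biholomorphism_group X A\<^esub> k) = c h \<otimes>\<^bsub>biholomorphism_group Y ?B\<^esub> c k"
    if "h \<in> Bij ?S" "k \<in> Bij ?S" for h k
  proof -
    have "k x \<in> ?S" if "x \<in> ?S" for x
      using \<open>k \<in> Bij ?S\<close> that by (auto simp: Bij_def bij_betw_def)
    then show ?thesis
      using that cBij by (auto simp: biholomorphism_group_def BijGroup_def compose_def c_def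
          fun_eq_iff gf fgy)
  qed
  have inj: "h = k" if "h \<in> Bij ?S" "k \<in> Bij ?S" "c h = c k" for h k
  proof
    fix x
    show "h x = k x"
    proof (cases "x \<in> ?S")
      case True
      then have "c h (f x) = c k (f x)" "h x \<in> ?S" "k x \<in> ?S"
        using that by (auto simp: Bij_def bij_betw_def)
      then show ?thesis
        using True by (simp add: c_def gf) (metis gf(1))
    next
      case False
      then show ?thesis
        using that by (simp add: Bij_def extensional_def)
    qed
  qed
  obtain k where k: "k \<in> hom G (biholomorphism_group X A)" "inj_on k (carrier G)"
    using G by (auto simp: acts_on_surface_def mon_def)
  have kB: "k a \<in> Bij ?S" if "a \<in> carrier G" for a
    using hom_in_carrier[OF k(1) that] by (auto simp: biholomorphism_group_def)
  have "c \<circ> k \<in> hom G (biholomorphism_group Y ?B)"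
    using hom_in_carrier[OF k(1)] hom_mult[OF k(1)] kB by (intro homI) (simp_all add: carr mult)
  moreover have "inj_on (c \<circ> k) (carrier G)"
    using k(2) kB inj by (auto simp: inj_on_def)
  ultimately show ?thesis
    by (auto simp: acts_on_surface_def mon_def)
qed

lemma compact_riemann_surface_inj_complex:
  assumes "compact_riemann_surface X A"
  obtains f :: "'a \<Rightarrow> complex" where "inj_on f (topspace (X :: 'a topology))"
proof -
  have A: "complex_atlas X A" and "compact_space X"
    using assms by (simp_all add: compact_riemann_surface_def)
  have *: "\<Union> (fst ` A) = topspace X"
    using A unfolding complex_atlas_def by (auto simp: case_prod_beta)
  have "\<forall>U \<in> fst ` A. openin X U"
    using complex_atlasD(1)[OF A] by auto
  then obtain \<F> where \<F>: "finite \<F>" "\<F> \<subseteq> fst ` A" "topspace X \<subseteq> \<Union> \<F>"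
    using \<open>compact_space X\<close> * unfolding compact_space_alt by (metis subset_refl)
  have "topspace X \<lesssim> (UNIV :: complex set)"
  proof -
    have "\<Union> \<F> \<lesssim> (UNIV :: complex set)"
      using \<F>(1,2)
    proof (induction \<F>)
      case empty
      show ?case by simp
    next
      case (insert U \<F>)
      obtain \<phi> where "(U, \<phi>) \<in> A" using insert.prems by auto
      then have "|U| \<le>o |UNIV :: complex set|"
        using complex_atlasD(3)[OF A] by (auto simp flip: card_of_ordLeq)
      moreover have "|\<Union> \<F>| \<le>o |UNIV :: complex set|"
        using insert unfolding lepoll_def by (auto simp flip: card_of_ordLeq)
      moreover have "infinite (UNIV :: complex set)"
        by (simp add: infinite_UNIV_char_0)
      ultimately have "|U \<union> \<Union> \<F>| \<le>o |UNIV :: complex set|"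
        by (intro card_of_Un_ordLeq_infinite)
      then show ?case
        using card_of_ordLeq[of "U \<union> \<Union> \<F>" "UNIV :: complex set"] by (auto simp: lepoll_def)
    qed
    then show ?thesis
      using \<F>(3) subset_imp_lepoll lepoll_trans by blast
  qed
  then show ?thesis
    using that by (auto simp: lepoll_def)
qed

lemma spectrumI:
  assumes X: "compact_riemann_surface (X :: 'a topology) A" "has_genus X g" "acts_on_surface G X A"
  shows "g \<in> spectrum G"
proof -
  obtain f :: "'a \<Rightarrow> complex" where f: "inj_on f (topspace X)"
    using compact_riemann_surface_inj_complex[OF X(1)] .
  define h where "h = inv_into (topspace X) f"
  define Y where "Y = pullback_topology (f ` topspace X) h X"
  have hf: "h (f x) = x" if "x \<in> topspace X" for x
    using f that by (simp add: h_def)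
  have Y: "topspace Y = f ` topspace X"
    by (auto simp: Y_def topspace_pullback_topology hf)
  have "continuous_map X Y f"
    unfolding Y_def
    by (rule continuous_map_pullback') (auto intro: continuous_map_eq[OF continuous_map_id] simp: hf)
  moreover have "continuous_map Y X h"
    unfolding Y_def by (metis continuous_map_id continuous_map_pullback id_comp)
  ultimately have fh: "homeomorphic_maps X Y f h"
    by (auto simp: homeomorphic_maps_def hf Y)
  then have XY: "X homeomorphic_space Y"
    by (auto simp: homeomorphic_space_def)
  have A: "complex_atlas X A"
    using X(1) by (simp add: compact_riemann_surface_def)
  have "compact_riemann_surface Y (image_atlas f h A)"
    using X(1) complex_atlas_image[OF fh A] XY Y
    by (simp add: compact_riemann_surface_def homeomorphic_connected_space
        homeomorphic_Hausdorff_space homeomorphic_compact_space)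
  moreover have "has_genus Y g"
    using X(2) homeomorphic_space_imp_isomorphic_homology_groups[OF XY, of 1] unfolding has_genus_def
    by (meson group.iso_sym group_relative_homology_group iso_trans)
  moreover have "acts_on_surface G Y (image_atlas f h A)"
    by (rule acts_on_surface_image[OF fh A X(3)])
  ultimately show ?thesis
    by (auto simp: spectrum_def)
qed

end

theory Submission
 imports Defs "HOL-Number_Theory.Cong" "HOL-Computational_Algebra.Polynomial_Factorial"
begin

text \<open>Let a cyclic group of order \<open>q = p\<^sup>k\<^sup>+\<^sup>1\<close> with generator \<open>h\<close> act on a surface of genus \<open>g \<ge> 2\<close>. If the map
 \<open>h ^^ p ^ k\<close> of order \<open>p\<close> were trivial on the first homology, a transfer argument on singular chains would
 show that the homology modulo \<open>p\<close> is generated by two classes, which contradicts \<open>g \<ge> 2\<close>. Hence \<open>h\<close> acts on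
 the homology, a free group of rank \<open>2 g\<close>, with order exactly \<open>q\<close>, and therefore \<open>\<phi>(q) \<le> 2 g\<close>.
 Conversely, a polygon whose sides are glued compatibly with a rotation is a Riemann surface with a cyclic group
 of automorphisms, whose genus is read off the gluing. The genera obtained in this way stay below the lower bound
 for the order \<open>p q\<close>, so the smallest genus increases strictly with \<open>q\<close>, except for the orders 2, 4 and 8. For
 these every genus occurs, genus 1 through translations of a torus.\<close>

text \<open>The bounds on the two sides need not be sharp; what matters is the slack between
  consecutive orders. For odd p a genus below q is realised for order q, while order p q requires at
  least (p - 1) q / 2 >= q. For p = 2 and q >= 16 a genus below q / 2 is realised, while order 2 q
  requires at least q / 2. The orders 2, 4, 8 share the minimum 2 because phi(8) = 4 still allows
  it. The lower bound is shaped by the branch points, where the action on simplices is not free and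
  the orbit space is not known to be a surface. An invariant neighbourhood N of the fixed points is
  therefore set apart. Modulo chains in N the chains form a free module over the group ring, so that
  invariant chains are norms and chains of norm zero have the form h v - v. What is left inside N is
  harmless, because N falls into pieces inside contractible discs, one for each fixed point. The
  step from order q to rank phi(q) uses no rational representation theory: the kernel of the
  cyclotomic polynomial would be divisible by every power of p if the rank were smaller.\<close>

abbreviation (input) Zmod where "Zmod \<equiv> integer_mod_group"

abbreviation keys where "keys \<equiv> Poly_Mapping.keys"

abbreviation lookup where "lookup \<equiv> Poly_Mapping.lookup"

notation frag_cmul (infixr "*." 75) and subtopology (infixl "on" 80)

abbreviation Delta where "Delta \<equiv> standard_simplex"

abbreviation chain where "chain \<equiv> singular_chain"

abbreviation bdry where "bdry \<equiv> chain_boundary"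

abbreviation relcycle where "relcycle \<equiv> singular_relcycle"

abbreviation relboundary where "relboundary \<equiv> singular_relboundary"

lemmas relcycle = singular_relcycle and relboundary = singular_relboundary

abbreviation cycle :: "nat => 'a topology => 'a chain => bool" where
 "cycle p X \<equiv> singular_relcycle p X {}"

abbreviation boundary :: "nat => 'a topology => 'a chain => bool" where
 "boundary p X \<equiv> singular_relboundary p X {}"

abbreviation homologous :: "nat => 'a topology => 'a chain => 'a chain => bool" where
 "homologous p X \<equiv> homologous_rel p X {}"

section \<open>Relative cycles and compact subsets of a surface\<close>

lemma singular_chain_subdivision_power:
 "chain p X c ==> chain p X ((singular_subdivision p ^^ n) c)"
 by (induction n) (auto simp: singular_chain_singular_subdivision)

lemma singular_subdivision_power_add:
 "(singular_subdivision p ^^ n) (a + b) = (singular_subdivision p ^^ n) a + (singular_subdivision p ^^ n) b"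
 by (induction n) (auto simp: singular_subdivision_add)

lemma chain_boundary_subdivision_power:
 "chain p X c ==> bdry p ((singular_subdivision p ^^ n) c) = (singular_subdivision (p - Suc 0) ^^ n) (bdry p c)"
 by (induction n)
   (auto simp: chain_boundary_singular_subdivision[OF singular_chain_subdivision_power])

lemma chain_map_subdivision_power:
 "chain p X c ==>
   (singular_subdivision p ^^ n) (chain_map p g c) = chain_map p g ((singular_subdivision p ^^ n) c)"
 by (induction n) (auto simp: naturality_singular_subdivision[OF singular_chain_subdivision_power])

lemma singular_relcycle_subdivision_power:
 assumes "relcycle p X S c"
 shows "relcycle p X S ((singular_subdivision p ^^ n) c)"
  and "homologous_rel p X S ((singular_subdivision p ^^ n) c) c"
proof -
 have *: "relcycle p X S ((singular_subdivision p ^^ n) c) \<and>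
      homologous_rel p X S ((singular_subdivision p ^^ n) c) c"
 proof (induction n)
  case (Suc n)
  thus ?case
   using homologous_rel_singular_subdivision homologous_rel_singular_relcycle homologous_rel_trans
   by (metis comp_apply funpow.simps(2))
 qed (use assms in auto)
 thus "relcycle p X S ((singular_subdivision p ^^ n) c)"
  "homologous_rel p X S ((singular_subdivision p ^^ n) c) c" by blast+
qed

lemma singular_relboundary_mono:
 assumes "relboundary p X S c" "S <= T"
 shows "relboundary p X T c" using assms unfolding relboundary by (blast intro: singular_chain_mono)

lemma singular_relcycle_mono:
 assumes "relcycle p X S c" "S <= T"
 shows "relcycle p X T c" using assms unfolding relcycle by (meson singular_chain_mono)

lemma homologous_rel_mono:
 "homologous_rel p X S a b ==> S <= T ==> homologous_rel p X T a b"
 unfolding homologous_rel_def by (rule singular_relboundary_mono)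

lemma homologous_rel_singular_relboundary:
 "homologous_rel p X S a b ==> relboundary p X S a \<longleftrightarrow> relboundary p X S b" unfolding homologous_rel_def
 by (metis diff_add_cancel singular_relboundary_add singular_relboundary_minus minus_diff_eq)

lemma small_chain_split:
 assumes U: "openin X U" and V: "openin X V"
  and w: "chain p (X on (U \<union> V)) w"
 obtains n d e where "chain p (X on U) d" "chain p (X on V) e"
  "(singular_subdivision p ^^ n) w = d + e"
proof -
 let ?Y = "X on (U \<union> V)"
 obtain n where n: "!!m f. [|n <= m; f \<in> keys ((singular_subdivision p ^^ m) w)|] ==> \<exists>W \<in> {U, V}. f \<in> (Delta p) \<rightarrow> W"
 proof (rule sufficient_iterated_singular_subdivision_exists)
  show "!!W. W \<in> {U, V} ==> openin ?Y W"
   using U V by (auto intro: openin_subtopology_Un openin_subset_topspace_eq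
     simp: openin_open_subtopology openin_Un)
  show "topspace ?Y <= \<Union>{U, V}" by auto
 qed (use w in auto)
 let ?c = "(singular_subdivision p ^^ n) w"
 have c: "chain p ?Y ?c" using w by (rule singular_chain_subdivision_power)
 have "keys ?c <= {f. singular_simplex p X f \<and> f ` Delta p <= U}
   \<union> {f. singular_simplex p X f \<and> f ` Delta p <= V}" using n[OF order_refl] c
  by (fastforce simp: singular_chain_def singular_simplex_subtopology)
 then obtain d e where "keys d <= {f. singular_simplex p X f \<and> f ` Delta p <= U}"
  "keys e <= {f. singular_simplex p X f \<and> f ` Delta p <= V}" "d + e = ?c"
  using frag_split by (metis (no_types, lifting))
 thus thesis by (intro that[of d e n]) (auto simp: singular_chain_def singular_simplex_subtopology)
qed

text \<open>The exactness of the relative Mayer--Vietoris sequence at the middle term, at the level of chains.\<close>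

lemma singular_relboundary_Int:
 assumes U: "openin X U" and V: "openin X V"
  and cU: "relboundary p X U c" and cV: "relboundary p X V c"
  and c: "relcycle p X (U \<inter> V) c"
  and van: "!!d. relcycle (Suc p) X (U \<union> V) d ==> relboundary (Suc p) X (U \<union> V) d"
 shows "relboundary p X (U \<inter> V) c"
proof -
 obtain d u where d: "chain (Suc p) X d" and u: "chain p (X on U) u"
  and cd: "bdry (Suc p) d + u = c" using cU unfolding relboundary by blast
 obtain d' v where d': "chain (Suc p) X d'" and v: "chain p (X on V) v"
  and cd': "bdry (Suc p) d' + v = c" using cV unfolding relboundary by blast
 have eq: "bdry (Suc p) (d - d') = v - u"
 proof -
  have "bdry (Suc p) d = c - u" "bdry (Suc p) d' = c - v" using cd cd' by (simp_all add: eq_diff_eq)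
  thus ?thesis by (simp add: chain_boundary_diff)
 qed
 have uv: "chain p (X on (U \<union> V)) u" "chain p (X on (U \<union> V)) v" using u v by (auto intro: singular_chain_mono)
 have "relcycle (Suc p) X (U \<union> V) (d - d')" using d d' uv by (simp add: relcycle eq singular_chain_diff)
 then obtain e w where e: "chain (Suc (Suc p)) X e"
  and w: "chain (Suc p) (X on (U \<union> V)) w"
  and ew: "bdry (Suc (Suc p)) e + w = d - d'" using van unfolding relboundary by blast
 have "bdry (Suc p) (bdry (Suc (Suc p)) e) = 0" using e chain_boundary_boundary_alt by blast
 hence bw: "bdry (Suc p) w = v - u" using eq ew by (metis add_0 chain_boundary_add)
 obtain n wu wv where wu: "chain (Suc p) (X on U) wu"
  and wv: "chain (Suc p) (X on V) wv"
  and sw: "(singular_subdivision (Suc p) ^^ n) w = wu + wv" using small_chain_split[OF U V w] .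
 let ?s = "\<lambda>q. singular_subdivision q ^^ n"
 have "?s p (v - u) = bdry (Suc p) (wu + wv)"
  using chain_boundary_subdivision_power[OF w, of n] by (simp add: bw sw)
 hence eq2: "?s p u + bdry (Suc p) wu = ?s p v - bdry (Suc p) wv"
  by (simp add: singular_subdivision_power_diff chain_boundary_add algebra_simps)
 \<comment> \<open>By \<open>eq2\<close> this chain has one expression inside U and another inside
   V, so it lies in the intersection; it becomes the remainder of the subdivided
   \<open>c\<close>.\<close>
 let ?r = "?s p u + bdry (Suc p) wu"
 have "chain p (X on U) ?r"
  using u wu by (auto intro!: singular_chain_add singular_chain_subdivision_power singular_chain_boundary_alt)
 moreover have "chain p (X on V) ?r" unfolding eq2 using v wv
  by (auto intro!: singular_chain_diff singular_chain_subdivision_power singular_chain_boundary_alt)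
 ultimately have r: "chain p (X on (U \<inter> V)) ?r" by (auto simp: singular_chain_subtopology)
 have "?s p c = bdry (Suc p) (?s (Suc p) d - wu) + ?r" using chain_boundary_subdivision_power[OF d, of n]
  by (simp add: chain_boundary_diff flip: cd singular_subdivision_power_add)
 moreover have "chain (Suc p) X (?s (Suc p) d - wu)"
  using d wu by (auto intro!: singular_chain_diff singular_chain_subdivision_power
    simp: singular_chain_subtopology)
 ultimately have "relboundary p X (U \<inter> V) (?s p c)" using r unfolding relboundary by metis
 thus ?thesis
  using singular_relcycle_subdivision_power(2)[OF c] homologous_rel_singular_relboundary by blast
qed

section \<open>Relative homology of the plane with respect to complements of compact sets\<close>

lemma trivial_homology_boundary:
 assumes "trivial_group (relative_homology_group (int p) X S)" "relcycle p X S c"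
 shows "relboundary p X S c"
proof -
 have "homologous_rel_set p X S c \<in> carrier (relative_homology_group (int p) X S)"
  using assms(2) by (simp add: carrier_relative_homology_group)
 hence "homologous_rel_set p X S c = \<one>\<^bsub>relative_homology_group (int p) X S\<^esub>"
  using assms(1) by (simp add: trivial_group_def)
 thus ?thesis by (simp add: homologous_rel_set_eq_relboundary)
qed

lemma contractible_cycle_boundary:
 assumes "contractible_space X" "p > 0" "cycle p X c"
 shows "boundary p X c"
proof (rule trivial_homology_boundary[OF _ assms(3)])
 show "trivial_group (homology_group (int p) X)"
  using trivial_reduced_homology_group_contractible_space[OF assms(1), of "int p"] assms(2)
  by (simp add: un_reduced_homology_group)
qed

lemma homology_group_circle:
 fixes x :: complex
 shows "homology_group 1 (top_of_set (sphere x 1)) \<cong> integer_group"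
  and "p ~= 0 ==> p ~= 1 ==> trivial_group (homology_group p (top_of_set (sphere x 1)))"
proof -
 have B: "independent (Basis :: complex set)" "pairwise orthogonal (Basis :: complex set)"
  by (auto simp: independent_Basis orthogonal_Basis)
 obtain f g where "homeomorphic_maps (nsphere (2 - 1)) (top_of_set (sphere 0 1 \<inter> span (Basis :: complex set))) f g"
  by (rule homeomorphic_maps_nsphere_euclidean_sphere[OF B, of 2]) auto
 hence "nsphere 1 homeomorphic_space top_of_set (sphere (0::complex) 1)"
  unfolding homeomorphic_space_def by auto
 moreover have "top_of_set (sphere (0::complex) 1) homeomorphic_space top_of_set (sphere x 1)"
  by (simp add: homeomorphic_spheres)
 ultimately have h: "top_of_set (sphere x 1) homeomorphic_space nsphere 1"
  by (meson homeomorphic_space_sym homeomorphic_space_trans)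
 have iso: "homology_group p (top_of_set (sphere x 1)) \<cong> homology_group p (nsphere 1)" for p
  using h by (rule homeomorphic_space_imp_isomorphic_homology_groups)
 show "homology_group 1 (top_of_set (sphere x 1)) \<cong> integer_group"
  using iso[of 1] reduced_homology_group_nsphere(1)[of 1] by (simp add: un_reduced_homology_group iso_trans)
 show "trivial_group (homology_group p (top_of_set (sphere x 1)))" if "p ~= 0" "p ~= 1"
  using iso[of p] reduced_homology_group_nsphere(2)[of p 1] that
  by (metis group_relative_homology_group isomorphic_group_triviality of_nat_1 un_reduced_homology_group)
qed

text \<open>The segment from y to its radial projection avoids K: if one of its points z is at least
  as far from x as y and lies in K, then y lies between x and z, hence in K by convexity; if z is
  nearer than y, it is still outside the disc of radius R.\<close>

lemma radial_map_complement:
 fixes x :: complex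
 assumes "convex K" "x \<in> K" "K <= ball x R"
 defines "g \<equiv> \<lambda>y. x + (R / norm (y - x)) *\<^sub>R (y - x)"
 shows "continuous_map (top_of_set (- {x})) (top_of_set (- K)) g"
  and "homotopic_with_canon (\<lambda>_. True) (- K) (- K) g id"
proof -
 have R: "R > 0" using assms(2,3) by (metis dist_self in_mono mem_ball)
 have cont: "continuous_on (- {x}) g" unfolding g_def by (intro continuous_intros) auto
 have gn: "norm (g y - x) = R" if "y ~= x" for y using that R by (simp add: g_def)
 have gK: "g y \<notin> K" if "y ~= x" for y using gn[OF that] assms(3) by (force simp: dist_norm norm_minus_commute)
 show "continuous_map (top_of_set (- {x})) (top_of_set (- K)) g"
  using cont gK by (auto simp: continuous_map_in_subtopology)
 have seg: "closed_segment (g y) (id y) <= - K" if y: "y \<in> - K" for y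
 proof
  fix z assume "z \<in> closed_segment (g y) (id y)"
  then obtain s where s: "0 <= s" "s <= 1" and z: "z = (1 - s) *\<^sub>R g y + s *\<^sub>R y"
   by (auto simp: closed_segment_def)
  have yx: "y ~= x" using y assms(2) by auto
  define l where "l = (1 - s) * (R / norm (y - x)) + s"
  have zl: "z = x + l *\<^sub>R (y - x)" unfolding z g_def l_def by (simp add: algebra_simps)
  show "z \<in> - K"
  proof (cases "l \<ge> 1")
   case True
   have "y = (1 - 1/l) *\<^sub>R x + (1/l) *\<^sub>R z" using True by (simp add: zl algebra_simps)
   hence "z \<in> K ==> y \<in> K"
    using convexD[OF assms(1,2), of z "1 - 1/l" "1/l"] True by (simp add: field_simps)
   thus ?thesis using y by auto
  next
   case False
   have "R / norm (y - x) < 1"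
   proof (rule ccontr)
    assume "\<not> ?thesis"
    hence "(1 - s) * 1 <= (1 - s) * (R / norm (y - x))" using s by (intro mult_left_mono) auto
    thus False using False by (simp add: l_def)
   qed
   hence lt: "R <= norm (y - x)" using yx by (simp add: field_simps)
   have "norm (z - x) = l * norm (y - x)" using s R by (simp add: zl l_def)
   also have "... = (1 - s) * R + s * norm (y - x)" using yx by (simp add: l_def field_simps)
   also have "... \<ge> (1 - s) * R + s * R" using s lt by (intro add_left_mono mult_left_mono) auto
   finally have "norm (z - x) \<ge> R" by (simp add: algebra_simps)
   thus ?thesis using assms(3) by (force simp: dist_norm norm_minus_commute)
  qed
 qed
 show "homotopic_with_canon (\<lambda>_. True) (- K) (- K) g id"
 proof (rule homotopic_with_linear)
  show "continuous_on (- K) g" using cont assms(2) by (auto intro: continuous_on_subset)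
 qed (use seg in \<open>auto simp: continuous_on_id\<close>)
qed

text \<open>The radial map is a left inverse, up to homotopy, of the inclusion of the complement of
  K into the punctured plane; so the inclusion is injective on homology.\<close>

lemma cycle_boundary_convex_complement:
 fixes x :: complex
 assumes K: "compact K" "convex K" "x \<in> K"
  and b: "cycle p (top_of_set (- K)) b"
  and bx: "boundary p (top_of_set (- {x})) b"
 shows "boundary p (top_of_set (- K)) b"
proof -
 obtain R where R: "K <= ball x R" using K(1) by (meson bounded_subset_ballD compact_imp_bounded)
 define g where "g = (\<lambda>y. x + (R / norm (y - x)) *\<^sub>R (y - x))"
 note g = radial_map_complement[OF K(2,3) R, folded g_def]
 have "boundary p (top_of_set (- K)) (chain_map p g b)"
  by (rule singular_relboundary_chain_map[OF bx g(1)]) auto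
 moreover have "chain_map p id b = b" using b by (intro chain_map_ident) (auto simp: singular_cycle)
 moreover have "homologous p (top_of_set (- K)) (chain_map p g b) (chain_map p id b)"
  by (rule homotopic_imp_homologous_rel_chain_maps[OF _ b]) (use g(2) in auto)
 ultimately show ?thesis by (simp add: homologous_rel_singular_relboundary)
qed

lemma homology_group_punctured_plane:
 fixes x :: complex
 shows "homology_group p (top_of_set (- {x})) \<cong> homology_group p (top_of_set (sphere x 1))"
proof (rule deformation_retract_imp_isomorphic_homology_groups)
 define g where "g = (\<lambda>y. x + (1 / norm (y - x)) *\<^sub>R (y - x))"
 note g = radial_map_complement[of "{x}" x 1, folded g_def]
 have "continuous_on (- {x}) g" unfolding g_def by (intro continuous_intros) auto
 moreover have "g ` (- {x}) <= sphere x 1" unfolding g_def by (auto simp: dist_norm split: if_splits)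
 moreover have "g y = y" if "y \<in> sphere x 1" for y using that by (simp add: g_def dist_norm norm_minus_commute)
 ultimately show "retraction_maps (top_of_set (- {x})) (top_of_set (sphere x 1)) g id"
  by (auto simp: retraction_maps_def continuous_map_in_subtopology)
 show "homotopic_with_canon (\<lambda>h. True) (- {x}) (- {x}) g id" using g by auto
qed

text \<open>The connecting map from H_p(X, S) to H_(p-1)(S) is injective because H_p(X) vanishes for
  contractible X and p > 0.\<close>

lemma contractible_relboundary_iff:
 assumes X: "contractible_space X" and p: "p > 0" and c: "relcycle p X S c"
 shows "relboundary p X S c \<longleftrightarrow> boundary (p - 1) (X on S) (bdry p c)"
proof
 assume "relboundary p X S c"
 then obtain d u where d: "chain (Suc p) X d" and u: "chain p (X on S) u"
  and c': "bdry (Suc p) d + u = c" unfolding relboundary by blast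
 hence "bdry p c = bdry p u"
  using chain_boundary_boundary_alt[OF d] by (simp add: chain_boundary_add flip: c')
 thus "boundary (p - 1) (X on S) (bdry p c)" unfolding singular_boundary using u p by (metis Suc_diff_1)
next
 assume "boundary (p - 1) (X on S) (bdry p c)"
 then obtain e where e: "chain p (X on S) e" and ec: "bdry p e = bdry p c"
  unfolding singular_boundary using p by auto
 have "cycle p X (c - e)"
  using c e ec by (auto simp: singular_cycle relcycle chain_boundary_diff singular_chain_subtopology
    intro!: singular_chain_diff)
 hence "boundary p X (c - e)" using contractible_cycle_boundary[OF X p] by blast
 hence "relboundary p X S (c - e)" by (rule singular_relboundary_mono) auto
 hence "relboundary p X S ((c - e) + e)"
  using e singular_chain_imp_relboundary by (intro singular_relboundary_add) blast+
 thus "relboundary p X S c" by simp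
qed

lemma contractible_space_plane: "contractible_space (euclidean :: complex topology)"
 using convex_imp_contractible[of "UNIV :: complex set"] contractible_space_top_of_set[of "UNIV :: complex set"]
 by simp

text \<open>The connecting map moves both claims to H_(p-1) of the complement of K, which embeds in
  that of a punctured plane. The latter has the homology of a circle, trivial in degree p - 1 >=
  2.\<close>

lemma plane_relcycle_convex:
 fixes K :: "complex set"
 assumes K: "compact K" "convex K" and c: "relcycle p euclidean (- K) c"
 shows "p \<ge> 3 ==> relboundary p euclidean (- K) c"
  and "p \<ge> 1 ==> x \<in> K ==> relboundary p euclidean (- {x}) c ==> relboundary p euclidean (- K) c"
proof -
 have b: "cycle (p - 1) (top_of_set (- K)) (bdry p c)"
  using c chain_boundary_boundary[of p euclidean c] unfolding singular_cycle by (simp add: relcycle)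
 have cx: "relcycle p euclidean (- {x}) c" if "x \<in> K" for x
  using c that by (auto intro: singular_relcycle_mono)
 show 2: "relboundary p euclidean (- K) c"
  if "p \<ge> 1" "x \<in> K" "relboundary p euclidean (- {x}) c" for x
 proof -
  have "boundary (p - 1) (top_of_set (- {x})) (bdry p c)"
   using contractible_relboundary_iff[OF contractible_space_plane _ cx[OF that(2)]] that by simp
  hence "boundary (p - 1) (top_of_set (- K)) (bdry p c)"
   using cycle_boundary_convex_complement[OF K that(2) b] by simp
  thus ?thesis using contractible_relboundary_iff[OF contractible_space_plane _ c] that by simp
 qed
 show "relboundary p euclidean (- K) c" if p: "p \<ge> 3"
 proof (cases "K = {}")
  case True
  thus ?thesis using c by (intro singular_chain_imp_relboundary) (simp add: relcycle)
 next
  case False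
  then obtain x where x: "x \<in> K" by blast
  have "trivial_group (homology_group (int (p - 1)) (top_of_set (sphere x 1)))"
   using p by (intro homology_group_circle(2)) auto
  hence "trivial_group (homology_group (int (p - 1)) (top_of_set (- {x})))"
   using homology_group_punctured_plane[of "int (p - 1)" x] isomorphic_group_triviality
    group_relative_homology_group by blast
  moreover have "cycle (p - 1) (top_of_set (- {x})) (bdry p c)" using b x by (auto intro: singular_cycle_mono)
  ultimately have "boundary (p - 1) (top_of_set (- {x})) (bdry p c)" by (rule trivial_homology_boundary)
  hence "relboundary p euclidean (- {x}) c"
   using contractible_relboundary_iff[OF contractible_space_plane _ cx[OF x]] p by simp
  thus ?thesis using 2 x p by simp
 qed
qed

text \<open>Relative Mayer-Vietoris, one set K at a time. The correction term lives over the
  intersections of K with the other sets: these are again compact and convex, fewer in number, but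
  one degree higher. Hence the induction runs on a bound for the number of sets, with p left
  free.\<close>

lemma plane_relcycle_convex_Union:
 fixes \<K> :: "complex set set"
 assumes "finite \<K>" "!!K. K \<in> \<K> ==> compact K \<and> convex K" "p \<ge> 3"
  "relcycle p euclidean (- \<Union>\<K>) c"
 shows "relboundary p euclidean (- \<Union>\<K>) c"
proof -
 have "relboundary p euclidean (- \<Union>\<K>) c"
  if "card \<K> <= n" "finite \<K>" "!!K. K \<in> \<K> ==> compact K \<and> convex K" "p \<ge> 3"
   "relcycle p euclidean (- \<Union>\<K>) c" for n p and \<K> :: "complex set set" and c using that
 proof (induction n arbitrary: \<K> p c)
  case 0
  thus ?case by (auto intro!: singular_chain_imp_relboundary simp: relcycle)
 next
  case (Suc n)
  show ?case
  proof (cases "\<K> = {}")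
   case True
   thus ?thesis using Suc.prems by (auto intro!: singular_chain_imp_relboundary simp: relcycle)
  next
   case False
   then obtain K \<L> where K: "\<K> = insert K \<L>" "K \<notin> \<L>" by (meson ex_in_conv mk_disjoint_insert)
   have L: "card \<L> <= n" "finite \<L>" using K Suc.prems(1,2) by auto
   let ?M = "(\<lambda>A. A \<inter> K) ` \<L>"
   have eq: "- \<Union>\<K> = (- \<Union>\<L>) \<inter> (- K)" "(- \<Union>\<L>) \<union> (- K) = - \<Union>?M" using K(1) by auto
   have cl: "closed (\<Union>\<L>)" "closed K"
   proof -
    have *: "!!A. A \<in> \<K> ==> closed A"  by (rule compact_imp_closed) (use Suc.prems(3) in blast)
    show "closed (\<Union>\<L>)" by (rule closed_Union) (use L K(1) * in blast)+
    show "closed K" using K(1) * by blast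
   qed
   have "relboundary p euclidean ((- \<Union>\<L>) \<inter> (- K)) c"
   proof (rule singular_relboundary_Int)
    show "openin euclidean (- \<Union>\<L>)" "openin euclidean (- K)" using cl by auto
    show "relboundary p euclidean (- \<Union>\<L>) c"
    proof (rule Suc.IH)
     show "relcycle p euclidean (- \<Union>\<L>) c" by (rule singular_relcycle_mono[OF Suc.prems(5)]) (use K in auto)
    qed (use K L Suc.prems in auto)
    show "relboundary p euclidean (- K) c"
    proof (rule plane_relcycle_convex(1))
     show "relcycle p euclidean (- K) c" by (rule singular_relcycle_mono[OF Suc.prems(5)]) (use K in auto)
    qed (use K Suc.prems in auto)
    show "relcycle p euclidean (- \<Union>\<L> \<inter> - K) c" using Suc.prems(5) by (simp only: eq(1))
    show "relboundary (Suc p) euclidean (- \<Union> \<L> \<union> - K) d"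
     if "relcycle (Suc p) euclidean (- \<Union> \<L> \<union> - K) d" for d unfolding eq(2)
    proof (rule Suc.IH)
     show "card ?M <= n" using L card_image_le order_trans by blast
     show "finite ?M" using L by blast
     show "compact B \<and> convex B" if "B \<in> ?M" for B
      using that K Suc.prems(3) by (metis (no_types, lifting) compact_Int convex_Int imageE insertCI)
     show "Suc p \<ge> 3" using Suc.prems(4) by simp
     show "relcycle (Suc p) euclidean (- \<Union>?M) d" using that by (simp only: eq(2))
    qed
   qed
   thus ?thesis by (simp only: eq(1))
  qed
 qed
 thus ?thesis using assms by blast
qed

text \<open>The same induction in degree 2. The correction term has degree 3 and vanishes by the
  preceding lemma, so vanishing over the single sets is all that must be supplied.\<close>

lemma plane_relcycle_convex_Union_2:
 fixes \<K> :: "complex set set"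
 assumes "finite \<K>" "!!K. K \<in> \<K> ==> compact K \<and> convex K"
  "relcycle 2 euclidean (- \<Union>\<K>) c"
  "!!K. K \<in> \<K> ==> relboundary 2 euclidean (- K) c"
 shows "relboundary 2 euclidean (- \<Union>\<K>) c" using assms
proof (induction \<K> rule: finite_induct)
 case empty
 thus ?case by (auto intro!: singular_chain_imp_relboundary simp: relcycle)
next
 case (insert K \<L>)
 let ?M = "(\<lambda>A. A \<inter> K) ` \<L>"
 have eq: "- \<Union>(insert K \<L>) = (- \<Union>\<L>) \<inter> (- K)" "(- \<Union>\<L>) \<union> (- K) = - \<Union>?M" by auto
 have cl: "closed (\<Union>\<L>)" "closed K"
 proof -
  have *: "!!A. A \<in> insert K \<L> ==> closed A"  by (rule compact_imp_closed) (use insert.prems(1) in blast)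
  show "closed (\<Union>\<L>)" by (rule closed_Union) (use insert.hyps * in blast)+
  show "closed K" using * by blast
 qed
 show ?case unfolding eq(1)
 proof (rule singular_relboundary_Int)
  show "openin euclidean (- \<Union>\<L>)" "openin euclidean (- K)" using cl by auto
  show "relboundary 2 euclidean (- \<Union>\<L>) c"
  proof (rule insert.IH)
   show "relcycle 2 euclidean (- \<Union>\<L>) c" by (rule singular_relcycle_mono[OF insert.prems(2)]) auto
  qed (use insert.prems in auto)
  show "relboundary (Suc 2) euclidean (- \<Union> \<L> \<union> - K) d"
   if "relcycle (Suc 2) euclidean (- \<Union> \<L> \<union> - K) d" for d unfolding eq(2)
  proof (rule plane_relcycle_convex_Union)
   show "compact B \<and> convex B" if "B \<in> ?M" for B
    using that insert.prems(1) by (metis (no_types, lifting) compact_Int convex_Int imageE insertCI)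
   show "finite ?M" using insert.hyps by blast
   show "relcycle (Suc 2) euclidean (- \<Union>?M) d" using that by (simp only: eq(2))
  qed simp
  show "relboundary 2 euclidean (- K) c" using insert.prems(3) by blast
  show "relcycle 2 euclidean (- \<Union> \<L> \<inter> - K) c" using insert.prems(2) by (simp only: eq(1))
 qed
qed

lemma chain_support_compactin:
 assumes "chain p X c"
 shows "compactin X (\<Union>f\<in>keys c. f ` Delta p)"
proof (rule compactin_Union)
 fix S assume "S \<in> (\<lambda>f. f ` Delta p) ` keys c"
 then obtain f where S: "S = f ` Delta p" "singular_simplex p X f"
  using assms by (auto simp: singular_chain_def)
 hence "continuous_map ((powertop_real UNIV) on (Delta p)) X f" by (simp add: singular_simplex_def)
 moreover have "compactin ((powertop_real UNIV) on (Delta p)) (Delta p)"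
  by (simp add: compactin_subtopology compactin_standard_simplex)
 ultimately show "compactin X S" using image_compactin S by blast
qed auto

text \<open>The boundary of c has compact support at positive distance r from K, so finitely many
  closed discs of radius r/2 cover K and still miss it: c is a relative cycle for the complement of
  a finite union of convex sets. In degree 2 each disc contains its centre, a point of K at which
  the class vanishes.\<close>

lemma plane_relcycle_compact:
 fixes K :: "complex set"
 assumes K: "compact K" and c: "relcycle p euclidean (- K) c"
 shows "p \<ge> 3 ==> relboundary p euclidean (- K) c"
  and "p = 2 ==> (!!x. x \<in> K ==> relboundary p euclidean (- {x}) c) ==> relboundary p euclidean (- K) c"
proof -
 define S where "S = (\<Union>f\<in>keys (bdry p c). f ` Delta (p - 1))"
 have bc: "chain (p - 1) (top_of_set (- K)) (bdry p c)" using c by (simp add: relcycle)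
 hence "compactin euclidean S" "S <= - K" using chain_support_compactin[of "p - 1" euclidean "bdry p c"]
  by (auto simp: singular_chain_subtopology S_def)
 hence "closed S" "K \<inter> S = {}" by (auto simp: compactin_euclidean_iff intro: compact_imp_closed)
 then obtain r where r: "r > 0" "!!x y. x \<in> K ==> y \<in> S ==> r <= dist x y"
  using separate_compact_closed[OF K] by metis
 obtain F where F: "finite F" "F <= K" "K <= (\<Union>x\<in>F. ball x (r/2))"
 proof (rule compactE_image[OF K, of K "\<lambda>x. ball x (r/2)"])
  show "K <= (\<Union>x\<in>K. ball x (r/2))" using r(1) by force
 qed auto
 let ?K = "(\<lambda>x. cball x (r/2)) ` F"
 have "S <= - \<Union>?K"
 proof clarsimp
  fix y x assume "y \<in> S" "x \<in> F" "dist x y * 2 <= r"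
  thus False using r(1) r(2)[of x y] F(2) by auto
 qed
 hence c': "relcycle p euclidean (- \<Union>?K) c"
  using c bc by (auto simp: relcycle singular_chain_subtopology S_def)
 have sub: "- \<Union>?K <= - K" using F(3) by (force simp: subset_iff)
 show "relboundary p euclidean (- K) c" if "p \<ge> 3"
  by (rule singular_relboundary_mono[OF plane_relcycle_convex_Union[OF _ _ that c'] sub]) (use F in auto)
 show "relboundary p euclidean (- K) c"
  if p: "p = 2" and loc: "!!x. x \<in> K ==> relboundary p euclidean (- {x}) c"
 proof -
  have "relboundary 2 euclidean (- \<Union>?K) c"
  proof (rule plane_relcycle_convex_Union_2)
   show "relboundary 2 euclidean (- B) c" if "B \<in> ?K" for B
   proof -
    obtain x where x: "x \<in> F" "B = cball x (r/2)" using \<open>B \<in> ?K\<close> by auto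
    have "relcycle 2 euclidean (- B) c" using c' that p by (auto intro: singular_relcycle_mono)
    moreover have "x \<in> B" using x r(1) by simp
    moreover have "relboundary 2 euclidean (- {x}) c" using loc x F(2) p by auto
    ultimately show ?thesis using x by (intro plane_relcycle_convex(2)[of B 2 c x]) auto
   qed
  qed (use F c' p in auto)
  thus ?thesis using sub p singular_relboundary_mono by blast
 qed
qed

section \<open>Excision and transfer of relative cycles into charts\<close>

lemma excision_sets:
 assumes "openin X V" "closedin X K" "K <= V"
 shows "X closure_of (topspace X - V) <= X interior_of (topspace X - K)"
  and "topspace X - (topspace X - V) = V" "topspace X - K - (topspace X - V) = V - K"
proof -
 show "X closure_of (topspace X - V) <= X interior_of (topspace X - K)"
  using assms closure_of_closedin[of X "topspace X - V"] interior_of_openin[of X "topspace X - K"]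
  by (simp add: openin_diff closedin_diff Diff_mono)
qed (use openin_subset[OF assms(1)] in auto)

lemma excision_open:
 assumes "openin X V" "closedin X K" "K <= V"
 shows "hom_induced p (X on V) (V - K) X (topspace X - K) id
  \<in> iso (relative_homology_group p (X on V) (V - K)) (relative_homology_group p X (topspace X - K))"
 using homology_excision_axiom[OF excision_sets(1)[OF assms], of "topspace X" p]
 unfolding excision_sets(2,3)[OF assms] by simp

lemma excision_relcycle_exists:
 assumes V: "openin X V" "closedin X K" "K <= V" and c: "relcycle p X (topspace X - K) c"
 obtains c' where "relcycle p (X on V) (V - K) c'"
  "homologous_rel p X (topspace X - K) c c'"
 using excised_relcycle_exists[OF excision_sets(1)[OF V], of "topspace X" p c] c
 unfolding excision_sets(2,3)[OF V] by (metis Diff_subset subtopology_topspace)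

lemma excision_relboundary_iff:
 assumes "openin X V" "closedin X K" "K <= V" and c: "relcycle p (X on V) (V - K) c"
 shows "relboundary p (X on V) (V - K) c \<longleftrightarrow> relboundary p X (topspace X - K) c"
proof
 have V: "V <= topspace X" using assms(1) by (rule openin_subset)
 have id: "chain_map p id c = c" using c by (intro chain_map_ident) (auto simp: relcycle)
 show "relboundary p X (topspace X - K) c" if "relboundary p (X on V) (V - K) c"
 proof -
  have "id \<in> V - K \<rightarrow> topspace X - K" using V by auto
  thus ?thesis using singular_relboundary_chain_map[OF that, of X id "topspace X - K"]
   by (simp add: id continuous_map_from_subtopology)
 qed
 assume b: "relboundary p X (topspace X - K) c"
 let ?f = "hom_induced (int p) (X on V) (V - K) X (topspace X - K) id"
 let ?G = "relative_homology_group (int p) (X on V) (V - K)"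
 have iso: "?f \<in> iso ?G (relative_homology_group (int p) X (topspace X - K))"
  by (rule excision_open[OF assms(1-3)])
 have "?f (homologous_rel_set p (X on V) (V - K) c) = homologous_rel_set p X (topspace X - K) (chain_map p id c)"
  using V by (intro hom_induced_chain_map c) (auto simp: continuous_map_from_subtopology)
 also have "... = ?f \<one>\<^bsub>?G\<^esub>"
  using b id hom_one[OF iso_imp_homomorphism[OF iso]] by (simp add: homologous_rel_set_eq_relboundary)
 finally have "homologous_rel_set p (X on V) (V - K) c = \<one>\<^bsub>?G\<^esub>"
 proof (rule inj_onD[rotated])
  show "inj_on ?f (carrier ?G)" using iso by (simp add: iso_def bij_betw_def)
  show "homologous_rel_set p (X on V) (V - K) c \<in> carrier ?G"
   using c by (simp add: carrier_relative_homology_group)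
  show "\<one>\<^bsub>?G\<^esub> \<in> carrier ?G" by (meson group.is_monoid group_relative_homology_group monoid.one_closed)
 qed
 thus "relboundary p (X on V) (V - K) c" by (simp add: homologous_rel_set_eq_relboundary)
qed

lemma homeomorphic_relboundary_iff:
 assumes f: "homeomorphic_map X Y f" and S: "S <= topspace X" and c: "chain p X c"
 shows "relboundary p X S c \<longleftrightarrow> relboundary p Y (f ` S) (chain_map p f c)"
proof
 show "relboundary p X S c ==> relboundary p Y (f ` S) (chain_map p f c)"
  using f by (auto intro!: singular_relboundary_chain_map simp: homeomorphic_imp_continuous_map)
 obtain g where g: "homeomorphic_maps X Y f g" using f by (auto simp: homeomorphic_map_maps)
 hence gf: "!!x. x \<in> topspace X ==> g (f x) = x" "continuous_map X Y f" "continuous_map Y X g"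
  by (auto simp: homeomorphic_maps_def)
 assume "relboundary p Y (f ` S) (chain_map p f c)"
 hence "relboundary p X S (chain_map p g (chain_map p f c))"
 proof (rule singular_relboundary_chain_map)
  show "g \<in> f ` S \<rightarrow> S" using gf S by (auto simp: subset_iff)
 qed (use gf in auto)
 moreover have "chain_map p g (chain_map p f c) = c"
  using gf chain_map_compose[of p g f] chain_map_id_gen[OF c, of "g \<circ> f"] by (simp add: fun_eq_iff)
 ultimately show "relboundary p X S c" by simp
qed

lemma complex_chart_compactin_image:
 assumes "complex_chart X (V, \<phi>)" "compactin X K" "K <= V"
 shows "compact (\<phi> ` K)"
proof -
 have "compactin (X on V) K" using assms by (simp add: compactin_subtopology)
 hence "compactin (top_of_set (\<phi> ` V)) (\<phi> ` K)"
  by (rule image_compactin)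
    (use assms(1) in \<open>auto simp: complex_chart_def homeomorphic_imp_continuous_map\<close>)
 thus ?thesis by (simp add: compactin_subtopology)
qed

text \<open>One planar chain d serves all compact L inside K simultaneously. This is what lets
  vanishing at single points of K be compared with vanishing over K by means of the plane.\<close>

lemma chart_transfer:
 assumes Y: "Hausdorff_space Y" and ch: "complex_chart Y (V, \<phi>)" and K: "compactin Y K" "K <= V"
  and c: "relcycle p Y (topspace Y - K) c"
 obtains d where "relcycle p euclidean (- \<phi> ` K) d"
  "!!L. compactin Y L ==> L <= K ==> relboundary p Y (topspace Y - L) c \<longleftrightarrow> relboundary p euclidean (- \<phi> ` L) d"
proof -
 have V: "openin Y V" and W: "open (\<phi> ` V)" and h: "homeomorphic_map (Y on V) (top_of_set (\<phi> ` V)) \<phi>"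
  using ch by (auto simp: complex_chart_def)
 have VY: "V <= topspace Y" using V by (rule openin_subset)
 have inj: "inj_on \<phi> V" using homeomorphic_imp_injective_map[OF h] VY by (simp add: Int_absorb1)
 have closed: "closedin Y L" if "compactin Y L" for L using Y that by (rule compactin_imp_closedin)
 obtain c' where c': "relcycle p (Y on V) (V - K) c'"
  and cc': "homologous_rel p Y (topspace Y - K) c c'"
  using excision_relcycle_exists[OF V closed[OF K(1)] K(2) c] .
 define d where "d = chain_map p \<phi> c'"
 have dW: "relcycle p (top_of_set (\<phi> ` V)) (\<phi> ` V - \<phi> ` L) d"
  if "L <= K" for L unfolding d_def
 proof (rule singular_relcycle_chain_map[OF singular_relcycle_mono[OF c', of "V - L"]])
  show "continuous_map (Y on V) (top_of_set (\<phi> ` V)) \<phi>" using h by (rule homeomorphic_imp_continuous_map)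
  show "\<phi> \<in> V - L \<rightarrow> \<phi> ` V - \<phi> ` L" using inj_on_image_mem_iff[OF inj] that K(2) by auto
  show "V - K <= V - L" using that by auto
 qed
 show thesis
 proof (rule that[of d])
  show "relcycle p euclidean (- \<phi> ` K) d"
   using dW[of K] by (simp add: relcycle singular_chain_subtopology) blast
  fix L assume L: "compactin Y L" "L <= K"
  hence LV: "L <= V" using K by auto
  have "relboundary p Y (topspace Y - L) c \<longleftrightarrow> relboundary p Y (topspace Y - L) c'"
   using homologous_rel_mono[OF cc', of "topspace Y - L"] L homologous_rel_singular_relboundary by blast
  also have "... \<longleftrightarrow> relboundary p (Y on V) (V - L) c'"
   using excision_relboundary_iff[OF V closed[OF L(1)] LV singular_relcycle_mono[OF c']] L by blast
  also have "... \<longleftrightarrow> relboundary p (top_of_set (\<phi> ` V)) (\<phi> ` (V - L)) d"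
   unfolding d_def using homeomorphic_relboundary_iff[OF h, of "V - L" p c'] c' VY by (auto simp: relcycle)
  also have "\<phi> ` (V - L) = \<phi> ` V - \<phi> ` L" using inj LV by (simp add: inj_on_image_set_diff[of \<phi> V])
  also have "relboundary p (top_of_set (\<phi> ` V)) (\<phi> ` V - \<phi> ` L) d \<longleftrightarrow>
        relboundary p euclidean (topspace euclidean - \<phi> ` L) d"
  proof (rule excision_relboundary_iff)
   show "closedin euclidean (\<phi> ` L)"
    using complex_chart_compactin_image[OF ch L(1) LV] compact_imp_closed by simp
  qed (use W LV L dW in auto)
  finally show "relboundary p Y (topspace Y - L) c \<longleftrightarrow> relboundary p euclidean (- \<phi> ` L) d"
   by (simp add: Compl_eq_Diff_UNIV)
 qed
qed

text \<open>The planar results pulled back by the chart. The third claim is the one that propagates: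
  over a set with convex image the class at a single point decides.\<close>

lemma chart_relcycle_boundary:
 assumes Y: "Hausdorff_space Y" and ch: "complex_chart Y (V, \<phi>)" and K: "compactin Y K" "K <= V"
  and c: "relcycle p Y (topspace Y - K) c"
 shows "p \<ge> 3 ==> relboundary p Y (topspace Y - K) c"
  and "p = 2 ==> (!!y. y \<in> K ==> relboundary p Y (topspace Y - {y}) c) ==> relboundary p Y (topspace Y - K) c"
  and "p = 2 ==> convex (\<phi> ` K) ==> y \<in> K ==> relboundary p Y (topspace Y - {y}) c ==>
      relboundary p Y (topspace Y - K) c"
proof -
 obtain d where d: "relcycle p euclidean (- \<phi> ` K) d"
  "!!L. compactin Y L ==> L <= K ==> relboundary p Y (topspace Y - L) c \<longleftrightarrow> relboundary p euclidean (- \<phi> ` L) d"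
  using chart_transfer[OF assms] by metis
 have cK: "compact (\<phi> ` K)" by (rule complex_chart_compactin_image[OF ch K])
 have pt: "relboundary p euclidean (- {\<phi> y}) d"
  if "relboundary p Y (topspace Y - {y}) c" "y \<in> K" for y
  using d(2)[of "{y}"] that K compactin_subset_topspace[OF K(1)] by auto
 show "p \<ge> 3 ==> relboundary p Y (topspace Y - K) c"
  using plane_relcycle_compact(1)[OF cK d(1)] d(2)[OF K(1)] by simp
 show "p = 2 ==> (!!y. y \<in> K ==> relboundary p Y (topspace Y - {y}) c) ==> relboundary p Y (topspace Y - K) c"
  using plane_relcycle_compact(2)[OF cK d(1)] d(2)[OF K(1)] pt by auto
 show "p = 2 ==> convex (\<phi> ` K) ==> y \<in> K ==> relboundary p Y (topspace Y - {y}) c ==>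
      relboundary p Y (topspace Y - K) c"
  using plane_relcycle_convex(2)[OF cK _ d(1), of "\<phi> y"] d(2)[OF K(1)] pt by auto
qed

lemma complex_chart_disc:
 assumes ch: "complex_chart Y (V, \<phi>)" and y: "y \<in> V"
 obtains r where "r > 0" "openin Y {v \<in> V. \<phi> v \<in> ball (\<phi> y) r}"
  "compactin Y {v \<in> V. \<phi> v \<in> cball (\<phi> y) r}"
  "\<phi> ` {v \<in> V. \<phi> v \<in> cball (\<phi> y) r} = cball (\<phi> y) r"
proof -
 have V: "openin Y V" and W: "open (\<phi> ` V)" and h: "homeomorphic_map (Y on V) (top_of_set (\<phi> ` V)) \<phi>"
  using ch by (auto simp: complex_chart_def)
 obtain r where r: "r > 0" "cball (\<phi> y) r <= \<phi> ` V" using W y by (meson image_eqI open_contains_cball)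
 obtain g where g: "homeomorphic_maps (Y on V) (top_of_set (\<phi> ` V)) \<phi> g"
  using h by (auto simp: homeomorphic_map_maps)
 have VY: "V <= topspace Y" using V by (rule openin_subset)
 have top: "topspace (Y on V) = V" using VY by auto
 have gV: "!!w. w \<in> \<phi> ` V ==> g w \<in> V \<and> \<phi> (g w) = w" "!!v. v \<in> V ==> g (\<phi> v) = v"
  and cont: "continuous_map (top_of_set (\<phi> ` V)) (Y on V) g" "continuous_map (Y on V) euclidean \<phi>"
  using g VY top by (auto simp: homeomorphic_maps_def continuous_map_in_subtopology)
 have eq: "{v \<in> V. \<phi> v \<in> cball (\<phi> y) r} = g ` cball (\<phi> y) r"
 proof (intro subset_antisym subsetI)
  fix v assume "v \<in> {v \<in> V. \<phi> v \<in> cball (\<phi> y) r}"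
  thus "v \<in> g ` cball (\<phi> y) r" using gV(2)[of v] by (metis (mono_tags, lifting) imageI mem_Collect_eq)
 qed (use gV(1) r(2) in auto)
 have "compactin (Y on V) (g ` cball (\<phi> y) r)"
  using r(2) by (intro image_compactin[OF _ cont(1)]) (simp add: compactin_subtopology)
 moreover have "openin (Y on V) {v \<in> topspace (Y on V). \<phi> v \<in> ball (\<phi> y) r}"
  by (rule openin_continuous_map_preimage[OF cont(2)]) simp
 moreover have "\<phi> ` g ` cball (\<phi> y) r = cball (\<phi> y) r" using gV(1) r(2) by (force simp: image_image)
 ultimately show thesis using r(1) that[of r] V unfolding eq top
  by (auto simp: compactin_subtopology openin_open_subtopology)
qed

text \<open>Charts are demanded only around K, since the orbit space is known to be a surface only
  away from the branch points. K is divided into finitely many compact pieces lying in charts,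
  joined by Mayer-Vietoris; every overlap lies in a chart, where degree 3 vanishes.\<close>

lemma surface_relcycle_boundary:
 assumes Y: "Hausdorff_space Y" and K: "compactin Y K"
  and ch: "!!y. y \<in> K ==> \<exists>V \<phi>. complex_chart Y (V, \<phi>) \<and> y \<in> V"
  and c: "relcycle 2 Y (topspace Y - K) c"
  and loc: "!!y. y \<in> K ==> relboundary 2 Y (topspace Y - {y}) c"
 shows "relboundary 2 Y (topspace Y - K) c"
proof -
 have "\<exists>U C V \<phi>. y \<in> U \<and> openin Y U \<and> U <= C \<and> compactin Y C \<and> complex_chart Y (V, \<phi>) \<and> C <= V"
  if y: "y \<in> K" for y
 proof -
  obtain V \<phi> where V: "complex_chart Y (V, \<phi>)" "y \<in> V" using ch y by blast
  obtain r where "r > 0" "openin Y {v \<in> V. \<phi> v \<in> ball (\<phi> y) r}"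
   "compactin Y {v \<in> V. \<phi> v \<in> cball (\<phi> y) r}" by (rule complex_chart_disc[OF V])
  thus ?thesis
   using V by (intro exI[of _ "{v \<in> V. \<phi> v \<in> ball (\<phi> y) r}"] exI[of _ "{v \<in> V. \<phi> v \<in> cball (\<phi> y) r}"]
     exI[of _ V] exI[of _ \<phi>]) auto
 qed
 then obtain U C V \<phi> where UC: "!!y. y \<in> K ==> y \<in> U y \<and> openin Y (U y) \<and> U y <= C y \<and>
   compactin Y (C y) \<and> complex_chart Y (V y, \<phi> y) \<and> C y <= V y" by metis
 obtain \<F> where \<F>: "finite \<F>" "\<F> <= U ` K" "K <= \<Union>\<F>"
 proof -
  have "\<exists>\<F>. finite \<F> \<and> \<F> <= U ` K \<and> K <= \<Union>\<F>" by (rule compactinD[OF K]) (use UC in auto)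
  thus ?thesis using that by blast
 qed
 then obtain F where F: "finite F" "F <= K" "K <= (\<Union>y\<in>F. U y)" by (metis finite_subset_image)
 define \<K> where "\<K> = (\<lambda>y. K \<inter> C y) ` F"
 have \<K>: "finite \<K>" "\<Union>\<K> = K" using F UC unfolding \<K>_def by auto blast
 have \<K>2: "compactin Y A \<and> (\<exists>V \<phi>. complex_chart Y (V, \<phi>) \<and> A <= V)" if "A \<in> \<K>" for A
 proof -
  obtain y where y: "y \<in> F" "A = K \<inter> C y" using \<open>A \<in> \<K>\<close> unfolding \<K>_def by auto
  hence u: "compactin Y (C y)" "complex_chart Y (V y, \<phi> y)" "C y <= V y" using UC F by blast+
  thus ?thesis using K Y y(2) by (meson compact_Int_closedin compactin_imp_closedin inf.coboundedI2)
 qed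
 have "relboundary 2 Y (topspace Y - \<Union>\<L>) c"
  if "\<L> <= \<K>" "relcycle 2 Y (topspace Y - \<Union>\<L>) c" for \<L> using finite_subset[OF that(1) \<K>(1)] that
 proof (induction \<L> rule: finite_induct)
  case empty
  thus ?case by (intro singular_chain_imp_relboundary) (simp add: relcycle)
 next
  case (insert A \<L>)
  have A: "compactin Y A" "A <= K" using \<K>2 \<K>(2) insert.prems(1) by blast+
  obtain V \<phi> where V: "complex_chart Y (V, \<phi>)" "A <= V" using \<K>2 insert.prems(1) by blast
  have "closedin Y (\<Union>\<L>)" using \<K>2 Y insert by (intro closedin_Union) (auto intro: compactin_imp_closedin)
  moreover have Acl: "closedin Y A" using A Y compactin_imp_closedin by blast
  ultimately have op: "openin Y (topspace Y - \<Union>\<L>)" "openin Y (topspace Y - A)"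
   and cpt: "compactin Y (\<Union>\<L> \<inter> A)" using A by (auto intro: closed_Int_compactin)
  have eq: "topspace Y - \<Union>(insert A \<L>) = (topspace Y - \<Union>\<L>) \<inter> (topspace Y - A)"
   "(topspace Y - \<Union>\<L>) \<union> (topspace Y - A) = topspace Y - (\<Union>\<L> \<inter> A)" by auto
  show ?case unfolding eq(1)
  proof (rule singular_relboundary_Int[OF op])
   show "relboundary 2 Y (topspace Y - \<Union>\<L>) c"
    using insert by (intro insert.IH) (auto intro: singular_relcycle_mono)
   show "relboundary 2 Y (topspace Y - A) c"
    by (rule chart_relcycle_boundary(2)[OF Y V(1) A(1) V(2)])
      (use insert.prems A loc in \<open>auto intro: singular_relcycle_mono\<close>)
   show "relcycle 2 Y ((topspace Y - \<Union>\<L>) \<inter> (topspace Y - A)) c" using insert.prems(2) by (simp only: eq(1))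
   show "relboundary (Suc 2) Y ((topspace Y - \<Union>\<L>) \<union> (topspace Y - A)) d"
    if "relcycle (Suc 2) Y ((topspace Y - \<Union>\<L>) \<union> (topspace Y - A)) d" for d
    using chart_relcycle_boundary(1)[OF Y V(1) cpt, of "Suc 2" d] V(2) that unfolding eq(2) by auto
  qed
 qed
 from this[of \<K>] show ?thesis using \<K> c by simp
qed

text \<open>Over a closed disc of a chart, vanishing at one point implies vanishing at all points.
  So the points of S where the class vanishes and those where it does not both form open
  sets.\<close>

lemma surface_cycle_clopen:
 assumes Y: "Hausdorff_space Y" and S: "openin Y S" "connectedin Y S"
  and ch: "!!y. y \<in> S ==> \<exists>V \<phi>. complex_chart Y (V, \<phi>) \<and> y \<in> V"
  and c: "cycle 2 Y c"
  and z: "z \<in> S" "relboundary 2 Y (topspace Y - {z}) c" and y: "y \<in> S"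
 shows "relboundary 2 Y (topspace Y - {y}) c"
proof -
 define P where "P y \<longleftrightarrow> relboundary 2 Y (topspace Y - {y}) c" for y
 have nb: "\<exists>U. openin Y U \<and> x \<in> U \<and> (\<forall>v\<in>U. P v = P x)" if xS: "x \<in> S" for x
 proof -
  obtain V \<phi> where V: "complex_chart Y (V, \<phi>)" "x \<in> V" using ch[OF xS] by blast
  obtain r where r: "r > 0" "openin Y {v \<in> V. \<phi> v \<in> ball (\<phi> x) r}"
   "compactin Y {v \<in> V. \<phi> v \<in> cball (\<phi> x) r}"
   "\<phi> ` {v \<in> V. \<phi> v \<in> cball (\<phi> x) r} = cball (\<phi> x) r" by (rule complex_chart_disc[OF V])
  define D where "D = {v \<in> V. \<phi> v \<in> cball (\<phi> x) r}"
  have *: "P v" if "P u" "u \<in> D" "v \<in> D" for u v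
  proof -
   have "relboundary 2 Y (topspace Y - D) c"
    by (rule chart_relcycle_boundary(3)[OF Y V(1), of D 2 c u])
      (use r that in \<open>auto simp: P_def D_def intro: singular_relcycle_mono[OF c]\<close>)
   thus ?thesis unfolding P_def by (rule singular_relboundary_mono) (use \<open>v \<in> D\<close> in auto)
  qed
  have "x \<in> D" "{v \<in> V. \<phi> v \<in> ball (\<phi> x) r} <= D" using V r(1) by (auto simp: D_def)
  hence "P v = P x" if "v \<in> {v \<in> V. \<phi> v \<in> ball (\<phi> x) r}" for v using * that by blast
  moreover have "x \<in> {v \<in> V. \<phi> v \<in> ball (\<phi> x) r}" using V r(1) by simp
  ultimately show ?thesis using r(2) by blast
 qed
 have "openin Y {x \<in> S. P x}" "openin Y {x \<in> S. \<not> P x}"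
 proof -
  have "\<exists>U. openin Y U \<and> x \<in> U \<and> U <= {x \<in> S. P x = b}" if "x \<in> S" "P x = b" for x b
  proof -
   obtain U where U: "openin Y U" "x \<in> U" "\<forall>v\<in>U. P v = P x" using nb \<open>x \<in> S\<close> by blast
   thus ?thesis using S(1) that by (intro exI[of _ "U \<inter> S"]) auto
  qed
  from this[of _ True] this[of _ False]
  show "openin Y {x \<in> S. P x}" "openin Y {x \<in> S. \<not> P x}" by (subst openin_subopen; auto)+
 qed
 hence "{x \<in> S. \<not> P x} = {}" using S(2) z unfolding connectedin P_def by blast
 thus ?thesis using y by (auto simp: P_def)
qed

section \<open>Local homology at a point, and connectedness of surfaces\<close>

lemma homologous_rel_set_add:
 assumes "relcycle p X S a" "relcycle p X S b"
 shows "homologous_rel_set p X S a \<otimes>\<^bsub>relative_homology_group (int p) X S\<^esub> homologous_rel_set p X S b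
    = homologous_rel_set p X S (a + b)"
proof (intro subset_antisym subsetI)
 fix c assume "c \<in> homologous_rel_set p X S a \<otimes>\<^bsub>relative_homology_group (int p) X S\<^esub> homologous_rel_set p X S b"
 thus "c \<in> homologous_rel_set p X S (a + b)"
  by (auto simp: mult_relative_homology_group intro: homologous_rel_add)
next
 fix c assume "c \<in> homologous_rel_set p X S (a + b)"
 hence "homologous_rel p X S b (c - a)" by (simp add: homologous_rel_def algebra_simps)
 thus "c \<in> homologous_rel_set p X S a \<otimes>\<^bsub>relative_homology_group (int p) X S\<^esub> homologous_rel_set p X S b"
  unfolding mult_relative_homology_group by (intro UN_I[of a] UN_I[of "c - a"]) auto
qed

lemma cyclic_relative_homology_generator:
 assumes "relative_homology_group (int p) X S \<cong> integer_group"
 obtains g where "relcycle p X S g"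
  "!!c. relcycle p X S c ==> \<exists>n. homologous_rel p X S c (n *. g)"
proof -
 let ?G = "relative_homology_group (int p) X S"
 obtain f where f: "f \<in> iso ?G integer_group" using assms by (auto simp: is_iso_def)
 hence hom: "f \<in> hom ?G integer_group" and bij: "bij_betw f (carrier ?G) UNIV" by (auto simp: iso_def)
 define F where "F c = f (homologous_rel_set p X S c)" for c
 have carr: "homologous_rel_set p X S c \<in> carrier ?G" if "relcycle p X S c" for c
  using that by (simp add: carrier_relative_homology_group)
 have add: "F (a + b) = F a + F b" if "relcycle p X S a" "relcycle p X S b" for a b
  using hom_mult[OF hom carr[OF that(1)] carr[OF that(2)]] homologous_rel_set_add[OF that] by (simp add: F_def)
 have zero: "F 0 = 0" using add[of 0 0] by simp
 have "1 \<in> f ` carrier ?G" using bij by (simp add: bij_betw_def)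
 then obtain g where g: "relcycle p X S g" "F g = 1" by (auto simp: carrier_relative_homology_group F_def)
 have minus: "F (- a) = - F a" if "relcycle p X S a" for a
  using add[OF that, of "- a"] that zero by (simp add: singular_relcycle_minus)
 have "F ((int n) *. g) = int n" for n
 proof (induction n)
  case (Suc n)
  thus ?case
   using add[of "(int n) *. g" g] g by (simp add: singular_relcycle_cmul frag_cmul_distrib algebra_simps)
 qed (simp add: zero)
 note nat = this
 have Fn: "F (n *. g) = n" for n
 proof (cases "n \<ge> 0")
  case True
  thus ?thesis using nat[of "nat n"] by simp
 next
  case False
  thus ?thesis using minus[of "(int (nat (- n))) *. g"] nat[of "nat (- n)"] g
   by (simp add: singular_relcycle_cmul)
 qed
 have "homologous_rel p X S c ((F c) *. g)" if c: "relcycle p X S c" for c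
 proof -
  have "homologous_rel_set p X S c = homologous_rel_set p X S ((F c) *. g)"
  proof (rule inj_onD)
   show "inj_on f (carrier ?G)" using bij by (simp add: bij_betw_def)
   show "f (homologous_rel_set p X S c) = f (homologous_rel_set p X S ((F c) *. g))"
    using Fn[of "F c"] by (simp add: F_def)
  qed (use carr c g singular_relcycle_cmul in blast)+
  thus ?thesis by (simp add: homologous_rel_set_eq)
 qed
 thus thesis using that g by blast
qed

lemma plane_local_homology:
 "relative_homology_group 2 (euclidean :: complex topology) (- {x}) \<cong> integer_group"
proof -
 have "relative_homology_group 2 (euclidean :: complex topology) (- {x}) \<cong>
    reduced_homology_group (2 - 1) (top_of_set (- {x}))"
 proof (rule is_isoI[OF iso_relative_homology_of_contractible[OF contractible_space_plane]])
  have "x + 1 \<in> - {x}" by simp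
  thus "topspace euclidean \<inter> - {x} ~= {}" by (metis Int_iff UNIV_I empty_iff topspace_euclidean)
 qed
 also have "reduced_homology_group (2 - 1) (top_of_set (- {x})) = homology_group 1 (top_of_set (- {x}))"
  by (simp add: un_reduced_homology_group)
 also have "... \<cong> homology_group 1 (top_of_set (sphere x 1))" by (rule homology_group_punctured_plane)
 also have "... \<cong> integer_group" by (rule homology_group_circle)
 finally show ?thesis .
qed

lemma chart_local_homology:
 assumes Y: "Hausdorff_space Y" and ch: "complex_chart Y (V, \<phi>)" and y: "y \<in> V"
 shows "relative_homology_group 2 Y (topspace Y - {y}) \<cong> integer_group"
proof -
 have V: "openin Y V" and W: "open (\<phi> ` V)" and h: "homeomorphic_map (Y on V) (top_of_set (\<phi> ` V)) \<phi>"
  using ch by (auto simp: complex_chart_def)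
 have VY: "V <= topspace Y" using V by (rule openin_subset)
 have inj: "inj_on \<phi> V" using homeomorphic_imp_injective_map[OF h] VY by (simp add: Int_absorb1)
 have top: "topspace (Y on V) = V" using VY by auto
 have "closedin Y {y}" using Y y VY closedin_Hausdorff_singleton by fastforce
 hence 1: "relative_homology_group 2 (Y on V) (V - {y}) \<cong> relative_homology_group 2 Y (topspace Y - {y})"
  using y by (intro is_isoI[OF excision_open[OF V]]) simp_all
 have 2: "relative_homology_group 2 (top_of_set (\<phi> ` V)) (\<phi> ` V - {\<phi> y}) \<cong>
      relative_homology_group 2 euclidean (topspace euclidean - {\<phi> y})"
  using y W by (intro is_isoI[OF excision_open]) auto
 have "hom_induced 2 (Y on V) (V - {y}) (top_of_set (\<phi> ` V)) (\<phi> ` (V - {y})) \<phi>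
  \<in> iso (relative_homology_group 2 (Y on V) (V - {y}))
     (relative_homology_group 2 (top_of_set (\<phi> ` V)) (\<phi> ` (V - {y})))"
  by (rule homeomorphic_map_relative_homology_iso[OF h]) (use VY in auto)
 moreover have "\<phi> ` (V - {y}) = \<phi> ` V - {\<phi> y}" using inj y by (auto simp: inj_on_def)
 ultimately have 3: "relative_homology_group 2 (Y on V) (V - {y}) \<cong>
   relative_homology_group 2 (top_of_set (\<phi> ` V)) (\<phi> ` V - {\<phi> y})" by (metis is_isoI)
 have 4: "relative_homology_group 2 euclidean (topspace euclidean - {\<phi> y}) \<cong> integer_group"
  using plane_local_homology by (simp add: Compl_eq_Diff_UNIV)
 show ?thesis using iso_trans[OF group.iso_sym[OF _ 1] iso_trans[OF 3 iso_trans[OF 2 4]]] by simp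
qed

lemma complex_chart_restrict:
 assumes "complex_chart X (V, \<phi>)" "openin X B" "B <= V"
 shows "complex_chart X (B, \<phi>)"
proof -
 have V: "openin X V" and W: "open (\<phi> ` V)" and h: "homeomorphic_map (X on V) (top_of_set (\<phi> ` V)) \<phi>"
  using assms(1) by (auto simp: complex_chart_def)
 have top: "topspace (X on V) = V" using openin_subset[OF V] by auto
 have "openin (X on V) B" using assms(2,3) V by (simp add: openin_open_subtopology)
 hence "openin (top_of_set (\<phi> ` V)) (\<phi> ` B)"
  using homeomorphic_map_openness[OF h, of B] assms(3) unfolding top by blast
 hence "open (\<phi> ` B)" using W by (simp add: openin_open_eq)
 moreover have "homeomorphic_map ((X on V) on B) ((top_of_set (\<phi> ` V)) on (\<phi> ` B)) \<phi>"
  by (rule homeomorphic_map_subtopologies[OF h]) (use assms(3) top in auto)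
 ultimately show ?thesis
  using assms(2,3) by (simp add: complex_chart_def subtopology_subtopology Int_absorb1 image_mono)
qed

lemma complex_chart_small_disc:
 assumes ch: "complex_chart X (V, \<phi>)" and U: "openin X U" and x: "x \<in> V" "x \<in> U"
 obtains B r where "complex_chart X (B, \<phi>)" "x \<in> B" "B <= U" "B <= V" "r > 0" "\<phi> ` B = ball (\<phi> x) r"
proof -
 have V: "openin X V" using ch by (simp add: complex_chart_def)
 have "complex_chart X (U \<inter> V, \<phi>)" by (rule complex_chart_restrict[OF ch]) (use U V in auto)
 moreover have "x \<in> U \<inter> V" using x by simp
 ultimately obtain r where r: "r > 0"
  "openin X {v \<in> U \<inter> V. \<phi> v \<in> ball (\<phi> x) r}" "\<phi> ` {v \<in> U \<inter> V. \<phi> v \<in> cball (\<phi> x) r} = cball (\<phi> x) r"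
  by (rule complex_chart_disc)
 let ?B = "{v \<in> U \<inter> V. \<phi> v \<in> ball (\<phi> x) r}"
 have "\<phi> ` ?B = ball (\<phi> x) r"
 proof (intro subset_antisym subsetI)
  fix w assume w: "w \<in> ball (\<phi> x) r"
  hence "w \<in> \<phi> ` {v \<in> U \<inter> V. \<phi> v \<in> cball (\<phi> x) r}" unfolding r(3) by auto
  thus "w \<in> \<phi> ` ?B" using w by auto
 qed auto
 moreover have "complex_chart X (?B, \<phi>)" by (rule complex_chart_restrict[OF ch r(2)]) auto
 ultimately show thesis using that[of ?B r] r(1) x by auto
qed

lemma complex_chart_homeomorphic_space:
 "complex_chart X (B, \<phi>) ==> (X on B) homeomorphic_space top_of_set (\<phi> ` B)"
 by (auto simp: complex_chart_def homeomorphic_map_imp_homeomorphic_space)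

lemma complex_chart_ball:
 assumes "complex_chart X (B, \<phi>)" "\<phi> ` B = ball z r" "r > 0"
 shows "contractible_space (X on B)" "path_connectedin X B"
proof -
 have h: "(X on B) homeomorphic_space top_of_set (ball z r)"
  using complex_chart_homeomorphic_space[OF assms(1)] assms(2) by simp
 have "contractible_space (top_of_set (ball z r))"
  by (simp add: contractible_space_top_of_set convex_imp_contractible)
 thus "contractible_space (X on B)" using homeomorphic_space_contractibility[OF h] by blast
 have "path_connected_space (top_of_set (ball z r))"
  using convex_imp_path_connected[OF convex_ball, of z r] path_connectedin_euclidean[of "ball z r"]
  unfolding path_connectedin_def by blast
 hence "path_connected_space (X on B)" using h homeomorphic_path_connected_space by blast
 moreover have "B <= topspace X" using assms(1) by (auto simp: complex_chart_def openin_subset)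
 ultimately show "path_connectedin X B" by (simp add: path_connectedin_def)
qed

definition locally_plane :: "'a topology => bool" where
 "locally_plane X \<longleftrightarrow> (\<forall>x\<in>topspace X. \<exists>V \<phi>. complex_chart X (V, \<phi>) \<and> x \<in> V)"

lemma locally_plane_disc:
 assumes "locally_plane X" "openin X U" "x \<in> U"
 obtains B \<phi> r where "complex_chart X (B, \<phi>)" "x \<in> B" "B <= U" "r > 0" "\<phi> ` B = ball (\<phi> x) r"
proof -
 have "x \<in> topspace X" using assms(2,3) openin_subset by blast
 then obtain V \<phi> where "complex_chart X (V, \<phi>)" "x \<in> V" using assms(1) by (auto simp: locally_plane_def)
 thus thesis using complex_chart_small_disc[OF _ assms(2) _ assms(3)] that by metis
qed

lemma locally_plane_path_connected:
 assumes "locally_plane X"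
 shows "locally_path_connected_space X" unfolding locally_path_connected_space
proof clarify
 fix U x assume "openin X U" "x \<in> U"
 then obtain B \<phi> r where B: "complex_chart X (B, \<phi>)" "x \<in> B" "B <= U" "r > 0" "\<phi> ` B = ball (\<phi> x) r"
  by (rule locally_plane_disc[OF assms])
 thus "\<exists>W. openin X W \<and> path_connectedin X W \<and> x \<in> W \<and> W <= U"
  using complex_chart_ball(2)[OF B(1,5,4)] by (intro exI[of _ B]) (auto simp: complex_chart_def)
qed

lemma locally_plane_connected_imp_path_connected:
 assumes "locally_plane X" "connected_space X"
 shows "path_connected_space X"
proof (cases "topspace X = {}")
 case False
 then obtain x where x: "x \<in> topspace X" by blast
 let ?C = "Collect (path_component_of X x)"
 have "openin X ?C" "closedin X ?C" using locally_plane_path_connected[OF assms(1)]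
  by (simp_all add: openin_path_component_of_locally_path_connected_space
    closedin_path_component_of_locally_path_connected_space)
 moreover have "x \<in> ?C" using x by (simp add: path_component_of_refl)
 ultimately have "?C = topspace X" using assms(2) unfolding connected_space_clopen_in by blast
 thus ?thesis by (metis path_connectedin_path_component_of path_connectedin_topspace)
qed (simp add: path_connected_space_topspace_empty)

lemma locally_plane_open:
 assumes "locally_plane X" "openin X U"
 shows "locally_plane (X on U)" unfolding locally_plane_def
proof
 fix x assume "x \<in> topspace (X on U)"
 hence "x \<in> U" by auto
 then obtain B \<phi> r where B: "complex_chart X (B, \<phi>)" "x \<in> B" "B <= U" "r > 0" "\<phi> ` B = ball (\<phi> x) r"
  by (rule locally_plane_disc[OF assms])
 hence "complex_chart (X on U) (B, \<phi>)"
  using assms(2) by (auto simp: complex_chart_def openin_open_subtopology subtopology_subtopology Int_absorb1)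
 thus "\<exists>V \<phi>. complex_chart (X on U) (V, \<phi>) \<and> x \<in> V" using B by blast
qed

text \<open>A punctured disc around x is connected, so it lies on one side of any separation of the
  complement of x; giving x back to that side would separate X itself.\<close>

lemma connected_space_punctured_surface:
 assumes X: "locally_plane X" "Hausdorff_space X" "connected_space X" and x: "x \<in> topspace X"
 shows "connected_space (X on (topspace X - {x}))"
proof -
 obtain B \<phi> r where B: "complex_chart X (B, \<phi>)" "x \<in> B" "r > 0" "\<phi> ` B = ball (\<phi> x) r"
  using locally_plane_disc[OF X(1) openin_topspace x] by metis
 have BX: "openin X B" "homeomorphic_map (X on B) (top_of_set (\<phi> ` B)) \<phi>"
  using B(1) by (auto simp: complex_chart_def)
 have sub: "B <= topspace X" using BX(1) by (rule openin_subset)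
 hence inj: "inj_on \<phi> B" using homeomorphic_imp_injective_map[OF BX(2)] by (simp add: Int_absorb1)
 have "homeomorphic_map ((X on B) on (B - {x})) ((top_of_set (\<phi> ` B)) on (\<phi> ` (B - {x}))) \<phi>"
  by (rule homeomorphic_map_subtopologies[OF BX(2)]) (use sub in auto)
 moreover have "\<phi> ` (B - {x}) = ball (\<phi> x) r - {\<phi> x}"
 proof -
  have "\<phi> ` (B - {x}) = \<phi> ` B - {\<phi> x}" using inj B(2) by (auto simp: inj_on_def)
  thus ?thesis by (simp add: B(4))
 qed
 ultimately have "(X on (B - {x})) homeomorphic_space top_of_set (ball (\<phi> x) r - {\<phi> x})"
  using B(4) by (auto simp: subtopology_subtopology Int_absorb1 homeomorphic_map_imp_homeomorphic_space)
 moreover have "connected (ball (\<phi> x) r - {\<phi> x})" by (rule connected_punctured_ball) simp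
 ultimately have "connected_space (X on (B - {x}))"
  using homeomorphic_connected_space connectedin_def connectedin_iff_connected by blast
 hence cB: "connectedin X (B - {x})" using sub by (auto simp: connectedin_def)
 have "\<phi> x + of_real (r/2) \<in> ball (\<phi> x) r" using B(3) by (simp add: dist_norm)
 then obtain b where b: "b \<in> B" "\<phi> b = \<phi> x + of_real (r/2)" using B(4) by (metis imageE)
 hence b': "b \<in> B - {x}" using B(3) by auto
 have op: "openin X (topspace X - {x})"
  using X(2) x by (metis closedin_Hausdorff_singleton openin_diff openin_topspace)
 have *: False
  if E: "openin X E1" "openin X E2" "E1 \<union> E2 = topspace X - {x}" "E1 \<inter> E2 = {}" "E2 ~= {}"
   "B - {x} <= E1" for E1 E2
 proof -
  have "openin X (E1 \<union> B)" using E(1) BX(1) by (rule openin_Un)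
  moreover have "(E1 \<union> B) \<inter> E2 = {}" "topspace X <= (E1 \<union> B) \<union> E2" "E1 \<union> B ~= {}" using E B(2) by auto
  ultimately show False using X(3) E(2,5) unfolding connected_space_def by blast
 qed
 have "connectedin X (topspace X - {x})" unfolding connectedin
 proof (intro conjI notI)
  assume "\<exists>E1 E2. openin X E1 \<and> openin X E2 \<and> topspace X - {x} <= E1 \<union> E2 \<and>
   E1 \<inter> E2 \<inter> (topspace X - {x}) = {} \<and> E1 \<inter> (topspace X - {x}) ~= {} \<and> E2 \<inter> (topspace X - {x}) ~= {}"
  then obtain E1 E2 where E: "openin X E1" "openin X E2" "topspace X - {x} <= E1 \<union> E2"
   "E1 \<inter> E2 \<inter> (topspace X - {x}) = {}" "E1 \<inter> (topspace X - {x}) ~= {}" "E2 \<inter> (topspace X - {x}) ~= {}" by blast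
  define D1 D2 where "D1 = E1 \<inter> (topspace X - {x})" and "D2 = E2 \<inter> (topspace X - {x})"
  have D: "openin X D1" "openin X D2" "D1 \<union> D2 = topspace X - {x}" "D1 \<inter> D2 = {}" "D1 ~= {}" "D2 ~= {}"
   using E op unfolding D1_def D2_def by (auto intro: openin_Int)
  have "B - {x} <= D1 \<union> D2" using D(3) sub by blast
  hence "D1 \<inter> (B - {x}) = {} \<or> D2 \<inter> (B - {x}) = {}" using cB D(1,2,4) unfolding connectedin by blast
  hence "B - {x} <= D1 \<or> B - {x} <= D2" using D(3) sub by blast
  thus False using *[of D1 D2] *[of D2 D1] D by (simp add: Int_commute Un_commute) blast
 qed blast
 thus ?thesis by (simp add: connectedin_def)
qed

lemma connectedin_surface_minus_finite:
 assumes X: "locally_plane X" "Hausdorff_space X" "connected_space X" and F: "finite F"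
 shows "connectedin X (topspace X - F)" using F
proof (induction F rule: finite_induct)
 case empty
 thus ?case using X(3) by (simp add: connectedin_topspace)
next
 case (insert x F)
 let ?Y = "X on (topspace X - F)"
 have "closedin X (topspace X \<inter> F)" using X(2) insert.hyps(1) by (intro closedin_Hausdorff_finite) auto
 hence op: "openin X (topspace X - F)"
  using openin_diff[OF openin_topspace, of X "topspace X \<inter> F"] by (simp add: Diff_Int)
 have Y: "locally_plane ?Y" "Hausdorff_space ?Y" "connected_space ?Y"
  using X insert.IH op by (auto simp: locally_plane_open Hausdorff_space_subtopology connectedin_def)
 show ?case
 proof (cases "x \<in> topspace X")
  case True
  hence "connected_space (?Y on (topspace ?Y - {x}))"
   using insert.hyps by (intro connected_space_punctured_surface[OF Y]) auto
  moreover have "topspace ?Y - {x} = topspace X - insert x F" by auto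
  ultimately have "connected_space (X on (topspace X - insert x F))"
   by (simp add: subtopology_subtopology) (metis Diff_insert Diff_subset Int_absorb1)
  thus ?thesis by (simp add: connectedin_def)
 next
  case False
  hence "topspace X - insert x F = topspace X - F" by auto
  thus ?thesis using insert.IH by simp
 qed
qed

section \<open>Periodic maps acting trivially on the first homology\<close>

lemma lookup_frag_extend_inj:
 assumes "inj_on g S" "keys c <= S" "s \<in> S"
 shows "lookup (frag_extend (frag_of \<circ> g) c) (g s) = lookup c s" using assms(2)
proof (induction c rule: frag_induction)
 case (one x)
 thus ?case using assms(1,3) by (auto simp: inj_on_def)
qed (auto simp: frag_extend_diff lookup_minus)

lemma lookup_frag_extend_restrict:
 "lookup (frag_extend (\<lambda>x. if x \<in> R then frag_of x else 0) c) s = (if s \<in> R then lookup c s else 0)"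
proof -
 have "keys c <= UNIV" by simp
 thus ?thesis
 proof (induction c rule: frag_induction)
  case (diff a b)
  thus ?case by (simp add: frag_extend_diff lookup_minus)
 qed auto
qed

locale periodic_map =
 fixes X :: "'a topology" and h :: "'a => 'a" and p :: nat
 assumes prime: "prime p" and cont: "continuous_map X X h"
  and period: "x \<in> topspace X ==> (h ^^ p) x = x"
begin

lemma p_gt_0: "p > 0" using prime by (rule prime_gt_0_nat)

lemma cont_pow: "continuous_map X X (h ^^ i)"
proof (induction i)
 case (Suc i)
 thus ?case using continuous_map_compose[OF Suc cont] by (simp only: funpow.simps)
qed simp

lemma pow_in: "x \<in> topspace X ==> (h ^^ i) x \<in> topspace X" using cont_pow by (auto simp: continuous_map_def)

lemma pow_period: "x \<in> topspace X ==> (h ^^ (k * p)) x = x"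
proof (induction k)
 case (Suc k)
 thus ?case using period by (simp add: funpow_add add.commute)
qed simp

lemma pow_mod: "x \<in> topspace X ==> (h ^^ i) x = (h ^^ (i mod p)) x"
 using pow_period[of x "i div p"] by (metis comp_apply funpow_add mod_div_mult_eq)

text \<open>The exponent i is invertible modulo the prime p, so h agrees on X with a power of
  \<open>h ^^ i\<close>.\<close>

lemma fixed_of_pow:
 assumes x: "x \<in> topspace X" and i: "0 < i" "i < p" "(h ^^ i) x = x"
 shows "h x = x"
proof -
 have "coprime i p" using prime i by (metis coprime_commute nat_dvd_not_less prime_imp_coprime_nat)
 then obtain a where "[i * a = Suc 0] (mod p)" using cong_solve_coprime_nat by blast
 hence a: "(i * a) mod p = 1" using prime_gt_1_nat[OF prime] by (simp add: cong_def)
 have "(h ^^ (i * a)) x = x" for a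
 proof (induction a)
  case (Suc a)
  thus ?case using i by (simp add: funpow_add)
 qed simp
 thus ?thesis using pow_mod[OF x, of "i * a"] a by simp
qed

lemma pow_inj:
 assumes x: "x \<in> topspace X" "h x ~= x" and ij: "i < p" "j < p" "(h ^^ i) x = (h ^^ j) x"
 shows "i = j"
proof -
 have *: False if "i < j" "j < p" "(h ^^ i) x = (h ^^ j) x" for i j
 proof -
  have jp: "p - j + j = p" using that(2) by linarith
  have "(h ^^ (p - j + i)) x = (h ^^ (p - j)) ((h ^^ i) x)" by (simp add: funpow_add)
  also have "... = (h ^^ (p - j)) ((h ^^ j) x)" by (simp only: that(3))
  also have "... = (h ^^ (p - j + j)) x" by (simp add: funpow_add)
  also have "... = x" unfolding jp by (rule period[OF x(1)])
  finally have "(h ^^ (p - j + i)) x = x" .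
  moreover have "0 < p - j + i" "p - j + i < p" using that(1,2) by linarith+
  ultimately have "h x = x" using fixed_of_pow[OF x(1)] by metis
  with x(2) show False ..
 qed
 show ?thesis using *[of i j] *[of j i] ij by (metis linorder_neqE_nat)
qed

abbreviation hs where "hs q i \<equiv> simplex_map q (h ^^ i)"

lemma hs_simplex: "singular_simplex q X \<sigma> ==> singular_simplex q X (hs q i \<sigma>)"
 by (rule singular_simplex_simplex_map[OF _ cont_pow])

lemma hs_hs: "hs q i (hs q j \<sigma>) = hs q (i + j) \<sigma>"
 using simplex_map_compose[of q "h ^^ i" "h ^^ j"] by (simp add: funpow_add)

lemma hs_period: "singular_simplex q X \<sigma> ==> hs q p \<sigma> = \<sigma>"
 using simplex_map_id_gen[of q X \<sigma> "h ^^ p"] period by blast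

lemma hs_0: "singular_simplex q X \<sigma> ==> hs q 0 \<sigma> = \<sigma>" by (rule simplex_map_id_gen) auto

lemma hs_mod: "singular_simplex q X \<sigma> ==> hs q i \<sigma> = hs q (i mod p) \<sigma>"
 using simplex_map_eq[of q X \<sigma> "h ^^ i" "h ^^ (i mod p)"] pow_mod by blast

lemma simplex_in: "singular_simplex q X \<sigma> ==> t \<in> Delta q ==> \<sigma> t \<in> topspace X"
 by (auto simp: singular_simplex_def continuous_map_def)

text \<open>The norm element 1 + h + ... + h^(p-1) of the group ring, acting on chains.\<close>

definition Nm where "Nm q c = (\<Sum>i<p. chain_map q (h ^^ i) c)"

lemma Nm_add: "Nm q (a + b) = Nm q a + Nm q b" by (simp add: Nm_def chain_map_add sum.distrib)

lemma Nm_diff: "Nm q (a - b) = Nm q a - Nm q b" by (simp add: Nm_def chain_map_diff sum_subtractf)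

lemma Nm_0 [simp]: "Nm q 0 = 0" by (simp add: Nm_def)

lemma Nm_cmul: "Nm q (k *. c) = k *. (Nm q c)" by (simp add: Nm_def frag_cmul_sum)

lemma Nm_chain: "chain q X c ==> chain q X (Nm q c)"
 unfolding Nm_def by (intro singular_chain_sum singular_chain_chain_map[OF _ cont_pow])

lemma Nm_boundary:
 "chain q X c ==> bdry q (Nm q c) = Nm (q - Suc 0) (bdry q c)"
 unfolding Nm_def by (simp add: chain_boundary_sum comp_def chain_boundary_chain_map)

lemma chain_map_pow_Suc:
 "chain_map q (h ^^ i) (chain_map q h c) = chain_map q (h ^^ Suc i) c"
 using chain_map_compose[of q "h ^^ i" h] by (simp add: funpow_swap1 fun_eq_iff comp_def)

lemma Nm_map:
 assumes c: "chain q X c"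
 shows "Nm q (chain_map q h c) = Nm q c"
proof -
 have *: "chain_map q (h ^^ p) c = c" "chain_map q (h ^^ 0) c = c"
  using c period by (auto intro: chain_map_id_gen)
 have "Nm q (chain_map q h c) + chain_map q (h ^^ 0) c = (\<Sum>i<Suc p. chain_map q (h ^^ i) c)"
  unfolding Nm_def chain_map_pow_Suc by (subst sum.lessThan_Suc_shift) (rule add.commute)
 also have "... = Nm q c + chain_map q (h ^^ p) c" by (simp add: Nm_def)
 finally show ?thesis using * by simp
qed

lemma Nm_map_diff: "chain q X c ==> Nm q (chain_map q h c - c) = 0" by (simp add: Nm_diff Nm_map)

text \<open>The image of h - 1, that is, the augmentation ideal of the group ring applied to the
  chains.\<close>

definition aug where "aug q = {chain_map q h v - v | v. chain q X v}"

lemma aug_diff: "a \<in> aug q ==> b \<in> aug q ==> a - b \<in> aug q" unfolding aug_def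
proof clarify
 fix v w assume "chain q X v" "chain q X w"
 thus "\<exists>u. chain_map q h v - v - (chain_map q h w - w) = chain_map q h u - u \<and> chain q X u"
  by (intro exI[of _ "v - w"]) (simp add: chain_map_diff singular_chain_diff)
qed

lemma aug_0: "0 \<in> aug q" unfolding aug_def by (rule CollectI, rule exI[of _ 0]) simp

lemma hs_aug: "singular_simplex q X \<sigma> ==> frag_of \<sigma> - frag_of (hs q i \<sigma>) \<in> aug q"
proof (induction i)
 case 0
 thus ?case by (simp only: hs_0[OF 0] diff_self aug_0)
next
 case (Suc i)
 have "frag_of (hs q (Suc i) \<sigma>) - frag_of (hs q i \<sigma>) \<in> aug q"
  unfolding aug_def using hs_simplex[OF Suc.prems, of i] hs_hs[of q 1 i \<sigma>]
  by (intro CollectI exI[of _ "frag_of (hs q i \<sigma>)"]) (simp add: singular_chain_of)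
 from aug_diff[OF Suc.IH[OF Suc.prems] this] show ?case by (simp del: funpow.simps)
qed

text \<open>A simplex differs from any of its translates by a telescoping sum of differences h v -
  v, so moving simplices within their orbits costs only a chain in \<open>aug q\<close>.\<close>

lemma frag_extend_aug:
 assumes "!!\<sigma>. \<sigma> \<in> keys c ==> singular_simplex q X \<sigma> \<and> (\<exists>i. r \<sigma> = hs q i \<sigma>)"
 shows "c - frag_extend (frag_of \<circ> r) c \<in> aug q"
proof -
 have "keys c <= {\<sigma>. singular_simplex q X \<sigma> \<and> (\<exists>i. r \<sigma> = hs q i \<sigma>)}" using assms by blast
 thus ?thesis
 proof (induction c rule: frag_induction)
  case (one \<sigma>)
  thus ?case using hs_aug by auto
 next
  case (diff a b)
  have "a - b - frag_extend (frag_of \<circ> r) (a - b) =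
   (a - frag_extend (frag_of \<circ> r) a) - (b - frag_extend (frag_of \<circ> r) b)" by (simp add: frag_extend_diff)
  thus ?case using aug_diff[OF diff.IH] by (simp only:)
 qed (simp add: aug_0)
qed

text \<open>For simplices of X the predicate depends only on the orbit, so the choice is the same
  for all members of an orbit (\<open>rep_hs\<close>).\<close>

definition rep where "rep q \<sigma> = (SOME \<rho>. \<exists>i. \<rho> = hs q i \<sigma>)"

lemma rep_hs: "singular_simplex q X \<sigma> ==> rep q (hs q j \<sigma>) = rep q \<sigma>"
proof -
 assume s: "singular_simplex q X \<sigma>"
 have "(\<exists>i. \<rho> = hs q i (hs q j \<sigma>)) \<longleftrightarrow> (\<exists>i. \<rho> = hs q i \<sigma>)" for \<rho>
 proof
  assume "\<exists>i. \<rho> = hs q i \<sigma>"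
  then obtain i where i: "\<rho> = hs q i \<sigma>" by blast
  have "hs q (i + j * (p - 1)) (hs q j \<sigma>) = hs q (i + j * (p - 1) + j) \<sigma>" by (simp add: hs_hs)
  also have "i + j * (p - 1) + j = i + j * p" using p_gt_0 by (cases p) (auto simp: algebra_simps)
  also have "hs q (i + j * p) \<sigma> = hs q i \<sigma>" using hs_mod[OF s, of "i + j * p"] hs_mod[OF s, of i] by simp
  finally show "\<exists>i. \<rho> = hs q i (hs q j \<sigma>)" unfolding i by (intro exI) (rule sym)
 next
  assume "\<exists>i. \<rho> = hs q i (hs q j \<sigma>)"
  thus "\<exists>i. \<rho> = hs q i \<sigma>" unfolding hs_hs by blast
 qed
 thus ?thesis unfolding rep_def by (simp only:)
qed

lemma rep_ex: "\<exists>i. rep q \<sigma> = hs q i \<sigma>" unfolding rep_def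
 by (rule someI[of "\<lambda>\<rho>. \<exists>i. \<rho> = hs q i \<sigma>" "hs q 0 \<sigma>"]) (rule exI, rule refl)

lemma rep_rep: "singular_simplex q X \<sigma> ==> rep q (rep q \<sigma>) = rep q \<sigma>" using rep_ex[of q \<sigma>] rep_hs[of q \<sigma>] by auto

end

locale periodic_map_nbhd = periodic_map +
 fixes N assumes N_open: "openin X N" and N_inv: "x \<in> topspace X ==> h x \<in> N \<longleftrightarrow> x \<in> N"
  and N_fixed: "x \<in> topspace X ==> h x = x ==> x \<in> N"
begin

text \<open>The simplices that leave N somewhere. Modulo chains in N they form a basis, and h
  permutes them freely because a point outside N is not fixed; this is the free module over the
  group ring.\<close>

definition out where "out q = {\<sigma>. singular_simplex q X \<sigma> \<and> \<not> \<sigma> ` Delta q <= N}"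

lemma N_pow: "x \<in> topspace X ==> (h ^^ i) x \<in> N \<longleftrightarrow> x \<in> N" by (induction i) (auto simp: N_inv pow_in)

lemma out_hs:
 assumes "\<sigma> \<in> out q"
 shows "hs q i \<sigma> \<in> out q"
proof -
 obtain t where t: "t \<in> Delta q" "\<sigma> t \<notin> N" and s: "singular_simplex q X \<sigma>" using assms by (auto simp: out_def)
 hence "hs q i \<sigma> t \<notin> N" using simplex_in N_pow by (simp add: simplex_map_def)
 thus ?thesis using t(1) hs_simplex[OF s] by (auto simp: out_def)
qed

lemma out_free:
 assumes "\<sigma> \<in> out q" "i < p" "j < p" "hs q i \<sigma> = hs q j \<sigma>"
 shows "i = j"
proof -
 obtain t where t: "t \<in> Delta q" "\<sigma> t \<notin> N" "singular_simplex q X \<sigma>" using assms(1) by (auto simp: out_def)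
 hence "h (\<sigma> t) ~= \<sigma> t" "\<sigma> t \<in> topspace X" using N_fixed simplex_in by blast+
 moreover have "(h ^^ i) (\<sigma> t) = (h ^^ j) (\<sigma> t)"
  using fun_cong[OF assms(4), of t] t(1) by (simp add: simplex_map_def)
 ultimately show ?thesis using pow_inj assms(2,3) by blast
qed

lemma chain_split_out:
 assumes "chain q X c"
 obtains a b where "c = a + b" "chain q (X on N) a" "keys b <= out q"
  "keys b <= keys c"
proof -
 have "keys c <= {\<sigma>. singular_simplex q (X on N) \<sigma>} \<union> (out q \<inter> keys c)"
  using assms by (auto simp: singular_chain_def out_def singular_simplex_subtopology)
 then obtain a b where "keys a <= {\<sigma>. singular_simplex q (X on N) \<sigma>}"
  "keys b <= out q \<inter> keys c" "a + b = c" using frag_split by (metis (no_types, lifting))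
 thus thesis using that[of a b] by (auto simp: singular_chain_def)
qed

lemma out_chain: "keys b <= out q ==> chain q X b" by (auto simp: singular_chain_def out_def)

lemma out_chain_N_zero:
 assumes "keys b <= out q" "chain q (X on N) b"
 shows "b = 0"
proof -
 have "keys b = {}" using assms by (fastforce simp: out_def singular_chain_def singular_simplex_subtopology)
 thus ?thesis by simp
qed

lemma keys_chain_map: "keys (chain_map q f c) <= simplex_map q f ` keys c"
 unfolding chain_map_def using keys_frag_extend[of "frag_of \<circ> simplex_map q f" c] by auto

lemma out_chain_map: "keys b <= out q ==> keys (chain_map q (h ^^ i) b) <= out q"
 using keys_chain_map[of q "h ^^ i" b] out_hs by blast

lemma out_Nm: "keys b <= out q ==> keys (Nm q b) <= out q"
 unfolding Nm_def using keys_sum[of "\<lambda>i. chain_map q (h ^^ i) b" "{..<p}"] out_chain_map[of b q] by blast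

lemma N_chain_map:
 assumes "chain q (X on N) a"
 shows "chain q (X on N) (chain_map q (h ^^ i) a)"
proof (rule singular_chain_chain_map[OF assms])
 show "continuous_map (X on N) (X on N) (h ^^ i)"
  using cont_pow N_pow by (auto simp: continuous_map_in_subtopology continuous_map_from_subtopology)
qed

lemma N_Nm: "chain q (X on N) a ==> chain q (X on N) (Nm q a)"
 unfolding Nm_def by (intro singular_chain_sum N_chain_map)

text \<open>The orbit of a simplex in \<open>out q\<close> has p distinct members, so exactly one of
  the p translates of its representative is equal to it.\<close>

lemma lookup_Nm:
 assumes e: "keys e <= {\<sigma> \<in> out q. rep q \<sigma> = \<sigma>}" and t: "\<tau> \<in> out q"
 shows "lookup (Nm q e) \<tau> = lookup e (rep q \<tau>)" using e
proof (induction e rule: frag_induction)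
 case (one \<sigma>)
 hence s: "\<sigma> \<in> out q" "rep q \<sigma> = \<sigma>" "singular_simplex q X \<sigma>" by (auto simp: out_def)
 have ts: "singular_simplex q X \<tau>" using t by (simp add: out_def)
 have "lookup (Nm q (frag_of \<sigma>)) \<tau> = (\<Sum>i<p. if hs q i \<sigma> = \<tau> then 1 else 0)"
  unfolding Nm_def by (simp add: lookup_sum eq_commute)
 also have "... = (if rep q \<tau> = \<sigma> then 1 else 0)"
 proof (cases "rep q \<tau> = \<sigma>")
  case True
  obtain j where "\<sigma> = hs q j \<tau>" using rep_ex True by metis
  hence "hs q (j * (p - 1)) \<sigma> = hs q (j * (p - 1) + j) \<tau>" by (simp add: hs_hs)
  also have "j * (p - 1) + j = j * p" using p_gt_0 by (cases p) (auto simp: algebra_simps)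
  also have "hs q (j * p) \<tau> = hs q 0 \<tau>" using hs_mod[OF ts, of "j * p"] by (simp only: mod_mult_self2_is_0)
  also have "... = \<tau>" by (rule hs_0[OF ts])
  finally have "hs q (j * (p - 1)) \<sigma> = \<tau>" .
  hence k: "hs q ((j * (p - 1)) mod p) \<sigma> = \<tau>" using hs_mod[OF s(3)] by metis
  let ?k = "(j * (p - 1)) mod p"
  have kp: "?k < p" using p_gt_0 by simp
  have "(\<Sum>i<p. if hs q i \<sigma> = \<tau> then 1 else 0) = (\<Sum>i<p. if i = ?k then 1 else (0::int))"
  proof (intro sum.cong refl if_cong)
   fix i assume "i \<in> {..<p}"
   thus "hs q i \<sigma> = \<tau> \<longleftrightarrow> i = ?k" using out_free[OF s(1), of i ?k] k kp by auto
  qed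
  also have "... = 1" using kp by simp
  finally show ?thesis using True by simp
 next
  case False
  have "hs q i \<sigma> ~= \<tau>" for i using rep_hs[OF s(3), of i] s(2) False by auto
  thus ?thesis using False by simp
 qed
 finally show ?case by simp
next
 case (diff a b)
 thus ?case by (simp add: Nm_diff lookup_minus)
qed simp

text \<open>One half of the vanishing of Tate cohomology for a free module: modulo N an invariant
  chain has constant coefficients on each orbit, so it is the norm of its restriction to one simplex
  per orbit.\<close>

lemma Nm_of_invariant:
 assumes c: "chain q X c" and inv: "chain q (X on N) (chain_map q h c - c)"
 obtains c' \<mu> where "chain q X c'" "chain q (X on N) \<mu>" "c = Nm q c' + \<mu>"
proof -
 obtain a b where ab: "c = a + b" and a: "chain q (X on N) a"
  and b: "keys b <= out q" using chain_split_out[OF c] by metis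
 have "chain_map q h b - b = (chain_map q h c - c) - (chain_map q h a - a)" by (simp add: ab chain_map_add)
 moreover have "chain q (X on N) (chain_map q h a - a)"
  using N_chain_map[OF a, of 1] a by (simp add: singular_chain_diff)
 ultimately have "chain q (X on N) (chain_map q h b - b)" using inv singular_chain_diff by metis
 moreover have "keys (chain_map q h b - b) <= out q"
  using out_chain_map[OF b, of 1] b keys_diff[of "chain_map q h b" b] by auto
 \<comment> \<open>The difference consists of simplices leaving N and is also a chain in N; hence it
   is zero and b is invariant exactly, not just modulo N.\<close>
 ultimately have hb: "chain_map q h b = b" using out_chain_N_zero by (metis eq_iff_diff_eq_0)
 have inj: "inj_on (hs q 1) {\<sigma>. singular_simplex q X \<sigma>}"
 proof (rule inj_on_inverseI)
  fix \<sigma> assume "\<sigma> \<in> {\<sigma>. singular_simplex q X \<sigma>}"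
  thus "hs q (p - 1) (hs q 1 \<sigma>) = \<sigma>" using hs_hs[of q "p - 1" 1] hs_period p_gt_0 by simp
 qed
 have l1: "lookup b (hs q i \<sigma>) = lookup b \<sigma>" if "singular_simplex q X \<sigma>" for i \<sigma>
 proof (induction i)
  case 0
  thus ?case by (simp only: hs_0[OF that])
 next
  case (Suc i)
  have "lookup (chain_map q (h ^^ 1) b) (hs q 1 (hs q i \<sigma>)) = lookup b (hs q i \<sigma>)" unfolding chain_map_def
   by (rule lookup_frag_extend_inj[OF inj]) (use b hs_simplex[OF that] in \<open>auto simp: out_def\<close>)
  moreover have "hs q 1 (hs q i \<sigma>) = hs q (Suc i) \<sigma>" using hs_hs[of q 1 i \<sigma>] by (simp only: plus_1_eq_Suc)
  moreover have "chain_map q (h ^^ 1) b = b" using hb by simp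
  ultimately show ?case using Suc by (simp only:)
 qed
 define R where "R = {\<sigma> \<in> out q. rep q \<sigma> = \<sigma>}"
 define e where "e = frag_extend (\<lambda>\<sigma>. if \<sigma> \<in> R then frag_of \<sigma> else 0) b"
 have le: "lookup e \<sigma> = (if \<sigma> \<in> R then lookup b \<sigma> else 0)" for \<sigma>
  unfolding e_def by (rule lookup_frag_extend_restrict)
 have eR: "keys e <= R" using le by (metis in_keys_iff subsetI)
 have "Nm q e = b"
 proof (rule poly_mapping_eqI)
  fix \<tau>
  show "lookup (Nm q e) \<tau> = lookup b \<tau>"
  proof (cases "\<tau> \<in> out q")
   case True
   hence ts: "singular_simplex q X \<tau>" by (simp add: out_def)
   obtain i where i: "rep q \<tau> = hs q i \<tau>" using rep_ex by blast
   have "rep q \<tau> \<in> R" using out_hs[OF True, of i] i rep_rep[OF ts] by (simp add: R_def)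
   thus ?thesis using lookup_Nm[OF eR[unfolded R_def] True] le[of "rep q \<tau>"] l1[OF ts, of i] i by simp
  next
   case False
   have "keys e <= out q" using eR by (auto simp: R_def)
   thus ?thesis using False b out_Nm[of e q] by (metis in_keys_iff subsetD)
  qed
 qed
 moreover have "chain q X e" using eR out_chain[of e q] by (auto simp: R_def)
 ultimately show thesis using that[of e a] a ab by (simp add: add.commute)
qed

text \<open>The other half of the vanishing: modulo N the kernel of the norm is the image of h - 1.
  Moving every simplex to its representative costs a chain in \<open>aug q\<close>, and a chain of
  representatives can be read off from its norm.\<close>

lemma aug_of_Nm_zero:
 assumes c: "chain q X c" and N0: "chain q (X on N) (Nm q c)"
 obtains v \<nu> where "chain q X v" "chain q (X on N) \<nu>" "c = chain_map q h v - v + \<nu>"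
proof -
 obtain a b where ab: "c = a + b" and a: "chain q (X on N) a"
  and b: "keys b <= out q" using chain_split_out[OF c] by metis
 have "Nm q b = Nm q c - Nm q a" by (simp add: ab Nm_add)
 hence "chain q (X on N) (Nm q b)" using N0 N_Nm[OF a] singular_chain_diff by metis
 hence Nb: "Nm q b = 0" using out_chain_N_zero[OF out_Nm[OF b]] by blast
 define e where "e = frag_extend (frag_of \<circ> rep q) b"
 have be: "b - e \<in> aug q" unfolding e_def by (rule frag_extend_aug) (use b rep_ex in \<open>auto simp: out_def\<close>)
 have eR: "keys e <= {\<sigma> \<in> out q. rep q \<sigma> = \<sigma>}"
 proof
  fix \<sigma> assume "\<sigma> \<in> keys e"
  then obtain \<tau> where t: "\<tau> \<in> keys b" "\<sigma> = rep q \<tau>"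
   using keys_frag_extend[of "frag_of \<circ> rep q" b] unfolding e_def by auto
  hence "\<tau> \<in> out q" "singular_simplex q X \<tau>" using b by (auto simp: out_def)
  thus "\<sigma> \<in> {\<sigma> \<in> out q. rep q \<sigma> = \<sigma>}" using t(2) rep_ex[of q \<tau>] out_hs rep_rep by auto
 qed
 obtain v where v: "b - e = chain_map q h v - v" "chain q X v" using be by (auto simp: aug_def)
 hence "Nm q (b - e) = 0" using Nm_map_diff by simp
 hence Ne: "Nm q e = 0" using Nb by (simp add: Nm_diff)
 have "e = 0"
 proof (rule poly_mapping_eqI)
  fix \<tau>
  show "lookup e \<tau> = lookup 0 \<tau>"
  proof (cases "\<tau> \<in> {\<sigma> \<in> out q. rep q \<sigma> = \<sigma>}")
   case True
   hence "\<tau> \<in> out q" "rep q \<tau> = \<tau>" by blast+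
   hence "lookup e \<tau> = lookup (Nm q e) \<tau>" using lookup_Nm[OF eR, of \<tau>] by (simp only:)
   thus ?thesis by (simp only: Ne)
  next
   case False
   hence "\<tau> \<notin> keys e" using eR by blast
   thus ?thesis by (simp add: in_keys_iff)
  qed
 qed
 hence "c = chain_map q h v - v + a" using v(1) ab by (simp add: add.commute)
 thus thesis using that[of v a] v(2) a by blast
qed

end

section \<open>The quotient topology and the orbit space\<close>

definition quot_top :: "'a topology => ('a => 'b) => 'b topology" where
 "quot_top X q = topology (\<lambda>U. U <= q ` topspace X \<and> openin X {x \<in> topspace X. q x \<in> U})"

lemma openin_quot_top:
 "openin (quot_top X q) U \<longleftrightarrow> U <= q ` topspace X \<and> openin X {x \<in> topspace X. q x \<in> U}"
proof -
 have "istopology (\<lambda>U. U <= q ` topspace X \<and> openin X {x \<in> topspace X. q x \<in> U})" unfolding istopology_def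
 proof (intro conjI allI impI)
  fix S T assume *: "S <= q ` topspace X \<and> openin X {x \<in> topspace X. q x \<in> S}"
   "T <= q ` topspace X \<and> openin X {x \<in> topspace X. q x \<in> T}"
  have "{x \<in> topspace X. q x \<in> S \<inter> T} = {x \<in> topspace X. q x \<in> S} \<inter> {x \<in> topspace X. q x \<in> T}" by auto
  thus "openin X {x \<in> topspace X. q x \<in> S \<inter> T}" using * by (simp add: openin_Int)
  show "S \<inter> T <= q ` topspace X" using * by auto
 next
  fix \<K> assume *: "\<forall>K\<in>\<K>. K <= q ` topspace X \<and> openin X {x \<in> topspace X. q x \<in> K}"
  have "{x \<in> topspace X. q x \<in> \<Union>\<K>} = (\<Union>K\<in>\<K>. {x \<in> topspace X. q x \<in> K})" by auto
  thus "openin X {x \<in> topspace X. q x \<in> \<Union>\<K>}" using * by (auto intro!: openin_Union)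
  show "\<Union>\<K> <= q ` topspace X" using * by auto
 qed
 thus ?thesis by (simp add: quot_top_def topology_inverse')
qed

lemma topspace_quot_top [simp]: "topspace (quot_top X q) = q ` topspace X"
proof -
 have "{x \<in> topspace X. q x \<in> q ` topspace X} = topspace X" by auto
 hence "openin (quot_top X q) (q ` topspace X)" by (simp add: openin_quot_top)
 hence "q ` topspace X <= topspace (quot_top X q)" by (rule openin_subset)
 moreover have "topspace (quot_top X q) <= q ` topspace X"
  using openin_topspace[of "quot_top X q"] unfolding openin_quot_top by blast
 ultimately show ?thesis by blast
qed

lemma quotient_map_quot_top: "quotient_map X (quot_top X q) q"
 unfolding quotient_map_def by (auto simp: openin_quot_top)

lemma continuous_map_quot_top: "continuous_map X (quot_top X q) q"
 by (rule quotient_imp_continuous_map[OF quotient_map_quot_top])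

lemma continuous_map_from_quot_top:
 assumes "continuous_map X Z (g \<circ> q)"
 shows "continuous_map (quot_top X q) Z g"
 using assms continuous_compose_quotient_map[OF quotient_map_quot_top] by blast

text \<open>Closed saturations make q a closed map with compact fibres, hence a perfect map. A
  perfect image of a compact Hausdorff space is regular, and its points are closed as images of
  closed points.\<close>

lemma Hausdorff_space_quot_top:
 assumes X: "compact_space X" "Hausdorff_space X"
  and cl: "!!C. closedin X C ==> closedin X {x \<in> topspace X. q x \<in> q ` C}"
 shows "Hausdorff_space (quot_top X q)"
proof -
 let ?Y = "quot_top X q"
 have C: "closedin ?Y (q ` C)" if "closedin X C" for C
 proof -
  have "{x \<in> topspace X. q x \<in> q ` topspace X - q ` C} = topspace X - {x \<in> topspace X. q x \<in> q ` C}" by auto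
  hence "openin ?Y (q ` topspace X - q ` C)" using cl[OF that] by (simp add: openin_quot_top openin_diff)
  thus ?thesis using closedin_subset[OF that] by (auto simp: closedin_def)
 qed
 hence cm: "closed_map X ?Y q" by (auto simp: closed_map_def)
 have sing: "closedin X {x}" if "x \<in> topspace X" for x using X(2) that by (rule closedin_Hausdorff_singleton)
 have fib: "compactin X {x \<in> topspace X. q x = y}" if "y \<in> topspace ?Y" for y
 proof -
  have "y \<in> q ` topspace X" using that by simp
  then obtain x where x: "x \<in> topspace X" "y = q x" by blast
  have "{x \<in> topspace X. q x = y} = {z \<in> topspace X. q z \<in> q ` {x}}" using x by auto
  thus ?thesis using cl[OF sing[OF x(1)]] X(1) by (simp add: closedin_compact_space)
 qed
 have "proper_map X ?Y q" unfolding proper_map_def using cm fib by auto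
 hence "perfect_map X ?Y q" by (simp add: perfect_map_def continuous_map_quot_top)
 hence "regular_space ?Y"
  using X regular_space_perfect_map_image compact_Hausdorff_imp_regular_space by blast
 moreover have "t1_space ?Y" unfolding t1_space_closedin_singleton
 proof
  fix y assume "y \<in> topspace ?Y"
  hence "y \<in> q ` topspace X" by simp
  then obtain x where "x \<in> topspace X" "y = q x" by blast
  thus "closedin ?Y {y}" using C[OF sing[of x]] by simp
 qed
 ultimately show ?thesis by (rule regular_t1_imp_Hausdorff_space)
qed

lemma complex_chart_push:
 assumes ch: "complex_chart X (V, \<phi>)" and W: "openin Y W"
  and f: "homeomorphic_map (X on V) (Y on W) f"
 shows "complex_chart Y (W, \<phi> \<circ> inv_into V f)"
proof -
 have V: "openin X V" and h: "homeomorphic_map (X on V) (top_of_set (\<phi> ` V)) \<phi>" "open (\<phi> ` V)"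
  using ch by (auto simp: complex_chart_def)
 have top: "topspace (X on V) = V" "topspace (Y on W) = W"
  using openin_subset[OF V] openin_subset[OF W] by auto
 have fV: "f ` V = W" "inj_on f V"
  using homeomorphic_imp_surjective_map[OF f] homeomorphic_imp_injective_map[OF f] by (simp_all only: top)
 obtain g where g: "homeomorphic_maps (X on V) (Y on W) f g" using f by (auto simp: homeomorphic_map_maps)
 hence gh: "homeomorphic_map (Y on W) (X on V) g" using homeomorphic_maps_map by blast
 have "inv_into V f w = g w" if w: "w \<in> W" for w
 proof -
  have "g w \<in> V" "f (g w) = w"
   using g w homeomorphic_imp_surjective_map[OF gh] unfolding homeomorphic_maps_def top by auto
  thus ?thesis using fV(2) by (metis inv_into_f_f)
 qed
 hence "homeomorphic_map (Y on W) (X on V) (inv_into V f)"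
  using gh by (rule_tac homeomorphic_map_eq[OF gh]) (simp add: top)
 hence "homeomorphic_map (Y on W) (top_of_set (\<phi> ` V)) (\<phi> \<circ> inv_into V f)"
  using h(1) by (rule homeomorphic_map_compose)
 moreover have "(\<phi> \<circ> inv_into V f) ` W = \<phi> ` V" using fV by (metis image_comp inv_into_image_cancel order_refl)
 ultimately show ?thesis using W h(2) by (simp add: complex_chart_def)
qed

context periodic_map
begin

definition orb where "orb x = (\<lambda>i. (h ^^ i) x) ` {..<p}"

definition Y where "Y = quot_top X orb"

lemma orb_eq_iff:
 assumes "x \<in> topspace X" "y \<in> topspace X"
 shows "orb x = orb y \<longleftrightarrow> (\<exists>i<p. y = (h ^^ i) x)"
proof
 assume "orb x = orb y"
 moreover have "y \<in> orb y" unfolding orb_def using p_gt_0 by (intro image_eqI[of _ _ 0]) auto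
 ultimately show "\<exists>i<p. y = (h ^^ i) x" by (auto simp: orb_def)
next
 assume "\<exists>i<p. y = (h ^^ i) x"
 then obtain i where i: "i < p" "y = (h ^^ i) x" by blast
 have sub: "orb ((h ^^ j) z) <= orb z" if z: "z \<in> topspace X" for z j
 proof
  fix w assume "w \<in> orb ((h ^^ j) z)"
  then obtain k where "w = (h ^^ (k + j)) z" by (auto simp: orb_def funpow_add)
  hence "w = (h ^^ ((k + j) mod p)) z" using pow_mod[OF z] by simp
  thus "w \<in> orb z" using p_gt_0 by (auto simp: orb_def)
 qed
 have "x = (h ^^ (p - i + i)) x" using i(1) period[OF assms(1)] by simp
 hence "x = (h ^^ (p - i)) y" by (simp add: i(2) funpow_add)
 hence "orb x <= orb y" using sub[OF assms(2)] by metis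
 thus "orb x = orb y" using sub[OF assms(1), of i] i(2) by auto
qed

lemma orb_h: "x \<in> topspace X ==> orb (h x) = orb x"
proof -
 assume x: "x \<in> topspace X"
 have hx: "h x \<in> topspace X" and "1 < p" using pow_in[OF x, of 1] prime_gt_1_nat[OF prime] by simp_all
 hence "\<exists>i<p. h x = (h ^^ i) x" by (intro exI[of _ 1]) simp
 thus ?thesis using orb_eq_iff[OF x hx] by blast
qed

lemma topspace_Y: "topspace Y = orb ` topspace X" by (simp add: Y_def)

lemma orb_saturation:
 assumes "C <= topspace X"
 shows "{x \<in> topspace X. orb x \<in> orb ` C} = (\<Union>i<p. {x \<in> topspace X. (h ^^ i) x \<in> C})"
proof (intro subset_antisym subsetI)
 fix x assume "x \<in> {x \<in> topspace X. orb x \<in> orb ` C}"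
 then obtain c where "c \<in> C" "orb x = orb c" "x \<in> topspace X" by blast
 thus "x \<in> (\<Union>i<p. {x \<in> topspace X. (h ^^ i) x \<in> C})" using orb_eq_iff[of x c] assms by blast
next
 fix x assume "x \<in> (\<Union>i<p. {x \<in> topspace X. (h ^^ i) x \<in> C})"
 then obtain i where i: "i < p" "x \<in> topspace X" "(h ^^ i) x \<in> C" by blast
 hence "orb x = orb ((h ^^ i) x)" using orb_eq_iff[of x "(h ^^ i) x"] pow_in by blast
 thus "x \<in> {x \<in> topspace X. orb x \<in> orb ` C}" using i by blast
qed

lemma orb_open: "openin X U ==> openin Y (orb ` U)" unfolding Y_def openin_quot_top
proof
 assume U: "openin X U"
 show "orb ` U <= orb ` topspace X" using openin_subset[OF U] by auto
 show "openin X {x \<in> topspace X. orb x \<in> orb ` U}" unfolding orb_saturation[OF openin_subset[OF U]]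
  by (intro openin_Union) (auto intro: openin_continuous_map_preimage[OF cont_pow U])
qed

lemma Hausdorff_Y: "compact_space X ==> Hausdorff_space X ==> Hausdorff_space Y" unfolding Y_def
proof (rule Hausdorff_space_quot_top)
 fix C assume C: "closedin X C"
 show "closedin X {x \<in> topspace X. orb x \<in> orb ` C}" unfolding orb_saturation[OF closedin_subset[OF C]]
  by (intro closedin_Union) (auto intro: closedin_continuous_map_preimage[OF cont_pow C])
qed

lemma continuous_orb: "continuous_map X Y orb" unfolding Y_def by (rule continuous_map_quot_top)

text \<open>The p translates of a moved point are distinct, so by Hausdorff separation some
  neighbourhood is carried off itself by each of h, ..., h^(p-1).\<close>

lemma free_chart:
 assumes X: "Hausdorff_space X" "locally_plane X" and x: "x \<in> topspace X" "h x ~= x"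
 obtains V \<phi> where "complex_chart X (V, \<phi>)" "x \<in> V" "inj_on orb V" "!!v. v \<in> V ==> h v ~= v"
proof -
 have "\<exists>W. openin X W \<and> x \<in> W \<and> (\<forall>z\<in>W. (h ^^ i) z \<notin> W)" if i: "0 < i" "i < p" for i
 proof -
  have "(h ^^ i) x ~= x" using pow_inj[OF x, of i 0] i by auto
  then obtain A B where AB: "openin X A" "openin X B" "x \<in> A" "(h ^^ i) x \<in> B" "A \<inter> B = {}"
   using X(1) x(1) pow_in[OF x(1), of i] unfolding Hausdorff_space_def disjnt_def by metis
  let ?W = "A \<inter> {z \<in> topspace X. (h ^^ i) z \<in> B}"
  have "openin X ?W" using AB openin_continuous_map_preimage[OF cont_pow AB(2)] by (intro openin_Int)
  thus ?thesis using AB x(1) by (intro exI[of _ ?W]) auto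
 qed
 then obtain W where W: "!!i. 0 < i ==> i < p ==> openin X (W i) \<and> x \<in> W i \<and> (\<forall>z\<in>W i. (h ^^ i) z \<notin> W i)" by metis
 define U where "U = topspace X \<inter> \<Inter>(W ` {0<..<p})"
 have U: "openin X U" "x \<in> U"
 proof -
  have "openin X (\<Inter>(insert (topspace X) (W ` {0<..<p})))" by (rule openin_Inter) (use W in auto)
  thus "openin X U" by (simp add: U_def)
  show "x \<in> U" using W x(1) by (auto simp: U_def)
 qed
 obtain V \<phi> r where V: "complex_chart X (V, \<phi>)" "x \<in> V" "V <= U" using locally_plane_disc[OF X(2) U] by metis
 have fr: "(h ^^ i) v \<notin> V" if "v \<in> V" "0 < i" "i < p" for v i
 proof -
  have "V <= W i" using V(3) that(2,3) by (auto simp: U_def)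
  thus ?thesis using W[OF that(2,3)] that(1) by blast
 qed
 show thesis
 proof (rule that[OF V(1,2)])
  show "inj_on orb V"
  proof (rule inj_onI)
   fix v w assume vw: "v \<in> V" "w \<in> V" "orb v = orb w"
   hence "v \<in> topspace X" "w \<in> topspace X" using V(3) by (auto simp: U_def)
   then obtain i where i: "i < p" "w = (h ^^ i) v" using orb_eq_iff vw by blast
   thus "v = w" using fr[OF vw(1), of i] vw(2) by (cases "i = 0") auto
  qed
  show "h v ~= v" if "v \<in> V" for v using fr[OF that, of 1] prime_gt_1_nat[OF prime] that by auto
 qed
qed

lemma orb_homeomorphic:
 assumes V: "openin X V" "inj_on orb V"
 shows "homeomorphic_map (X on V) (Y on (orb ` V)) orb"
proof (rule bijective_open_imp_homeomorphic_map)
 have sub: "V <= topspace X" using V(1) by (rule openin_subset)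
 show "continuous_map (X on V) (Y on (orb ` V)) orb"
  using continuous_orb by (auto simp: continuous_map_in_subtopology continuous_map_from_subtopology)
 show "open_map (X on V) (Y on (orb ` V)) orb" unfolding open_map_def
  using V orb_open by (simp add: openin_open_subtopology image_mono)
 show "orb ` topspace (X on V) = topspace (Y on (orb ` V))" using sub topspace_Y by auto
 show "inj_on orb (topspace (X on V))" using V(2) sub by (simp add: Int_absorb1)
qed

lemma free_chart_Y:
 assumes "complex_chart X (V, \<phi>)" "inj_on orb V"
 shows "complex_chart Y (orb ` V, \<phi> \<circ> inv_into V orb)"
proof (rule complex_chart_push[OF assms(1)])
 have V: "openin X V" using assms(1) by (simp add: complex_chart_def)
 show "openin Y (orb ` V)" using V by (rule orb_open)
 show "homeomorphic_map (X on V) (Y on (orb ` V)) orb" using V assms(2) by (rule orb_homeomorphic)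
qed

lemma simplex_lift:
 assumes V: "openin X V" "inj_on orb V"
  and f: "singular_simplex q Y f" "f ` Delta q <= orb ` V"
 obtains \<sigma> where "singular_simplex q (X on V) \<sigma>" "simplex_map q orb \<sigma> = f"
proof -
 obtain g where g: "homeomorphic_maps (X on V) (Y on (orb ` V)) orb g"
  using orb_homeomorphic[OF V] by (auto simp: homeomorphic_map_maps)
 have f': "singular_simplex q (Y on (orb ` V)) f" using f by (simp add: singular_simplex_subtopology)
 have cg: "continuous_map (Y on (orb ` V)) (X on V) g"
  and og: "!!y. y \<in> topspace (Y on (orb ` V)) ==> (orb \<circ> g) y = y" using g by (auto simp: homeomorphic_maps_def)
 have "singular_simplex q (X on V) (simplex_map q g f)" by (rule singular_simplex_simplex_map[OF f' cg])
 moreover have "simplex_map q orb (simplex_map q g f) = f"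
  using fun_cong[OF simplex_map_compose[of q orb g], of f] simplex_map_id_gen[OF f' og]
  by (simp only: comp_apply)
 ultimately show thesis by (rule that)
qed

text \<open>The sets where \<open>\<rho>\<close> agrees with the i-th translate of
  \<open>\<sigma>\<close>, i < p, are closed and cover the standard simplex; they are disjoint
  because h moves every point of \<open>\<sigma>\<close>. Connectedness leaves just one of
  them.\<close>

lemma orbit_simplex_unique:
 assumes X: "Hausdorff_space X" and \<sigma>: "singular_simplex q X \<sigma>" and \<rho>: "singular_simplex q X \<rho>"
  and eq: "simplex_map q orb \<sigma> = simplex_map q orb \<rho>"
  and free: "!!t. t \<in> Delta q ==> h (\<sigma> t) ~= \<sigma> t"
 shows "\<exists>i. \<rho> = hs q i \<sigma>"
proof -
 let ?S = "(powertop_real UNIV) on (Delta q)"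
 define E where "E i = {t \<in> topspace ?S. \<rho> t = ((h ^^ i) \<circ> \<sigma>) t}" for i
 have top: "topspace ?S = Delta q" by simp
 have cl: "closedin ?S (E i)" for i unfolding E_def
 proof (rule closedin_continuous_maps_eq[OF X])
  show "continuous_map ?S X \<rho>" using \<rho> by (simp add: singular_simplex_def)
  show "continuous_map ?S X ((h ^^ i) \<circ> \<sigma>)"
   by (rule continuous_map_compose[OF _ cont_pow]) (use \<sigma> in \<open>simp add: singular_simplex_def\<close>)
 qed
 have cov: "\<exists>i<p. t \<in> E i" if t: "t \<in> Delta q" for t
 proof -
  have "orb (\<sigma> t) = orb (\<rho> t)" using fun_cong[OF eq, of t] t by (simp add: simplex_map_def)
  then obtain i where "i < p" "\<rho> t = (h ^^ i) (\<sigma> t)"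
   using orb_eq_iff simplex_in[OF \<sigma> t] simplex_in[OF \<rho> t] by blast
  thus ?thesis using t by (auto simp: E_def)
 qed
 have disj: "i = j" if "t \<in> E i" "t \<in> E j" "i < p" "j < p" for i j t
 proof -
  have t: "t \<in> Delta q" "(h ^^ i) (\<sigma> t) = (h ^^ j) (\<sigma> t)" using that by (auto simp: E_def)
  thus ?thesis using pow_inj[OF simplex_in[OF \<sigma> t(1)] free[OF t(1)] that(3,4)] by blast
 qed
 obtain t where t: "t \<in> Delta q" using nonempty_standard_simplex by blast
 then obtain i where i: "i < p" "t \<in> E i" using cov by blast
 have "closedin ?S (\<Union>(E ` ({..<p} - {i})))" by (intro closedin_Union) (use cl in auto)
 moreover have "E i = topspace ?S - \<Union>(E ` ({..<p} - {i}))"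
 proof (intro subset_antisym subsetI)
  fix s assume s: "s \<in> E i"
  hence "s \<in> topspace ?S" by (simp add: E_def)
  thus "s \<in> topspace ?S - \<Union>(E ` ({..<p} - {i}))" using disj[OF s] i(1) by blast
 next
  fix s assume "s \<in> topspace ?S - \<Union>(E ` ({..<p} - {i}))"
  thus "s \<in> E i" using cov[of s] top by auto
 qed
 ultimately have "openin ?S (E i)" by (metis openin_diff openin_topspace)
 moreover have "connected_space ?S" using connectedin_standard_simplex[of q] by (simp add: connectedin_def)
 ultimately have "E i = topspace ?S" using cl i(2) unfolding connected_space_clopen_in by blast
 hence all: "\<rho> s = (h ^^ i) (\<sigma> s)" if "s \<in> Delta q" for s using that by (auto simp: E_def)
 have "\<rho> = hs q i \<sigma>"
 proof
  fix s show "\<rho> s = hs q i \<sigma> s"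
   using all[of s] \<rho> by (auto simp: simplex_map_def singular_simplex_def extensional_def)
 qed
 thus ?thesis by blast
qed

end

context periodic_map_nbhd
begin

lemma orb_in_N: "x \<in> topspace X ==> orb x \<in> orb ` N \<longleftrightarrow> x \<in> N"
proof
 assume x: "x \<in> topspace X" and "orb x \<in> orb ` N"
 then obtain y where y: "y \<in> N" "orb x = orb y" by blast
 hence "y \<in> topspace X" using openin_subset[OF N_open] by blast
 then obtain i where "y = (h ^^ i) x" using orb_eq_iff x y by blast
 thus "x \<in> N" using N_pow[OF x] y by blast
qed blast

text \<open>A simplex of moved points is determined up to translation by its projection. So if the
  part of c outside N cancels after projection, it already cancels within orbits, which means that
  it lies in \<open>aug q\<close>.\<close>

lemma aug_of_orbit:
 assumes X: "Hausdorff_space X" and c: "chain q X c"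
  and small: "!!\<sigma>. \<sigma> \<in> keys c ==> \<sigma> ` Delta q <= N \<or> (\<forall>t\<in>Delta q. h (\<sigma> t) ~= \<sigma> t)"
  and N0: "chain q (Y on (orb ` N)) (chain_map q orb c)"
 obtains v \<nu> where "chain q X v" "chain q (X on N) \<nu>" "c = chain_map q h v - v + \<nu>"
proof -
 obtain a b where ab: "c = a + b" and a: "chain q (X on N) a"
  and b: "keys b <= out q" "keys b <= keys c" using chain_split_out[OF c] by metis
 have bs: "singular_simplex q X \<sigma>" "\<not> \<sigma> ` Delta q <= N" "\<forall>t\<in>Delta q. h (\<sigma> t) ~= \<sigma> t"
  if "\<sigma> \<in> keys b" for \<sigma>
 proof -
  have "\<sigma> \<in> out q" "\<sigma> \<in> keys c" using that b by blast+
  thus "singular_simplex q X \<sigma>" "\<not> \<sigma> ` Delta q <= N"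
   "\<forall>t\<in>Delta q. h (\<sigma> t) ~= \<sigma> t" using small[of \<sigma>] by (simp_all add: out_def)
 qed
 have "chain q (Y on (orb ` N)) (chain_map q orb a)"
  by (rule singular_chain_chain_map[OF a])
    (use continuous_orb in \<open>auto simp: continuous_map_in_subtopology continuous_map_from_subtopology\<close>)
 moreover have "chain_map q orb b = chain_map q orb c - chain_map q orb a" by (simp add: ab chain_map_add)
 ultimately have oN: "chain q (Y on (orb ` N)) (chain_map q orb b)" using N0 singular_chain_diff by metis
 have "keys (chain_map q orb b) = {}"
 proof (rule ccontr)
  assume "\<not> ?thesis"
  then obtain f where f: "f \<in> keys (chain_map q orb b)" by blast
  then obtain \<sigma> where s: "\<sigma> \<in> keys b" "f = simplex_map q orb \<sigma>" using keys_chain_map by blast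
  have fN: "f ` Delta q <= orb ` N"
  proof -
   have "singular_simplex q (Y on (orb ` N)) f" using oN f unfolding singular_chain_def by blast
   thus ?thesis unfolding singular_simplex_subtopology by blast
  qed
  have "\<sigma> ` Delta q <= N"
  proof
   fix x assume "x \<in> \<sigma> ` Delta q"
   then obtain t where t: "t \<in> Delta q" "x = \<sigma> t" by blast
   have "orb x \<in> orb ` N" using fN t s(2) by (force simp: simplex_map_def)
   thus "x \<in> N" using orb_in_N simplex_in[OF bs(1)[OF s(1)] t(1)] t(2) by blast
  qed
  thus False using bs(2)[OF s(1)] by blast
 qed
 hence ob: "chain_map q orb b = 0" by simp
 \<comment> \<open>A choice of one lift for each simplex of the orbit space. Lifting the projection
   of b, which is zero, gives zero; but it also differs from b by an element of
   \<open>aug q\<close>.\<close>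
 define s where "s f = (SOME \<rho>. singular_simplex q X \<rho> \<and> simplex_map q orb \<rho> = f)" for f
 have s: "\<exists>i. s (simplex_map q orb \<sigma>) = hs q i \<sigma>" if "\<sigma> \<in> keys b" for \<sigma>
 proof -
  have "singular_simplex q X (s (simplex_map q orb \<sigma>)) \<and>
     simplex_map q orb (s (simplex_map q orb \<sigma>)) = simplex_map q orb \<sigma>" unfolding s_def
   by (rule someI[of "\<lambda>\<rho>. singular_simplex q X \<rho> \<and> simplex_map q orb \<rho> = simplex_map q orb \<sigma>" \<sigma>])
     (use bs(1)[OF that] in simp)
  thus ?thesis using orbit_simplex_unique[OF X bs(1)[OF that]] bs(3)[OF that] by metis
 qed
 have "b - frag_extend (frag_of \<circ> (s \<circ> simplex_map q orb)) b \<in> aug q"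
  by (rule frag_extend_aug) (use bs(1) s in auto)
 moreover have "frag_extend (frag_of \<circ> (s \<circ> simplex_map q orb)) b = frag_extend (frag_of \<circ> s) (chain_map q orb b)"
  unfolding chain_map_def by (simp add: frag_extend_compose comp_assoc)
 ultimately have "b \<in> aug q" using ob by simp
 then obtain v where v: "chain q X v" "b = chain_map q h v - v" by (auto simp: aug_def)
 have "c = chain_map q h v - v + a" unfolding ab v(2) by (rule add.commute)
 thus thesis using that v(1) a by blast
qed

end

section \<open>Two generators of the first homology modulo p\<close>

lemma zero_chain_path_connected:
 assumes X: "path_connected_space X" and f: "singular_simplex 0 X f" and d: "chain 0 X d"
 obtains n b where "chain 1 X b" "d = n *. (frag_of f) + bdry 1 b"
proof -
 have "\<exists>n b. chain 1 X b \<and> d = n *. (frag_of f) + bdry 1 b" using d unfolding singular_chain_def[of 0]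
 proof (induction d rule: frag_induction)
  case zero
  show ?case by (intro exI[of _ 0] exI[of _ "0::'a chain"]) simp
 next
  case (one x)
  hence "boundary 0 X (frag_of x - frag_of f)"
   using iso_integer_zeroth_homology_group_aux[OF X _ f] by (simp add: homologous_rel_def)
  then obtain b where "chain 1 X b" "bdry 1 b = frag_of x - frag_of f" by (auto simp: singular_boundary)
  thus ?case by (intro exI[of _ 1] exI[of _ b]) simp
 next
  case (diff a b)
  then obtain m c n d where "chain 1 X c" "a = m *. (frag_of f) + bdry 1 c"
   "chain 1 X d" "b = n *. (frag_of f) + bdry 1 d" by blast
  thus ?case
   by (intro exI[of _ "m - n"] exI[of _ "c - d"])
     (simp add: singular_chain_diff chain_boundary_diff frag_cmul_diff_distrib)
 qed
 thus thesis using that by blast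
qed

lemma chain_boundary_const_simplex:
 "bdry 1 (frag_of (restrict (\<lambda>_. a) (Delta 1))) = 0"
proof -
 have "singular_face (Suc 0) k (restrict (\<lambda>_. a) (Delta 1)) = restrict (\<lambda>_. a) (Delta 0)"
  if "k <= 1" for k using that simplical_face_in_standard_simplex[of 1 k]
  by (auto simp: singular_face_def restrict_def fun_eq_iff)
 thus ?thesis by (simp add: chain_boundary_of numeral_2_eq_2)
qed

lemma int_subgroup_generator:
 fixes S :: "int set"
 assumes "S ~= {}" "!!a b. a \<in> S ==> b \<in> S ==> a - b \<in> S"
 obtains d where "d \<in> S" "!!n. n \<in> S ==> d dvd n"
proof -
 have 0: "0 \<in> S" using assms by (metis all_not_in_conv diff_self)
 have neg: "- a \<in> S" if "a \<in> S" for a using assms(2)[OF 0 that] by simp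
 have add: "a + b \<in> S" if "a \<in> S" "b \<in> S" for a b using assms(2)[OF that(1) neg[OF that(2)]] by simp
 have mult: "int k * a \<in> S" if "a \<in> S" for k a by (induction k) (use 0 add that in \<open>auto simp: algebra_simps\<close>)
 have mult': "k * a \<in> S" if "a \<in> S" for k a
  using mult[OF that, of "nat k"] neg[OF mult[OF that, of "nat (- k)"]] by (cases "k \<ge> 0") auto
 show thesis
 proof (cases "\<exists>a\<in>S. a > 0")
  case False
  have "a = 0" if "a \<in> S" for a
  proof (rule ccontr)
   assume "a ~= 0"
   hence "a > 0 \<or> - a > 0" by linarith
   thus False using False neg[OF that] that by blast
  qed
  thus ?thesis using that[of 0] 0 by auto
 next
  case True
  define d where "d = (LEAST n::nat. n > 0 \<and> int n \<in> S)"
  obtain a where a: "a \<in> S" "a > 0" using True by blast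
  hence "nat a > 0 \<and> int (nat a) \<in> S" by simp
  hence d: "d > 0" "int d \<in> S" unfolding d_def by (metis (mono_tags, lifting) LeastI)+
  have least: "d <= n" if "n > 0" "int n \<in> S" for n unfolding d_def by (rule Least_le) (use that in simp)
  have "int d dvd n" if n: "n \<in> S" for n
  proof -
   have "n mod int d = n - (n div int d) * int d" by (simp add: minus_div_mult_eq_mod)
   hence "n mod int d \<in> S" using assms(2)[OF n mult'[OF d(2)]] by simp
   moreover have "0 <= n mod int d" "n mod int d < int d" using d(1) by simp_all
   ultimately have "n mod int d = 0" using least[of "nat (n mod int d)"] by force
   thus ?thesis by (simp add: dvd_eq_mod_eq_0)
  qed
  thus ?thesis using that d(2) by blast
 qed
qed

lemma homologous_rel_cmul:
 "homologous_rel p X S a b ==> homologous_rel p X S (k *. a) (k *. b)"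
proof -
 assume "homologous_rel p X S a b"
 hence "relboundary p X S (k *. (a - b))" unfolding homologous_rel_def by (rule singular_relboundary_cmul)
 moreover have "k *. (a - b) = k *. a - k *. b"
  by (metis add_diff_cancel_right' diff_add_cancel frag_cmul_distrib2)
 ultimately show ?thesis by (simp add: homologous_rel_def)
qed

context periodic_map_nbhd
begin

text \<open>A 2-chain \<open>w\<close> with \<open>\<partial>w = hz - z\<close> projects to a 2-cycle of the orbit space. Its class lies in a cyclic group,
 since it is determined by its local degree at one point. When it vanishes, \<open>z\<close> is homologous to a norm.\<close>

lemma two_generators_mod_p:
 assumes X: "Hausdorff_space X" "compact_space X" "connected_space X" "locally_plane X"
  and fin: "finite {x \<in> topspace X. h x = x}"
  and triv: "!!z. cycle 1 X z ==> homologous 1 X (chain_map 1 h z) z"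
  and x0: "x0 \<in> topspace X" "h x0 ~= x0"
  and N1: "!!c. chain 0 (X on N) c ==> \<exists>f r. chain 0 (X on {x \<in> topspace X. h x = x}) f \<and>
       chain 1 (X on N) r \<and> c = f + bdry 1 r"
  and N2: "!!e f k. chain 1 (X on N) e ==> chain 0 (X on {x \<in> topspace X. h x = x}) f ==>
    bdry 1 e = k *. f ==> k ~= 0 ==> f = 0"
  and N3: "!!e. cycle 1 (X on N) e ==> boundary 1 X e"
 obtains a b where "cycle 1 X a" "cycle 1 X b"
  "!!z. cycle 1 X z ==> \<exists>m n z'. cycle 1 X z' \<and> homologous 1 X z (m *. a + n *. b + (int p) *. z')"
proof -
 let ?F = "{x \<in> topspace X. h x = x}"
 have HY: "Hausdorff_space Y" using X Hausdorff_Y by blast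
 have cpY: "compact_space Y"
  using image_compactin[OF _ continuous_orb, of "topspace X"] X(2) topspace_Y by (simp add: compact_space_def)
 have clF: "closedin X ?F" using X(1) fin by (intro closedin_Hausdorff_finite) auto
 \<comment> \<open>The part of the orbit space known to be a surface. It is connected because
   removing finitely many fixed points does not disconnect X.\<close>
 define S where "S = orb ` (topspace X - ?F)"
 have Sop: "openin Y S" unfolding S_def using clF by (intro orb_open openin_diff) auto
 have Sconn: "connectedin Y S"
  unfolding S_def by (rule connectedin_continuous_map_image[OF continuous_orb connectedin_surface_minus_finite[OF X(4,1,3) fin]])
 have Sch: "\<exists>V \<phi>. complex_chart Y (V, \<phi>) \<and> y \<in> V" if y: "y \<in> S" for y
 proof -
  obtain x where x: "x \<in> topspace X" "h x ~= x" "y = orb x" using y by (auto simp: S_def)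
  obtain V \<phi> where V: "complex_chart X (V, \<phi>)" "x \<in> V" "inj_on orb V"
   using free_chart[OF X(1,4) x(1,2)] by metis
  show ?thesis using free_chart_Y[OF V(1,3)] V(2) x(3) by blast
 qed
 define y0 where "y0 = orb x0"
 have y0: "y0 \<in> S" using x0 by (auto simp: y0_def S_def)
 obtain V0 \<phi>0 where V0: "complex_chart Y (V0, \<phi>0)" "y0 \<in> V0" using Sch[OF y0] by blast
 have lh: "relative_homology_group (int 2) Y (topspace Y - {y0}) \<cong> integer_group"
  using chart_local_homology[OF HY V0] by simp
 obtain g where g: "relcycle 2 Y (topspace Y - {y0}) g"
  "!!c. relcycle 2 Y (topspace Y - {y0}) c ==> \<exists>n. homologous_rel 2 Y (topspace Y - {y0}) c (n *. g)"
  using cyclic_relative_homology_generator[OF lh] by metis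
 define P where "P z w \<longleftrightarrow> cycle 1 X z \<and> chain 2 X w \<and> bdry 2 w = chain_map 1 h z - z" for z w
 have P_diff: "P (z - k *. z') (w - k *. w')" if "P z w" "P z' w'" for z w z' w' k
 proof -
  have kd: "k *. (a - b) = k *. a - k *. b" for a b :: "'a chain"
   by (metis add_diff_cancel_right' diff_add_cancel frag_cmul_distrib2)
  show ?thesis using that unfolding P_def
   by (simp add: singular_relcycle_diff singular_relcycle_cmul singular_chain_diff singular_chain_cmul
     chain_boundary_diff chain_boundary_cmul chain_map_diff kd)
 qed
 have P_cycle: "cycle 2 Y (chain_map 2 orb w)" if "P z w" for z w
 proof -
  have w: "chain 2 X w" and z: "chain 1 X z" and b: "bdry 2 w = chain_map 1 h z - z"
   using that by (auto simp: P_def singular_cycle)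
  have "chain_map 1 orb (chain_map 1 h z) = chain_map 1 (orb \<circ> h) z"
   using chain_map_compose[of 1 orb h] by simp
  also have "... = chain_map 1 orb z" by (rule chain_map_eq[OF z]) (simp add: orb_h)
  finally have "bdry 2 (chain_map 2 orb w) = 0"
   using chain_boundary_chain_map[OF w, of orb] by (simp add: b chain_map_diff)
  thus ?thesis using singular_chain_chain_map[OF w continuous_orb] by (simp add: singular_cycle)
 qed
 have P_rel: "relcycle 2 Y T (chain_map 2 orb w)" if "P z w" for z w T
  by (rule singular_relcycle_mono[OF P_cycle[OF that]]) simp
 \<comment> \<open>The local degrees at \<open>y0\<close> of the admissible 2-chains form a subgroup
   of the integers. A cycle \<open>z0\<close> whose chain attains its generator is the first of the
   two classes.\<close>
 define A where "A = {n. \<exists>z w. P z w \<and> homologous_rel 2 Y (topspace Y - {y0}) (chain_map 2 orb w) (n *. g)}"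
 have A0: "A ~= {}"
 proof -
  have "P 0 0" by (simp add: P_def)
  hence "0 \<in> A" unfolding A_def by (intro CollectI exI[of _ 0] conjI) auto
  thus ?thesis by blast
 qed
 have Adiff: "m - n \<in> A" if mn: "m \<in> A" "n \<in> A" for m n
 proof -
  obtain z w z' w' where *: "P z w" "homologous_rel 2 Y (topspace Y - {y0}) (chain_map 2 orb w) (m *. g)"
   "P z' w'" "homologous_rel 2 Y (topspace Y - {y0}) (chain_map 2 orb w') (n *. g)"
   using mn unfolding A_def by blast
  have "P (z - z') (w - w')" using P_diff[OF *(1,3), of 1] by simp
  moreover have "homologous_rel 2 Y (topspace Y - {y0}) (chain_map 2 orb (w - w')) ((m - n) *. g)"
   using homologous_rel_diff[OF *(2,4)] by (simp add: chain_map_diff frag_cmul_diff_distrib)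
  ultimately show ?thesis unfolding A_def by blast
 qed
 obtain n0 where n0: "n0 \<in> A" "!!n. n \<in> A ==> n0 dvd n" using int_subgroup_generator[OF A0 Adiff] by metis
 obtain z0 w0 where z0: "P z0 w0" "homologous_rel 2 Y (topspace Y - {y0}) (chain_map 2 orb w0) (n0 *. g)"
  using n0(1) unfolding A_def by blast
 have pc: "path_connected_space X" by (rule locally_plane_connected_imp_path_connected[OF X(4,3)])
 define pt where "pt = (\<lambda>t\<in>Delta 0. x0)"
 have pt: "singular_simplex 0 X pt" using x0(1) by (simp add: pt_def singular_simplex_def)
 have hpt: "singular_simplex 0 X (simplex_map 0 h pt)" by (rule singular_simplex_simplex_map[OF pt cont])
 \<comment> \<open>A chain leading from x0 to h x0. Its p translates join up to a cycle, the second
   of the two classes.\<close>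
 obtain c0 where c0: "chain 1 X c0" "bdry 1 c0 = chain_map 0 h (frag_of pt) - frag_of pt"
  using iso_integer_zeroth_homology_group_aux[OF pc hpt pt]
  by (auto simp: homologous_rel_def singular_boundary)
 have Nc0: "cycle 1 X (Nm 1 c0)"
 proof -
  have "bdry 1 (Nm 1 c0) = Nm 0 (bdry 1 c0)" using Nm_boundary[OF c0(1)] by simp
  also have "... = 0" unfolding c0(2) by (rule Nm_map_diff) (simp add: singular_chain_of pt)
  finally show ?thesis using Nm_chain[OF c0(1)] by (simp add: singular_cycle)
 qed
 have main: "\<exists>n z'. cycle 1 X z' \<and> homologous 1 X z (n *. (Nm 1 c0) + (int p) *. z')"
  if zw: "P z w" and loc: "relboundary 2 Y (topspace Y - {y0}) (chain_map 2 orb w)" for z w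
 proof -
  have w: "chain 2 X w" and z: "cycle 1 X z" "chain 1 X z"
   and bw: "bdry 2 w = chain_map 1 h z - z" using zw by (auto simp: P_def singular_cycle)
  have locS: "relboundary 2 Y (topspace Y - {y}) (chain_map 2 orb w)" if "y \<in> S" for y
   by (rule surface_cycle_clopen[OF HY Sop Sconn Sch P_cycle[OF zw] y0 loc that])
  \<comment> \<open>K avoids the branch points, and vanishing of the class has just been spread from
    \<open>y0\<close> to all points of S. Therefore the projection of w is a boundary up to a chain
    u near the branch points.\<close>
  define K where "K = topspace Y - orb ` N"
  have NY: "openin Y (orb ` N)" by (rule orb_open[OF N_open])
  have NYK: "topspace Y - K = orb ` N" using openin_subset[OF NY] by (auto simp: K_def)
  have KS: "K <= S"
  proof
   fix y assume "y \<in> K"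
   then obtain x where "x \<in> topspace X" "y = orb x" "x \<notin> N" by (auto simp: K_def topspace_Y)
   thus "y \<in> S" using N_fixed by (auto simp: S_def)
  qed
  have "compactin Y K" using cpY NY by (simp add: K_def closedin_compact_space closedin_diff)
  hence "relboundary 2 Y (topspace Y - K) (chain_map 2 orb w)"
   by (rule surface_relcycle_boundary[OF HY]) (use KS Sch locS P_rel[OF zw] in blast)+
  then obtain e u where e: "chain 3 Y e" and u: "chain 2 (Y on (orb ` N)) u"
   and eu: "bdry 3 e + u = chain_map 2 orb w"
   unfolding relboundary NYK by (auto simp: numeral_3_eq_3 numeral_2_eq_2)
  \<comment> \<open>A cover of the orbit space by sets over which simplices can be lifted, together
    with the neighbourhood of the branch points; e is subdivided until each simplex lies in one
    member.\<close>
  define \<C> where "\<C> = insert (orb ` N) {orb ` V | V. openin X V \<and> inj_on orb V \<and> (\<forall>v\<in>V. h v ~= v)}"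
  have \<C>: "!!U. U \<in> \<C> ==> openin Y U" using NY orb_open unfolding \<C>_def by blast
  have \<C>cov: "topspace Y <= \<Union>\<C>"
  proof
   fix y assume "y \<in> topspace Y"
   then obtain x where x: "x \<in> topspace X" "y = orb x" by (auto simp: topspace_Y)
   show "y \<in> \<Union>\<C>"
   proof (cases "h x = x")
    case True
    thus ?thesis using N_fixed x by (auto simp: \<C>_def)
   next
    case False
    obtain V \<phi> where V: "complex_chart X (V, \<phi>)" "x \<in> V" "inj_on orb V" "!!v. v \<in> V ==> h v ~= v"
     using free_chart[OF X(1,4) x(1) False] by metis
    hence "orb ` V \<in> \<C>" unfolding \<C>_def complex_chart_def by blast
    thus ?thesis using V(2) x(2) by blast
   qed
  qed
  obtain m1 where m1: "!!m f. [|m1 <= m; f \<in> keys ((singular_subdivision 3 ^^ m) e)|] ==> \<exists>V\<in>\<C>. f \<in> Delta 3 \<rightarrow> V"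
   by (rule sufficient_iterated_singular_subdivision_exists[OF \<C> \<C>cov e]) (assumption, rule that, blast)
  have D: "!!U. U \<in> {N, topspace X - ?F} ==> openin X U" using N_open clF by auto
  have Dcov: "topspace X <= \<Union>{N, topspace X - ?F}" using N_fixed by auto
  obtain m2 where m2: "!!m f. [|m2 <= m; f \<in> keys ((singular_subdivision 2 ^^ m) w)|]
    ==> \<exists>V\<in>{N, topspace X - ?F}. f \<in> Delta 2 \<rightarrow> V"
   by (rule sufficient_iterated_singular_subdivision_exists[OF D Dcov w]) (assumption, rule that, blast)
  define m where "m = max m1 m2"
  let ?s = "\<lambda>q. singular_subdivision q ^^ m"
  define L where "L = {f. singular_simplex 3 Y f \<and>
   (\<exists>V. openin X V \<and> inj_on orb V \<and> (\<forall>v\<in>V. h v ~= v) \<and> f ` Delta 3 <= orb ` V)}"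
  have se: "chain 3 Y (?s 3 e)" by (rule singular_chain_subdivision_power[OF e])
  have "keys (?s 3 e) <= L \<union> {f. singular_simplex 3 (Y on (orb ` N)) f}"
  proof
   fix f assume f: "f \<in> keys (?s 3 e)"
   hence fs: "singular_simplex 3 Y f" using se by (auto simp: singular_chain_def)
   obtain V where V: "V \<in> \<C>" "f \<in> Delta 3 \<rightarrow> V" using m1[of m f] f by (auto simp: m_def)
   hence "f ` Delta 3 <= V" by blast
   thus "f \<in> L \<union> {f. singular_simplex 3 (Y on (orb ` N)) f}"
    using V(1) fs unfolding \<C>_def L_def singular_simplex_subtopology by blast
  qed
  then obtain e1 e2 where e1: "keys e1 <= L"
   and "keys e2 <= {f. singular_simplex 3 (Y on (orb ` N)) f}" and e12: "e1 + e2 = ?s 3 e"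
   using frag_split by metis
  hence e2: "chain 3 (Y on (orb ` N)) e2" by (simp add: singular_chain_def)
  have "\<exists>\<sigma>. singular_simplex 3 (X on (topspace X - ?F)) \<sigma> \<and> simplex_map 3 orb \<sigma> = f" if "f \<in> L" for f
  proof -
   obtain V where V: "openin X V" "inj_on orb V" "\<forall>v\<in>V. h v ~= v" "f ` Delta 3 <= orb ` V"
    and f: "singular_simplex 3 Y f" using \<open>f \<in> L\<close> unfolding L_def by blast
   obtain \<sigma> where "singular_simplex 3 (X on V) \<sigma>" "simplex_map 3 orb \<sigma> = f"
    using simplex_lift[OF V(1,2) f V(4)] by metis
   moreover have "V <= topspace X - ?F" using V(3) openin_subset[OF V(1)] by blast
   ultimately show ?thesis using singular_simplex_mono by blast
  qed
  then obtain l where l: "!!f. f \<in> L ==> singular_simplex 3 (X on (topspace X - ?F)) (l f)"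
   "!!f. f \<in> L ==> simplex_map 3 orb (l f) = f" by metis
  define E where "E = frag_extend (frag_of \<circ> l) e1"
  have E: "chain 3 (X on (topspace X - ?F)) E"
   unfolding E_def using e1 l(1) by (intro singular_chain_extend) (auto simp: singular_chain_of)
  have oE: "chain_map 3 orb E = e1"
  proof -
   have "chain_map 3 orb E = frag_extend (frag_of \<circ> (simplex_map 3 orb \<circ> l)) e1"
    unfolding E_def chain_map_def by (simp add: frag_extend_compose comp_assoc)
   also have "... = frag_extend frag_of e1" by (rule frag_extend_eq) (use e1 l(2) in auto)
   finally show ?thesis by (simp flip: frag_expansion)
  qed
  have EX: "chain 3 X E" using E by (simp add: singular_chain_subtopology)
  \<comment> \<open>Subtracting the boundary of the lifted part E leaves a chain whose projection
    lies near the branch points, the situation of \<open>aug_of_orbit\<close>.\<close>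
  define \<omega> where "\<omega> = ?s 2 w - bdry 3 E"
  have sw: "chain 2 X (?s 2 w)" by (rule singular_chain_subdivision_power[OF w])
  have bE: "chain 2 (X on (topspace X - ?F)) (bdry 3 E)" using singular_chain_boundary[OF E] by simp
  have \<omega>c: "chain 2 X \<omega>"
   unfolding \<omega>_def using sw bE by (intro singular_chain_diff) (simp_all add: singular_chain_subtopology)
  have small: "\<sigma> ` Delta 2 <= N \<or> (\<forall>t\<in>Delta 2. h (\<sigma> t) ~= \<sigma> t)"
   if "\<sigma> \<in> keys \<omega>" for \<sigma>
  proof -
   have "\<sigma> \<in> keys (?s 2 w) \<or> \<sigma> \<in> keys (bdry 3 E)"
    using that keys_diff[of "?s 2 w" "bdry 3 E"] unfolding \<omega>_def by blast
   thus ?thesis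
   proof
    assume "\<sigma> \<in> keys (?s 2 w)"
    then obtain V where "V \<in> {N, topspace X - ?F}" "\<sigma> \<in> Delta 2 \<rightarrow> V" using m2[of m \<sigma>] by (auto simp: m_def)
    thus ?thesis by blast
   next
    assume "\<sigma> \<in> keys (bdry 3 E)"
    hence "\<sigma> ` Delta 2 <= topspace X - ?F" using bE by (simp add: singular_chain_subtopology)
    thus ?thesis by blast
   qed
  qed
  have "chain_map 2 orb \<omega> = bdry 3 e2 + ?s 2 u"
  proof -
   have "chain_map 2 orb (?s 2 w) = ?s 2 (bdry 3 e + u)"
    using chain_map_subdivision_power[OF w, of m orb] eu by simp
   also have "... = bdry 3 (e1 + e2) + ?s 2 u"
    using chain_boundary_subdivision_power[OF e, of m] by (simp add: singular_subdivision_power_add e12)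
   finally show ?thesis using chain_boundary_chain_map[OF EX, of orb] oE
    by (simp add: \<omega>_def chain_map_diff chain_boundary_add)
  qed
  hence "chain 2 (Y on (orb ` N)) (chain_map 2 orb \<omega>)"
   using singular_chain_boundary[OF e2] singular_chain_subdivision_power[OF u, of m]
   by (simp add: singular_chain_add)
  then obtain v \<nu> where v: "chain 2 X v" and \<nu>: "chain 2 (X on N) \<nu>"
   and \<omega>: "\<omega> = chain_map 2 h v - v + \<nu>" using aug_of_orbit[OF X(1) \<omega>c small] by blast
  define z1 where "z1 = ?s 1 z"
  have z1: "cycle 1 X z1" "homologous 1 X z1 z"
   unfolding z1_def by (rule singular_relcycle_subdivision_power[OF z(1)])+
  have "bdry 2 \<omega> = chain_map 1 h z1 - z1"
   using chain_boundary_subdivision_power[OF w, of m] chain_boundary_boundary[OF EX]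
    chain_map_subdivision_power[OF z(2), of m h]
   by (simp add: \<omega>_def chain_boundary_diff bw singular_subdivision_power_diff z1_def)
  moreover have "bdry 2 \<omega> = chain_map 1 h (bdry 2 v) - bdry 2 v + bdry 2 \<nu>"
   using chain_boundary_chain_map[OF v, of h] by (simp add: \<omega> chain_boundary_add chain_boundary_diff)
  \<comment> \<open>After changing the cycle by a boundary it is invariant up to a chain in N, so it
    is a norm up to such a chain.\<close>
  ultimately have "chain_map 1 h (z1 - bdry 2 v) - (z1 - bdry 2 v) = bdry 2 \<nu>"
   by (simp add: chain_map_diff algebra_simps)
  moreover have "chain 1 (X on N) (bdry 2 \<nu>)" using singular_chain_boundary[OF \<nu>] by simp
  moreover have bv: "chain 1 X (bdry 2 v)" using singular_chain_boundary[OF v] by simp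
  hence "chain 1 X (z1 - bdry 2 v)" using z1(1) by (auto simp: singular_cycle intro: singular_chain_diff)
  ultimately obtain c \<mu> where c: "chain 1 X c" and \<mu>: "chain 1 (X on N) \<mu>"
   and c\<mu>: "z1 - bdry 2 v = Nm 1 c + \<mu>" using Nm_of_invariant[of 1 "z1 - bdry 2 v"] by metis
  have bc: "chain 0 X (bdry 1 c)" using singular_chain_boundary[OF c] by simp
  have "bdry 1 (z1 - bdry 2 v) = 0"
   using z1(1) chain_boundary_boundary[OF v] by (simp add: chain_boundary_diff singular_cycle)
  hence "Nm 0 (bdry 1 c) + bdry 1 \<mu> = 0" using Nm_boundary[OF c] by (simp add: c\<mu> chain_boundary_add)
  hence "Nm 0 (bdry 1 c) = - bdry 1 \<mu>" by (simp add: eq_neg_iff_add_eq_0)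
  hence "chain 0 (X on N) (Nm 0 (bdry 1 c))"
   using singular_chain_boundary[OF \<mu>] by (simp add: singular_chain_minus)
  then obtain d \<nu>0 where d: "chain 0 X d" and \<nu>0: "chain 0 (X on N) \<nu>0"
   and bcd: "bdry 1 c = chain_map 0 h d - d + \<nu>0" using aug_of_Nm_zero[OF bc] by metis
  obtain n b where b: "chain 1 X b" and db: "d = n *. (frag_of pt) + bdry 1 b"
   using zero_chain_path_connected[OF pc pt d] .
  obtain \<nu>1 r where \<nu>1: "chain 0 (X on ?F) \<nu>1" and r: "chain 1 (X on N) r"
   and \<nu>r: "\<nu>0 = \<nu>1 + bdry 1 r" using N1[OF \<nu>0] by blast
  have rX: "chain 1 X r" using r by (simp add: singular_chain_subtopology)
  \<comment> \<open>Corrects c so that only fixed points remain in its boundary: the terms with b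
    and \<open>c0\<close> cancel the contribution of d, and r reduces \<open>\<nu>0\<close> to fixed
    points.\<close>
  define c2 where "c2 = c - (chain_map 1 h b - b) - n *. c0 - r"
  have hb: "chain 1 X (chain_map 1 h b)" by (rule singular_chain_chain_map[OF b cont])
  have c2: "chain 1 X c2"
   unfolding c2_def using c b hb c0(1) rX by (intro singular_chain_diff singular_chain_cmul)
  have kd: "k *. (a - b) = k *. a - k *. b" for k and a b :: "'a chain"
   by (metis add_diff_cancel_right' diff_add_cancel frag_cmul_distrib2)
  have bc2: "bdry 1 c2 = \<nu>1"
  proof -
   have "bdry 1 c2 = bdry 1 c - (chain_map 0 h (bdry 1 b) - bdry 1 b) - n *. (bdry 1 c0) - bdry 1 r"
    using chain_boundary_chain_map[OF b, of h] by (simp add: c2_def chain_boundary_diff chain_boundary_cmul)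
   also have "... = \<nu>1" unfolding bcd db \<nu>r c0(2) by (simp add: chain_map_add kd del: chain_map_of)
   finally show ?thesis .
  qed
  define \<eta> where "\<eta> = Nm 1 r + \<mu>"
  have \<eta>: "chain 1 (X on N) \<eta>" unfolding \<eta>_def by (intro singular_chain_add N_Nm r \<mu>)
  have eq: "z1 - bdry 2 v = Nm 1 c2 + n *. (Nm 1 c0) + \<eta>"
  proof -
   have "Nm 1 c2 = Nm 1 c - n *. (Nm 1 c0) - Nm 1 r"
    using Nm_map_diff[OF b] by (simp add: c2_def Nm_diff Nm_cmul)
   thus ?thesis by (simp add: c\<mu> \<eta>_def)
  qed
  have N\<nu>1: "Nm 0 \<nu>1 = (int p) *. \<nu>1"
  proof -
   have "(h ^^ i) x = x" if "h x = x" for i x using that by (induction i) auto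
   hence "chain_map 0 (h ^^ i) \<nu>1 = \<nu>1" for i using chain_map_id_gen[OF \<nu>1, of "h ^^ i"] by auto
   hence "Nm 0 \<nu>1 = (\<Sum>i<p. \<nu>1)" by (simp add: Nm_def)
   also have "... = (int p) *. \<nu>1" by (induction p) (auto simp: frag_cmul_distrib)
   finally show ?thesis .
  qed
  have "bdry 1 (z1 - bdry 2 v) = 0"
   using z1(1) chain_boundary_boundary[OF v] by (simp add: chain_boundary_diff singular_cycle)
  hence "Nm 0 \<nu>1 + bdry 1 \<eta> = 0" using Nm_boundary[OF c2] Nc0 unfolding eq
   by (simp add: chain_boundary_add chain_boundary_cmul bc2[unfolded One_nat_def] singular_cycle)
  hence "bdry 1 \<eta> = (- int p) *. \<nu>1"
   unfolding N\<nu>1 by (metis add.commute eq_neg_iff_add_eq_0 minus_frag_cmul)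
  \<comment> \<open>The norm multiplies fixed points by p, so a nonzero multiple of
    \<open>\<nu>1\<close> bounds inside N. By \<open>N2\<close> this forces it to be zero, and
    \<open>c2\<close> is a cycle.\<close>
  hence \<nu>10: "\<nu>1 = 0" using N2[OF \<eta> \<nu>1] p_gt_0 by simp
  have "cycle 1 (X on N) \<eta>" using \<eta> \<open>bdry 1 \<eta> = (- int p) *. \<nu>1\<close> by (simp add: singular_cycle \<nu>10)
  hence \<eta>b: "boundary 1 X \<eta>" by (rule N3)
  have c2c: "cycle 1 X c2" using c2 bc2 \<nu>10 by (simp add: singular_cycle)
  have hc2: "homologous 1 X (chain_map 1 (h ^^ i) c2) c2" for i
  proof (induction i)
   case 0
   have "chain_map 1 (h ^^ 0) c2 = c2" using c2 by (intro chain_map_id_gen) auto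
   thus ?case by (simp only: homologous_rel_refl)
  next
   case (Suc i)
   have "cycle 1 X (chain_map 1 (h ^^ i) c2)" by (rule singular_relcycle_chain_map[OF c2c cont_pow]) simp
   from triv[OF this] have "homologous 1 X (chain_map 1 (h ^^ Suc i) c2) (chain_map 1 (h ^^ i) c2)"
    using chain_map_compose[of 1 h "h ^^ i"] by (simp only: funpow.simps comp_apply)
   thus ?case using homologous_rel_trans[OF Suc] by blast
  qed
  \<comment> \<open>This is where trivial action on the homology enters: it turns the norm of a
    cycle into p times that cycle.\<close>
  have Nc2: "homologous 1 X (Nm 1 c2) ((int p) *. c2)"
  proof -
   have "homologous 1 X (\<Sum>i<k. chain_map 1 (h ^^ i) c2) ((int k) *. c2)" for k
   proof (induction k)
    case (Suc k)
    thus ?case using homologous_rel_add[OF Suc hc2[of k]] by (simp add: frag_cmul_distrib algebra_simps)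
   qed simp
   thus ?thesis by (simp add: Nm_def)
  qed
  have "homologous 1 X z1 (n *. (Nm 1 c0) + (int p) *. c2)"
  proof -
   have "boundary 1 X (bdry 2 v)" using v by (auto simp: singular_boundary numeral_2_eq_2)
   hence "boundary 1 X (bdry 2 v + \<eta> + (Nm 1 c2 - (int p) *. c2))"
    using \<eta>b Nc2 unfolding homologous_rel_def by (intro singular_relboundary_add)
   moreover have "z1 = bdry 2 v + (Nm 1 c2 + n *. (Nm 1 c0) + \<eta>)" using eq by (simp add: algebra_simps)
   ultimately show ?thesis by (simp add: homologous_rel_def algebra_simps)
  qed
  thus ?thesis using c2c z1(2) homologous_rel_sym homologous_rel_trans by blast
 qed
 show thesis
 proof (rule that[of z0 "Nm 1 c0"])
  show "cycle 1 X z0" using z0(1) by (simp add: P_def)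
  show "cycle 1 X (Nm 1 c0)" by (rule Nc0)
  fix z assume z: "cycle 1 X z"
  then obtain w where w: "chain 2 X w" "bdry 2 w = chain_map 1 h z - z"
   using triv unfolding homologous_rel_def singular_boundary by (auto simp: numeral_2_eq_2)
  hence zw: "P z w" using z by (simp add: P_def)
  obtain n where n: "homologous_rel 2 Y (topspace Y - {y0}) (chain_map 2 orb w) (n *. g)"
   using g(2)[OF P_rel[OF zw]] by blast
  hence "n \<in> A" using zw unfolding A_def by blast
  then obtain k where k: "n = n0 * k" using n0(2) by blast
  let ?z = "z - k *. z0" and ?w = "w - k *. w0"
  have "homologous_rel 2 Y (topspace Y - {y0}) (chain_map 2 orb ?w) (n *. g - k *. (n0 *. g))"
   using homologous_rel_diff[OF n homologous_rel_cmul[OF z0(2), of k]] by (simp add: chain_map_diff)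
  hence "relboundary 2 Y (topspace Y - {y0}) (chain_map 2 orb ?w)"
   by (simp add: k homologous_rel_def mult.commute)
  then obtain m z' where z': "cycle 1 X z'"
   "homologous 1 X ?z (m *. (Nm 1 c0) + (int p) *. z')" using main[OF P_diff[OF zw z0(1)]] by blast
  have "homologous 1 X z (k *. z0 + m *. (Nm 1 c0) + (int p) *. z')"
   using homologous_rel_add[OF z'(2) homologous_rel_refl[of 1 X "{}" "k *. z0"]] by (simp add: algebra_simps)
  thus "\<exists>m n z'. cycle 1 X z' \<and>
    homologous 1 X z (m *. z0 + n *. (Nm 1 c0) + (int p) *. z')" using z'(1) by blast
 qed
qed

end

text \<open>An isomorphism of the homology with a free abelian group, expressed on cycles rather
  than on classes, so that chain-level identities can be fed to it directly.\<close>

locale homology_coordinates =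
 fixes q :: nat and X :: "'a topology" and J :: "'j set" and \<Phi> :: "'a chain => 'j \<Rightarrow>\<^sub>0 int"
 assumes add: "!!a b. cycle q X a ==> cycle q X b ==> \<Phi> (a + b) = \<Phi> a + \<Phi> b"
  and eq: "!!a b. cycle q X a ==> cycle q X b ==> \<Phi> a = \<Phi> b \<longleftrightarrow> homologous q X a b"
  and keys: "!!a. cycle q X a ==> keys (\<Phi> a) <= J"
  and surj: "!!x. keys x <= J ==> \<exists>a. cycle q X a \<and> \<Phi> a = x"
  and cmul: "!!n a. cycle q X a ==> \<Phi> (n *. a) = n *. (\<Phi> a)"

lemma homology_coordinates_exist:
 assumes "homology_group (int q) X \<cong> free_Abelian_group J"
 obtains \<Phi> where "homology_coordinates q X J \<Phi>"
proof -
 let ?G = "homology_group (int q) X"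
 obtain f where f: "f \<in> iso ?G (free_Abelian_group J)" using assms by (auto simp: is_iso_def)
 hence hom: "f \<in> hom ?G (free_Abelian_group J)" and bij: "bij_betw f (carrier ?G) (carrier (free_Abelian_group J))"
  by (auto simp: iso_def)
 define F where "F c = f (homologous_rel_set q X {} c)" for c
 have carr: "homologous_rel_set q X {} c \<in> carrier ?G" if "cycle q X c" for c
  using that by (simp add: carrier_relative_homology_group)
 have add: "F (a + b) = F a + F b" if "cycle q X a" "cycle q X b" for a b
  using hom_mult[OF hom carr[OF that(1)] carr[OF that(2)]] homologous_rel_set_add[OF that] by (simp add: F_def)
 have zero: "F 0 = 0" using add[of 0 0] by simp
 have minus: "F (- a) = - F a" if "cycle q X a" for a
  using add[OF that, of "- a"] that zero by (simp add: singular_relcycle_minus add_eq_0_iff)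
 have nat: "F ((int n) *. a) = (int n) *. (F a)" if a: "cycle q X a" for n a
 proof (induction n)
  case (Suc n)
  thus ?case
   using add[of "(int n) *. a" a] a by (simp add: singular_relcycle_cmul frag_cmul_distrib algebra_simps)
 qed (simp add: zero)
 have mult: "F (n *. a) = n *. (F a)" if a: "cycle q X a" for n a
 proof (cases "n \<ge> 0")
  case True
  thus ?thesis using nat[OF a, of "nat n"] by simp
 next
  case False
  thus ?thesis using minus[of "(int (nat (- n))) *. a"] nat[OF a, of "nat (- n)"] a
   by (simp add: singular_relcycle_cmul)
 qed
 have inj: "inj_on f (carrier ?G)" using bij by (simp add: bij_betw_def)
 show thesis
 proof (rule that[of F], unfold_locales)
  show "F a = F b \<longleftrightarrow> homologous q X a b"
   if "cycle q X a" "cycle q X b" for a b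
   using inj_on_eq_iff[OF inj carr[OF that(1)] carr[OF that(2)]] by (simp add: F_def homologous_rel_set_eq)
  show "keys (F a) <= J" if "cycle q X a" for a using hom_in_carrier[OF hom carr[OF that]] by (simp add: F_def)
  show "\<exists>a. cycle q X a \<and> F a = x" if "keys x <= J" for x
  proof -
   have "x \<in> f ` carrier ?G" using bij that by (simp add: bij_betw_def)
   thus ?thesis by (auto simp: carrier_relative_homology_group F_def)
  qed
 qed (rule add mult; assumption)+
qed

text \<open>Counting residues: all p^|J| vectors modulo p must occur among the at most p^2
  combinations of u and v.\<close>

lemma free_two_generators_mod_p:
 fixes p :: nat
 assumes J: "finite J" and p: "p > 1"
  and gen: "!!x. keys x <= J ==> \<exists>m n y. x = m *. u + n *. v + (int p) *. y"
 shows "card J <= 2"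
proof -
 let ?r = "\<lambda>x. \<lambda>j\<in>J. lookup x j mod int p"
 have "(J \<rightarrow>\<^sub>E {0..<int p}) <= (\<lambda>(m, n). ?r (m *. u + n *. v)) ` ({0..<int p} \<times> {0..<int p})"
 proof
  fix g assume g: "g \<in> J \<rightarrow>\<^sub>E {0..<int p}"
  define x where "x = (\<Sum>j\<in>J. (g j) *. (frag_of j))"
  have lx: "lookup x j = (if j \<in> J then g j else 0)" for j
  proof -
   have "lookup x j = (\<Sum>i\<in>J. if j = i then g i else 0)"
    unfolding x_def by (auto simp: lookup_sum intro!: sum.cong)
   thus ?thesis using J by simp
  qed
  have "keys x <= J" using lx by (auto simp: in_keys_iff split: if_splits)
  then obtain m n y where x: "x = m *. u + n *. v + (int p) *. y" using gen by blast
  have "g = ?r ((m mod int p) *. u + (n mod int p) *. v)"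
  proof
   fix j
   show "g j = ?r ((m mod int p) *. u + (n mod int p) *. v) j"
   proof (cases "j \<in> J")
    case True
    hence gj: "0 <= g j" "g j < int p" using g by auto
    have "g j = m * lookup u j + n * lookup v j + int p * lookup y j"
     using lx[of j] True by (simp add: x lookup_add)
    hence "g j mod int p = (m * lookup u j + n * lookup v j) mod int p" by simp
    also have "... = ((m mod int p) * lookup u j + (n mod int p) * lookup v j) mod int p"
     by (intro mod_add_cong) (simp_all add: mod_mult_left_eq)
    finally show ?thesis using True gj by (simp add: lookup_add)
   qed (use g in auto)
  qed
  thus "g \<in> (\<lambda>(m, n). ?r (m *. u + n *. v)) ` ({0..<int p} \<times> {0..<int p})"
   using p by (intro image_eqI[of _ _ "(m mod int p, n mod int p)"]) auto
 qed
 hence "card (J \<rightarrow>\<^sub>E {0..<int p}) <= card ((\<lambda>(m, n). ?r (m *. u + n *. v)) ` ({0..<int p} \<times> {0..<int p}))"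
  by (rule card_mono[rotated]) simp
 also have "... <= card ({0..<int p} \<times> {0..<int p})" by (rule card_image_le) simp
 also have "... = p ^ 2" by (simp add: card_cartesian_product power2_eq_square)
 finally have "p ^ card J <= p ^ 2" using J by (simp add: card_PiE)
 thus ?thesis using power_le_imp_le_exp[OF p] by blast
qed

section \<open>Invariant neighbourhoods of the fixed points\<close>

lemma singular_simplex_image_connectedin:
 assumes "singular_simplex q X \<sigma>"
 shows "connectedin X (\<sigma> ` Delta q)"
proof (rule connectedin_continuous_map_image)
 show "continuous_map ((powertop_real UNIV) on (Delta q)) X \<sigma>" using assms by (simp add: singular_simplex_def)
 show "connectedin ((powertop_real UNIV) on (Delta q)) (Delta q)"
  using connectedin_standard_simplex[of q] by (simp add: connectedin_subtopology)
qed

lemma Hausdorff_separate_finite: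
 assumes X: "Hausdorff_space X" and F: "finite F" "F <= topspace X"
 obtains U where "!!x. x \<in> F ==> openin X (U x) \<and> x \<in> U x"
  "!!x y. x \<in> F ==> y \<in> F ==> x ~= y ==> U x \<inter> U y = {}"
proof -
 have "\<exists>A B. openin X A \<and> openin X B \<and> x \<in> A \<and> y \<in> B \<and> A \<inter> B = {}" if "x \<in> F" "y \<in> F" "x ~= y" for x y
  using X F that unfolding Hausdorff_space_def disjnt_def by blast
 then obtain A B where AB: "!!x y. x \<in> F ==> y \<in> F ==> x ~= y ==>
   openin X (A x y) \<and> openin X (B x y) \<and> x \<in> A x y \<and> y \<in> B x y \<and> A x y \<inter> B x y = {}" by metis
 define U where "U x = topspace X \<inter> \<Inter>((\<lambda>y. A x y \<inter> B y x) ` (F - {x}))" for x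
 show thesis
 proof (rule that[of U])
  fix x assume x: "x \<in> F"
  have "openin X (\<Inter>(insert (topspace X) ((\<lambda>y. A x y \<inter> B y x) ` (F - {x}))))"
   using F(1) AB x by (intro openin_Inter) (auto intro!: openin_Int)
  thus "openin X (U x) \<and> x \<in> U x" using AB x F(2) by (auto simp: U_def)
 next
  fix x y assume xy: "x \<in> F" "y \<in> F" "x ~= y"
  have "U x <= A x y" "U y <= B x y" using xy by (auto simp: U_def)
  thus "U x \<inter> U y = {}" using AB[OF xy] by blast
 qed
qed

context periodic_map
begin

text \<open>M is the path component of x among the points whose whole orbit stays in a disc D. Its
  image under h is path connected, stays among these points and contains x, so M is invariant. M
  need not be contractible itself; lying in the contractible D is enough.\<close>

lemma fixed_point_nbhd:
 assumes X: "locally_plane X" and x: "x \<in> topspace X" "h x = x" and U: "openin X U" "x \<in> U"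
 obtains M D where "openin X M" "x \<in> M" "path_connectedin X M" "M <= D" "D <= U" "openin X D"
  "contractible_space (X on D)" "!!z. z \<in> topspace X ==> h z \<in> M \<longleftrightarrow> z \<in> M"
proof -
 obtain D \<phi> r where D: "complex_chart X (D, \<phi>)" "x \<in> D" "D <= U" "r > 0" "\<phi> ` D = ball (\<phi> x) r"
  using locally_plane_disc[OF X U] by metis
 have Dop: "openin X D" using D(1) by (simp add: complex_chart_def)
 define E where "E = topspace X \<inter> \<Inter>((\<lambda>i. {z \<in> topspace X. (h ^^ i) z \<in> D}) ` {..<p})"
 have Eop: "openin X E"
 proof -
  have "openin X (\<Inter>(insert (topspace X) ((\<lambda>i. {z \<in> topspace X. (h ^^ i) z \<in> D}) ` {..<p})))"
   by (intro openin_Inter) (auto intro: openin_continuous_map_preimage[OF cont_pow Dop])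
  thus ?thesis by (simp add: E_def)
 qed
 have hx: "(h ^^ i) x = x" for i using x(2) by (induction i) auto
 have xE: "x \<in> E" using x hx D(2) by (auto simp: E_def)
 define M where "M = Collect (path_component_of (X on E) x)"
 have "openin X M" using locally_plane_path_connected[OF X] Eop xE
  unfolding M_def locally_path_connected_space_eq_open_path_component_of by blast
 moreover have xM: "x \<in> M" using xE x by (simp add: M_def path_component_of_refl)
 moreover have ME: "M <= E" unfolding M_def using path_component_of_subset_topspace[of "X on E" x] by auto
 moreover have pM: "path_connectedin X M" using path_connectedin_path_component_of[of "X on E" x]
  by (simp add: M_def path_connectedin_subtopology)
 moreover have ED: "E <= D" using p_gt_0 by (force simp: E_def)
 moreover have hM: "h z \<in> M" if z: "z \<in> M" for z
 proof -
  have "path_connectedin X (h ` M)" by (rule path_connectedin_continuous_map_image[OF cont pM])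
  moreover have "h ` M <= E"
  proof
   fix y assume "y \<in> h ` M"
   then obtain w where w: "w \<in> E" "y = h w" using ME by blast
   hence wX: "w \<in> topspace X" by (simp add: E_def)
   have "(h ^^ i) (h w) \<in> D" if i: "i < p" for i
   proof -
    have "(h ^^ i) (h w) = (h ^^ Suc i) w" by (simp add: funpow_swap1)
    also have "... = (h ^^ (Suc i mod p)) w" by (rule pow_mod[OF wX])
    also have "... \<in> D" using w(1) p_gt_0 by (auto simp: E_def)
    finally show ?thesis .
   qed
   thus "y \<in> E" using pow_in[OF wX, of 1] w(2) by (auto simp: E_def)
  qed
  moreover have "x \<in> h ` M" using xM x(2) by force
  ultimately have "h ` M <= M"
   unfolding M_def by (intro path_component_of_maximal) (auto simp: path_connectedin_subtopology)
  thus ?thesis using z by blast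
 qed
 moreover have "z \<in> M" if z: "z \<in> topspace X" "h z \<in> M" for z
 proof -
  have "(h ^^ i) (h z) \<in> M" for i using z(2) hM by (induction i) auto
  hence "(h ^^ (p - 1)) (h z) \<in> M" .
  moreover have "(h ^^ (p - 1)) (h z) = (h ^^ p) z" using p_gt_0 by (cases p) (auto simp: funpow_swap1)
  ultimately show ?thesis using period[OF z(1)] by simp
 qed
 ultimately show thesis using that[of M D] D(3) Dop complex_chart_ball(1)[OF D(1,5,4)] by blast
qed

lemma two_generators:
 assumes X: "Hausdorff_space X" "compact_space X" "connected_space X" "locally_plane X"
  and fin: "finite {x \<in> topspace X. h x = x}"
  and triv: "!!z. cycle 1 X z ==> homologous 1 X (chain_map 1 h z) z"
  and x0: "x0 \<in> topspace X" "h x0 ~= x0"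
 obtains a b where "cycle 1 X a" "cycle 1 X b"
  "!!z. cycle 1 X z ==> \<exists>m n z'. cycle 1 X z' \<and> homologous 1 X z (m *. a + n *. b + (int p) *. z')"
proof -
 define F where "F = {x \<in> topspace X. h x = x}"
 have F: "finite F" "F <= topspace X" using fin by (auto simp: F_def)
 obtain U where U: "!!x. x \<in> F ==> openin X (U x) \<and> x \<in> U x"
  "!!x y. x \<in> F ==> y \<in> F ==> x ~= y ==> U x \<inter> U y = {}" using Hausdorff_separate_finite[OF X(1) F] by metis
 have "\<exists>M D. openin X M \<and> x \<in> M \<and> path_connectedin X M \<and> M <= D \<and> D <= U x \<and>
   contractible_space (X on D) \<and> (\<forall>z\<in>topspace X. h z \<in> M \<longleftrightarrow> z \<in> M)" if x: "x \<in> F" for x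
 proof -
  have "x \<in> topspace X" "h x = x" using x by (auto simp: F_def)
  then obtain M D where "openin X M" "x \<in> M" "path_connectedin X M" "M <= D" "D <= U x"
   "contractible_space (X on D)" "!!z. z \<in> topspace X ==> h z \<in> M \<longleftrightarrow> z \<in> M"
   using fixed_point_nbhd[OF X(4), of x "U x"] U(1)[OF x] by metis
  thus ?thesis by blast
 qed
 then obtain M D where M: "!!x. x \<in> F ==> openin X (M x) \<and> x \<in> M x \<and> path_connectedin X (M x) \<and> M x <= D x \<and>
   D x <= U x \<and> contractible_space (X on (D x)) \<and> (\<forall>z\<in>topspace X. h z \<in> M x \<longleftrightarrow> z \<in> M x)" by metis
 have disj: "M x \<inter> M y = {}" if "x \<in> F" "y \<in> F" "x ~= y" for x y
  using M[OF that(1)] M[OF that(2)] U(2)[OF that] by blast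
 define N where "N = (\<Union>x\<in>F. M x)"
 interpret periodic_map_nbhd X h p N
 proof
  show "openin X N" unfolding N_def using M by blast
  show "h x \<in> N \<longleftrightarrow> x \<in> N" if "x \<in> topspace X" for x using M that by (auto simp: N_def)
  show "x \<in> N" if "x \<in> topspace X" "h x = x" for x using M that by (auto simp: N_def F_def)
 qed
 \<comment> \<open>Simplices are connected and the sets \<open>M x\<close> are open and
   disjoint.\<close>
 have comp: "\<exists>x\<in>F. \<sigma> ` Delta q <= M x" if s: "singular_simplex q (X on N) \<sigma>" for q \<sigma>
 proof -
  have sN: "\<sigma> ` Delta q <= N" "connectedin X (\<sigma> ` Delta q)"
   using s singular_simplex_image_connectedin by (auto simp: singular_simplex_subtopology)
  obtain t where t: "t \<in> Delta q" using nonempty_standard_simplex by blast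
  then obtain x where x: "x \<in> F" "\<sigma> t \<in> M x" using sN(1) by (auto simp: N_def)
  have "openin X (M x)" "openin X (\<Union>y\<in>F - {x}. M y)" using M x by auto
  moreover have "\<sigma> ` Delta q <= M x \<union> (\<Union>y\<in>F - {x}. M y)" using sN(1) x(1) by (auto simp: N_def)
  moreover have "M x \<inter> (\<Union>y\<in>F - {x}. M y) \<inter> \<sigma> ` Delta q = {}" using disj x(1) by blast
  moreover have "M x \<inter> \<sigma> ` Delta q ~= {}" using x(2) t by blast
  ultimately have "(\<Union>y\<in>F - {x}. M y) \<inter> \<sigma> ` Delta q = {}" using connectedinD[OF sN(2)] by blast
  moreover have "N = M x \<union> (\<Union>y\<in>F - {x}. M y)" using x(1) by (auto simp: N_def)
  ultimately have "\<sigma> ` Delta q <= M x" using sN(1) by blast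
  thus ?thesis using x(1) by blast
 qed
 have MN: "M x <= N" if "x \<in> F" for x using that by (auto simp: N_def)
 have N1: "\<exists>f r. chain 0 (X on F) f \<and> chain 1 (X on N) r \<and>
   c = f + bdry 1 r" if "chain 0 (X on N) c" for c using that unfolding singular_chain_def[of 0 "X on N"]
 proof (induction c rule: frag_induction)
  case zero
  show ?case by (intro exI[of _ "0::'a chain"]) simp
 next
  case (one \<sigma>)
  hence s: "singular_simplex 0 (X on N) \<sigma>" by simp
  obtain x where x: "x \<in> F" "\<sigma> ` Delta 0 <= M x" using comp[OF s] by blast
  have sM: "singular_simplex 0 (X on (M x)) \<sigma>" using s x(2) by (simp add: singular_simplex_subtopology)
  define \<tau> where "\<tau> = (\<lambda>t\<in>Delta 0. x)"
  have xX: "x \<in> topspace X" using x(1) F(2) by blast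
  have tM: "singular_simplex 0 (X on (M x)) \<tau>" "singular_simplex 0 (X on F) \<tau>"
   using M[OF x(1)] x(1) xX by (auto simp: singular_simplex_def \<tau>_def)
  have "path_connected_space (X on (M x))" using M[OF x(1)] by (auto simp: path_connectedin_def)
  from iso_integer_zeroth_homology_group_aux[OF this sM tM(1)]
  obtain r where r: "chain 1 (X on (M x)) r" "bdry 1 r = frag_of \<sigma> - frag_of \<tau>"
   by (auto simp: homologous_rel_def singular_boundary)
  thus ?case using tM(2) singular_chain_mono[OF r(1) MN[OF x(1)]]
   by (intro exI[of _ "frag_of \<tau>"] exI[of _ r]) (simp add: singular_chain_of)
 next
  case (diff a b)
  then obtain f r f' r' where "chain 0 (X on F) f" "chain 1 (X on N) r"
   "a = f + bdry 1 r" "chain 0 (X on F) f'" "chain 1 (X on N) r'"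
   "b = f' + bdry 1 r'" by blast
  thus ?case
   by (intro exI[of _ "f - f'"] exI[of _ "r - r'"]) (simp add: singular_chain_diff chain_boundary_diff)
 qed
 \<comment> \<open>Collapses each \<open>M x\<close> to its fixed point. It is used only as a
   function on points, so that 1-simplices in N become constant while 0-chains of fixed points are
   unchanged.\<close>
 define \<pi> where "\<pi> z = (THE x. x \<in> F \<and> z \<in> M x)" for z
 have \<pi>: "\<pi> z = x" if "x \<in> F" "z \<in> M x" for x z unfolding \<pi>_def using that disj by blast
 have N2: "f = 0" if e: "chain 1 (X on N) e" and f: "chain 0 (X on F) f"
  and ef: "bdry 1 e = k *. f" and k: "k ~= 0" for e f k
 proof -
  have "bdry 1 (chain_map 1 \<pi> e) = 0" using e unfolding singular_chain_def
  proof (induction e rule: frag_induction)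
   case (one \<sigma>)
   then obtain x where x: "x \<in> F" "\<sigma> ` Delta 1 <= M x" using comp by blast
   hence "\<pi> (\<sigma> t) = x" if "t \<in> Delta 1" for t using \<pi>[OF x(1)] that by blast
   hence "simplex_map 1 \<pi> \<sigma> = restrict (\<lambda>_. x) (Delta 1)"
    by (auto simp: simplex_map_def restrict_def fun_eq_iff)
   thus ?case using chain_boundary_const_simplex[of x] by simp
  qed (auto simp: chain_map_diff chain_boundary_diff)
  hence "chain_map 0 \<pi> (k *. f) = 0"
   using chain_boundary_chain_map[OF e, of \<pi>] by (simp add: ef[unfolded One_nat_def])
  moreover have "chain_map 0 \<pi> f = f" by (rule chain_map_id_gen[OF f]) (use \<pi> M in auto)
  ultimately show ?thesis using k by simp
 qed
 \<comment> \<open>Pieces are split off one at a time. The boundary of the part in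
   \<open>M x\<close> lies in \<open>M x\<close> and in the other pieces as well, so it is zero;
   that part then bounds in the contractible \<open>D x\<close>.\<close>
 have N3: "boundary 1 X e" if "cycle 1 (X on N) e" for e
 proof -
  have "boundary 1 X e"
   if "A <= F" "cycle 1 (X on (\<Union>x\<in>A. M x)) e" for A e using finite_subset[OF that(1) F(1)] that
  proof (induction A arbitrary: e rule: finite_induct)
   case empty
   hence "e = 0" by (simp add: singular_cycle singular_chain_empty)
   thus ?case by simp
  next
   case (insert x A)
   let ?B = "\<Union>y\<in>A. M y"
   have x: "x \<in> F" "A <= F" using insert.prems by auto
   have dj: "M x \<inter> ?B = {}" using disj x insert.hyps by blast
   have e: "chain 1 (X on (M x \<union> ?B)) e" "bdry 1 e = 0" using insert.prems(2) by (auto simp: singular_cycle)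
   have "keys e <= {\<sigma>. singular_simplex 1 (X on (M x)) \<sigma>} \<union> {\<sigma>. singular_simplex 1 (X on ?B) \<sigma>}"
   proof
    fix \<sigma> assume "\<sigma> \<in> keys e"
    hence s: "singular_simplex 1 (X on (M x \<union> ?B)) \<sigma>" using e(1) by (auto simp: singular_chain_def)
    have "M x \<union> ?B <= N" using x by (auto simp: N_def)
    then obtain y where y: "y \<in> F" "\<sigma> ` Delta 1 <= M y" using comp[OF singular_simplex_mono[OF s]] by blast
    have sX: "singular_simplex 1 X \<sigma>" "\<sigma> ` Delta 1 <= M x \<union> ?B"
     using s by (auto simp: singular_simplex_subtopology)
    have "y = x \<or> y \<in> A"
    proof (rule ccontr)
     assume "\<not> (y = x \<or> y \<in> A)"
     hence "M y \<inter> (M x \<union> ?B) = {}" using disj y(1) x by blast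
     thus False using y(2) sX(2) nonempty_standard_simplex[of 1] by blast
    qed
    thus "\<sigma> \<in> {\<sigma>. singular_simplex 1 (X on (M x)) \<sigma>} \<union> {\<sigma>. singular_simplex 1 (X on ?B) \<sigma>}"
     using y(2) sX(1) unfolding singular_simplex_subtopology by blast
   qed
   then obtain a b where ab: "a + b = e" and "keys a <= {\<sigma>. singular_simplex 1 (X on (M x)) \<sigma>}"
    "keys b <= {\<sigma>. singular_simplex 1 (X on ?B) \<sigma>}" using frag_split by metis
   hence a: "chain 1 (X on (M x)) a" and b: "chain 1 (X on ?B) b" by (auto simp: singular_chain_def)
   have "bdry 1 a = - bdry 1 b" using e(2) by (simp add: chain_boundary_add eq_neg_iff_add_eq_0 flip: ab)
   hence "chain 0 (X on (M x)) (bdry 1 a)"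
    "chain 0 (X on ?B) (bdry 1 a)"
    using singular_chain_boundary[OF a] singular_chain_boundary[OF b] by (simp_all add: singular_chain_minus)
   hence "keys (bdry 1 a) = {}"
    using dj nonempty_standard_simplex[of 0] unfolding singular_chain_subtopology by blast
   hence ba: "bdry 1 a = 0" by simp
   hence bb: "bdry 1 b = 0" using e(2) by (simp add: chain_boundary_add flip: ab)
   have "boundary 1 X b" using insert.IH[OF x(2)] b bb by (simp add: singular_cycle)
   moreover have "boundary 1 X a"
   proof -
    have "cycle 1 (X on (D x)) a"
     using singular_chain_mono[OF a] M[OF x(1)] ba by (simp add: singular_cycle)
    hence "boundary 1 (X on (D x)) a"
     using contractible_cycle_boundary[of "X on (D x)" 1] M[OF x(1)] by simp
    thus ?thesis using singular_boundary_mono[of "D x" UNIV 1 X a] by simp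
   qed
   ultimately show ?case using singular_relboundary_add ab by blast
  qed
  from this[of F e] that show ?thesis by (simp add: N_def)
 qed
 show thesis
  by (rule two_generators_mod_p[OF X fin triv x0])
    (assumption, erule N1[unfolded F_def], rule N2[unfolded F_def], assumption+, erule N3, rule that, assumption+)
qed

lemma trivial_action_rank_le_2:
 assumes X: "Hausdorff_space X" "compact_space X" "connected_space X" "locally_plane X"
  and fin: "finite {x \<in> topspace X. h x = x}"
  and triv: "!!z. cycle 1 X z ==> homologous 1 X (chain_map 1 h z) z"
  and x0: "x0 \<in> topspace X" "h x0 ~= x0"
  and free: "homology_group 1 X \<cong> free_Abelian_group J" "finite J"
 shows "card J <= 2"
proof -
 obtain a b where ab: "cycle 1 X a" "cycle 1 X b"
  "!!z. cycle 1 X z ==> \<exists>m n z'. cycle 1 X z' \<and> homologous 1 X z (m *. a + n *. b + (int p) *. z')"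
  by (rule two_generators[OF X fin triv x0]) (assumption, rule that, assumption+)
 have "homology_group (int 1) X \<cong> free_Abelian_group J" using free(1) by simp
 then obtain \<Phi> where "homology_coordinates 1 X J \<Phi>" by (rule homology_coordinates_exist)
 then interpret H: homology_coordinates 1 X J \<Phi> .
 note \<Phi> = H.add H.eq H.keys H.surj H.cmul
 show ?thesis
 proof (rule free_two_generators_mod_p[OF free(2) prime_gt_1_nat[OF prime]])
  fix x :: "'b \<Rightarrow>\<^sub>0 int" assume "keys x <= J"
  then obtain z where z: "cycle 1 X z" "\<Phi> z = x" using \<Phi>(4) by blast
  then obtain m n z' where z': "cycle 1 X z'"
   "homologous 1 X z (m *. a + n *. b + (int p) *. z')" using ab(3) by blast
  have c: "cycle 1 X (m *. a)" "cycle 1 X (n *. b)"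
   "cycle 1 X ((int p) *. z')" using ab z' by (auto intro: singular_relcycle_cmul)
  have "\<Phi> z = \<Phi> (m *. a + n *. b + (int p) *. z')"
   by (rule \<Phi>(2)[THEN iffD2]) (use z(1) z'(2) c in \<open>auto intro: singular_relcycle_add\<close>)
  also have "... = m *. (\<Phi> a) + n *. (\<Phi> b) + (int p) *. (\<Phi> z')"
   by (simp only: \<Phi>(1)[OF singular_relcycle_add[OF c(1,2)] c(3)] \<Phi>(1)[OF c(1,2)]
     \<Phi>(5)[OF ab(1)] \<Phi>(5)[OF ab(2)] \<Phi>(5)[OF z'(1)])
  finally show "\<exists>m n y. x = m *. (\<Phi> a) + n *. (\<Phi> b) + (int p) *. y" using z(2) by blast
 qed
qed

end

section \<open>Integral matrices of prime power order\<close>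

locale lattice_endo =
 fixes J :: "'j set" and A :: "('j \<Rightarrow>\<^sub>0 int) => ('j \<Rightarrow>\<^sub>0 int)"
 assumes J: "finite J" and A_in: "keys x <= J ==> keys (A x) <= J"
  and A_add: "keys x <= J ==> keys y <= J ==> A (x + y) = A x + A y"
begin

abbreviation M where "M \<equiv> {x :: 'j \<Rightarrow>\<^sub>0 int. keys x <= J}"

lemma M_add: "x \<in> M ==> y \<in> M ==> x + y \<in> M" using keys_add[of x y] by auto

lemma M_cmul: "x \<in> M ==> c *. x \<in> M" using keys_cmul[of c x] by auto

lemma A_0: "A 0 = 0" using A_add[of 0 0] by simp

lemma A_cmul: "x \<in> M ==> A (c *. x) = c *. (A x)"
proof -
 assume x: "x \<in> M"
 have neg: "A (- y) = - A y" if "y \<in> M" for y using A_add[of y "- y"] that A_0 by (simp add: add_eq_0_iff)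
 have nat: "A ((int n) *. x) = (int n) *. (A x)" for n
 proof (induction n)
  case (Suc n)
  thus ?case
   using A_add[of "(int n) *. x" x] x M_cmul[OF x, of "int n"] by (simp add: frag_cmul_distrib add.commute)
 qed (simp add: A_0)
 show ?thesis
 proof (cases "c \<ge> 0")
  case True
  thus ?thesis using nat[of "nat c"] by simp
 next
  case False
  thus ?thesis using nat[of "nat (- c)"] neg[OF M_cmul[OF x, of "int (nat (- c))"]] by simp
 qed
qed

text \<open>Horner evaluation: \<open>act P x\<close> is P(A) x, which makes M a module over the
  integer polynomials.\<close>

definition act :: "int poly => ('j \<Rightarrow>\<^sub>0 int) => ('j \<Rightarrow>\<^sub>0 int)" where
 "act P x = fold_coeffs (\<lambda>a y. a *. x + A y) P 0"

lemma act_0 [simp]: "act 0 x = 0" by (simp add: act_def)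

lemma act_pCons: "act (pCons a P) x = a *. x + A (act P x)"
proof (cases "a = 0 \<and> P = 0")
 case True
 thus ?thesis by (simp add: A_0)
next
 case False
 let ?f = "\<lambda>a y. a *. x + A y"
 have "fold_coeffs ?f (pCons a P) = ?f a \<circ> fold_coeffs ?f P"
 proof (cases "a = 0")
  case True
  hence "P ~= 0" using False by simp
  thus ?thesis by (rule fold_coeffs_pCons_not_0_0_eq)
 qed (rule fold_coeffs_pCons_coeff_not_0_eq)
 thus ?thesis unfolding act_def by (simp only: o_apply)
qed

lemma act_in: "x \<in> M ==> act P x \<in> M"
proof (induction P)
 case (pCons a P)
 have "a *. x \<in> M" by (rule M_cmul[OF pCons.prems])
 moreover have "A (act P x) \<in> M" using A_in pCons.IH[OF pCons.prems] by simp
 ultimately show ?case unfolding act_pCons by (rule M_add)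
qed simp

lemma act_add: "x \<in> M ==> act (P + Q) x = act P x + act Q x"
proof (induction P arbitrary: Q)
 case (pCons a P)
 obtain b R where Q: "Q = pCons b R" by (rule pCons_cases)
 have "A (act P x + act R x) = A (act P x) + A (act R x)"
  using A_add act_in[OF pCons.prems, of P] act_in[OF pCons.prems, of R] by simp
 thus ?case
  using pCons.IH[OF pCons.prems, of R] by (simp add: Q act_pCons frag_cmul_distrib algebra_simps)
qed simp

lemma act_smult: "x \<in> M ==> act (Polynomial.smult c P) x = c *. (act P x)"
proof (induction P)
 case (pCons a P)
 thus ?case using A_cmul[OF act_in[OF pCons.prems, of P], of c] by (simp add: act_pCons frag_cmul_distrib2)
qed simp

lemma act_mult: "x \<in> M ==> act (P * Q) x = act P (act Q x)"
proof (induction P)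
 case (pCons a P)
 thus ?case by (simp add: mult_pCons_left act_add act_smult act_pCons)
qed simp

lemma act_1 [simp]: "act 1 x = x" by (simp add: one_pCons act_pCons A_0)

lemma act_diff: "x \<in> M ==> act (P - Q) x = act P x - act Q x" using act_add[of x "P - Q" Q] by simp

lemma act_const: "act [:c:] x = c *. x" by (simp add: act_pCons A_0)

lemma act_X: "act [:0, 1:] x = A x" by (simp add: act_pCons A_0)

lemma act_power: "x \<in> M ==> act (P ^ k) x = (act P ^^ k) x"
proof (induction k)
 case (Suc k)
 thus ?case by (simp add: act_mult)
qed simp

lemma act_X_power: "x \<in> M ==> act ([:0, 1:] ^ k) x = (A ^^ k) x"
proof -
 have "act [:0, 1:] = A" using act_X by (rule ext)
 thus "act ([:0, 1:] ^ k) x = (A ^^ k) x" if "x \<in> M" using act_power[OF that, of "[:0, 1:]" k] by simp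
qed

lemma act_arg_add:
 assumes "x \<in> M" "y \<in> M"
 shows "act P (x + y) = act P x + act P y"
proof (induction P)
 case (pCons a P)
 have "A (act P x + act P y) = A (act P x) + A (act P y)"
  using A_add act_in[OF assms(1), of P] act_in[OF assms(2), of P] by simp
 thus ?case using pCons by (simp add: act_pCons frag_cmul_distrib2 algebra_simps)
qed simp

lemma act_arg_cmul: "x \<in> M ==> act P (c *. x) = c *. (act P x)"
 using act_mult[of x P "[:c:]"] act_mult[of x "[:c:]" P] by (simp add: act_const mult.commute)

lemma act_arg_sum:
 assumes "finite I" "!!i. i \<in> I ==> f i \<in> M"
 shows "act P (sum f I) = (\<Sum>i\<in>I. act P (f i)) \<and> sum f I \<in> M" using assms
proof (induction I rule: finite_induct)
 case empty
 have "act P 0 = 0" using act_arg_add[of 0 0 P] by simp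
 thus ?case by simp
next
 case (insert i I)
 thus ?case using act_arg_add[of "f i" "sum f I" P] M_add[of "f i" "sum f I"] by simp
qed

definition multiples where "multiples p = {p *. y | y. y \<in> M}"

lemma multiples_iff: "x \<in> multiples p \<longleftrightarrow> x \<in> M \<and> (\<forall>j\<in>J. p dvd lookup x j)"
proof
 assume "x \<in> multiples p"
 thus "x \<in> M \<and> (\<forall>j\<in>J. p dvd lookup x j)" using M_cmul by (auto simp: multiples_def)
next
 assume x: "x \<in> M \<and> (\<forall>j\<in>J. p dvd lookup x j)"
 define y where "y = (\<Sum>j\<in>J. (lookup x j div p) *. (frag_of j))"
 have ly: "lookup y j = (if j \<in> J then lookup x j div p else 0)" for j
 proof -
  have "lookup y j = (\<Sum>i\<in>J. if j = i then lookup x i div p else 0)"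
   unfolding y_def by (auto simp: lookup_sum intro!: sum.cong)
  thus ?thesis using J by simp
 qed
 have "y \<in> M" using ly by (auto simp: in_keys_iff split: if_splits)
 moreover have "x = p *. y" using x ly by (intro poly_mapping_eqI) (auto simp: in_keys_iff)
 ultimately show "x \<in> multiples p" by (auto simp: multiples_def)
qed

lemma multiples_add: "x \<in> multiples p ==> y \<in> multiples p ==> x + y \<in> multiples p"
 unfolding multiples_iff using M_add by (auto simp: lookup_add)

lemma multiples_cmul: "x \<in> multiples p ==> c *. x \<in> multiples p" unfolding multiples_iff using M_cmul by auto

lemma multiples_add_cancel:
 assumes "x + y \<in> multiples p" "y \<in> multiples p"
 shows "x \<in> multiples p"
proof -
 have "(x + y) + (- 1) *. y \<in> multiples p" by (rule multiples_add[OF assms(1) multiples_cmul[OF assms(2)]])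
 thus ?thesis by simp
qed

lemma multiples_act: "x \<in> multiples p ==> act P x \<in> multiples p"
proof -
 assume "x \<in> multiples p"
 then obtain y where y: "y \<in> M" "x = p *. y" unfolding multiples_def by blast
 show ?thesis unfolding multiples_def y(2) act_arg_cmul[OF y(1)] using act_in[OF y(1), of P] by blast
qed

lemma multiples_sum: "finite I ==> (!!i. i \<in> I ==> f i \<in> multiples p) ==> sum f I \<in> multiples p"
proof (induction I rule: finite_induct)
 case empty
 thus ?case by (simp add: multiples_iff)
qed (auto simp: multiples_add)

lemma multiples_cancel:
 fixes p :: int
 assumes p: "prime p" and c: "\<not> p dvd c" and x: "x \<in> M" "c *. x \<in> multiples p"
 shows "x \<in> multiples p" unfolding multiples_iff
proof (intro conjI ballI x(1))
 fix j assume j: "j \<in> J"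
 have "p dvd c * lookup x j" using x(2) j unfolding multiples_iff by simp
 thus "p dvd lookup x j" using prime_dvd_mult_iff[OF p] c by simp
qed

text \<open>If \<open>S\<^sup>r x\<close> were non-zero modulo \<open>p\<close>, then \<open>x, S x, ..., S\<^sup>r x\<close> would be linearly independent in
 a vector space of dimension \<open>r\<close> over the field with \<open>p\<close> elements.\<close>

lemma nilpotent_mod_prime:
 fixes p :: int
 assumes p: "prime p" and x: "x \<in> M" and nil: "act (S ^ q) x \<in> multiples p"
 shows "act (S ^ card J) x \<in> multiples p"
proof (rule ccontr)
 assume not: "act (S ^ card J) x \<notin> multiples p"
 have up: "act (S ^ l) x \<in> multiples p" if "act (S ^ k) x \<in> multiples p" "k <= l" for k l
  using multiples_act[OF that(1), of "S ^ (l - k)"] act_mult[OF x, of "S ^ (l - k)" "S ^ k"] that(2)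
  by (simp flip: power_add)
 define K where "K = (LEAST k. act (S ^ k) x \<in> multiples p)"
 have K: "act (S ^ K) x \<in> multiples p" unfolding K_def by (rule LeastI) (rule nil)
 have KJ: "card J < K" using up[OF K] not by (meson not_le)
 then obtain k where k: "K = Suc k" by (cases K) auto
 have kn: "act (S ^ k) x \<notin> multiples p"
  using not_less_Least[of k "\<lambda>k. act (S ^ k) x \<in> multiples p"] k unfolding K_def by simp
 \<comment> \<open>At the first coefficient i not divisible by p, apply S^(k-i): the later terms
   reach S^K and fall into p M, the earlier ones have coefficients divisible by p, and only the term
   with S^k x survives.\<close>
 have indep: "\<forall>i\<le>k. p dvd c i" if c: "(\<Sum>i\<le>k. (c i) *. (act (S ^ i) x)) \<in> multiples p" for c
 proof (rule ccontr)
  assume "\<not> (\<forall>i\<le>k. p dvd c i)"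
  then obtain i where i: "i <= k" "\<not> p dvd c i" "!!j. j < i ==> p dvd c j"
   using exists_least_iff[of "\<lambda>i. i <= k \<and> \<not> p dvd c i"] by (meson less_imp_le order_trans)
  have "act (S ^ (k - i)) (\<Sum>j\<le>k. (c j) *. (act (S ^ j) x)) \<in> multiples p" by (rule multiples_act[OF c])
  moreover have "act (S ^ (k - i)) (\<Sum>j\<le>k. (c j) *. (act (S ^ j) x)) =
    (\<Sum>j\<le>k. (c j) *. (act (S ^ (k - i + j)) x))"
   using act_arg_sum[of "{..k}" "\<lambda>j. (c j) *. (act (S ^ j) x)" "S ^ (k - i)"] M_cmul act_in[OF x]
   by (simp add: act_arg_cmul[OF act_in[OF x]] act_mult[OF x] power_add)
  moreover have "(\<Sum>j\<le>k. (c j) *. (act (S ^ (k - i + j)) x)) =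
    (c i) *. (act (S ^ k) x) + (\<Sum>j\<in>{..k} - {i}. (c j) *. (act (S ^ (k - i + j)) x))"
   using i(1) by (subst sum.remove[of _ i]) auto
  moreover have "(\<Sum>j\<in>{..k} - {i}. (c j) *. (act (S ^ (k - i + j)) x)) \<in> multiples p"
  proof (rule multiples_sum)
   fix j assume j: "j \<in> {..k} - {i}"
   show "(c j) *. (act (S ^ (k - i + j)) x) \<in> multiples p"
   proof (cases "j < i")
    case True
    then obtain t where "c j = p * t" using i(3) by blast
    hence "(c j) *. (act (S ^ (k - i + j)) x) = p *. (t *. (act (S ^ (k - i + j)) x))" by simp
    thus ?thesis using M_cmul[OF act_in[OF x]] unfolding multiples_def by blast
   next
    case False
    hence "K <= k - i + j" using j i(1) k by auto
    thus ?thesis by (intro multiples_cmul up[OF K])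
   qed
  qed simp
  ultimately have "(c i) *. (act (S ^ k) x) \<in> multiples p" by (simp only:) (erule (1) multiples_add_cancel)
  thus False using multiples_cancel[OF p i(2) act_in[OF x]] kn by blast
 qed
 \<comment> \<open>Counting takes the place of linear algebra: by \<open>indep\<close>, distinct
   coefficient vectors with entries in [0, p) have distinct residue vectors indexed by J.\<close>
 let ?f = "\<lambda>c. \<lambda>j\<in>J. lookup (\<Sum>i\<le>k. (c i) *. (act (S ^ i) x)) j mod p"
 have p0: "p > 0" using prime_gt_0_int[OF p] .
 have "inj_on ?f ({..k} \<rightarrow>\<^sub>E {0..<p})"
 proof (rule inj_onI)
  fix c d assume cd: "c \<in> {..k} \<rightarrow>\<^sub>E {0..<p}" "d \<in> {..k} \<rightarrow>\<^sub>E {0..<p}" "?f c = ?f d"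
  have eq: "(\<Sum>i\<le>k. (c i - d i) *. (act (S ^ i) x)) =
    (\<Sum>i\<le>k. (c i) *. (act (S ^ i) x)) - (\<Sum>i\<le>k. (d i) *. (act (S ^ i) x))"
   by (simp add: frag_cmul_diff_distrib sum_subtractf)
  have "(\<Sum>i\<le>k. (c i - d i) *. (act (S ^ i) x)) \<in> multiples p" unfolding multiples_iff
  proof
   show "(\<Sum>i\<le>k. (c i - d i) *. (act (S ^ i) x)) \<in> M"
    using act_arg_sum[of "{..k}" "\<lambda>i. (c i - d i) *. (act (S ^ i) x)"] M_cmul act_in[OF x] by auto
   show "\<forall>j\<in>J. p dvd lookup (\<Sum>i\<le>k. (c i - d i) *. (act (S ^ i) x)) j"
   proof
    fix j assume "j \<in> J"
    hence "lookup (\<Sum>i\<le>k. (c i) *. (act (S ^ i) x)) j mod p =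
     lookup (\<Sum>i\<le>k. (d i) *. (act (S ^ i) x)) j mod p" using fun_cong[OF cd(3), of j] by simp
    thus "p dvd lookup (\<Sum>i\<le>k. (c i - d i) *. (act (S ^ i) x)) j"
     unfolding eq lookup_minus by (simp add: mod_eq_dvd_iff)
   qed
  qed
  from indep[OF this] have *: "p dvd c i - d i" if "i <= k" for i using that by blast
  show "c = d"
  proof
   fix i
   show "c i = d i"
   proof (cases "i <= k")
    case True
    hence "c i \<in> {0..<p}" "d i \<in> {0..<p}" using cd by auto
    thus ?thesis using *[OF True] by (simp add: mod_eq_dvd_iff[symmetric])
   next
    case False
    thus ?thesis using PiE_arb[OF cd(1), of i] PiE_arb[OF cd(2), of i] by simp
   qed
  qed
 qed
 moreover have "?f ` ({..k} \<rightarrow>\<^sub>E {0..<p}) <= J \<rightarrow>\<^sub>E {0..<p}" using p0 by auto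
 moreover have "finite (J \<rightarrow>\<^sub>E {0..<p})" using J by (simp add: finite_PiE)
 ultimately have "card ({..k} \<rightarrow>\<^sub>E {0..<p}) <= card (J \<rightarrow>\<^sub>E {0..<p})" by (rule card_inj_on_le)
 hence "nat p ^ Suc k <= nat p ^ card J" using J p0 by (simp add: card_PiE)
 moreover have "nat p > 1" using prime_gt_1_int[OF p] by simp
 ultimately have "Suc k <= card J" using power_le_imp_le_exp by blast
 thus False using KJ k by simp
qed

end

section \<open>Powers of X - 1 modulo p and the cyclotomic polynomial\<close>

lemma prime_dvd_add_power_diff:
 fixes a b :: "'a :: comm_ring_1"
 assumes p: "prime p"
 shows "of_nat p dvd (a + b) ^ p - (a ^ p + b ^ p)"
proof -
 have p0: "p > 0" using prime_gt_0_nat[OF p] .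
 let ?t = "\<lambda>k. of_nat (p choose k) * a ^ k * b ^ (p - k)"
 have "(a + b) ^ p = sum ?t {..p}" by (rule binomial_ring)
 also have "... = ?t 0 + ?t p + sum ?t ({..p} - {0, p})"
  using p0 by (simp add: sum.remove[of "{..p}" 0] sum.remove[of "{..p} - {0}" p] insert_commute Diff_insert2[symmetric] del: binomial_n_0)
 finally have "(a + b) ^ p - (a ^ p + b ^ p) = sum ?t ({..p} - {0, p})" by simp
 moreover have "of_nat p dvd sum ?t ({..p} - {0, p})"
 proof (rule dvd_sum)
  fix k assume "k \<in> {..p} - {0, p}"
  hence "p dvd (p choose k)" using p by (intro dvd_choose_prime) auto
  hence "of_nat p dvd (of_nat (p choose k) :: 'a)" by (auto elim!: dvdE)
  thus "of_nat p dvd ?t k" by (simp add: dvd_mult2)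
 qed
 ultimately show ?thesis by simp
qed

lemma dvd_power_diff:
 fixes a b :: "'a :: comm_ring_1"
 assumes "c dvd a - b"
 shows "c dvd a ^ n - b ^ n" using assms by (simp add: power_diff_sumr2)

lemma prime_dvd_power_prime_power_diff:
 fixes x :: "'a :: comm_ring_1"
 assumes p: "prime p"
 shows "of_nat p dvd (x - 1) ^ (p ^ j) - (x ^ (p ^ j) - 1)"
proof (induction j)
 case (Suc j)
 let ?b = "x ^ (p ^ j) - 1"
 have "of_nat p dvd ((x - 1) ^ (p ^ j)) ^ p - ?b ^ p" by (rule dvd_power_diff[OF Suc])
 moreover have "of_nat p dvd (?b + 1) ^ p - (?b ^ p + 1 ^ p)" by (rule prime_dvd_add_power_diff[OF p])
 ultimately have "of_nat p dvd ((x - 1) ^ (p ^ j)) ^ p - ?b ^ p - ((?b + 1) ^ p - (?b ^ p + 1 ^ p))" by (rule dvd_diff)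
 thus ?case by (simp add: algebra_simps flip: power_mult)
qed simp

text \<open>The left side is the cyclotomic polynomial of p^(k+1), the quotient of X^(p^(k+1)) - 1
  by X^(p^k) - 1. Modulo p both are powers of S = X - 1, and the common factor S^(p^k) can be
  cancelled since p is a prime of Z[X] that does not divide it.\<close>

lemma cyclotomic_prime_power_decomposition:
 fixes p k :: nat
 assumes p: "prime p"
 defines "S \<equiv> [:- 1, 1:] :: int poly" and "X \<equiv> [:0, 1:] :: int poly"
 obtains U W :: "int poly" where
  "(\<Sum>i<p. (X ^ (p ^ k)) ^ i) = S ^ ((p - 1) * p ^ k) + of_nat p * U" "U = 1 + S * W"
proof -
 let ?m = "p ^ k" and ?F = "\<Sum>i<p. (X ^ (p ^ k)) ^ i" and ?d = "(p - 1) * p ^ k"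
 have p1: "p > 1" using prime_gt_1_nat[OF p] .
 have SX: "S = X - 1" by (simp add: S_def X_def one_pCons)
 have geo: "(X ^ ?m - 1) * ?F = X ^ (p ^ Suc k) - 1"
  using power_diff_1_eq[of "X ^ ?m" p] by (simp add: mult.commute[of p] flip: power_mult)
 have d: "of_nat p dvd S ^ ?m * (S ^ ?d - ?F)"
 proof -
  have "of_nat p dvd (S ^ (p ^ Suc k) - (X ^ (p ^ Suc k) - 1)) - (S ^ ?m - (X ^ ?m - 1)) * ?F"
   unfolding SX by (rule dvd_diff[OF prime_dvd_power_prime_power_diff[OF p] dvd_mult2[OF prime_dvd_power_prime_power_diff[OF p]]])
  moreover have "S ^ (p ^ Suc k) = S ^ ?m * S ^ ?d"
  proof -
   have "p ^ Suc k = ?m + ?d" using p1 by (cases p) simp_all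
   thus ?thesis by (simp add: power_add)
  qed
  moreover have "(a - b) - (c - f) * g = c * (e - g)" if "a = c * e" "f * g = b" for a b c e f g :: "int poly"
   unfolding that(1) that(2)[symmetric] by (simp add: algebra_simps)
  ultimately show ?thesis using geo by simp
 qed
 have pe: "prime_elem (of_nat p :: int poly)"
  using lift_prime_elem_poly[of "int p"] p by (simp add: of_nat_poly)
 have "\<not> of_nat p dvd S ^ ?m"
 proof
  assume "of_nat p dvd S ^ ?m"
  hence "of_nat p dvd S" by (rule prime_elem_dvd_power[OF pe])
  hence "[:int p:] dvd S" by (simp add: of_nat_poly)
  hence "int p dvd Polynomial.coeff S 1" using const_poly_dvd_iff by blast
  thus False using p1 by (simp add: S_def)
 qed
 hence "of_nat p dvd S ^ ?d - ?F" using prime_elem_dvd_multD[OF pe d] by blast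
 hence "of_nat p dvd ?F - S ^ ?d" by (metis dvd_minus_iff minus_diff_eq)
 then obtain U where U: "?F - S ^ ?d = of_nat p * U" by blast
 \<comment> \<open>At 1 the polynomial S vanishes and all p summands of ?F are 1. So U has the value
   1 there, which is exactly divisibility of U - 1 by S.\<close>
 have "poly (?F - S ^ ?d) 1 = int p" using p1 by (simp add: poly_sum S_def X_def power_0_left)
 hence "int p * poly U 1 = int p" unfolding U by simp
 hence "poly U 1 = 1" using p1 by simp
 hence "poly (U - 1) 1 = 0" by simp
 hence "S dvd U - 1" unfolding S_def by (simp only: poly_eq_0_iff_dvd)
 then obtain W where "U - 1 = S * W" by blast
 thus thesis using U by (intro that[of U W]) (simp_all add: algebra_simps)
qed

context lattice_endo
begin

text \<open>Suppose the rank r is smaller than d, the degree of the cyclotomic polynomial F. Let N'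
  be the kernel of F(A). Since S^r maps N' into p N', the equation F y = 0 can be divided by p and
  solved for y, so that S maps N' onto itself. Then N' = S^r N' lies in p N', and iteration makes N'
  divisible by all powers of p, hence zero. But A^(p^k) - 1 sends \<open>x0\<close> to a nonzero
  element of N'.\<close>

lemma period_bound:
 fixes p k :: nat
 assumes p: "prime p" and per: "!!x. x \<in> M ==> (A ^^ (p ^ Suc k)) x = x"
  and x0: "x0 \<in> M" "(A ^^ (p ^ k)) x0 ~= x0"
 shows "(p - 1) * p ^ k <= card J"
proof (rule ccontr)
 define S where "S = ([:- 1, 1:] :: int poly)"
 define X where "X = ([:0, 1:] :: int poly)"
 define F where "F = (\<Sum>i<p. (X ^ (p ^ k)) ^ i)"
 define d where "d = (p - 1) * p ^ k"
 define r where "r = card J"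
 assume "\<not> (p - 1) * p ^ k <= card J"
 hence "r < d" unfolding d_def r_def by (simp only: not_le)
 then obtain e where e: "d = Suc (r + e)" using less_imp_Suc_add by blast
 obtain U W where UW: "F = S ^ d + of_nat p * U" "U = 1 + S * W"
  using cyclotomic_prime_power_decomposition[OF p, of k] unfolding S_def X_def F_def d_def by blast
 have pz: "prime (int p)" using p by simp
 have p1: "p > 1" using prime_gt_1_nat[OF p] .
 have ofp: "act (of_nat p * P) x = (int p) *. (act P x)" if "x \<in> M" for P x
  using act_mult[OF that, of "of_nat p" P] by (simp add: of_nat_poly act_const)
 have Ap: "act (X ^ j) x = (A ^^ j) x" if "x \<in> M" for j x unfolding X_def by (rule act_X_power[OF that])
 have cancel: "z = 0" if "(int p) *. z = 0" for z :: "'j \<Rightarrow>\<^sub>0 int"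
  using that p1 by (simp add: poly_mapping_eq_iff fun_eq_iff)
 define N' where "N' = {x \<in> M. act F x = 0}"
 have N'M: "x \<in> M" if "x \<in> N'" for x using that unfolding N'_def by simp
 have N'act: "act P x \<in> N'" if "x \<in> N'" for P x
 proof -
  have x: "x \<in> M" "act F x = 0" using that unfolding N'_def by simp_all
  have "act F (act P x) = act P (act F x)"
   using act_mult[OF x(1), of F P] act_mult[OF x(1), of P F] by (simp add: mult.commute)
  also have "... = 0" using act_arg_cmul[of 0 P 0] x(2) by simp
  finally show ?thesis using act_in[OF x(1)] unfolding N'_def by simp
 qed
 have N'add: "x + y \<in> N'" if "x \<in> N'" "y \<in> N'" for x y
  using that M_add[of x y] act_arg_add[of x y F] unfolding N'_def by simp
 have N'pure: "z \<in> N'" if "(int p) *. z \<in> N'" "z \<in> M" for z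
  using that cancel act_arg_cmul[OF that(2), of F "int p"] unfolding N'_def by simp
 have nil: "act (S ^ r) x \<in> multiples (int p)" if x: "x \<in> M" for x unfolding r_def
 proof (rule nilpotent_mod_prime[OF pz x])
  obtain V where "S ^ (p ^ Suc k) - (X ^ (p ^ Suc k) - 1) = of_nat p * V"
   using prime_dvd_power_prime_power_diff[OF p, of X "Suc k"] unfolding S_def X_def
   by (auto simp: one_pCons elim!: dvdE)
  hence "S ^ (p ^ Suc k) = (X ^ (p ^ Suc k) - 1) + of_nat p * V" by (simp add: algebra_simps)
  hence "act (S ^ (p ^ Suc k)) x = (int p) *. (act V x)"
   by (simp only: act_add[OF x] act_diff[OF x] ofp[OF x] Ap[OF x] per[OF x] act_1) simp
  thus "act (S ^ (p ^ Suc k)) x \<in> multiples (int p)"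
   using act_in[OF x, of V] unfolding multiples_def by blast
 qed
 have step: "\<exists>z\<in>N'. act (S ^ r) y = (int p) *. z" if y: "y \<in> N'" for y
 proof -
  obtain z where z: "z \<in> M" "act (S ^ r) y = (int p) *. z"
   using nil[OF N'M[OF y]] unfolding multiples_def by blast
  thus ?thesis using N'pure[OF _ z(1)] N'act[OF y, of "S ^ r"] by (intro bexI[of _ z]) simp_all
 qed
 \<comment> \<open>Here r < d is used: F y = 0 becomes p (S^(e+1) z + U y) = 0, and U = 1 + S W
   exhibits y as S applied to an element of N'.\<close>
 have div: "\<exists>z\<in>N'. y = act S z" if y: "y \<in> N'" for y
 proof -
  have yM: "y \<in> M" by (rule N'M[OF y])
  obtain z where z: "z \<in> N'" "act (S ^ r) y = (int p) *. z" using step[OF y] by blast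
  have zM: "z \<in> M" by (rule N'M[OF z(1)])
  have "S ^ d = S ^ Suc e * S ^ r" by (simp add: e power_add mult_ac)
  hence "act F y = (int p) *. (act (S ^ Suc e) z) + (int p) *. (act U y)"
   unfolding UW(1) act_add[OF yM] ofp[OF yM]
   by (simp only: act_mult[OF yM, of "S ^ Suc e"] z(2) act_arg_cmul[OF zM])
  hence "(int p) *. (act (S ^ Suc e) z + act U y) = 0"
   using y unfolding N'_def by (simp add: frag_cmul_distrib2)
  hence "act (S ^ Suc e) z + act U y = 0" by (rule cancel)
  moreover have "act U y = y + act S (act W y)" unfolding UW(2) act_add[OF yM] act_mult[OF yM] act_1 ..
  moreover have "act (S ^ Suc e) z = act S (act (S ^ e) z)" using act_mult[OF zM, of S "S ^ e"] by simp
  moreover have "act S (act (S ^ e) z) + act S (act W y) = act S (act (S ^ e) z + act W y)"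
   using act_arg_add[OF act_in[OF zM] act_in[OF yM], of S "S ^ e" W] by simp
  ultimately have "y = - act S (act (S ^ e) z + act W y)" by (simp add: algebra_simps eq_neg_iff_add_eq_0)
  moreover have in': "act (S ^ e) z + act W y \<in> N'" by (intro N'add N'act z y)
  moreover have "- act S (act (S ^ e) z + act W y) = act S ((- 1) *. (act (S ^ e) z + act W y))"
   using act_arg_cmul[OF N'M[OF in'], of S "- 1"] by simp
  moreover have "(- 1) *. (act (S ^ e) z + act W y) \<in> N'"
   using N'act[OF in', of "[:- 1:]"] by (simp add: act_const)
  ultimately show ?thesis by (intro bexI[of _ "(- 1) *. (act (S ^ e) z + act W y)"]) simp_all
 qed
 have divr: "\<exists>z\<in>N'. y = act (S ^ l) z" if y: "y \<in> N'" for y l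
 proof (induction l)
  case 0
  thus ?case using y by (intro bexI[of _ y]) simp_all
 next
  case (Suc l)
  then obtain z where z: "z \<in> N'" "y = act (S ^ l) z" by blast
  obtain w where w: "w \<in> N'" "z = act S w" using div[OF z(1)] by blast
  have "y = act (S ^ Suc l) w"
   unfolding z(2) w(2) using act_mult[OF N'M[OF w(1)], of "S ^ l" S] by (simp add: mult.commute)
  thus ?case using w(1) by blast
 qed
 have pk: "\<exists>z\<in>N'. y = (int p ^ l) *. z" if y: "y \<in> N'" for y l
 proof (induction l)
  case 0
  thus ?case using y by (intro bexI[of _ y]) simp_all
 next
  case (Suc l)
  then obtain z where z: "z \<in> N'" "y = (int p ^ l) *. z" by blast
  obtain v where v: "v \<in> N'" "z = act (S ^ r) v" using divr[OF z(1)] by blast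
  obtain w where w: "w \<in> N'" "act (S ^ r) v = (int p) *. w" using step[OF v(1)] by blast
  have "y = (int p ^ Suc l) *. w" unfolding z(2) v(2) w(2) by (simp add: mult.commute)
  thus ?case using w(1) by blast
 qed
 define y where "y = act (X ^ (p ^ k) - 1) x0"
 have "F * (X ^ (p ^ k) - 1) = X ^ (p ^ Suc k) - 1" unfolding F_def using power_diff_1_eq[of "X ^ (p ^ k)" p]
  by (simp add: mult.commute[of p] mult.commute[of "sum _ _"] flip: power_mult)
 hence "act F y = act (X ^ (p ^ Suc k) - 1) x0"
  unfolding y_def using act_mult[OF x0(1), of F "X ^ (p ^ k) - 1"] by simp
 also have "... = 0" using act_diff[OF x0(1)] Ap[OF x0(1)] per[OF x0(1)] by simp
 finally have y: "y \<in> N'" using act_in[OF x0(1)] unfolding N'_def y_def by simp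
 have "y ~= 0" unfolding y_def act_diff[OF x0(1)] Ap[OF x0(1)] using x0(2) by simp
 then obtain j where j: "lookup y j ~= 0" by (metis in_keys_iff keys_eq_empty all_not_in_conv)
 \<comment> \<open>A nonzero coordinate c of y would be divisible by p^|c|, which is larger than
   |c|.\<close>
 define c where "c = lookup y j"
 obtain z where z: "y = (int p ^ nat \<bar>c\<bar>) *. z" using pk[OF y] by blast
 have "c = int p ^ nat \<bar>c\<bar> * lookup z j" using arg_cong[OF z, of "\<lambda>y. lookup y j"] c_def by simp
 hence "int p ^ nat \<bar>c\<bar> dvd c" by (rule dvdI)
 hence "int p ^ nat \<bar>c\<bar> <= \<bar>c\<bar>" using j dvd_imp_le_int[of c "int p ^ nat \<bar>c\<bar>"] p1 unfolding c_def by simp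
 moreover have "nat \<bar>c\<bar> < p ^ nat \<bar>c\<bar>" by (rule power_gt_expt) (use p1 in simp)
 hence "\<bar>c\<bar> < int p ^ nat \<bar>c\<bar>" by (metis nat_less_iff of_nat_power abs_ge_zero)
 ultimately show False by simp
qed

end

section \<open>Lower bounds for the genus\<close>

lemma complex_atlas_chart:
 assumes "complex_atlas X A" "x \<in> topspace X"
 obtains U \<phi> where "(U, \<phi>) \<in> A" "complex_chart X (U, \<phi>)" "x \<in> U"
 using assms unfolding complex_atlas_def by blast

lemma complex_atlas_locally_plane: "complex_atlas X A ==> locally_plane X"
 unfolding locally_plane_def using complex_atlas_chart by (metis (no_types))

lemma fixed_points_closedin:
 assumes "Hausdorff_space X" "continuous_map X X h"
 shows "closedin X {x \<in> topspace X. h x = x}"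
 using closedin_continuous_maps_eq[OF assms continuous_map_id] by simp

text \<open>The identity theorem for the chart expression of h minus the identity, on a disc small
  enough for h to stay in the chart: its zeros are the fixed points and are isolated unless it
  vanishes identically.\<close>

lemma holomorphic_map_fixed_point_dichotomy:
 assumes X: "Hausdorff_space X" "complex_atlas X A" and h: "holomorphic_map X A X A h" and x: "x \<in> topspace X"
 obtains U where "openin X U" "x \<in> U" "(\<forall>y\<in>U. h y = y) \<or> (\<forall>y\<in>U - {x}. h y ~= y)"
proof (cases "h x = x")
 case False
 have cont: "continuous_map X X h" using h by (simp add: holomorphic_map_def)
 have "openin X (topspace X - {x \<in> topspace X. h x = x})" using fixed_points_closedin[OF X(1) cont] by blast
 thus thesis using that[of "topspace X - {x \<in> topspace X. h x = x}"] False x by auto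
next
 case True
 have cont: "continuous_map X X h" using h by (simp add: holomorphic_map_def)
 obtain V \<phi> where V: "(V, \<phi>) \<in> A" "complex_chart X (V, \<phi>)" "x \<in> V" by (rule complex_atlas_chart[OF X(2) x])
 note D = complex_atlasD[OF X(2) V(1)]
 have "openin X {y \<in> topspace X. h y \<in> V}" using cont D(1) by (rule openin_continuous_map_preimage)
 then obtain B r where B: "complex_chart X (B, \<phi>)" "x \<in> B" "B <= {y \<in> topspace X. h y \<in> V}" "B <= V"
   "r > 0" "\<phi> ` B = ball (\<phi> x) r"
  using complex_chart_small_disc[OF V(2) _ V(3), of "{y \<in> topspace X. h y \<in> V}"] True x V(3) by auto
 define g where "g z = (\<phi> \<circ> h \<circ> inv_into V \<phi>) z - z" for z
 have "(\<phi> \<circ> h \<circ> inv_into V \<phi>) holomorphic_on \<phi> ` {x \<in> V. h x \<in> V}"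
  using h V(1) unfolding holomorphic_map_def by blast
 moreover have "ball (\<phi> x) r <= \<phi> ` {x \<in> V. h x \<in> V}" unfolding B(6)[symmetric] using B(3,4) by blast
 ultimately have g: "g holomorphic_on ball (\<phi> x) r"
  unfolding g_def by (intro holomorphic_intros) (rule holomorphic_on_subset)
 have gz: "g (\<phi> y) = 0 \<longleftrightarrow> h y = y" if "y \<in> B" for y
 proof -
  have "y \<in> V" "h y \<in> V" using B(3,4) that by auto
  thus ?thesis unfolding g_def using D(3) by (simp add: inj_on_eq_iff)
 qed
 have Bo: "openin X B" using B(1) by (simp add: complex_chart_def)
 show thesis
 proof (cases "\<forall>y\<in>B. h y = y")
  case True
  thus ?thesis using that Bo B(2) by blast
 next
  case False
  then obtain y where y: "y \<in> B" "h y ~= y" by blast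
  obtain s where s: "0 < s" "ball (\<phi> x) s <= ball (\<phi> x) r" "!!z. z \<in> ball (\<phi> x) s - {\<phi> x} ==> g z ~= 0"
   using isolated_zeros[OF g open_ball connected_ball, of "\<phi> x" "\<phi> y"] B(2,5,6) y gz True by blast
  have xs: "\<phi> x \<in> ball (\<phi> x) s" using s(1) by simp
  have "openin (top_of_set (\<phi> ` B)) (ball (\<phi> x) s)" unfolding B(6) using s(2) by (simp add: openin_open_eq)
  hence "openin (X on B) {y \<in> topspace (X on B). \<phi> y \<in> ball (\<phi> x) s}"
   using B(1) unfolding complex_chart_def
   by (intro openin_continuous_map_preimage) (auto dest: homeomorphic_imp_continuous_map)
  moreover have "topspace (X on B) = B" using openin_subset[OF Bo] by auto
  ultimately have o: "openin X {y \<in> B. \<phi> y \<in> ball (\<phi> x) s}" using Bo by (metis openin_trans_full)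
  have inj: "\<phi> y ~= \<phi> x" if "y \<in> B" "y ~= x" for y using inj_onD[OF D(3), of y x] B(2,4) that by blast
  have "h y ~= y" if "y \<in> {y \<in> B. \<phi> y \<in> ball (\<phi> x) s} - {x}" for y
   using that gz[of y] s(3)[of "\<phi> y"] inj[of y] by blast
  thus ?thesis using that[OF o] B(2) xs by blast
 qed
qed

text \<open>Infinitely many fixed points accumulate by compactness, and at an accumulation point the
  dichotomy gives an interior point of the fixed set. The same dichotomy makes that interior closed,
  so by connectedness it is everything.\<close>

lemma holomorphic_map_finite_fixed_points:
 assumes X: "compact_riemann_surface X A" and h: "holomorphic_map X A X A h"
  and x0: "x0 \<in> topspace X" "h x0 ~= x0"
 shows "finite {x \<in> topspace X. h x = x}" (is "finite ?F")
proof (rule ccontr)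
 assume "infinite ?F"
 have Y: "connected_space X" "Hausdorff_space X" "compact_space X" "complex_atlas X A"
  using X by (simp_all add: compact_riemann_surface_def)
 obtain a where a: "a \<in> X derived_set_of ?F"
  using compact_space_imp_Bolzano_Weierstrass[OF Y(3) \<open>infinite ?F\<close>] by auto
 note dich = holomorphic_map_fixed_point_dichotomy[OF Y(2,4) h]
 let ?I = "X interior_of ?F"
 have "a \<in> topspace X" using a by (simp add: derived_set_of_def)
 then obtain U where U: "openin X U" "a \<in> U" "(\<forall>y\<in>U. h y = y) \<or> (\<forall>y\<in>U - {a}. h y ~= y)" by (rule dich)
 have "\<not> (\<forall>y\<in>U - {a}. h y ~= y)" using a U(1,2) unfolding derived_set_of_def by auto
 hence "U <= ?F" using U openin_subset[OF U(1)] by auto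
 hence aI: "a \<in> ?I" using U by (auto simp: interior_of_def)
 have "openin X (topspace X - ?I)"
 proof (subst openin_subopen, intro ballI)
  fix x assume x: "x \<in> topspace X - ?I"
  hence "x \<in> topspace X" by simp
  then obtain U where U: "openin X U" "x \<in> U" "(\<forall>y\<in>U. h y = y) \<or> (\<forall>y\<in>U - {x}. h y ~= y)" by (rule dich)
  have "\<not> (\<forall>y\<in>U. h y = y)"
  proof
   assume "\<forall>y\<in>U. h y = y"
   hence "U <= ?F" using openin_subset[OF U(1)] by auto
   thus False using U x by (auto simp: interior_of_def)
  qed
  hence "\<forall>y\<in>U - {x}. h y ~= y" using U(3) by blast
  moreover have "?I <= ?F" by (rule interior_of_subset)
  ultimately have "U \<inter> ?I = {}" using x by blast
  thus "\<exists>T. openin X T \<and> x \<in> T \<and> T <= topspace X - ?I" using U openin_subset[OF U(1)] by blast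
 qed
 hence "closedin X ?I" by (simp add: closedin_def interior_of_subset_topspace)
 hence "?I = {} \<or> ?I = topspace X" using Y(1) by (simp add: connected_space_clopen_in)
 hence "?I = topspace X" using aI by blast
 thus False using x0 interior_of_subset[of X ?F] by blast
qed

text \<open>h is kept apart from \<open>f ^^ (p ^ k)\<close>, with which it agrees only on X:
  elements of the biholomorphism group are extensional, and iterates of f may differ from them
  elsewhere.\<close>

lemma order_prime_power_genus_bound:
 fixes p k g :: nat
 assumes X: "compact_riemann_surface X A" and g: "has_genus X g" "g \<ge> 2" and p: "prime p"
  and f: "continuous_map X X f" and h: "holomorphic_map X A X A h"
  and fh: "!!x. x \<in> topspace X ==> (f ^^ (p ^ k)) x = h x"
  and per: "!!x. x \<in> topspace X ==> (f ^^ (p ^ Suc k)) x = x"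
  and x0: "x0 \<in> topspace X" "h x0 ~= x0"
 shows "(p - 1) * p ^ k <= 2 * g"
proof -
 have Y: "connected_space X" "Hausdorff_space X" "compact_space X" "complex_atlas X A"
  using X by (simp_all add: compact_riemann_surface_def)
 have ch: "continuous_map X X h" using h by (simp add: holomorphic_map_def)
 let ?J = "{..<2 * g}"
 have iso: "homology_group (int 1) X \<cong> free_Abelian_group ?J" using g(1) by (simp add: has_genus_def)
 obtain \<Phi> where "homology_coordinates 1 X ?J \<Phi>" by (rule homology_coordinates_exist[OF iso])
 then interpret H: homology_coordinates 1 X ?J \<Phi> .
 note \<Phi> = H.add H.eq H.keys H.surj H.cmul
 define rep where "rep x = (SOME a. cycle 1 X a \<and> \<Phi> a = x)" for x
 have rep: "cycle 1 X (rep x)" "\<Phi> (rep x) = x" if "keys x <= ?J" for x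
  using someI_ex[OF \<Phi>(4)[OF that]] unfolding rep_def by blast+
 have cyc: "cycle 1 X (chain_map 1 u a)"
  if "cycle 1 X a" "continuous_map X X u" for u a by (rule singular_relcycle_chain_map[OF that]) simp
 define B where "B x = \<Phi> (chain_map 1 f (rep x))" for x
 have B\<Phi>: "B (\<Phi> a) = \<Phi> (chain_map 1 f a)" if a: "cycle 1 X a" for a
 proof -
  have r: "cycle 1 X (rep (\<Phi> a))" "\<Phi> (rep (\<Phi> a)) = \<Phi> a" using rep \<Phi>(3)[OF a] by blast+
  hence "homologous 1 X (rep (\<Phi> a)) a" using \<Phi>(2) a by blast
  hence "boundary 1 X (chain_map 1 f (rep (\<Phi> a) - a))"
   unfolding homologous_rel_def by (rule singular_relboundary_chain_map[OF _ f]) simp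
  hence "homologous 1 X (chain_map 1 f (rep (\<Phi> a))) (chain_map 1 f a)"
   unfolding homologous_rel_def chain_map_diff .
  thus ?thesis unfolding B_def using \<Phi>(2) cyc[OF r(1) f] cyc[OF a f] by blast
 qed
 have cf: "continuous_map X X (f ^^ i)" for i
 proof (induction i)
  case 0
  show ?case by (simp only: funpow.simps(1) continuous_map_id)
 next
  case (Suc i)
  thus ?case using continuous_map_compose[OF Suc f] by (simp only: funpow.simps(2))
 qed
 have Bp: "(B ^^ i) (\<Phi> a) = \<Phi> (chain_map 1 (f ^^ i) a)" if a: "cycle 1 X a" for a i
 proof (induction i)
  case 0
  have "chain 1 X a" using a by (simp add: singular_relcycle_def)
  from chain_map_ident[OF this] show ?case by (simp add: id_def)
 next
  case (Suc i)
  thus ?case using B\<Phi>[OF cyc[OF a cf[of i]]] fun_cong[OF chain_map_compose[of 1 f "f ^^ i"], of a]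
   by (simp add: o_def)
 qed
 have in': "\<exists>a. cycle 1 X a \<and> x = \<Phi> a" if "keys x <= ?J" for x using \<Phi>(4)[OF that] by blast
 interpret L: lattice_endo ?J B
 proof
  show "finite ?J" by simp
  show "keys (B x) <= ?J" if "keys x <= ?J" for x unfolding B_def by (rule \<Phi>(3)[OF cyc[OF rep(1)[OF that] f]])
  show "B (x + y) = B x + B y" if x: "keys x <= ?J" and y: "keys y <= ?J" for x y
  proof -
   obtain a where a: "cycle 1 X a" "x = \<Phi> a" using in'[OF x] by blast
   obtain b where b: "cycle 1 X b" "y = \<Phi> b" using in'[OF y] by blast
   have "x + y = \<Phi> (a + b)" using \<Phi>(1)[OF a(1) b(1)] a b by simp
   thus ?thesis using B\<Phi>[OF singular_relcycle_add[OF a(1) b(1)]] B\<Phi>[OF a(1)] B\<Phi>[OF b(1)]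
     \<Phi>(1)[OF cyc[OF a(1) f] cyc[OF b(1) f]] unfolding a(2) b(2) by (simp only: chain_map_add)
  qed
 qed
 have "\<exists>x :: nat \<Rightarrow>\<^sub>0 int. x \<in> {x. keys x <= ?J} \<and> (B ^^ (p ^ k)) x ~= x"
 proof (rule ccontr)
  \<comment> \<open>Otherwise h, a map of prime period p, acts trivially on the first homology,
    whose rank would then be at most 2, against 2 g >= 4.\<close>
  assume not: "\<not> ?thesis"
  have triv: "homologous 1 X (chain_map 1 h z) z" if z: "cycle 1 X z" for z
  proof -
   have "(B ^^ (p ^ k)) (\<Phi> z) = \<Phi> z" using not \<Phi>(3)[OF z] by blast
   hence "\<Phi> (chain_map 1 (f ^^ (p ^ k)) z) = \<Phi> z" using Bp[OF z] by simp
   moreover have "chain_map 1 (f ^^ (p ^ k)) z = chain_map 1 h z"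
    using z fh by (intro chain_map_eq[of _ X]) (simp_all add: singular_relcycle_def)
   ultimately show ?thesis using \<Phi>(2)[OF cyc[OF z ch] z] by simp
  qed
  have hp: "x \<in> topspace X ==> (h ^^ j) x = (f ^^ (p ^ k * j)) x \<and> (h ^^ j) x \<in> topspace X" for x j
  proof (induction j)
   case (Suc j)
   hence IH: "(h ^^ j) x = (f ^^ (p ^ k * j)) x" "(h ^^ j) x \<in> topspace X" by blast+
   have "(h ^^ Suc j) x = (f ^^ (p ^ k)) ((h ^^ j) x)" using fh[OF IH(2)] by simp
   also have "... = (f ^^ (p ^ k + p ^ k * j)) x" unfolding IH(1) by (simp only: funpow_add o_apply)
   finally have "(h ^^ Suc j) x = (f ^^ (p ^ k * Suc j)) x" by simp
   moreover have "h ((h ^^ j) x) \<in> topspace X" using continuous_map_funspace[OF ch] IH(2) by (rule funcset_mem)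
   ultimately show ?case by simp
  qed simp
  interpret periodic_map X h p
  proof
   show "(h ^^ p) x = x" if x: "x \<in> topspace X" for x
    using hp[OF x, of p] per[OF x] by (simp add: mult.commute)
  qed (fact p ch)+
  have "homology_group 1 X \<cong> free_Abelian_group ?J" using iso by simp
  hence "card ?J <= 2" by (intro trivial_action_rank_le_2[OF Y(2,3,1) complex_atlas_locally_plane[OF Y(4)]
     holomorphic_map_finite_fixed_points[OF X h x0] triv x0]) simp_all
  thus False using g(2) by simp
 qed
 then obtain x where x: "x \<in> {x. keys x <= ?J}" "(B ^^ (p ^ k)) x ~= x" by blast
 have "(p - 1) * p ^ k <= card ?J"
 proof (rule L.period_bound[OF p _ x])
  fix x :: "nat \<Rightarrow>\<^sub>0 int" assume "x \<in> {x. keys x <= ?J}"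
  then obtain a where a: "cycle 1 X a" "x = \<Phi> a" using in' by blast
  have "chain_map 1 (f ^^ (p ^ Suc k)) a = a"
   using a(1) per by (intro chain_map_id_gen[of _ X]) (simp_all add: singular_relcycle_def del: power_Suc)
  thus "(B ^^ (p ^ Suc k)) x = x" unfolding a(2) Bp[OF a(1)] by (simp only:)
 qed
 thus ?thesis by simp
qed

lemma spectrum_lower_bound:
 fixes p k :: nat
 assumes G: "group G" "cyclic_group G" "order G = p ^ Suc k" and p: "prime p" and g: "g \<in> spectrum G" "g \<ge> 2"
 shows "(p - 1) * p ^ k <= 2 * g"
proof -
 interpret G: group G by (rule G(1))
 obtain X :: "complex topology" and A where X: "compact_riemann_surface X A" "has_genus X g" "acts_on_surface G X A"
  using g(1) unfolding spectrum_def by blast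
 obtain \<psi> where \<psi>: "\<psi> \<in> hom G (biholomorphism_group X A)" "inj_on \<psi> (carrier G)"
  using X(3) by (auto simp: acts_on_surface_def mon_def)
 obtain a where a: "a \<in> carrier G" "subgroup_generated G {a} = G" using G(2) by (auto simp: cyclic_group_def)
 have ord: "G.ord a = p ^ Suc k"
 proof -
  have "generate G {a} = carrier G" using a by (metis G.carrier_subgroup_generated_by_singleton G.generate_pow_card carrier_subgroup_generated Int_absorb1 empty_subsetI insert_subset)
  thus ?thesis using G.generate_pow_card[OF a(1)] G(3) by (simp add: order_def)
 qed
 let ?S = "topspace X"
 have bih: "\<psi> b \<in> Bij ?S" "holomorphic_map X A X A (\<psi> b)" if "b \<in> carrier G" for b
  using hom_in_carrier[OF \<psi>(1) that] by (auto simp: biholomorphism_group_def)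
 have mem: "\<psi> b x \<in> ?S" if "b \<in> carrier G" "x \<in> ?S" for b x
  using bih(1)[OF that(1)] that(2) by (auto simp: Bij_def bij_betw_def)
 have mul: "\<psi> (b \<otimes>\<^bsub>G\<^esub> c) x = \<psi> b (\<psi> c x)" if "b \<in> carrier G" "c \<in> carrier G" "x \<in> ?S" for b c x
  using hom_mult[OF \<psi>(1) that(1,2)] bih(1)[OF that(1)] bih(1)[OF that(2)] that(3)
  by (simp add: biholomorphism_group_def BijGroup_def compose_def)
 have one: "\<psi> \<one>\<^bsub>G\<^esub> x = x" if x: "x \<in> ?S" for x
 proof -
  have "\<psi> \<one>\<^bsub>G\<^esub> (\<psi> \<one>\<^bsub>G\<^esub> x) = \<psi> \<one>\<^bsub>G\<^esub> x" using mul[of "\<one>\<^bsub>G\<^esub>" "\<one>\<^bsub>G\<^esub>" x] x by simp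
  moreover have "inj_on (\<psi> \<one>\<^bsub>G\<^esub>) ?S" using bih(1)[OF G.one_closed] by (simp add: Bij_def bij_betw_def)
  ultimately show ?thesis using mem[OF G.one_closed x] x by (simp add: inj_on_eq_iff)
 qed
 have pw: "\<psi> (a [^]\<^bsub>G\<^esub> i) x = (\<psi> a ^^ i) x \<and> (\<psi> a ^^ i) x \<in> ?S" if x: "x \<in> ?S" for i :: nat and x
 proof (induction i)
  case 0
  show ?case using one[OF x] x by simp
 next
  case (Suc i)
  have "\<psi> (a [^]\<^bsub>G\<^esub> Suc i) x = \<psi> (a \<otimes>\<^bsub>G\<^esub> a [^]\<^bsub>G\<^esub> i) x" using a(1) by (simp add: G.nat_pow_comm[of a 1 i, simplified])
  also have "... = \<psi> a ((\<psi> a ^^ i) x)" using mul[OF a(1) _ x] Suc a(1) by simp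
  finally show ?case using mem[OF a(1)] Suc by simp
 qed
 define h where "h = \<psi> (a [^]\<^bsub>G\<^esub> (p ^ k))"
 have p1: "p > 1" by (rule prime_gt_1_nat[OF p])
 \<comment> \<open>Faithfulness forbids that a^(p^k) acts as the identity; extensionality turns
   agreement on X into equality of the maps.\<close>
 have hne: "\<exists>x0\<in>?S. h x0 ~= x0"
 proof (rule ccontr)
  assume "\<not> ?thesis"
  hence "h = \<psi> \<one>\<^bsub>G\<^esub>" using one bih(1)[OF G.one_closed] bih(1)[of "a [^]\<^bsub>G\<^esub> (p ^ k)"] a(1) unfolding h_def
   by (auto simp: Bij_def intro!: extensionalityI[of _ ?S])
  hence "a [^]\<^bsub>G\<^esub> (p ^ k) = \<one>\<^bsub>G\<^esub>" unfolding h_def using \<psi>(2) a(1) by (auto dest: inj_onD)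
  hence "p ^ Suc k dvd p ^ k" using G.pow_eq_id[OF a(1)] ord by simp
  thus False using p1 power_dvd_imp_le[of p "Suc k" k] by simp
 qed
 then obtain x0 where x0: "x0 \<in> ?S" "h x0 ~= x0" by blast
 show ?thesis
 proof (rule order_prime_power_genus_bound[OF X(1,2) g(2) p, of "\<psi> a" h k])
  show "continuous_map X X (\<psi> a)" using bih(2)[OF a(1)] by (simp add: holomorphic_map_def)
  show "holomorphic_map X A X A h" unfolding h_def using a(1) by (intro bih) simp
  show "(\<psi> a ^^ (p ^ k)) x = h x" if "x \<in> ?S" for x unfolding h_def using pw[OF that] by simp
  show "(\<psi> a ^^ (p ^ Suc k)) x = x" if x: "x \<in> ?S" for x
  proof -
   have "a [^]\<^bsub>G\<^esub> (p ^ Suc k) = \<one>\<^bsub>G\<^esub>" using G.pow_eq_id[OF a(1), of "p ^ Suc k"] ord by simp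
   thus ?thesis using pw[OF x, of "p ^ Suc k"] one[OF x] by simp
  qed
 qed (fact x0)+
qed

section \<open>Loops and winding numbers\<close>

definition point_simplex :: "'a => (nat => real) => 'a" where
 "point_simplex a = restrict (\<lambda>_. a) (Delta 0)"

definition path_simplex :: "(real => 'a) => (nat => real) => 'a" where
 "path_simplex p = restrict (\<lambda>x. p (x 1)) (Delta 1)"

abbreviation path_chain :: "(real => 'a) => 'a chain" where
 "path_chain p \<equiv> frag_of (path_simplex p)"

abbreviation unit_interval :: "real topology" where
 "unit_interval \<equiv> top_of_set {0..1}"

lemma singular_simplex_path_simplex:
 assumes "continuous_map unit_interval X p"
 shows "singular_simplex 1 X (path_simplex p)"
proof -
 have "continuous_map ((powertop_real UNIV) on (Delta 1)) euclideanreal (\<lambda>x. x 1)"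
  by (intro continuous_map_from_subtopology continuous_map_product_projection) simp
 moreover have "(\<lambda>x. x 1) ` topspace ((powertop_real UNIV) on (Delta 1)) <= {0..1::real}"
  by (auto simp: standard_simplex_def)
 ultimately have "continuous_map ((powertop_real UNIV) on (Delta 1)) unit_interval (\<lambda>x. x 1)"
  by (auto simp: continuous_map_in_subtopology)
 from continuous_map_compose[OF this assms] show ?thesis unfolding singular_simplex_def path_simplex_def
  by (auto intro: continuous_map_eq)
qed

lemma singular_chain_path_chain: "continuous_map unit_interval X p ==> chain 1 X (path_chain p)"
 using singular_simplex_path_simplex by (simp add: singular_chain_of)

lemma path_simplex_cong: "(!!u. 0 <= u ==> u <= 1 ==> p u = p' u) ==> path_simplex p = path_simplex p'"
 unfolding path_simplex_def by (auto simp: standard_simplex_def restrict_def fun_eq_iff)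

lemma singular_simplex_1_cases:
 assumes "singular_simplex 1 X f"
 obtains p where "continuous_map unit_interval X p" "f = path_simplex p"
proof -
 define \<iota> where "\<iota> u = (\<lambda>i. if i = 0 then 1 - u else if i = Suc 0 then u else 0 :: real)" for u
 have "continuous_map unit_interval ((powertop_real UNIV) on (Delta 1)) \<iota>"
  unfolding continuous_map_in_subtopology continuous_map_componentwise_UNIV
 proof (intro conjI allI)
  show "continuous_map unit_interval euclideanreal (\<lambda>x. \<iota> x k)" for k
   unfolding \<iota>_def by (cases "k = 0"; cases "k = Suc 0") (auto intro!: continuous_intros)
  show "\<iota> \<in> topspace unit_interval \<rightarrow> Delta 1" by (auto simp: \<iota>_def standard_simplex_def)
 qed
 hence "continuous_map unit_interval X (f \<circ> \<iota>)"
  using assms unfolding singular_simplex_def by (blast intro: continuous_map_compose)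
 moreover have "f = path_simplex (f \<circ> \<iota>)"
 proof
  fix x
  show "f x = path_simplex (f \<circ> \<iota>) x"
  proof (cases "x \<in> Delta 1")
   case True
   hence "\<iota> (x 1) = x" by (auto simp: \<iota>_def standard_simplex_def fun_eq_iff Suc_lessI)
   thus ?thesis using True by (simp add: path_simplex_def)
  next
   case False
   thus ?thesis using assms by (simp add: path_simplex_def singular_simplex_def extensional_def)
  qed
 qed
 ultimately show thesis by (rule that)
qed

lemma chain_boundary_path_chain:
 "bdry 1 (path_chain p) = frag_of (point_simplex (p 1)) - frag_of (point_simplex (p 0))"
proof -
 have "singular_face 1 0 (path_simplex p) = point_simplex (p 1)" "singular_face 1 1 (path_simplex p) = point_simplex (p 0)"
  using simplical_face_in_standard_simplex[of 1 0] simplical_face_in_standard_simplex[of 1 1]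
  by (auto simp: singular_face_def path_simplex_def point_simplex_def restrict_def fun_eq_iff
    simplical_face_def standard_simplex_0)
 thus ?thesis by (simp add: chain_boundary_of)
qed

lemma chain_map_path_chain: "chain_map 1 g (path_chain p) = path_chain (g \<circ> p)"
proof -
 have "simplex_map 1 g (path_simplex p) = path_simplex (g \<circ> p)"
  by (auto simp: simplex_map_def path_simplex_def restrict_def fun_eq_iff)
 thus ?thesis by (simp add: chain_map_of)
qed

lemma singular_relcycle_1:
 "cycle 1 X c \<longleftrightarrow> chain 1 X c \<and> bdry 1 c = 0" by (rule singular_cycle)

lemma contractible_image_boundary:
 assumes "contractible_space Y" "continuous_map Y X f" "chain 1 Y c" "bdry 1 c = 0"
 shows "boundary 1 X (chain_map 1 f c)"
proof (rule singular_relboundary_chain_map[OF _ assms(2)])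
 show "boundary 1 Y c"
  by (rule contractible_cycle_boundary[OF assms(1) zero_less_one])
    (use assms(3,4) in \<open>unfold singular_relcycle_1, blast\<close>)
qed simp

lemma reverse_path_boundary:
 assumes p: "continuous_map unit_interval X p"
 shows "boundary 1 X (path_chain p + path_chain (\<lambda>u. p (1 - u)))"
proof -
 let ?c = "path_chain (\<lambda>u. u) + path_chain (\<lambda>u. 1 - u :: real)"
 have "contractible_space unit_interval" by (simp add: contractible_space_top_of_set convex_imp_contractible)
 moreover have "chain 1 unit_interval ?c"
  by (intro singular_chain_add singular_chain_path_chain) (auto intro!: continuous_intros)
 moreover have "bdry 1 ?c = 0" by (simp only: chain_boundary_add chain_boundary_path_chain) simp
 ultimately have "boundary 1 X (chain_map 1 p ?c)" by (intro contractible_image_boundary[OF _ p])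
 thus ?thesis by (simp only: chain_map_add chain_map_path_chain) (simp add: o_def)
qed

lemma constant_path_boundary:
 assumes "a \<in> topspace X"
 shows "boundary 1 X (path_chain (\<lambda>_. a))"
proof -
 have "boundary 1 X (chain_map 1 (\<lambda>_. a) (path_chain (\<lambda>u. 0 :: real)))"
 proof (rule contractible_image_boundary)
  show "contractible_space unit_interval" by (simp add: contractible_space_top_of_set convex_imp_contractible)
  show "continuous_map unit_interval X (\<lambda>_. a)" using assms by simp
  show "chain 1 unit_interval (path_chain (\<lambda>u. 0))" by (rule singular_chain_path_chain) simp
  show "bdry 1 (path_chain (\<lambda>u. 0::real)) = 0" by (simp only: chain_boundary_path_chain) simp
 qed
 thus ?thesis by (simp only: chain_map_path_chain) (simp add: o_def)
qed

text \<open>\<open>\<gamma> x\<close> is thought of as a path from a base point to x, which closes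
  up the small paths of a subdivided cycle. The added terms depend only on end points, so they
  cancel in a cycle.\<close>

lemma small_paths_generate_cycles:
 fixes \<gamma> :: "'a => 'a chain"
 assumes \<U>: "!!U. U \<in> \<U> ==> openin X U" "topspace X <= \<Union>\<U>"
  and Q: "!!a b. a \<in> Q ==> b \<in> Q ==> a - b \<in> Q" "!!b. boundary 1 X b ==> b \<in> Q"
  and small: "!!U p. U \<in> \<U> ==> continuous_map unit_interval (X on U) p ==> path_chain p + \<gamma> (p 0) - \<gamma> (p 1) \<in> Q"
  and z: "cycle 1 X z"
 shows "z \<in> Q"
proof -
 have zero: "0 \<in> Q" by (rule Q(2)) simp
 have add: "a + b \<in> Q" if "a \<in> Q" "b \<in> Q" for a b using Q(1)[OF that(1) Q(1)[OF zero that(2)]] by simp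
 have sc: "chain 1 X z" using z unfolding singular_relcycle_1 by blast
 obtain n where n: "!!m f. [|n <= m; f \<in> keys ((singular_subdivision 1 ^^ m) z)|] ==> \<exists>V \<in> \<U>. f \<in> (Delta 1) \<rightarrow> V"
  by (rule sufficient_iterated_singular_subdivision_exists[OF \<U> sc]) (assumption, rule that, blast)
 define z' where "z' = (singular_subdivision 1 ^^ n) z"
 have z': "cycle 1 X z'" "homologous 1 X z' z"
  unfolding z'_def by (rule singular_relcycle_subdivision_power[OF z])+
 define S where "S = {f. singular_simplex 1 X f \<and> (\<exists>V\<in>\<U>. f \<in> Delta 1 \<rightarrow> V)}"
 \<comment> \<open>Linear extension of \<open>\<gamma>\<close> to 0-simplices, evaluated at the
   single point of the standard 0-simplex. It vanishes on the boundary of a cycle.\<close>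
 define \<Gamma> where "\<Gamma> = frag_extend (\<lambda>w :: (nat => real) => 'a. \<gamma> (w (\<lambda>i. if i = 0 then 1 else 0)))"
 have pt: "\<Gamma> (frag_of (point_simplex a)) = \<gamma> a" for a by (simp add: \<Gamma>_def point_simplex_def standard_simplex_0)
 have "keys z' <= S" using n[OF order_refl] z'(1) unfolding S_def z'_def[symmetric]
  unfolding singular_relcycle_1 singular_chain_def by blast
 hence "z' - \<Gamma> (bdry 1 z') \<in> Q"
 proof (induction z' rule: frag_induction)
  case zero
  thus ?case using \<open>0 \<in> Q\<close> by (simp add: \<Gamma>_def)
 next
  case (one f)
  then obtain V where f: "singular_simplex 1 X f" "V \<in> \<U>" "f \<in> Delta 1 \<rightarrow> V" unfolding S_def by blast
  have "singular_simplex 1 (X on V) f" using f(1,3) by (auto simp: singular_simplex_subtopology)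
  then obtain p where p: "continuous_map unit_interval (X on V) p" "f = path_simplex p"
   by (rule singular_simplex_1_cases)
  have "\<Gamma> (bdry 1 (frag_of f)) = \<gamma> (p 1) - \<gamma> (p 0)"
   unfolding p(2) chain_boundary_path_chain using pt[of "p 1"] pt[of "p 0"] by (simp add: \<Gamma>_def frag_extend_diff)
  moreover have "path_chain p - (\<gamma> (p 1) - \<gamma> (p 0)) = path_chain p + \<gamma> (p 0) - \<gamma> (p 1)" by simp
  ultimately show ?case using small[OF f(2) p(1)] p(2) by (simp only:)
 next
  case (diff a b)
  have "\<Gamma> (bdry 1 (a - b)) = \<Gamma> (bdry 1 a) - \<Gamma> (bdry 1 b)"
   unfolding chain_boundary_diff by (simp add: \<Gamma>_def frag_extend_diff)
  moreover have "a - b - (\<Gamma> (bdry 1 a) - \<Gamma> (bdry 1 b)) = (a - \<Gamma> (bdry 1 a)) - (b - \<Gamma> (bdry 1 b))" by simp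
  ultimately show ?case using Q(1)[OF diff] by (simp only:)
 qed
 hence "z' \<in> Q" using z'(1) unfolding singular_relcycle_1 by (simp add: \<Gamma>_def)
 moreover have "z' - z \<in> Q" using z'(2) Q(2) by (simp add: homologous_rel_def)
 ultimately show ?thesis using Q(1)[of z' "z' - z"] by simp
qed

lemma homologous_rel_iff: "homologous_rel p X S a b \<longleftrightarrow> relboundary p X S (a - b)"
 by (simp add: homologous_rel_def)

text \<open>A universal covering by a vector space with the lattice as deck group, reduced to what
  computing the first homology needs: path lifting and a description of the fibres.\<close>

locale lattice_covering =
 fixes X :: "'a topology" and e :: "'e::real_normed_vector => 'a" and \<Lambda> :: "'e set"
 assumes e: "continuous_map euclidean X e"
  and lift: "!!p. continuous_map unit_interval X p ==> \<exists>\<phi>. continuous_on {0..1} \<phi> \<and> (\<forall>u\<in>{0..1}. e (\<phi> u) = p u)"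
  and diff: "!!a b. a \<in> \<Lambda> ==> b \<in> \<Lambda> ==> a - b \<in> \<Lambda>" and zero: "0 \<in> \<Lambda>"
  and period: "!!x a. a \<in> \<Lambda> ==> e (x + a) = e x"
  and fibre: "!!x y. e x = e y ==> y - x \<in> \<Lambda>"
begin

definition seg :: "'e => 'e => real => 'e" where "seg a b u = a + u *\<^sub>R (b - a)"

definition loop :: "'e => 'a chain" where "loop a = path_chain (\<lambda>u. e (u *\<^sub>R a))"

lemma push_boundary:
 assumes "chain 1 euclidean c" "bdry 1 c = 0"
 shows "boundary 1 X (chain_map 1 e c)"
proof (rule contractible_image_boundary[OF _ e assms])
 have "contractible (UNIV :: 'e set)" by (rule convex_imp_contractible) simp
 thus "contractible_space (euclidean :: 'e topology)"
  using contractible_space_top_of_set[of "UNIV :: 'e set"] by simp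
qed

lemma seg_chain: "chain 1 euclidean (path_chain (seg a b))"
 by (rule singular_chain_path_chain) (auto simp: seg_def[abs_def] intro!: continuous_intros)

lemma seg_boundary:
 "bdry 1 (path_chain (seg a b)) = frag_of (point_simplex b) - frag_of (point_simplex a)"
 by (simp only: chain_boundary_path_chain) (simp add: seg_def)

lemma push_seg: "a \<in> \<Lambda> ==> chain_map 1 e (path_chain (seg a (a + b))) = loop b"
 unfolding chain_map_path_chain loop_def using period[of a]
 by (simp add: seg_def[abs_def] o_def add.commute[of a])

lemma loop_chain: "chain 1 X (loop a)"
proof -
 have "continuous_map unit_interval X (e \<circ> (\<lambda>u. u *\<^sub>R a))"
  by (rule continuous_map_compose[OF _ e]) (auto intro!: continuous_intros)
 thus ?thesis unfolding loop_def by (intro singular_chain_path_chain) (simp add: o_def)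
qed

lemma loop_cycle: "a \<in> \<Lambda> ==> cycle 1 X (loop a)" unfolding singular_relcycle_1
 using loop_chain[of a] period[of a 0] by (simp add: loop_def chain_boundary_path_chain[unfolded One_nat_def])

lemma loop_add:
 assumes "a \<in> \<Lambda>"
 shows "homologous 1 X (loop (a + b)) (loop a + loop b)"
proof -
 let ?c = "path_chain (seg 0 (0 + (a + b))) - (path_chain (seg 0 (0 + a)) + path_chain (seg a (a + b)))"
 have "boundary 1 X (chain_map 1 e ?c)"
 proof (rule push_boundary)
  show "chain 1 euclidean ?c" by (intro singular_chain_diff singular_chain_add seg_chain)
  show "bdry 1 ?c = 0" by (simp only: chain_boundary_diff chain_boundary_add seg_boundary) simp
 qed
 thus ?thesis
  unfolding homologous_rel_iff chain_map_diff chain_map_add push_seg[OF zero] push_seg[OF assms] .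
qed

lemma loop_mult:
 assumes a: "a \<in> \<Lambda>"
 shows "homologous 1 X (loop (of_int n *\<^sub>R a)) (n *. (loop a))" unfolding homologous_rel_iff
proof (induction n rule: int_induct[where k = 0])
 case base
 show ?case using loop_add[OF zero, of 0] unfolding homologous_rel_iff
  by (simp add: singular_relboundary_minus[of _ _ _ "loop 0", unfolded One_nat_def])
next
 case (step1 i)
 have 1: "of_int (i + 1) *\<^sub>R a = a + of_int i *\<^sub>R a" by (simp add: scaleR_add_left)
 have "(i + 1) *. (loop a) = loop a + i *. (loop a)" by (simp add: frag_cmul_distrib)
 hence "loop (of_int (i + 1) *\<^sub>R a) - (i + 1) *. (loop a) =
   loop (a + of_int i *\<^sub>R a) - (loop a + loop (of_int i *\<^sub>R a)) + (loop (of_int i *\<^sub>R a) - i *. (loop a))"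
  unfolding 1 by simp
 thus ?case
  using singular_relboundary_add[OF loop_add[OF a, unfolded homologous_rel_iff] step1(2)] by (simp only:)
next
 case (step2 i)
 have 1: "of_int i *\<^sub>R a = a + of_int (i - 1) *\<^sub>R a" by (simp add: scaleR_diff_left)
 have "(i - 1) *. (loop a) = i *. (loop a) - loop a" by (simp add: frag_cmul_diff_distrib)
 hence "loop (of_int (i - 1) *\<^sub>R a) - (i - 1) *. (loop a) = (loop (of_int i *\<^sub>R a) - i *. (loop a)) -
   (loop (a + of_int (i - 1) *\<^sub>R a) - (loop a + loop (of_int (i - 1) *\<^sub>R a)))" unfolding 1 by simp
 thus ?case
  using singular_relboundary_diff[OF step2(2) loop_add[OF a, unfolded homologous_rel_iff]] by (simp only:)
qed

text \<open>\<open>loop (r x)\<close> is a path from \<open>e 0\<close> to x, where r picks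
  preimages; it closes up an arbitrary path. The closed result lifts to a path whose ends are
  compared by lattice vectors.\<close>

lemma cycle_homologous_loop:
 assumes z: "cycle 1 X z"
 shows "\<exists>a\<in>\<Lambda>. homologous 1 X z (loop a)"
proof -
 define Q where "Q = {c. \<exists>a\<in>\<Lambda>. homologous 1 X c (loop a)}"
 define r where "r x = (SOME y. e y = x)" for x
 have r: "e (r (e y)) = e y" for y unfolding r_def by (rule someI) simp
 have Q1: "c - d \<in> Q" if cd: "c \<in> Q" "d \<in> Q" for c d
 proof -
  obtain a b where ab: "a \<in> \<Lambda>" "b \<in> \<Lambda>" "homologous 1 X c (loop a)" "homologous 1 X d (loop b)"
   using cd unfolding Q_def by blast
  have "boundary 1 X (((c - loop a) - (d - loop b)) + (loop (b + (a - b)) - (loop b + loop (a - b))))"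
   by (rule singular_relboundary_add[OF singular_relboundary_diff[OF ab(3,4)[unfolded homologous_rel_iff]]
     loop_add[OF ab(2), of "a - b", unfolded homologous_rel_iff]])
  hence "homologous 1 X (c - d) (loop (a - b))" unfolding homologous_rel_iff by (simp add: algebra_simps)
  thus ?thesis using diff[OF ab(1,2)] unfolding Q_def by blast
 qed
 have Q2: "b \<in> Q" if "boundary 1 X b" for b
 proof -
  have "homologous 1 X (loop 0) (0 *. (loop 0))" using loop_mult[OF zero, of 0] by simp
  hence "homologous 1 X b (loop 0)"
   using that singular_relboundary_diff[OF that, of "loop 0"] unfolding homologous_rel_iff by simp
  thus ?thesis using zero unfolding Q_def by blast
 qed
 have "z \<in> Q"
 proof (rule small_paths_generate_cycles[of "{topspace X}", OF _ _ Q1 Q2 _ z])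
  fix U p assume "U \<in> {topspace X}" "continuous_map unit_interval (X on U) p"
  hence "continuous_map unit_interval X p" by simp
  then obtain \<phi> where \<phi>: "continuous_on {0..1} \<phi>" "!!u. u \<in> {0..1} ==> e (\<phi> u) = p u" using lift by blast
  \<comment> \<open>\<open>m0\<close> and \<open>m1\<close> are the lattice vectors by which the
    ends of the lift differ from the chosen preimages. The four paths in ?c form a closed polygon in
    the vector space, hence a boundary, and projecting it gives the relation.\<close>
  define m0 where "m0 = \<phi> 0 - r (p 0)"
  define m1 where "m1 = \<phi> 1 - r (p 1)"
  have m: "m0 \<in> \<Lambda>" "m1 \<in> \<Lambda>" using fibre[of "r (p 0)" "\<phi> 0"] fibre[of "r (p 1)" "\<phi> 1"] r \<phi>(2)
   unfolding m0_def m1_def by (metis atLeastAtMost_iff order_refl zero_le_one)+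
  let ?c = "path_chain \<phi> + path_chain (seg m0 (m0 + r (p 0))) - path_chain (seg m1 (m1 + r (p 1))) - path_chain (seg m0 (m0 + (m1 - m0)))"
  have "boundary 1 X (chain_map 1 e ?c)"
  proof (rule push_boundary)
   show "chain 1 euclidean ?c"
    using \<phi>(1) by (intro singular_chain_diff singular_chain_add seg_chain singular_chain_path_chain) simp
   show "bdry 1 ?c = 0"
    by (simp only: chain_boundary_diff chain_boundary_add seg_boundary chain_boundary_path_chain)
      (simp add: m0_def m1_def seg_def)
  qed
  moreover have "path_simplex (e \<circ> \<phi>) = path_simplex p" by (rule path_simplex_cong) (simp add: \<phi>(2))
  ultimately have "homologous 1 X (path_chain p + loop (r (p 0)) - loop (r (p 1))) (loop (m1 - m0))"
   by (simp only: chain_map_diff chain_map_add push_seg[OF m(1)] push_seg[OF m(2)] homologous_rel_iff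
     chain_map_path_chain[of e \<phi>])
  thus "path_chain p + loop (r (p 0)) - loop (r (p 1)) \<in> Q" using diff[OF m(2,1)] unfolding Q_def by blast
 qed auto
 thus ?thesis unfolding Q_def by blast
qed

end

section \<open>The circle and winding numbers\<close>

definition circ :: "real => complex" where "circ t = cis (2 * pi * t)"

abbreviation unit_circle :: "complex topology" where "unit_circle \<equiv> top_of_set (sphere 0 1)"

lemma circ_eq_exp: "circ t = exp (of_real (2 * pi * t) * \<i>)" by (simp add: circ_def cis_conv_exp mult.commute)

lemma continuous_circ: "continuous_on S circ" unfolding circ_eq_exp[abs_def] by (intro continuous_intros)

lemma continuous_on_circ [continuous_intros]: "continuous_on S f ==> continuous_on S (\<lambda>x. circ (f x))"
 unfolding circ_eq_exp by (intro continuous_intros)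

lemma norm_circ [simp]: "norm (circ t) = 1" by (simp add: circ_def)

lemma circ_add: "circ (s + t) = circ s * circ t" by (simp add: circ_def cis_mult distrib_left)

lemma circ_eq_iff: "circ s = circ t \<longleftrightarrow> t - s \<in> \<int>"
proof
 assume "circ s = circ t"
 then obtain n :: int where "2 * pi * s = 2 * pi * t + 2 * pi * of_int n"
  unfolding circ_def cis_conv_exp exp_eq by (auto simp: complex_eq_iff)
 hence "2 * pi * (t - s) = 2 * pi * of_int (- n)" by (simp add: algebra_simps)
 hence "t - s = of_int (- n)" by (simp only: mult_cancel_left) simp
 thus "t - s \<in> \<int>" by simp
next
 assume "t - s \<in> \<int>"
 then obtain n where "t - s = of_int n" by (auto elim: Ints_cases)
 hence "t = s + of_int n" by simp
 moreover have "circ (of_int n) = 1" by (simp add: circ_def cis_multiple_2pi)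
 ultimately show "circ s = circ t" by (simp add: circ_add)
qed

lemma circ_of_int [simp]: "circ (of_int n) = 1" "circ 0 = 1" "circ 1 = 1"
 by (simp_all add: circ_def cis_multiple_2pi)

lemma circ_surj:
 assumes "norm z = 1"
 obtains t where "0 <= t" "t < 1" "z = circ t"
proof -
 obtain s where s: "0 <= s" "s < 2 * pi" "z = cis s" using assms by (metis complex_unimodular_polar cis.ctr)
 thus thesis using that[of "s / (2 * pi)"] by (simp add: circ_def)
qed

lemma circle_path_lift:
 assumes "continuous_map unit_interval unit_circle p"
 shows "\<exists>\<phi>. continuous_on {0..1} \<phi> \<and> (\<forall>u\<in>{0..1}. circ (\<phi> u) = p u)"
proof -
 have p: "continuous_on {0..1} p" "!!u. u \<in> {0..1} ==> norm (p u) = 1"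
  using assms by (auto simp: continuous_map_in_subtopology)
 have nz: "p u ~= 0" if "u \<in> {0..1}" for u using p(2)[OF that] by auto
 have ct: "contractible {0..1::real}" by (rule convex_imp_contractible) simp
 obtain g where g: "continuous_on {0..1} g" "!!u. u \<in> {0..1} ==> p u = exp (g u)"
  by (rule continuous_logarithm_on_contractible[OF p(1) ct nz]) (assumption, rule that, assumption+)
 have "circ (Im (g u) / (2 * pi)) = p u" if u: "u \<in> {0..1}" for u
 proof -
  have "Re (g u) = 0" using p(2)[OF u] g(2)[OF u] by (simp add: norm_exp_eq_Re)
  hence "g u = of_real (Im (g u)) * \<i>" by (simp add: complex_eq_iff)
  thus ?thesis using g(2)[OF u] by (simp add: circ_eq_exp)
 qed
 moreover have "continuous_on {0..1} (\<lambda>u. Im (g u) / (2 * pi))" using g(1) by (intro continuous_intros) auto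
 ultimately show ?thesis by blast
qed

interpretation circle: lattice_covering unit_circle circ "\<int> :: real set"
proof
 show "continuous_map euclidean unit_circle circ" by (auto simp: continuous_map_in_subtopology continuous_circ)
qed (use circle_path_lift in \<open>auto simp: circ_eq_iff\<close>)

definition circle_loop :: "complex chain" where "circle_loop = path_chain circ"

lemma circle_loop_cycle: "cycle 1 unit_circle circle_loop"
 using circle.loop_cycle[of 1] by (simp add: circle_loop_def circle.loop_def)

text \<open>The coordinate given by an abstract isomorphism with the integers takes the value 1 or
  -1 on \<open>circle_loop\<close>, because every cycle is homologous to a multiple of that loop;
  multiplying by this sign normalises it.\<close>

lemma winding_functional:
 obtains w :: "complex chain => int" where
  "!!a b. cycle 1 unit_circle a ==> cycle 1 unit_circle b ==> w (a + b) = w a + w b"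
  "!!n a. cycle 1 unit_circle a ==> w (n *. a) = n * w a"
  "!!a b. cycle 1 unit_circle a ==> cycle 1 unit_circle b ==> homologous 1 unit_circle a b ==> w a = w b"
  "w circle_loop = 1"
proof -
 have "homology_group (int 1) unit_circle \<cong> integer_group" using homology_group_circle(1)[of 0] by simp
 hence iso: "homology_group (int 1) unit_circle \<cong> free_Abelian_group {()}"
  by (rule iso_trans[OF _ isomorphic_group_integer_free_Abelian_group_singleton])
 obtain \<Phi> where "homology_coordinates 1 unit_circle {()} \<Phi>" by (rule homology_coordinates_exist[OF iso])
 then interpret H: homology_coordinates 1 unit_circle "{()}" \<Phi> .
 note \<Phi> = H.add H.eq H.keys H.surj H.cmul
 define v where "v a = lookup (\<Phi> a) ()" for a
 obtain a where a: "cycle 1 unit_circle a" "\<Phi> a = frag_of ()" using \<Phi>(4)[of "frag_of ()"] by auto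
 obtain b where b: "b \<in> \<int>" "homologous 1 unit_circle a (circle.loop b)"
  using circle.cycle_homologous_loop[OF a(1)] by blast
 obtain n where n: "b = of_int n" using b(1) by (auto elim: Ints_cases)
 have "homologous 1 unit_circle (circle.loop b) (n *. circle_loop)"
  using circle.loop_mult[of 1 n] n by (simp add: circle_loop_def circle.loop_def)
 from homologous_rel_trans[OF this b(2)] have "homologous 1 unit_circle a (n *. circle_loop)" .
 hence "\<Phi> a = \<Phi> (n *. circle_loop)"
  using \<Phi>(2)[OF a(1) singular_relcycle_cmul[OF circle_loop_cycle]] by blast
 hence "frag_of () = n *. (\<Phi> circle_loop)" using a(2) \<Phi>(5)[OF circle_loop_cycle] by simp
 hence "lookup (frag_of ()) () = lookup (n *. (\<Phi> circle_loop)) ()" by (rule arg_cong)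
 hence "1 = n * v circle_loop" unfolding v_def by simp
 hence vv: "v circle_loop * v circle_loop = 1" by (metis zmult_eq_1_iff mult.commute)
 show thesis
 proof (rule that[of "\<lambda>a. v circle_loop * v a"])
  show "v circle_loop * v (a + b) = v circle_loop * v a + v circle_loop * v b"
   if "cycle 1 unit_circle a" "cycle 1 unit_circle b" for a b
   using \<Phi>(1)[OF that] by (simp add: v_def lookup_add distrib_left)
  show "v circle_loop * v (n *. a) = n * (v circle_loop * v a)" if "cycle 1 unit_circle a" for n a
   using \<Phi>(5)[OF that] by (simp add: v_def)
  show "v circle_loop * v a = v circle_loop * v b" if "cycle 1 unit_circle a" "cycle 1 unit_circle b"
   "homologous 1 unit_circle a b" for a b using \<Phi>(2)[OF that(1,2)] that(3) by (simp add: v_def)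
 qed (fact vv)
qed

lemma circle_loop_or_constant:
 "homologous 1 unit_circle (path_chain (\<lambda>u. if b then circ u else 1)) ((if b then 1 else 0) *. circle_loop)"
 using constant_path_boundary[of 1 unit_circle] unfolding homologous_rel_iff by (simp add: circle_loop_def)

text \<open>The winding numbers of the maps \<open>g i\<close> along the cycles \<open>z j\<close>
  form the identity matrix, so the coefficients of a combination can be recovered; with generation
  this makes the classes a basis.\<close>

lemma homology_group_winding_basis:
 assumes J: "finite J" and z: "!!j. j \<in> J ==> cycle 1 X (z j)"
  and g: "!!i. continuous_map X unit_circle (g i)"
  and gz: "!!i j. i \<in> J ==> j \<in> J ==>
   homologous 1 unit_circle (chain_map 1 (g i) (z j)) ((if i = j then 1 else 0) *. circle_loop)"
  and gen: "!!c. cycle 1 X c ==> \<exists>n. homologous 1 X c (\<Sum>j\<in>J. (n j) *. (z j))"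
 shows "homology_group 1 X \<cong> free_Abelian_group J"
proof -
 obtain w :: "complex chain => int" where w:
  "!!a b. cycle 1 unit_circle a ==> cycle 1 unit_circle b ==> w (a + b) = w a + w b"
  "!!n a. cycle 1 unit_circle a ==> w (n *. a) = n * w a"
  "!!a b. cycle 1 unit_circle a ==> cycle 1 unit_circle b ==> homologous 1 unit_circle a b ==> w a = w b"
  "w circle_loop = 1" by (rule winding_functional) (rule that, assumption+)
 define W where "W c i = w (chain_map 1 (g i) c)" for c i
 have gc: "cycle 1 unit_circle (chain_map 1 (g i) c)" if "cycle 1 X c" for i c
  by (rule singular_relcycle_chain_map[OF that g]) simp
 have W_add: "W (a + b) i = W a i + W b i" if "cycle 1 X a" "cycle 1 X b" for a b i
  unfolding W_def chain_map_add by (rule w(1)[OF gc[OF that(1)] gc[OF that(2)]])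
 have W_cmul: "W (n *. a) i = n * W a i" if "cycle 1 X a" for n a i
  unfolding W_def chain_map_cmul by (rule w(2)[OF gc[OF that]])
 have W_eq: "W a i = W b i"
  if "cycle 1 X a" "cycle 1 X b" "homologous 1 X a b" for a b i unfolding W_def
  by (rule w(3)[OF gc[OF that(1)] gc[OF that(2)]])
    (use singular_relboundary_chain_map[OF that(3)[unfolded homologous_rel_iff] g, of i "{}"]
    in \<open>simp add: homologous_rel_iff chain_map_diff\<close>)
 have W_z: "W (z j) i = (if i = j then 1 else 0)" if "i \<in> J" "j \<in> J" for i j
  unfolding W_def w(3)[OF gc[OF z[OF that(2)]] singular_relcycle_cmul[OF circle_loop_cycle] gz[OF that]]
   w(2)[OF circle_loop_cycle] w(4) by simp
 let ?H = "homology_group (int 1) X" and ?F = "free_Abelian_group J"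
 define L where "L x = (\<Sum>j\<in>J. (lookup x j) *. (z j))" for x
 have cyc_sum: "cycle 1 X (\<Sum>j\<in>I. (n j) *. (z j)) \<and>
   W (\<Sum>j\<in>I. (n j) *. (z j)) i = (\<Sum>j\<in>I. n j * W (z j) i)" if "I <= J" for I n i
  using finite_subset[OF that J] that
 proof (induction I rule: finite_induct)
  case empty
  have "W (0 *. 0) i = 0 * W 0 i" by (rule W_cmul) simp
  thus ?case by simp
 next
  case (insert j I)
  thus ?case using W_add W_cmul z[of j] by (simp add: singular_relcycle_add singular_relcycle_cmul)
 qed
 have L_cyc: "cycle 1 X (L x)" for x unfolding L_def using cyc_sum[of J] by blast
 have L_W: "W (L x) i = lookup x i" if "i \<in> J" for x i
 proof -
  have "W (L x) i = (\<Sum>j\<in>J. lookup x j * (if i = j then 1 else 0))"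
   unfolding L_def using cyc_sum[of J "lookup x" i] W_z[OF that] by simp
  also have "... = (\<Sum>j\<in>J. if i = j then lookup x j else 0)" by (rule sum.cong) auto
  finally show ?thesis using J that by simp
 qed
 have carr: "carrier ?H = homologous_rel_set 1 X {} ` {c. cycle 1 X c}"
  by (simp only: carrier_relative_homology_group)
 have mult: "homologous_rel_set 1 X {} a \<otimes>\<^bsub>?H\<^esub> homologous_rel_set 1 X {} b = homologous_rel_set 1 X {} (a + b)"
  if "cycle 1 X a" "cycle 1 X b" for a b using homologous_rel_set_add[OF that] by simp
 define f where "f x = homologous_rel_set 1 X {} (L x)" for x
 have "f \<in> hom ?F ?H"
 proof (rule homI)
  show "f x \<in> carrier ?H" for x unfolding f_def carr using L_cyc by blast
  show "f (x \<otimes>\<^bsub>?F\<^esub> y) = f x \<otimes>\<^bsub>?H\<^esub> f y" for x y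
  proof -
   have "L (x + y) = L x + L y" unfolding L_def by (simp add: lookup_add frag_cmul_distrib sum.distrib)
   thus ?thesis unfolding f_def mult[OF L_cyc L_cyc] by simp
  qed
 qed
 moreover have "bij_betw f (carrier ?F) (carrier ?H)" unfolding bij_betw_def
 proof
  show "inj_on f (carrier ?F)"
  proof (rule inj_onI)
   fix x y assume xy: "x \<in> carrier ?F" "y \<in> carrier ?F" "f x = f y"
   hence "homologous 1 X (L x) (L y)" unfolding f_def by (simp add: homologous_rel_set_eq)
   hence "W (L x) i = W (L y) i" for i by (rule W_eq[OF L_cyc L_cyc])
   hence "lookup x i = lookup y i" if "i \<in> J" for i using L_W[OF that] by metis
   moreover have "lookup x i = lookup y i" if "i \<notin> J" for i
    using xy(1,2) that by (auto simp: in_keys_iff subset_iff) (metis+)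
   ultimately show "x = y" by (intro poly_mapping_eqI) blast
  qed
  show "f ` carrier ?F = carrier ?H"
  proof
   show "f ` carrier ?F <= carrier ?H" unfolding f_def carr using L_cyc by blast
   show "carrier ?H <= f ` carrier ?F"
   proof
    fix h assume "h \<in> carrier ?H"
    then obtain c where c: "cycle 1 X c" "h = homologous_rel_set 1 X {} c" unfolding carr by blast
    obtain n where n: "homologous 1 X c (\<Sum>j\<in>J. (n j) *. (z j))" using gen[OF c(1)] by blast
    define x where "x = (\<Sum>j\<in>J. (n j) *. (frag_of j))"
    have lx: "lookup x i = (if i \<in> J then n i else 0)" for i
    proof -
     have "lookup x i = (\<Sum>j\<in>J. if i = j then n j else 0)"
      unfolding x_def by (auto simp: lookup_sum intro!: sum.cong)
     thus ?thesis using J by simp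
    qed
    have "x \<in> carrier ?F" using lx by (auto simp: in_keys_iff split: if_splits)
    moreover have "L x = (\<Sum>j\<in>J. (n j) *. (z j))" unfolding L_def lx by (rule sum.cong) auto
    hence "f x = h" unfolding f_def c(2) using n by (simp add: homologous_rel_set_eq homologous_rel_sym)
    ultimately show "h \<in> f ` carrier ?F" by blast
   qed
  qed
 qed
 ultimately have "?F \<cong> ?H" by (auto simp: is_iso_def iso_def)
 hence "?H \<cong> ?F" by (rule group.iso_sym[OF group_free_Abelian_group])
 thus ?thesis by simp
qed

section \<open>Cyclic actions on a torus\<close>

lemma holomorphic_map_cong:
 assumes A: "complex_atlas X A" and f: "holomorphic_map X A Y B f" and fg: "!!x. x \<in> topspace X ==> g x = f x"
 shows "holomorphic_map X A Y B g"
proof -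
 have "(\<psi> \<circ> g \<circ> inv_into U \<phi>) holomorphic_on \<phi> ` {x \<in> U. g x \<in> V}"
  if U: "(U, \<phi>) \<in> A" and V: "(V, \<psi>) \<in> B" for U \<phi> V \<psi>
 proof -
  have sub: "U <= topspace X" by (rule complex_atlasD(4)[OF A U])
  hence S: "{x \<in> U. g x \<in> V} = {x \<in> U. f x \<in> V}" using fg by auto
  have "(\<psi> \<circ> f \<circ> inv_into U \<phi>) holomorphic_on \<phi> ` {x \<in> U. f x \<in> V}"
   using f U V unfolding holomorphic_map_def by blast
  moreover have "(\<psi> \<circ> f \<circ> inv_into U \<phi>) w = (\<psi> \<circ> g \<circ> inv_into U \<phi>) w" if "w \<in> \<phi> ` {x \<in> U. f x \<in> V}" for w
  proof -
   have "inv_into U \<phi> w \<in> topspace X" using that sub by (auto simp: inv_into_into)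
   thus ?thesis using fg by simp
  qed
  ultimately show ?thesis unfolding S by (rule holomorphic_transform)
 qed
 moreover have "continuous_map X Y g"
  using f fg unfolding holomorphic_map_def by (auto intro: continuous_map_eq)
 ultimately show ?thesis unfolding holomorphic_map_def by blast
qed

text \<open>R is indexed by all integers and obeys its laws only on X. Restricting the maps to X
  makes them extensional, as elements of the biholomorphism group have to be.\<close>

lemma cyclic_acts_on_surface:
 fixes R :: "int => 'a => 'a"
 assumes A: "complex_atlas X A" and n: "n > 0" and hol: "!!i. holomorphic_map X A X A (R i)"
  and add: "!!i j x. x \<in> topspace X ==> R (i + j) x = R i (R j x)"
  and R0: "!!x. x \<in> topspace X ==> R 0 x = x" and Rn: "!!x. x \<in> topspace X ==> R (int n) x = x"
  and faithful: "!!i. 0 < i ==> i < int n ==> \<exists>x\<in>topspace X. R i x ~= x"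
 shows "acts_on_surface (Zmod n) X A"
proof -
 let ?S = "topspace X" and ?G = "Zmod n" and ?B = "biholomorphism_group X A"
 have in': "R i x \<in> ?S" if "x \<in> ?S" for i x
  using hol[of i] that unfolding holomorphic_map_def by (auto dest: continuous_map_funspace)
 have inv: "R i (R (- i) x) = x" "R (- i) (R i x) = x" if "x \<in> ?S" for i x
  using add[OF that, of i "- i"] add[OF that, of "- i" i] R0[OF that] by simp_all
 define \<psi> where "\<psi> i = restrict (R i) ?S" for i
 have bij: "bij_betw (\<psi> i) ?S ?S" for i by (rule bij_betwI[of _ _ _ "R (- i)"]) (auto simp: \<psi>_def in' inv)
 have Bij: "\<psi> i \<in> Bij ?S" for i using bij by (simp add: Bij_def \<psi>_def)
 have invf: "inv_into ?S (\<psi> i) x = R (- i) x" if "x \<in> ?S" for i x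
  using bij[of i] that in'[OF that, of "- i"] inv(1)[OF that, of i]
  by (intro inv_into_f_eq) (auto simp: \<psi>_def bij_betw_def)
 have carr: "\<psi> i \<in> carrier ?B" for i unfolding biholomorphism_group_def
  using Bij[of i] holomorphic_map_cong[OF A hol[of i], of "\<psi> i"]
   holomorphic_map_cong[OF A hol[of "- i"], of "inv_into ?S (\<psi> i)"] invf by (auto simp: \<psi>_def)
 have per: "R (int n * k) x = x" if x: "x \<in> ?S" for k x
 proof -
  have nat: "R (int n * int m) x = x" if "x \<in> ?S" for m x
  proof (induction m)
   case (Suc m)
   have "R (int n * int (Suc m)) x = R (int n) (R (int n * int m) x)"
    using add[OF that, of "int n" "int n * int m"] by (simp add: distrib_left)
   thus ?case using Suc Rn that by simp
  qed (simp add: R0 that)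
  show ?thesis
  proof (cases "k \<ge> 0")
   case True
   thus ?thesis using nat[OF x, of "nat k"] by simp
  next
   case False
   thus ?thesis using nat[OF x, of "nat (- k)"] inv(1)[OF x, of "int n * k"] by simp
  qed
 qed
 have mod: "R (i mod int n) x = R i x" if "x \<in> ?S" for i x
  using add[OF that, of "i mod int n" "int n * (i div int n)"] per[OF that] by simp
 have "\<psi> \<in> hom ?G ?B"
 proof (rule homI)
  show "\<psi> (i \<otimes>\<^bsub>?G\<^esub> j) = \<psi> i \<otimes>\<^bsub>?B\<^esub> \<psi> j" if "i \<in> carrier ?G" "j \<in> carrier ?G" for i j
  proof -
   have "\<psi> ((i + j) mod int n) = compose ?S (\<psi> i) (\<psi> j)"
    by (auto simp: \<psi>_def compose_def mod add in' fun_eq_iff)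
   thus ?thesis using Bij by (simp add: mult_integer_mod_group biholomorphism_group_def BijGroup_def)
  qed
 qed (rule carr)
 moreover have "inj_on \<psi> (carrier ?G)"
 proof (rule inj_onI)
  fix i j assume ij: "i \<in> carrier ?G" "j \<in> carrier ?G" "\<psi> i = \<psi> j"
  hence r: "0 <= i" "i < int n" "0 <= j" "j < int n" using n by (auto simp: carrier_integer_mod_group)
  have eq: "R i x = R j x" if "x \<in> ?S" for x using fun_cong[OF ij(3), of x] that by (simp add: \<psi>_def)
  have "R (i - j) x = x" "R (j - i) x = x" if "x \<in> ?S" for x
  proof -
   have x': "R (- j) x \<in> ?S" "R (- i) x \<in> ?S" using in' that by blast+
   show "R (i - j) x = x" using add[OF that, of i "- j"] eq[OF x'(1)] inv(1)[OF that, of j] by simp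
   show "R (j - i) x = x" using add[OF that, of j "- i"] eq[OF x'(2)] inv(1)[OF that, of i] by simp
  qed
  hence "\<not> (0 < i - j)" "\<not> (0 < j - i)" using faithful[of "i - j"] faithful[of "j - i"] r by force+
  thus "i = j" by simp
 qed
 ultimately show ?thesis unfolding acts_on_surface_def mon_def by blast
qed

section \<open>The square torus\<close>

lemma holomorphic_on_local_translation:
 assumes "!!z. z \<in> S ==> \<exists>d>0. \<exists>c. \<forall>w\<in>S \<inter> ball z d. f w = w + c"
 shows "f holomorphic_on S" unfolding holomorphic_on_def
proof
 fix z assume z: "z \<in> S"
 then obtain d c where d: "d > 0" "!!w. w \<in> S ==> dist w z < d ==> w + c = f w"
  using assms[OF z] by (auto simp: dist_commute)
 have "(\<lambda>w. w + c) field_differentiable (at z within S)" by (intro derivative_intros)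
 from field_differentiable_transform_within[OF d(1) z d(2) this] show "f field_differentiable (at z within S)" .
qed

text \<open>The torus of the Gaussian integers as a product of two circles, with the real and
  imaginary parts as angles.\<close>

definition torus_map :: "complex => complex \<times> complex" where
 "torus_map z = (circ (Re z), circ (Im z))"

definition torus :: "(complex \<times> complex) topology" where
 "torus = top_of_set (sphere 0 1 \<times> sphere 0 1)"

definition gaussian_integers :: "complex set" where
 "gaussian_integers = {z. Re z \<in> \<int> \<and> Im z \<in> \<int>}"

lemma torus_map_eq_iff: "torus_map z = torus_map w \<longleftrightarrow> w - z \<in> gaussian_integers"
 by (simp add: torus_map_def circ_eq_iff gaussian_integers_def)

lemma continuous_torus_map: "continuous_on S torus_map" unfolding torus_map_def by (intro continuous_intros)

lemma torus_map_surj: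
 assumes "x \<in> topspace torus"
 obtains z where "0 <= Re z" "Re z <= 1" "0 <= Im z" "Im z <= 1" "torus_map z = x"
proof -
 obtain a b where x: "x = (a, b)" "norm a = 1" "norm b = 1" using assms by (auto simp: torus_def)
 obtain s where s: "0 <= s" "s < 1" "a = circ s" by (rule circ_surj[OF x(2)])
 obtain t where t: "0 <= t" "t < 1" "b = circ t" by (rule circ_surj[OF x(3)])
 show thesis using that[of "Complex s t"] s t x by (simp add: torus_map_def)
qed

lemma topspace_torus: "topspace torus = range torus_map"
proof
 show "topspace torus <= range torus_map" by (blast elim: torus_map_surj)
qed (auto simp: torus_def torus_map_def)

lemma continuous_map_torus_map: "continuous_map euclidean torus torus_map"
 unfolding torus_def continuous_map_in_subtopology using continuous_torus_map by (auto simp: torus_map_def)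

interpretation torus: lattice_covering torus torus_map gaussian_integers
proof
 show "\<exists>\<phi>. continuous_on {0..1} \<phi> \<and> (\<forall>u\<in>{0..1}. torus_map (\<phi> u) = p u)" if p: "continuous_map unit_interval torus p" for p
 proof -
  have "continuous_on {0..1} p" "p \<in> {0..1} \<rightarrow> sphere 0 1 \<times> sphere 0 1"
   using p unfolding torus_def continuous_map_in_subtopology by auto
  hence "continuous_map unit_interval unit_circle (fst \<circ> p)" "continuous_map unit_interval unit_circle (snd \<circ> p)"
   unfolding continuous_map_in_subtopology by (auto intro!: continuous_intros simp: o_def Pi_iff mem_Times_iff)
  from this[THEN circle_path_lift] obtain \<phi> \<theta> where
   *: "continuous_on {0..1} \<phi>" "!!u. u \<in> {0..1} ==> circ (\<phi> u) = fst (p u)"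
   "continuous_on {0..1} \<theta>" "!!u. u \<in> {0..1} ==> circ (\<theta> u) = snd (p u)" unfolding o_def by blast
  have "continuous_on {0..1} (\<lambda>u. Complex (\<phi> u) (\<theta> u))" using *(1,3) by (intro continuous_intros)
  moreover have "torus_map (Complex (\<phi> u) (\<theta> u)) = p u" if "u \<in> {0..1}" for u
   using *(2,4)[OF that] by (simp add: torus_map_def)
  ultimately show ?thesis by (intro exI[of _ "\<lambda>u. Complex (\<phi> u) (\<theta> u)"]) blast
 qed
qed (auto simp: continuous_map_torus_map torus_map_eq_iff gaussian_integers_def torus_map_def circ_eq_iff)

lemma has_genus_torus: "has_genus torus 1"
proof -
 define g where "g i = (if i = (0::nat) then fst else snd :: complex \<times> complex => complex)" for i
 define v where "v i = (if i = (0::nat) then 1 else \<i>)" for i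
 have g: "continuous_map torus unit_circle (g i)" for i unfolding torus_def g_def continuous_map_in_subtopology
  by (auto intro!: continuous_intros continuous_map_from_subtopology)
 have vG: "v i \<in> gaussian_integers" for i by (simp add: v_def gaussian_integers_def)
 have "homology_group 1 torus \<cong> free_Abelian_group {0, 1 :: nat}"
 proof (rule homology_group_winding_basis[of _ _ "\<lambda>j. torus.loop (v j)" g])
  show "homologous 1 unit_circle (chain_map 1 (g i) (torus.loop (v j))) ((if i = j then 1 else 0) *. circle_loop)"
   if "i \<in> {0, 1}" "j \<in> {0, 1}" for i j
  proof -
   have "chain_map 1 (g i) (torus.loop (v j)) = path_chain (\<lambda>u. if i = j then circ u else 1)"
    using that unfolding torus.loop_def chain_map_path_chain by (auto simp: o_def g_def v_def torus_map_def)
   thus ?thesis using circle_loop_or_constant by simp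
  qed
  show "\<exists>n. homologous 1 torus c (\<Sum>j\<in>{0, 1}. (n j) *. (torus.loop (v j)))"
   if c: "cycle 1 torus c" for c
  proof -
   obtain a where a: "a \<in> gaussian_integers" "homologous 1 torus c (torus.loop a)"
    using torus.cycle_homologous_loop[OF c] by blast
   obtain m k where mk: "Re a = of_int m" "Im a = of_int k" using a(1) by (auto simp: gaussian_integers_def elim!: Ints_cases)
   have a': "a = of_int m *\<^sub>R v 0 + of_int k *\<^sub>R v 1" using mk by (simp add: complex_eq_iff v_def)
   have m: "of_int m *\<^sub>R v 0 \<in> gaussian_integers" by (simp add: v_def gaussian_integers_def)
   have "boundary 1 torus ((c - torus.loop a) + (torus.loop a - (torus.loop (of_int m *\<^sub>R v 0) + torus.loop (of_int k *\<^sub>R v 1)))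
    + ((torus.loop (of_int m *\<^sub>R v 0) - m *. (torus.loop (v 0))) + (torus.loop (of_int k *\<^sub>R v 1) - k *. (torus.loop (v 1)))))"
    using a(2) torus.loop_add[OF m, of "of_int k *\<^sub>R v 1"] torus.loop_mult[OF vG[of 0], of m] torus.loop_mult[OF vG[of 1], of k]
    unfolding homologous_rel_iff a'[symmetric] by (intro singular_relboundary_add)
   moreover have "(c - torus.loop a) + (torus.loop a - (torus.loop (of_int m *\<^sub>R v 0) + torus.loop (of_int k *\<^sub>R v 1)))
    + ((torus.loop (of_int m *\<^sub>R v 0) - m *. (torus.loop (v 0))) + (torus.loop (of_int k *\<^sub>R v 1) - k *. (torus.loop (v 1))))
    = c - (\<Sum>j\<in>{0, 1}. (if j = 0 then m else k) *. (torus.loop (v j)))" by simp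
   ultimately show ?thesis unfolding homologous_rel_iff by (intro exI[of _ "\<lambda>j. if j = 0 then m else k"]) (simp only:)
  qed
  show "cycle 1 torus (torus.loop (v j))" for j by (rule torus.loop_cycle[OF vG])
 qed (simp_all add: g)
 moreover have "{..<2 * 1} = {0, 1 :: nat}" by auto
 ultimately show ?thesis unfolding has_genus_def by simp
qed

text \<open>W is the union of all lattice translates of B, and K is a compact fundamental square.
  The complement of the image of B is the image of the compact set K - W.\<close>

lemma torus_map_open:
 assumes "open B"
 shows "openin torus (torus_map ` B)"
proof -
 define W where "W = (\<Union>a\<in>gaussian_integers. (\<lambda>w. w + a) ` B)"
 have W: "open W" unfolding W_def using assms by (intro open_UN ballI open_translation_subtract[of B "- _", simplified]) simp
 define K where "K = cbox 0 (Complex 1 1)"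
 have "compact (K - W)" unfolding K_def using W by (intro compact_diff) auto
 hence "compact (torus_map ` (K - W))" by (intro compact_continuous_image continuous_torus_map)
 hence "closed (torus_map ` (K - W))" by (rule compact_imp_closed)
 hence "closedin torus (torus_map ` (K - W))"
  unfolding torus_def by (rule closed_subset[rotated]) (auto simp: torus_map_def)
 hence o: "openin torus (topspace torus - torus_map ` (K - W))" by blast
 have WB: "torus_map z \<in> torus_map ` B \<longleftrightarrow> z \<in> W" for z
 proof
  assume "torus_map z \<in> torus_map ` B"
  then obtain b where b: "b \<in> B" "torus_map b = torus_map z" by auto
  hence "z - b \<in> gaussian_integers" by (simp add: torus_map_eq_iff)
  thus "z \<in> W" unfolding W_def using b(1) by (intro UN_I[of "z - b"] image_eqI[of _ _ b]) simp_all
 next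
  assume "z \<in> W"
  then obtain a b where ab: "a \<in> gaussian_integers" "b \<in> B" "z = b + a" unfolding W_def by blast
  hence "torus_map b = torus_map z" by (simp add: torus_map_eq_iff)
  thus "torus_map z \<in> torus_map ` B" using ab(2) by (metis imageI)
 qed
 have "torus_map ` B = topspace torus - torus_map ` (K - W)"
 proof
  show "torus_map ` B <= topspace torus - torus_map ` (K - W)"
  proof
   fix x assume x: "x \<in> torus_map ` B"
   have "x \<notin> torus_map ` (K - W)" using x WB by blast
   thus "x \<in> topspace torus - torus_map ` (K - W)" using x topspace_torus by auto
  qed
  show "topspace torus - torus_map ` (K - W) <= torus_map ` B"
  proof
   fix x assume x: "x \<in> topspace torus - torus_map ` (K - W)"
   hence "x \<in> topspace torus" by simp
   then obtain z where z: "0 <= Re z" "Re z <= 1" "0 <= Im z" "Im z <= 1" "torus_map z = x" by (rule torus_map_surj)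
   hence "z \<in> K" unfolding K_def by (simp add: in_cbox_complex_iff)
   hence "z \<in> W" using x z(5) by blast
   thus "x \<in> torus_map ` B" using WB[of z] z(5) by simp
  qed
 qed
 thus ?thesis using o by simp
qed

lemma torus_map_inj: "inj_on torus_map (ball z (1/2))"
proof (rule inj_onI)
 fix u v assume uv: "u \<in> ball z (1/2)" "v \<in> ball z (1/2)" "torus_map u = torus_map v"
 have "dist u v < 1" using uv(1,2) dist_triangle_half_r[of z u 1 v] by simp
 hence n: "norm (v - u) < 1" by (simp add: dist_norm norm_minus_commute)
 hence "\<bar>Re (v - u)\<bar> < 1" "\<bar>Im (v - u)\<bar> < 1" using abs_Re_le_cmod[of "v - u"] abs_Im_le_cmod[of "v - u"] by linarith+
 moreover have "Re (v - u) \<in> \<int>" "Im (v - u) \<in> \<int>"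
  using uv(3) unfolding torus_map_eq_iff by (auto simp: gaussian_integers_def)
 ultimately have "Re (v - u) = 0" "Im (v - u) = 0" using Ints_nonzero_abs_less1 by blast+
 thus "u = v" by (simp add: complex_eq_iff)
qed

definition torus_atlas :: "(complex \<times> complex) chart set" where
 "torus_atlas = range (\<lambda>z. (torus_map ` ball z (1/2), inv_into (ball z (1/2)) torus_map))"

lemma complex_chart_inverse:
 assumes B: "open B" and f: "continuous_map (top_of_set B) X f" "inj_on f B"
  and op: "!!W. open W ==> W <= B ==> openin X (f ` W)"
 shows "complex_chart X (f ` B, inv_into B f)"
proof -
 let ?U = "f ` B"
 have U: "openin X ?U" by (rule op[OF B]) simp
 have tU: "topspace (X on ?U) = ?U" using openin_subset[OF U] by auto
 have h: "homeomorphic_map (top_of_set B) (X on ?U) f"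
 proof (rule bijective_open_imp_homeomorphic_map)
  show "continuous_map (top_of_set B) (X on ?U) f" using f(1) by (auto simp: continuous_map_in_subtopology)
  show "open_map (top_of_set B) (X on ?U) f" unfolding open_map_def
  proof (intro allI impI)
   fix W assume "openin (top_of_set B) W"
   hence W: "open W" "W <= B" using B by (auto simp: openin_open_eq)
   show "openin (X on ?U) (f ` W)" using W(2) U op[OF W] by (simp add: openin_open_subtopology image_mono)
  qed
 qed (use tU f(2) in auto)
 obtain g where g: "homeomorphic_maps (top_of_set B) (X on ?U) f g"
  using h by (auto simp: homeomorphic_map_maps)
 have eq: "g x = inv_into B f x" if "x \<in> ?U" for x
 proof -
  obtain b where b: "b \<in> B" "x = f b" using \<open>x \<in> ?U\<close> by blast
  have "g (f b) = b" using g b(1) by (simp add: homeomorphic_maps_def)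
  thus ?thesis using inv_into_f_f[OF f(2) b(1)] b(2) by simp
 qed
 have im: "inv_into B f ` ?U = B" using inv_into_image_cancel[OF f(2), of B] by simp
 have "homeomorphic_map (X on ?U) (top_of_set B) g" using g by (auto simp: homeomorphic_maps_map)
 hence "homeomorphic_map (X on ?U) (top_of_set B) (inv_into B f)"
  by (rule homeomorphic_map_eq) (use tU eq in auto)
 thus ?thesis using U im B by (simp add: complex_chart_def)
qed

lemma torus_chart: "complex_chart torus (torus_map ` ball z (1/2), inv_into (ball z (1/2)) torus_map)"
 by (rule complex_chart_inverse)
   (auto simp: torus_map_inj torus_map_open continuous_map_torus_map continuous_map_from_subtopology)

definition torus_translation :: "complex => complex \<times> complex => complex \<times> complex" where
 "torus_translation c x = (circ (Re c) * fst x, circ (Im c) * snd x)"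

lemma torus_translation: "torus_translation c (torus_map z) = torus_map (z + c)"
 by (simp add: torus_translation_def torus_map_def circ_add mult.commute)

text \<open>In the charts the map is locally a translation: two candidate values lie in a disc on
  which \<open>torus_map\<close> is injective and have the same image. The case c = 0 gives the
  transition maps of the atlas.\<close>

lemma torus_translation_local:
 fixes c z0 z1 :: complex
 defines "U \<equiv> torus_map ` ball z0 (1/2)" and "V \<equiv> torus_map ` ball z1 (1/2)"
 defines "\<phi> \<equiv> inv_into (ball z0 (1/2)) torus_map" and "\<psi> \<equiv> inv_into (ball z1 (1/2)) torus_map"
 shows "(\<psi> \<circ> torus_translation c \<circ> inv_into U \<phi>) holomorphic_on \<phi> ` {x \<in> U. torus_translation c x \<in> V}"
  (is "?f holomorphic_on ?S")
proof (rule holomorphic_on_local_translation)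
 have f: "w \<in> ball z0 (1/2) \<and> ?f w \<in> ball z1 (1/2) \<and> torus_map (?f w) = torus_map (w + c)" if w: "w \<in> ?S" for w
 proof -
  obtain x where x: "x \<in> U" "torus_translation c x \<in> V" "w = \<phi> x" using w by blast
  obtain b where b: "b \<in> ball z0 (1/2)" "x = torus_map b" using x(1) unfolding U_def by blast
  have wb: "w = b" unfolding x(3) b(2) \<phi>_def by (rule inv_into_f_f[OF torus_map_inj b(1)])
  have "inj_on \<phi> U" unfolding \<phi>_def U_def by (rule inj_on_inv_into) simp
  hence "inv_into U \<phi> w = x" using x(1,3) by simp
  hence fw: "?f w = \<psi> (torus_map (w + c))" using b(2) wb torus_translation by simp
  have "torus_map (w + c) \<in> V" using x(2) b(2) wb torus_translation by simp
  hence "\<psi> (torus_map (w + c)) \<in> ball z1 (1/2)" "torus_map (\<psi> (torus_map (w + c))) = torus_map (w + c)"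
   unfolding \<psi>_def V_def by (rule inv_into_into, rule f_inv_into_f)
  thus ?thesis using b(1) wb fw by simp
 qed
 fix z assume z: "z \<in> ?S"
 obtain d where d: "d > 0" "ball (?f z) d <= ball z1 (1/2)" using f[OF z] open_contains_ball[of "ball z1 (1/2)"] by blast
 have "?f w = w + (?f z - z)" if w: "w \<in> ?S \<inter> ball z d" for w
 proof (rule inj_onD[OF torus_map_inj[of z1]])
  have "dist (?f z) (w + (?f z - z)) = dist z w" by (simp add: dist_norm)
  hence "w + (?f z - z) \<in> ball (?f z) d" using w by (simp only: mem_ball Int_iff)
  thus "w + (?f z - z) \<in> ball z1 (1/2)" by (rule subsetD[OF d(2)])
  show "?f w \<in> ball z1 (1/2)" using f w by blast
  have "?f z - (z + c) \<in> gaussian_integers" using f[OF z] torus_map_eq_iff[of "z + c" "?f z"] by simp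
  hence "torus_map (w + c) = torus_map (w + (?f z - z))" unfolding torus_map_eq_iff by (simp add: algebra_simps)
  thus "torus_map (?f w) = torus_map (w + (?f z - z))" using f w by auto
 qed
 thus "\<exists>d>0. \<exists>c. \<forall>w\<in>?S \<inter> ball z d. ?f w = w + c" using d(1) by blast
qed

lemma holomorphic_map_torus_translation: "holomorphic_map torus torus_atlas torus torus_atlas (torus_translation c)"
 unfolding holomorphic_map_def
proof
 show "continuous_map torus torus (torus_translation c)"
  unfolding torus_def torus_translation_def continuous_map_in_subtopology
  by (auto intro!: continuous_intros continuous_map_from_subtopology simp: norm_mult)
qed (auto simp: torus_atlas_def torus_translation_local)

lemma compact_riemann_surface_torus: "compact_riemann_surface torus torus_atlas"
 unfolding compact_riemann_surface_def
proof (intro conjI)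
 have c: "compact (sphere (0::complex) 1 \<times> sphere (0::complex) 1)" by (intro compact_Times) auto
 show "topspace torus ~= {}" by (simp add: topspace_torus)
 show "Hausdorff_space torus" unfolding torus_def by (simp add: Hausdorff_space_subtopology)
 show "compact_space torus" unfolding torus_def using c by (simp add: compact_space_subtopology)
 have "connectedin torus (torus_map ` UNIV)"
  by (rule connectedin_continuous_map_image[OF continuous_map_torus_map]) (simp add: convex_connected)
 thus "connected_space torus" by (simp add: topspace_torus[symmetric] connectedin_topspace)
 show "complex_atlas torus torus_atlas" unfolding complex_atlas_def
 proof (intro conjI)
  show "\<forall>c\<in>torus_atlas. complex_chart torus c" unfolding torus_atlas_def using torus_chart by blast
  show "(\<Union>(U, \<phi>)\<in>torus_atlas. U) = topspace torus"
   unfolding torus_atlas_def topspace_torus by (auto intro: centre_in_ball[THEN iffD2])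
  have id: "torus_translation 0 = (\<lambda>x. x)" by (auto simp: torus_translation_def fun_eq_iff)
  show "\<forall>(U, \<phi>)\<in>torus_atlas. \<forall>(V, \<psi>)\<in>torus_atlas. (\<psi> \<circ> inv_into U \<phi>) holomorphic_on \<phi> ` (U \<inter> V)"
   unfolding torus_atlas_def using torus_translation_local[of _ 0] by (auto simp: id o_def Int_def)
 qed
qed

text \<open>Translation by 1/n in the real direction has order exactly n on the torus.\<close>

lemma one_in_spectrum_cyclic:
 assumes n: "n > 0"
 shows "1 \<in> spectrum (Zmod n)"
proof (rule spectrumI[OF compact_riemann_surface_torus has_genus_torus])
 define R where "R i = torus_translation (of_real (real_of_int i / real n))" for i
 have R: "R i (torus_map z) = torus_map (z + of_real (real_of_int i / real n))" for i z
  unfolding R_def by (rule torus_translation)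
 show "acts_on_surface (Zmod n) torus torus_atlas"
 proof (rule cyclic_acts_on_surface[of _ _ _ R])
  show "complex_atlas torus torus_atlas" using compact_riemann_surface_torus by (simp add: compact_riemann_surface_def)
  show "holomorphic_map torus torus_atlas torus torus_atlas (R i)" for i
   unfolding R_def by (rule holomorphic_map_torus_translation)
  show "R (i + j) x = R i (R j x)" if "x \<in> topspace torus" for i j x
   using that unfolding topspace_torus by (auto simp: R add_divide_distrib add_ac)
  show "R 0 x = x" if "x \<in> topspace torus" for x using that unfolding topspace_torus by (auto simp: R)
  show "R (int n) x = x" if "x \<in> topspace torus" for x
   using that n unfolding topspace_torus by (auto simp: R torus_map_eq_iff gaussian_integers_def)
  show "\<exists>x\<in>topspace torus. R i x ~= x" if i: "0 < i" "i < int n" for i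
  proof
   have "real_of_int i / real n \<notin> \<int>"
   proof
    assume "real_of_int i / real n \<in> \<int>"
    moreover have "\<bar>real_of_int i / real n\<bar> < 1" using i by simp
    ultimately have "real_of_int i / real n = 0" using Ints_nonzero_abs_less1 by blast
    thus False using i by simp
   qed
   thus "R i (torus_map 0) ~= torus_map 0" by (simp add: R torus_map_eq_iff gaussian_integers_def)
  qed (simp add: topspace_torus)
 qed (fact n)
qed

section \<open>Polygons with glued sides\<close>

text \<open>Side \<open>i\<close> of an \<open>L\<close>-gon, parametrised by \<open>[i, i + 1]\<close>, is glued to side \<open>\<tau> i\<close> with reversed orientation;
 \<open>nextv\<close> passes to the neighbouring corner at the same vertex of the surface.\<close>

locale polygon_gluing =
 fixes L :: int and \<tau> :: "int => int"
 assumes L: "L \<ge> 4" "even L" and \<tau>_invol: "\<tau> (\<tau> i) = i" and \<tau>_L: "\<tau> (i + L) = \<tau> i + L"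
  and \<tau>_parity: "even (\<tau> i) \<longleftrightarrow> odd i"
begin

definition e :: "real => complex" where "e t = circ (t / of_int L)"

definition nextv :: "int => int" where "nextv i = \<tau> i + 1"

abbreviation nextn where "nextn m \<equiv> nextv ^^ m"

text \<open>The parameter i + s on side i, with 0 < s < 1, is glued to
  \<open>\<tau> i + 1 - s\<close>; the reversal of the side is the minus sign.\<close>

definition partner :: "real => real" where "partner t = of_int (\<tau> \<lfloor>t\<rfloor> + 1 + \<lfloor>t\<rfloor>) - t"

definition boundary_class :: "real => complex set" where
 "boundary_class t = (if t \<in> \<int> then {e (of_int (nextn m \<lfloor>t\<rfloor>)) | m. True} else {e t, e (partner t)})"

text \<open>Points of the surface are the equivalence classes themselves, as sets of points of the
  closed disc. The choice of t is immaterial because classes have period L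
  (\<open>boundary_class_shift\<close>).\<close>

definition q :: "complex => complex set" where
 "q z = (if norm z < 1 then {z} else boundary_class (SOME t. z = e t))"

definition X :: "complex set topology" where "X = quot_top (top_of_set (cball 0 1)) q"

lemma L_pos: "real_of_int L > 0" using L by simp

lemma e_eq_iff: "e s = e t \<longleftrightarrow> (\<exists>k. t = s + of_int (k * L))"
proof -
 have "e s = e t \<longleftrightarrow> (t - s) / of_int L \<in> \<int>" by (simp add: e_def circ_eq_iff diff_divide_distrib)
 also have "... \<longleftrightarrow> (\<exists>k::int. (t - s) / of_int L = of_int k)" by (auto elim: Ints_cases)
 also have "... \<longleftrightarrow> (\<exists>k. t = s + of_int (k * L))" using L_pos by (auto simp: field_simps)
 finally show ?thesis .
qed

lemma e_surj:
 assumes "norm z = 1"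
 obtains t where "0 <= t" "t < of_int L" "z = e t"
proof -
 obtain t where "0 <= t" "t < 1" "z = circ t" by (rule circ_surj[OF assms])
 thus thesis using that[of "t * of_int L"] L_pos by (simp add: e_def)
qed

lemma norm_e [simp]: "norm (e t) = 1" by (simp add: e_def)

lemma continuous_on_e [continuous_intros]: "continuous_on S f ==> continuous_on S (\<lambda>x. e (f x))"
 unfolding e_def using L_pos by (intro continuous_intros) auto

lemma \<tau>_shift: "\<tau> (i + k * L) = \<tau> i + k * L"
proof (induction k rule: int_induct[where k = 0])
 case (step1 k)
 thus ?case using \<tau>_L[of "i + k * L"] by (simp add: algebra_simps)
next
 case (step2 k)
 thus ?case using \<tau>_L[of "i + (k - 1) * L"] by (simp add: algebra_simps)
qed simp

lemma nextv_Suc: "(nextv ^^ Suc m) i = \<tau> (nextn m i) + 1" by (simp only: funpow.simps o_apply nextv_def)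

lemma nextv_shift: "nextn m (i + k * L) = nextn m i + k * L"
proof (induction m)
 case (Suc m)
 thus ?case using \<tau>_shift[of "nextn m i" k] unfolding nextv_Suc by simp
qed simp

lemma nextv_parity: "even (nextn m i) \<longleftrightarrow> even i"
proof (induction m)
 case (Suc m)
 thus ?case unfolding nextv_Suc using \<tau>_parity by simp
qed simp

lemma nextv_inj: "nextn m i = nextn m j ==> i = j"
proof (induction m)
 case (Suc m)
 hence "\<tau> (nextn m i) = \<tau> (nextn m j)" unfolding nextv_Suc by simp
 hence "nextn m i = nextn m j" using \<tau>_invol by metis
 thus ?case by (rule Suc.IH)
qed simp

text \<open>Among the first L + 1 iterates two agree modulo L, and injectivity of
  \<open>nextv\<close> together with its compatibility with shifts cancels the common part.\<close>

lemma nextv_period: "\<exists>d>0. \<exists>k. nextn d i = i + k * L"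
proof -
 have "\<not> inj_on (\<lambda>m. nextn m i mod L) {0..nat L}"
 proof (rule pigeonhole)
  have "(\<lambda>m. nextn m i mod L) ` {0..nat L} <= {0..<L}" using L by auto
  hence "card ((\<lambda>m. nextn m i mod L) ` {0..nat L}) <= card {0..<L}" by (intro card_mono) auto
  thus "card ((\<lambda>m. nextn m i mod L) ` {0..nat L}) < card {0..nat L}" using L by simp
 qed
 then obtain m n where "nextn m i mod L = nextn n i mod L" "m ~= n" unfolding inj_on_def by auto
 then obtain m n where mn: "nextn m i mod L = nextn n i mod L" "m < n" by (metis linorder_neqE_nat)
 hence "L dvd nextn n i - nextn m i" by (metis mod_eq_dvd_iff)
 then obtain k where k: "nextn n i = nextn m i + k * L"
  by (metis add.commute diff_add_cancel dvdE mult.commute)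
 have "nextn m (nextn (n - m) i) = nextn n i"
  using mn(2) by (simp flip: funpow_add[THEN fun_cong, unfolded o_apply])
 hence "nextn m (nextn (n - m) i) = nextn m (i + k * L)" using k nextv_shift by simp
 hence "nextn (n - m) i = i + k * L" by (rule nextv_inj)
 thus ?thesis using mn(2) by (intro exI[of _ "n - m"]) auto
qed

lemma nextv_back: "\<exists>n k. nextn n (nextn m i) = i + k * L"
proof -
 obtain d k where d: "d > 0" "nextn d i = i + k * L" using nextv_period by blast
 have dm: "\<exists>k. nextn (d * j) i = i + k * L" for j
 proof (induction j)
  case (Suc j)
  then obtain l where "nextn (d * j) i = i + l * L" by blast
  hence "nextn (d * Suc j) i = i + (k + l) * L"
   using d(2) nextv_shift[of d i l] by (simp add: funpow_add algebra_simps)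
  thus ?case by blast
 qed (auto intro: exI[of _ 0])
 have "m <= d * m" using d(1) by simp
 hence "nextn (d * m - m) (nextn m i) = nextn (d * m) i"
  by (simp flip: funpow_add[THEN fun_cong, unfolded o_apply])
 thus ?thesis using dm[of m] by metis
qed

lemma boundary_class_vertex: "boundary_class (of_int i) = {e (of_int (nextn m i)) | m. True}"
 by (simp add: boundary_class_def)

lemma partner_floor:
 assumes "t \<notin> \<int>"
 shows "\<lfloor>partner t\<rfloor> = \<tau> \<lfloor>t\<rfloor>" "partner t \<notin> \<int>" "partner (partner t) = t"
proof -
 have t: "of_int \<lfloor>t\<rfloor> < t" "t < of_int \<lfloor>t\<rfloor> + 1"
  using assms floor_correct[of t] Ints_of_int[of "\<lfloor>t\<rfloor>"] by (auto simp: order_le_less)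
 thus f: "\<lfloor>partner t\<rfloor> = \<tau> \<lfloor>t\<rfloor>" by (simp add: partner_def floor_eq_iff) linarith
 show "partner t \<notin> \<int>"
 proof
  assume "partner t \<in> \<int>"
  hence "of_int (\<tau> \<lfloor>t\<rfloor> + 1 + \<lfloor>t\<rfloor>) - partner t \<in> \<int>" by (intro Ints_diff) auto
  thus False using assms by (simp add: partner_def)
 qed
 show "partner (partner t) = t" using f \<tau>_invol by (simp add: partner_def)
qed

lemma partner_shift: "partner (t + of_int (k * L)) = partner t + of_int (k * L)"
proof -
 have f: "\<lfloor>t + of_int (k * L)\<rfloor> = \<lfloor>t\<rfloor> + k * L" by (simp only: floor_add_int)
 show ?thesis unfolding partner_def f \<tau>_shift by simp
qed

lemma Ints_shift: "t + of_int k \<in> \<int> \<longleftrightarrow> (t::real) \<in> \<int>"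
 by (metis Ints_add Ints_diff Ints_of_int add_diff_cancel_right')

lemma boundary_class_shift: "boundary_class (t + of_int (k * L)) = boundary_class t"
proof (cases "t \<in> \<int>")
 case True
 then obtain i where i: "t = of_int i" by (auto elim: Ints_cases)
 have "e (of_int (nextn m (i + k * L))) = e (of_int (nextn m i))" for m
  unfolding nextv_shift using e_eq_iff[of "of_int (nextn m i)"] by (metis of_int_add)
 hence "boundary_class (of_int (i + k * L)) = boundary_class (of_int i)" unfolding boundary_class_vertex by simp
 thus ?thesis by (simp add: i)
next
 case False
 hence "t + of_int (k * L) \<notin> \<int>" by (simp only: Ints_shift not_False_eq_True)
 moreover have "e (t + of_int (k * L)) = e t" "e (partner t + of_int (k * L)) = e (partner t)" using e_eq_iff by metis+
 ultimately show ?thesis using False unfolding boundary_class_def partner_shift by simp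
qed

lemma q_e: "q (e t) = boundary_class t"
proof -
 have "e t = e (SOME s. e t = e s)" by (rule someI) simp
 then obtain k where "(SOME s. e t = e s) = t + of_int (k * L)" unfolding e_eq_iff by blast
 thus ?thesis by (simp only: q_def norm_e less_irrefl if_False boundary_class_shift)
qed

lemma e_in_boundary_class: "e t \<in> boundary_class t"
proof (cases "t \<in> \<int>")
 case True
 then obtain i where "t = of_int i" by (auto elim: Ints_cases)
 thus ?thesis by (auto simp: boundary_class_vertex intro!: exI[of _ "0::nat"])
qed (simp add: boundary_class_def)

lemma boundary_class_nextv: "boundary_class (of_int (nextn m i)) = boundary_class (of_int i)"
proof
 show "boundary_class (of_int (nextn m i)) <= boundary_class (of_int i)"
  unfolding boundary_class_vertex by (auto simp flip: funpow_add[THEN fun_cong, unfolded o_apply])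
 obtain n k where nk: "nextn n (nextn m i) = i + k * L" using nextv_back by blast
 have "boundary_class (of_int i) = boundary_class (of_int (nextn n (nextn m i)))"
  unfolding nk using boundary_class_shift[of "of_int i" k] by simp
 also have "... <= boundary_class (of_int (nextn m i))"
  unfolding boundary_class_vertex by (auto intro: exI[of _ "_ + n"] simp: funpow_add)
 finally show "boundary_class (of_int i) <= boundary_class (of_int (nextn m i))" .
qed

lemma boundary_class_partner: "boundary_class (partner t) = boundary_class t" if "t \<notin> \<int>"
 using partner_floor[OF that] that by (auto simp: boundary_class_def)

lemma boundary_class_eq_nonint:
 assumes t: "t \<notin> \<int>"
 shows "boundary_class t = boundary_class s \<longleftrightarrow> e s = e t \<or> e s = e (partner t)"
proof
 assume "boundary_class t = boundary_class s"
 hence "e s \<in> boundary_class t" using e_in_boundary_class by simp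
 thus "e s = e t \<or> e s = e (partner t)" using t by (simp add: boundary_class_def)
next
 assume "e s = e t \<or> e s = e (partner t)"
 hence "boundary_class s = boundary_class t \<or> boundary_class s = boundary_class (partner t)"
  using q_e by metis
 thus "boundary_class t = boundary_class s" using boundary_class_partner[OF t] by auto
qed

lemma boundary_class_eq_vertex:
 "boundary_class (of_int i) = boundary_class s \<longleftrightarrow> (\<exists>m k. s = of_int (nextn m i + k * L))"
proof
 assume "boundary_class (of_int i) = boundary_class s"
 hence "e s \<in> boundary_class (of_int i)" using e_in_boundary_class by simp
 then obtain m where "e (of_int (nextn m i)) = e s" unfolding boundary_class_vertex by auto
 then obtain k where "s = of_int (nextn m i) + of_int (k * L)" unfolding e_eq_iff by blast
 thus "\<exists>m k. s = of_int (nextn m i + k * L)" by (metis of_int_add)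
next
 assume "\<exists>m k. s = of_int (nextn m i + k * L)"
 then obtain m k where s: "s = of_int (nextn m i) + of_int (k * L)" by auto
 show "boundary_class (of_int i) = boundary_class s" unfolding s boundary_class_shift boundary_class_nextv ..
qed

lemma q_interior: "norm z < 1 ==> q z = {z}" by (simp add: q_def)

lemma boundary_class_norm: "w \<in> boundary_class t ==> norm w = 1"
 by (auto simp: boundary_class_def split: if_splits)

lemma q_eq_interior:
 assumes "norm z < 1" "norm w <= 1"
 shows "q z = q w \<longleftrightarrow> z = w"
proof (cases "norm w < 1")
 case False
 then obtain t where "w = e t" using assms(2) e_surj[of w] by (metis order_le_less)
 thus ?thesis using assms(1) q_interior[OF assms(1)] boundary_class_norm[of z t] q_e[of t] e_in_boundary_class[of t] by auto
qed (use assms q_interior in auto)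

lemma side_reversed:
 assumes "0 <= s" "s <= 1"
 shows "q (e (of_int (\<tau> i) + 1 - s)) = q (e (of_int i + s))"
proof -
 consider "s = 0" | "s = 1" | "0 < s" "s < 1" using assms by fastforce
 thus ?thesis
 proof cases
  case 1
  thus ?thesis using boundary_class_nextv[of 1 i] by (simp add: q_e nextv_def add.commute)
 next
  case 2
  thus ?thesis using boundary_class_nextv[of 1 "\<tau> i"] by (simp add: q_e nextv_def \<tau>_invol add.commute)
 next
  case 3
  hence f: "\<lfloor>of_int i + s\<rfloor> = i" by (simp add: floor_eq_iff)
  hence "of_int i + s \<notin> \<int>" using 3 by (metis Ints_cases add_cancel_right_right floor_of_int less_irrefl)
  moreover have "partner (of_int i + s) = of_int (\<tau> i) + 1 - s" using f by (simp add: partner_def)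
  ultimately show ?thesis using boundary_class_partner[of "of_int i + s"] by (simp add: q_e)
 qed
qed

text \<open>Saturating C adds, for each of the L sides, the reversed copy \<open>Z i\<close> on the
  partner side of what C has on side i, and finitely many vertices. This is a finite union of
  compact sets.\<close>

lemma saturation_closed:
 assumes "closedin (top_of_set (cball 0 1)) C"
 shows "closedin (top_of_set (cball 0 1)) {z \<in> cball 0 1. q z \<in> q ` C}"
proof -
 have C: "compact C" "C <= cball 0 1"
  using closedin_compact[OF compact_cball assms] closedin_subset[OF assms] by simp_all
 define Z where "Z i = (\<lambda>s. e (of_int (\<tau> i) + 1 - s)) ` {s \<in> {0..1}. e (of_int i + s) \<in> C}" for i
 define V where "V = {e (of_int j) | j. j \<in> {0..<L} \<and> q (e (of_int j)) \<in> q ` C}"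
 have Zc: "compact (Z i)" for i
 proof -
  have "closed C" using C(1) by (rule compact_imp_closed)
  hence "closedin (top_of_set {0..1}) ({0..1} \<inter> (\<lambda>s. e (of_int i + s)) -` C)"
   by (intro continuous_closedin_preimage continuous_intros)
  hence "compact ({0..1} \<inter> (\<lambda>s. e (of_int i + s)) -` C)" by (rule closedin_compact[rotated]) simp
  moreover have "{s \<in> {0..1}. e (of_int i + s) \<in> C} = {0..1} \<inter> (\<lambda>s. e (of_int i + s)) -` C" by auto
  ultimately show ?thesis unfolding Z_def by (intro compact_continuous_image continuous_intros) simp
 qed
 have Zsub: "Z i <= {z \<in> cball 0 1. q z \<in> q ` C}" for i
 proof
  fix z assume "z \<in> Z i"
  then obtain s where s: "s \<in> {0..1}" "e (of_int i + s) \<in> C" "z = e (of_int (\<tau> i) + 1 - s)" unfolding Z_def by blast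
  hence "q z = q (e (of_int i + s))" using side_reversed by simp
  thus "z \<in> {z \<in> cball 0 1. q z \<in> q ` C}" using s by auto
 qed
 have "{z \<in> cball 0 1. q z \<in> q ` C} = C \<union> (\<Union>i\<in>{0..<L}. Z i) \<union> V" (is "?S = ?T")
 proof
  show "?T <= ?S" using C(2) Zsub unfolding V_def by auto
  show "?S <= ?T"
  proof
   fix z assume "z \<in> ?S"
   then obtain w where zw: "norm z <= 1" "w \<in> C" "q z = q w" by auto
   have w1: "norm w <= 1" using zw(2) C(2) by auto
   show "z \<in> ?T"
   proof (cases "norm z < 1 \<or> norm w < 1")
    case True
    hence "z = w" using zw(1,3) w1 q_eq_interior by metis
    thus ?thesis using zw(2) by simp
   next
    case False
    hence n: "norm z = 1" "norm w = 1" using zw(1) w1 by auto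
    obtain s where s: "0 <= s" "s < of_int L" "z = e s" by (rule e_surj[OF n(1)])
    obtain t where t: "0 <= t" "t < of_int L" "w = e t" by (rule e_surj[OF n(2)])
    show ?thesis
    proof (cases "s \<in> \<int>")
     case True
     then obtain j where j: "s = of_int j" by (auto elim: Ints_cases)
     hence "j \<in> {0..<L}" using s by simp
     hence "z \<in> V" unfolding V_def s(3) j using zw(2,3) s(3) j by auto
     thus ?thesis by blast
    next
     case False
     hence "e t = e s \<or> e t = e (partner s)"
      using zw(3) unfolding s(3) t(3) q_e boundary_class_eq_nonint[OF False] by simp
     moreover have ?thesis if et: "e t = e (partner s)"
     proof -
      have tn: "t \<notin> \<int>"
      proof
       assume "t \<in> \<int>"
       moreover obtain k where "partner s = t + of_int (k * L)" using et unfolding e_eq_iff by blast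
       ultimately have "partner s \<in> \<int>" by simp
       thus False using partner_floor(2)[OF False] by blast
      qed
      have st: "e s = e (partner t)"
      proof -
       obtain k where "partner s = t + of_int (k * L)" using et unfolding e_eq_iff by blast
       hence "s = partner t + of_int (k * L)" using partner_floor(3)[OF False] partner_shift by metis
       thus ?thesis by (metis e_eq_iff)
      qed
      have "z \<in> Z \<lfloor>t\<rfloor>" unfolding Z_def s(3) st
      proof (rule image_eqI[of _ _ "t - of_int \<lfloor>t\<rfloor>"])
       show "e (partner t) = e (of_int (\<tau> \<lfloor>t\<rfloor>) + 1 - (t - of_int \<lfloor>t\<rfloor>))" by (simp add: partner_def algebra_simps)
       show "t - of_int \<lfloor>t\<rfloor> \<in> {s \<in> {0..1}. e (of_int \<lfloor>t\<rfloor> + s) \<in> C}"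
        using zw(2) t(3) floor_correct[of t] by (auto simp: algebra_simps)
      qed
      moreover have "\<lfloor>t\<rfloor> \<in> {0..<L}" using t by (simp add: floor_less_iff)
      ultimately show ?thesis by blast
     qed
     ultimately show ?thesis using zw(2) s(3) t(3) by auto
    qed
   qed
  qed
 qed
 moreover have "compact (C \<union> (\<Union>i\<in>{0..<L}. Z i) \<union> V)"
 proof (intro compact_Un C(1) compact_UN)
  have "V <= (\<lambda>j. e (of_int j)) ` {0..<L}" unfolding V_def by auto
  thus "compact V" by (intro finite_imp_compact) (rule finite_subset, auto)
 qed (use Zc in auto)
 ultimately show ?thesis using compact_imp_closed by (metis (no_types, lifting) closed_subset mem_Collect_eq subsetI)
qed

lemma topspace_X: "topspace X = q ` cball 0 1" by (simp add: X_def)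

lemma continuous_q: "continuous_map (top_of_set (cball 0 1)) X q"
 unfolding X_def by (rule continuous_map_quot_top)

lemma Hausdorff_X: "Hausdorff_space X" unfolding X_def
 by (rule Hausdorff_space_quot_top) (use saturation_closed in \<open>auto simp: compact_space_subtopology Hausdorff_space_subtopology\<close>)

lemma compact_X: "compact_space X"
proof -
 have "compactin X (q ` cball 0 1)"
  by (rule image_compactin[OF _ continuous_q]) (simp add: compactin_subtopology)
 thus ?thesis by (simp add: topspace_X[symmetric] compact_space_def)
qed

lemma connected_X: "connected_space X"
proof -
 have "connectedin X (q ` cball 0 1)"
  by (rule connectedin_continuous_map_image[OF continuous_q])
    (simp add: connectedin_subtopology convex_connected)
 thus ?thesis by (simp add: topspace_X[symmetric] connectedin_topspace)
qed

lemma openin_X_iff: "openin X U \<longleftrightarrow> U <= q ` cball 0 1 \<and> openin (top_of_set (cball 0 1)) {z \<in> cball 0 1. q z \<in> U}"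
 by (simp add: X_def openin_quot_top)

lemma openin_X_interior:
 assumes "open W" "W <= ball 0 1"
 shows "openin X (q ` W)"
proof -
 have "{z \<in> cball 0 1. q z \<in> q ` W} = W" using assms(2) q_eq_interior by (auto simp: subset_iff)
 moreover have "openin (top_of_set (cball 0 1)) W" using assms by (intro open_subset) auto
 moreover have "q ` W <= q ` cball 0 1" using assms(2) by auto
 ultimately show ?thesis unfolding openin_X_iff by simp
qed

lemma q_inj_interior: "inj_on q (ball 0 1)" using q_eq_interior by (auto intro!: inj_onI)

definition face :: "complex set set" where "face = q ` ball 0 1"

definition face_chart :: "complex set => complex" where "face_chart = inv_into (ball 0 1) q"

lemma face_chart_q: "norm z < 1 ==> face_chart (q z) = z"
 unfolding face_chart_def by (rule inv_into_f_f[OF q_inj_interior]) simp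

lemma complex_chart_face: "complex_chart X (face, face_chart)" unfolding face_def face_chart_def
 by (rule complex_chart_inverse)
   (auto simp: q_inj_interior openin_X_interior intro: continuous_map_from_subtopology_mono[OF continuous_q])

end

text \<open>Two continuous maps from a compact space into Hausdorff spaces with the same fibres have
  homeomorphic images. The parameter space P thus yields a chart without a formula on X, restricted
  afterwards to the open sets U and W.\<close>

lemma complex_chart_common_fibres:
 assumes X: "Hausdorff_space X" and P: "compact_space P"
  and \<beta>: "continuous_map P X \<beta>" and \<kappa>: "continuous_map P euclidean \<kappa>"
  and fib: "!!x y. x \<in> topspace P ==> y \<in> topspace P ==> \<beta> x = \<beta> y \<longleftrightarrow> \<kappa> x = \<kappa> y"
  and W: "open W" "W <= \<kappa> ` topspace P" and U: "openin X U" "U = \<beta> ` {x \<in> topspace P. \<kappa> x \<in> W}"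
 obtains \<phi> where "complex_chart X (U, \<phi>)" "!!x. x \<in> topspace P ==> \<phi> (\<beta> x) = \<kappa> x" "\<phi> ` U = W"
proof -
 let ?K = "\<beta> ` topspace P"
 define \<phi> where "\<phi> = \<kappa> \<circ> inv_into (topspace P) \<beta>"
 have \<phi>: "\<phi> (\<beta> x) = \<kappa> x" if "x \<in> topspace P" for x
 proof -
  have "inv_into (topspace P) \<beta> (\<beta> x) \<in> topspace P" "\<beta> (inv_into (topspace P) \<beta> (\<beta> x)) = \<beta> x"
   using that by (auto simp: inv_into_into f_inv_into_f)
  thus ?thesis using fib[OF _ that] unfolding \<phi>_def by simp
 qed
 have K: "compactin X ?K" using image_compactin[OF _ \<beta>] P by (simp add: compact_space_def)
 have tK: "topspace (X on ?K) = ?K" using compactin_subset_topspace[OF K] by auto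
 have "quotient_map P (X on ?K) \<beta>" using \<beta> P Hausdorff_space_subtopology[OF X] tK
  by (intro T1_Spaces.continuous_imp_quotient_map) (auto simp: continuous_map_in_subtopology)
 moreover have "continuous_map P (top_of_set (\<kappa> ` topspace P)) (\<phi> \<circ> \<beta>)"
  unfolding continuous_map_in_subtopology using \<phi> by (auto intro: continuous_map_eq[OF \<kappa>])
 ultimately have c: "continuous_map (X on ?K) (top_of_set (\<kappa> ` topspace P)) \<phi>"
  by (rule continuous_compose_quotient_map)
 have im: "\<phi> ` \<beta> ` S = \<kappa> ` S" if "S <= topspace P" for S using \<phi> that by (force simp: image_iff)
 have hK: "homeomorphic_map (X on ?K) (top_of_set (\<kappa> ` topspace P)) \<phi>"
 proof (rule continuous_imp_homeomorphic_map[OF c])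
  show "compact_space (X on ?K)" using K by (simp add: compactin_subspace)
  show "\<phi> ` topspace (X on ?K) = topspace (top_of_set (\<kappa> ` topspace P))" unfolding tK using im[of "topspace P"] by simp
  show "inj_on \<phi> (topspace (X on ?K))" unfolding tK using \<phi> fib by (auto intro!: inj_onI)
 qed (auto simp: Hausdorff_space_subtopology)
 have imU: "\<phi> ` U = W" unfolding U(2) using im[of "{x \<in> topspace P. \<kappa> x \<in> W}"] W(2) by auto
 have KU: "?K \<inter> U = U" unfolding U(2) by auto
 have "homeomorphic_map ((X on ?K) on U) ((top_of_set (\<kappa> ` topspace P)) on W) \<phi>"
  by (rule homeomorphic_map_subtopologies[OF hK]) (use W(2) imU KU in \<open>simp only: tK topspace_euclidean_subtopology Int_absorb1\<close>)
 moreover have "((X on ?K) on U) = (X on U)" using KU by (simp add: subtopology_subtopology)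
 moreover have "((top_of_set (\<kappa> ` topspace P)) on W) = top_of_set W"
  using W(2) by (simp add: subtopology_subtopology Int_absorb1)
 ultimately show thesis using that[of \<phi>] U(1) W(1) imU \<phi> by (simp add: complex_chart_def)
qed

section \<open>Stars of the vertices\<close>

context polygon_gluing
begin

text \<open>Unrolls the punctured disc: the closed upper half plane covers it with period L, real
  points run along the boundary as \<open>e\<close> does, and the corners sit at the
  integers.\<close>

definition pexp :: "complex => complex" where "pexp w = exp (\<i> * of_real (2 * pi / of_int L) * w)"

lemma pexp_of_real: "pexp (of_real t) = e t" by (simp add: pexp_def e_def circ_eq_exp mult_ac)

lemma norm_pexp: "norm (pexp w) = exp (- (2 * pi / of_int L) * Im w)" by (simp add: pexp_def)

lemma norm_pexp_le_1: "norm (pexp w) <= 1 \<longleftrightarrow> 0 <= Im w" and norm_pexp_less_1: "norm (pexp w) < 1 \<longleftrightarrow> 0 < Im w"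
proof -
 have p: "2 * pi / of_int L > 0" using L_pos by simp
 show "norm (pexp w) <= 1 \<longleftrightarrow> 0 <= Im w" "norm (pexp w) < 1 \<longleftrightarrow> 0 < Im w"
  unfolding norm_pexp exp_le_one_iff exp_less_one_iff mult_minus_left neg_le_0_iff_le neg_less_0_iff_less
  using p by (auto simp only: zero_le_mult_iff zero_less_mult_iff)
qed

lemma continuous_on_pexp [continuous_intros]: "continuous_on S f ==> continuous_on S (\<lambda>x. pexp (f x))"
 unfolding pexp_def by (intro continuous_intros)

lemma pexp_eq_iff: "pexp w = pexp w' \<longleftrightarrow> (\<exists>k. w' = w + of_int (k * L))"
proof -
 have "pexp w = pexp w' \<longleftrightarrow> (\<exists>n::int. \<i> * of_real (2 * pi / of_int L) * w = \<i> * of_real (2 * pi / of_int L) * w' + of_int (2 * n) * of_real pi * \<i>)"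
  unfolding pexp_def exp_eq by simp
 also have "... \<longleftrightarrow> (\<exists>n::int. w' = w + of_int (- n * L))"
 proof (rule ex_cong1)
  fix n :: int
  have "\<i> * of_real (2 * pi / of_int L) * w = \<i> * of_real (2 * pi / of_int L) * w' + of_int (2 * n) * of_real pi * \<i>
    \<longleftrightarrow> \<i> * of_real (2 * pi / of_int L) * w = \<i> * of_real (2 * pi / of_int L) * (w' + of_int (n * L))"
   using L_pos by (simp add: field_simps)
  also have "... \<longleftrightarrow> w = w' + of_int (n * L)" using L_pos by simp
  also have "... \<longleftrightarrow> w' = w + of_int (- n * L)" by (auto simp: algebra_simps)
  finally show "(\<i> * of_real (2 * pi / of_int L) * w = \<i> * of_real (2 * pi / of_int L) * w' + of_int (2 * n) * of_real pi * \<i>) = (w' = w + of_int (- n * L))" .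
 qed
 also have "... \<longleftrightarrow> (\<exists>k. w' = w + of_int (k * L))" by (metis minus_minus)
 finally show ?thesis .
qed

lemma pexp_shift: "pexp (w + of_int (k * L)) = pexp w" using pexp_eq_iff by metis

text \<open>The radius 3/4 exceeds 1/2, so that half discs at consecutive corners cover the boundary
  circle, and stays below 1, so that none of them reaches another corner.\<close>

abbreviation half_disc :: "complex set" where "half_disc \<equiv> {\<zeta>. 0 <= Im \<zeta> \<and> norm \<zeta> < 3/4}"

definition star :: "int => complex set" where
 "star c = {pexp (of_int (nextn m c) + \<zeta>) | m \<zeta>. \<zeta> \<in> half_disc}"

lemma side_partner:
 assumes "0 <= r" "r <= 1"
 shows "q (e (of_int ((nextv ^^ Suc m) c) - r)) = q (e (of_int (nextn m c) + r))"
 using side_reversed[OF assms, of "nextn m c"] unfolding nextv_Suc by simp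

lemma pexp_real: "Im \<zeta> = 0 ==> pexp (of_int i + \<zeta>) = e (of_int i + Re \<zeta>)"
proof -
 assume "Im \<zeta> = 0"
 hence "\<zeta> = of_real (Re \<zeta>)" by (simp add: complex_eq_iff)
 thus ?thesis using pexp_of_real[of "of_int i + Re \<zeta>"] by simp
qed

text \<open>The sides meeting the \<open>m\<close>-th corner of a vertex are glued to sides of the neighbouring corners.\<close>

lemma q_eq_corner:
 assumes z: "norm z <= 1" and \<zeta>: "0 <= Im \<zeta>" "norm \<zeta> < 1" and q: "q z = q (pexp (of_int (nextn m c) + \<zeta>))"
 obtains "z = pexp (of_int (nextn m c) + \<zeta>)"
 | n where "\<zeta> = 0" "z = pexp (of_int (nextn n c))"
 | r where "0 < r" "r < 1" "\<zeta> = of_real r" "z = pexp (of_int ((nextv ^^ Suc m) c) - of_real r)"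
 | r n k where "0 < r" "r < 1" "\<zeta> = - of_real r" "nextn m c = (nextv ^^ Suc n) c + k * L" "z = pexp (of_int (nextn n c) + of_real r)"
proof (cases "norm z < 1 \<or> 0 < Im \<zeta>")
 case True
 have "norm (pexp (of_int (nextn m c) + \<zeta>)) <= 1" using \<zeta> by (simp add: norm_pexp_le_1)
 moreover have "norm (pexp (of_int (nextn m c) + \<zeta>)) < 1" if "0 < Im \<zeta>" using that by (simp add: norm_pexp_less_1)
 ultimately have "z = pexp (of_int (nextn m c) + \<zeta>)" using True z q q_eq_interior by metis
 thus thesis by (rule that(1))
next
 case False
 hence "norm z = 1" and i0: "Im \<zeta> = 0" using z \<zeta> by auto
 then obtain s where s: "z = e s" using e_surj by metis
 define c' where "c' = nextn m c"
 define x where "x = Re \<zeta>"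
 have zx: "\<zeta> = of_real x" using i0 by (simp add: x_def complex_eq_iff)
 hence x1: "\<bar>x\<bar> < 1" using \<zeta>(2) by simp
 have qq: "boundary_class s = boundary_class (of_int c' + x)"
  using q unfolding s c'_def[symmetric] pexp_real[OF i0] q_e x_def .
 have fl: "e (of_int j + y) = pexp (of_int j + of_real y)" for j y
  using pexp_of_real[of "of_int j + y"] by simp
 have ni: "of_int c' + x \<notin> \<int>" if "x ~= 0"
 proof
  assume "of_int c' + x \<in> \<int>"
  hence "of_int c' + x - of_int c' \<in> \<int>" by (intro Ints_diff) auto
  thus False using Ints_nonzero_abs_less1[of x] x1 that by simp
 qed
 consider "x = 0" | "0 < x" | "x < 0" by linarith
 thus thesis
 proof cases
  case 1
  hence "boundary_class (of_int c') = boundary_class s" using qq by simp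
  then obtain j k where "s = of_int (nextn j c') + of_int (k * L)"
   unfolding boundary_class_eq_vertex by (metis of_int_add)
  hence "e (of_int (nextn j c')) = e s" using e_eq_iff by blast
  hence "z = pexp (of_int (nextn (j + m) c))"
   using s fl[of "nextn j c'" 0] by (simp add: c'_def funpow_add)
  thus thesis using that(2) zx 1 by simp
 next
  case 2
  hence f: "\<lfloor>of_int c' + x\<rfloor> = c'" using x1 by (simp add: floor_eq_iff)
  have "partner (of_int c' + x) = of_int ((nextv ^^ Suc m) c) + - x"
   unfolding partner_def f unfolding nextv_Suc c'_def by simp
  hence "e s = e (of_int c' + x) \<or> e s = e (of_int ((nextv ^^ Suc m) c) + - x)"
   using boundary_class_eq_nonint[OF ni, of s] 2 qq by simp
  thus thesis using that(1) that(3)[of x] 2 x1 zx s unfolding fl c'_def by auto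
 next
  case 3
  hence f: "\<lfloor>of_int c' + x\<rfloor> = c' - 1" using x1 by (simp add: floor_eq_iff)
  have p: "partner (of_int c' + x) = of_int (\<tau> (c' - 1)) + - x" unfolding partner_def f by simp
  have "nextn 1 (\<tau> (c' - 1)) = c'" by (simp add: nextv_def \<tau>_invol)
  then obtain n k where nk: "nextn n c' = \<tau> (c' - 1) + k * L" using nextv_back[of 1 "\<tau> (c' - 1)"] by auto
  have nm: "nextn n c' = nextn (n + m) c" by (simp add: c'_def funpow_add)
  have "e (of_int (\<tau> (c' - 1)) + - x) = e (of_int (nextn (n + m) c) + - x)"
   unfolding e_eq_iff nm[symmetric] nk by (intro exI[of _ k]) simp
  hence "e s = e (of_int c' + x) \<or> e s = e (of_int (nextn (n + m) c) + - x)"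
   using boundary_class_eq_nonint[OF ni, of s] 3 qq p by simp
  moreover have "nextn m c = (nextv ^^ Suc (n + m)) c + (- k) * L"
   using nk nm \<tau>_shift[of "\<tau> (c' - 1)" k] unfolding nextv_Suc by (simp add: \<tau>_invol c'_def)
  ultimately show thesis using that(1) that(4)[of "- x" "n + m" "- k"] 3 x1 zx s unfolding fl c'_def by auto
 qed
qed

lemma star_saturated:
 assumes "norm z <= 1" "q z \<in> q ` star c"
 shows "z \<in> star c"
proof -
 obtain m \<zeta> where m: "q z = q (pexp (of_int (nextn m c) + \<zeta>))" "0 <= Im \<zeta>" "norm \<zeta> < 3/4"
  using assms(2) unfolding star_def by blast
 have in': "pexp (of_int (nextn j c) + x) \<in> star c" if "0 <= Im x" "norm x < 3/4" for j x
  using that unfolding star_def by blast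
 have "norm \<zeta> < 1" using m(3) by simp
 from assms(1) m(2) this m(1) show ?thesis
 proof (cases rule: q_eq_corner)
  case 1
  thus ?thesis using in'[OF m(2,3)] by simp
 next
  case (2 n)
  thus ?thesis using in'[of 0 n] by simp
 next
  case (3 r)
  thus ?thesis using in'[of "- of_real r" "Suc m"] m(3) by simp
 next
  case (4 r n k)
  thus ?thesis using in'[of "of_real r" n] m(3) by simp
 qed
qed

lemma pexp_inj: "inj_on pexp (ball c (3/4))"
proof (rule inj_onI)
 fix u v assume uv: "u \<in> ball c (3/4)" "v \<in> ball c (3/4)" "pexp u = pexp v"
 then obtain k where k: "v = u + of_int (k * L)" unfolding pexp_eq_iff by blast
 have "dist u v < 2" using uv(1,2) dist_triangle3[of u v c] by simp
 hence "norm (of_int (k * L) :: complex) < 2" unfolding k by (simp add: dist_norm)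
 hence "\<bar>k * L\<bar> < 2" unfolding norm_of_int by linarith
 moreover have "\<bar>k * L\<bar> \<ge> 4" if "k ~= 0" using that L mult_mono[of 1 "\<bar>k\<bar>" 4 L] by (simp add: abs_mult)
 ultimately have "k = 0" by fastforce
 thus "u = v" using k by simp
qed

lemma openin_star: "openin X (q ` star c)"
proof -
 have op: "open (pexp ` ball w (3/4))" for w
  by (rule open_mapping_thm3[OF _ open_ball pexp_inj]) (auto simp: pexp_def[abs_def] intro!: holomorphic_intros)
 have "star c = cball 0 1 \<inter> (\<Union>m. pexp ` ball (of_int (nextn m c)) (3/4))"
 proof (intro subset_antisym subsetI)
  fix z assume "z \<in> star c"
  then obtain m \<zeta> where "z = pexp (of_int (nextn m c) + \<zeta>)" "0 <= Im \<zeta>" "norm \<zeta> < 3/4" unfolding star_def by blast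
  thus "z \<in> cball 0 1 \<inter> (\<Union>m. pexp ` ball (of_int (nextn m c)) (3/4))"
   by (auto simp: norm_pexp_le_1 dist_norm intro!: exI[of _ m])
 next
  fix z assume z: "z \<in> cball 0 1 \<inter> (\<Union>m. pexp ` ball (of_int (nextn m c)) (3/4))"
  then obtain m w where w: "z = pexp w" "dist (of_int (nextn m c)) w < 3/4" by auto
  have "0 <= Im w" using z w(1) by (simp add: norm_pexp_le_1)
  thus "z \<in> star c" unfolding star_def
   using w by (auto intro!: exI[of _ m] exI[of _ "w - of_int (nextn m c)"] simp: dist_norm norm_minus_commute)
 qed
 hence "openin (top_of_set (cball 0 1)) (star c)"
  using op by (metis (no_types, lifting) open_UN openin_open)
 moreover have "{z \<in> cball 0 1. q z \<in> q ` star c} = star c"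
 proof (intro subset_antisym subsetI)
  fix z assume "z \<in> star c"
  thus "z \<in> {z \<in> cball 0 1. q z \<in> q ` star c}" by (auto simp: star_def norm_pexp_le_1)
 next
  fix z assume "z \<in> {z \<in> cball 0 1. q z \<in> q ` star c}"
  thus "z \<in> star c" by (intro star_saturated) auto
 qed
 moreover have "star c <= cball 0 1" by (auto simp: star_def norm_pexp_le_1)
 ultimately show ?thesis unfolding openin_X_iff by auto
qed

end

text \<open>Polar coordinates with the angle pi x measured from the positive imaginary axis: |x| <=
  1/2 describes the closed upper half plane, x = -1/2 its positive and x = 1/2 its negative real
  ray.\<close>

definition polar :: "real => real => complex" where "polar r x = \<i> * of_real r * cis (pi * x)"

lemma polar_simps: "Re (polar r x) = - (r * sin (pi * x))" "Im (polar r x) = r * cos (pi * x)"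
 by (simp_all add: polar_def)

lemma norm_polar: "r \<ge> 0 ==> norm (polar r x) = r" by (simp add: polar_def norm_mult)

lemma polar_Im_nonneg: "0 <= r ==> \<bar>x\<bar> <= 1/2 ==> 0 <= Im (polar r x)"
proof -
 assume r: "0 <= r" and x: "\<bar>x\<bar> <= 1/2"
 have "\<bar>pi * x\<bar> <= pi / 2" using mult_left_mono[OF x, of pi] by (simp add: abs_mult)
 hence "0 <= cos (pi * x)" by (intro cos_ge_zero) linarith+
 thus ?thesis using r by (simp add: polar_simps)
qed

lemma sin_pi_inj:
 assumes "\<bar>x\<bar> <= 1/2" "\<bar>y\<bar> <= 1/2" "sin (pi * x) = sin (pi * y)"
 shows "x = y"
proof -
 have "\<bar>pi * x\<bar> <= pi / 2" "\<bar>pi * y\<bar> <= pi / 2"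
  using mult_left_mono[OF assms(1), of pi] mult_left_mono[OF assms(2), of pi] by (simp_all add: abs_mult)
 hence "- (pi / 2) <= pi * x" "pi * x <= pi / 2" "- (pi / 2) <= pi * y" "pi * y <= pi / 2"
  unfolding abs_le_iff by linarith+
 from sin_inj_pi[OF this assms(3)] have "pi * x = pi * y" .
 thus ?thesis by simp
qed

lemma polar_inj:
 assumes "0 <= r" "0 <= s" "\<bar>x\<bar> <= 1/2" "\<bar>y\<bar> <= 1/2" "polar r x = polar s y"
 shows "r = s \<and> (r = 0 \<or> x = y)"
proof -
 have "r = s" using assms(5) norm_polar[OF assms(1), of x] norm_polar[OF assms(2), of y] by simp
 moreover have "r * sin (pi * x) = s * sin (pi * y)" using arg_cong[OF assms(5), of Re] by (simp add: polar_simps)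
 ultimately show ?thesis using sin_pi_inj[OF assms(3,4)] by auto
qed

lemma polar_half: "polar r (- (1/2)) = of_real r" "polar r (1/2) = - of_real r"
 by (simp_all add: complex_eq_iff polar_simps)

lemma polar_of_real:
 assumes "0 < s" "0 <= r" "\<bar>x\<bar> <= 1/2"
 shows "polar r x = of_real s ==> r = s \<and> x = - (1/2)" and "polar r x = - of_real s ==> r = s \<and> x = 1/2"
 using polar_inj[of r s x "- (1/2)"] polar_inj[of r s x "1/2"] assms by (auto simp: polar_half)

lemma half_plane_polar:
 assumes "0 <= Im \<zeta>" "\<zeta> ~= 0"
 defines "x \<equiv> Im (Ln (- \<i> * \<zeta>)) / pi"
 shows "\<bar>x\<bar> <= 1/2" "\<zeta> = polar (norm \<zeta>) x"
proof -
 have "Re (- \<i> * \<zeta>) \<ge> 0" "- \<i> * \<zeta> ~= 0" using assms(1,2) by auto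
 hence "\<bar>Im (Ln (- \<i> * \<zeta>))\<bar> <= pi / 2" using Re_Ln_pos_le by blast
 thus "\<bar>x\<bar> <= 1/2" by (simp add: x_def abs_mult field_simps)
 have "- \<i> * \<zeta> = of_real (norm (- \<i> * \<zeta>)) * cis (Im (Ln (- \<i> * \<zeta>)))"
  using exp_Ln[OF \<open>- \<i> * \<zeta> ~= 0\<close>] exp_eq_polar[of "Ln (- \<i> * \<zeta>)"] norm_exp_eq_Re[of "Ln (- \<i> * \<zeta>)"]
  by (simp add: exp_of_real[symmetric])
 hence "\<i> * (- \<i> * \<zeta>) = \<i> * (of_real (norm \<zeta>) * cis (pi * x))" by (simp add: x_def norm_mult)
 thus "\<zeta> = polar (norm \<zeta>) x" by (simp add: polar_def mult.assoc)
qed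

lemma powr_inj_nonneg:
 fixes a :: real
 assumes "0 < a" "0 <= r" "0 <= s" "r powr a = s powr a"
 shows "r = s"
 using powr_less_mono2[OF assms(1,2), of s] powr_less_mono2[OF assms(1,3), of r] assms(4) by linarith

text \<open>Rounding d t to the nearest integer j leaves x with |x| <= 1/2, and m is the residue of
  -j modulo d.\<close>

lemma finite_covered_surj:
 assumes d: "0 < (d::nat)"
 obtains m x where "m < d" "\<bar>x\<bar> <= 1/2" "circ t = circ ((x - real m) / real d)"
proof -
 define y where "y = real d * t"
 define j where "j = \<lfloor>y + 1/2\<rfloor>"
 define m where "m = nat ((- j) mod int d)"
 have jm: "(- j) mod int d = - j - int d * ((- j) div int d)" by (simp add: minus_mult_div_eq_mod[symmetric])
 have m: "int m = (- j) mod int d" using d by (simp add: m_def)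
 have md: "m < d" using m pos_mod_bound[of "int d" "- j"] d by (metis of_nat_0_less_iff of_nat_less_iff)
 have x: "\<bar>y - of_int j\<bar> <= 1/2" using floor_correct[of "y + 1/2"] unfolding j_def by (simp add: abs_if) linarith
 have "real m = - of_int j - real d * of_int ((- j) div int d)"
  using arg_cong[OF trans[OF m jm], of real_of_int] by simp
 hence "(y - of_int j - real m) / real d = t + of_int ((- j) div int d)"
  using d by (simp add: y_def field_simps)
 hence "circ t = circ ((y - of_int j - real m) / real d)" by (simp add: circ_eq_iff)
 thus thesis using that md x by blast
qed

section \<open>Cone coordinates and charts at the vertices\<close>

context polygon_gluing
begin

text \<open>The number of corners of the polygon that meet at the vertex.\<close>

definition deg :: "int => nat" where "deg c = (LEAST d. d > 0 \<and> (\<exists>k. nextn d c = c + k * L))"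

lemma deg: "deg c > 0" "\<exists>k. (nextv ^^ deg c) c = c + k * L"
proof -
 have "\<exists>d. d > 0 \<and> (\<exists>k. nextn d c = c + k * L)" using nextv_period by blast
 from LeastI_ex[OF this] show "deg c > 0" "\<exists>k. (nextv ^^ deg c) c = c + k * L" unfolding deg_def by blast+
qed

lemma deg_unique:
 assumes "m < deg c" "n < deg c" "nextn n c = nextn m c + k * L"
 shows "m = n"
proof -
 have no: "False" if ij: "i < j" "j < deg c" "nextn j c = nextn i c + l * L" for i j l
 proof -
  have "nextn i (nextn (j - i) c) = nextn i (c + l * L)"
   using ij(1,3) nextv_shift[of i c l] by (simp flip: funpow_add[THEN fun_cong, unfolded o_apply])
  hence "nextn (j - i) c = c + l * L" by (rule nextv_inj)
  hence "deg c <= j - i" unfolding deg_def using ij(1) by (intro Least_le) auto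
  thus False using ij(1,2) by simp
 qed
 have "nextn m c = nextn n c + (- k) * L" using assms(3) by simp
 hence "\<not> n < m" using no assms(1) by blast
 moreover have "\<not> m < n" using no assms(2,3) by blast
 ultimately show ?thesis by simp
qed

lemma nextv_mod_deg: "\<exists>n k. n < deg c \<and> nextn m c = nextn n c + k * L"
proof (induction m)
 case 0
 show ?case using deg(1)[of c] by (intro exI[of _ 0]) simp
next
 case (Suc m)
 then obtain n k where nk: "n < deg c" "nextn m c = nextn n c + k * L" by blast
 have s: "(nextv ^^ Suc m) c = (nextv ^^ Suc n) c + k * L" unfolding nextv_Suc nk(2) \<tau>_shift by simp
 show ?case
 proof (cases "Suc n < deg c")
  case False
  hence "Suc n = deg c" using nk(1) by simp
  then obtain l where "(nextv ^^ Suc n) c = c + l * L" using deg(2)[of c] by auto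
  hence "(nextv ^^ Suc m) c = nextn 0 c + (l + k) * L" using s by (simp add: distrib_right)
  thus ?thesis using deg(1)[of c] by blast
 qed (use s in blast)
qed

text \<open>Corners of one vertex have the same parity, so distinct ones are at least 2 apart along
  the boundary, too far for offsets of norm below 1.\<close>

lemma corner_unique:
 assumes "pexp (of_int a + \<zeta>) = pexp (of_int b + \<zeta>')" "even a \<longleftrightarrow> even b" "norm \<zeta> < 1" "norm \<zeta>' < 1"
 shows "\<zeta>' = \<zeta> \<and> (\<exists>k. b = a + k * L)"
proof -
 obtain k where k: "of_int b + \<zeta>' = of_int a + \<zeta> + of_int (k * L)" using assms(1) unfolding pexp_eq_iff by blast
 hence eq: "\<zeta> - \<zeta>' = of_int (b - a - k * L)" by (simp add: algebra_simps)
 have "norm (\<zeta> - \<zeta>') < 2" using norm_triangle_ineq4[of \<zeta> \<zeta>'] assms(3,4) by linarith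
 hence "\<bar>b - a - k * L\<bar> < 2" unfolding eq norm_of_int by linarith
 moreover have "even (b - a - k * L)" using assms(2) L(2) by simp
 ultimately have "b - a - k * L = 0" by presburger
 thus ?thesis using eq by (intro conjI exI[of _ k]) auto
qed

definition corner :: "int => nat \<times> real \<times> real => complex" where
 "corner c = (\<lambda>(m, r, x). pexp (of_int (nextn m c) + polar r x))"

text \<open>The \<open>deg c\<close> half discs at a vertex have total angle pi times
  \<open>deg c\<close>, and the exponent 2 / deg c turns them into one full disc. Corner m fills the
  sector around the angle -2 pi m / deg c; the sign is negative because the next corner is met
  across the positive ray x = -1/2.\<close>

definition cone :: "int => nat \<times> real \<times> real => complex" where
 "cone c = (\<lambda>(m, r, x). of_real (r powr (2 / real (deg c))) * circ ((x - real m) / real (deg c)))"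

definition cone_radius :: "int => real" where "cone_radius c = (3/4) powr (2 / real (deg c))"

lemma norm_cone: "norm (cone c (m, r, x)) = r powr (2 / real (deg c))" by (simp add: cone_def norm_mult)

text \<open>Between consecutive corners the two arguments coincide; from the last corner back to the
  first they differ by one full turn.\<close>

lemma cone_adjacent:
 assumes "m < deg c" "n < deg c" "nextn n c = (nextv ^^ Suc m) c + k * L"
 shows "circ ((- (1/2) - real m) / real (deg c)) = circ ((1/2 - real n) / real (deg c))"
proof (cases "Suc m < deg c")
 case True
 hence "n = Suc m" using deg_unique[OF True assms(2,3)] by simp
 thus ?thesis by simp
next
 case False
 hence d: "Suc m = deg c" using assms(1) by simp
 obtain l where "(nextv ^^ Suc m) c = c + l * L" using deg(2)[of c] d by auto
 hence "nextn n c = nextn 0 c + (l + k) * L" using assms(3) by (simp add: distrib_right)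
 hence "n = 0" using deg_unique[OF deg(1) assms(2)] by blast
 moreover have "(1/2) / real (deg c) - (- (1/2) - real m) / real (deg c) = 1"
  unfolding d[symmetric] by (simp add: field_simps)
 ultimately show ?thesis unfolding circ_eq_iff by simp
qed

lemma corner_adjacent:
 assumes "0 <= r" "r <= 1" "nextn n c = (nextv ^^ Suc m) c + k * L"
 shows "q (corner c (m, r, - (1/2))) = q (corner c (n, r, 1/2))"
proof -
 have "corner c (n, r, 1/2) = pexp (of_int ((nextv ^^ Suc m) c) - of_real r + of_int (k * L))"
  using polar_half(2)[of r] by (simp add: corner_def assms(3) algebra_simps)
 also have "... = e (of_int ((nextv ^^ Suc m) c) - r)"
  unfolding pexp_shift using pexp_of_real[of "of_int ((nextv ^^ Suc m) c) - r"] by simp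
 finally have 1: "corner c (n, r, 1/2) = e (of_int ((nextv ^^ Suc m) c) - r)" .
 have 2: "corner c (m, r, - (1/2)) = e (of_int (nextn m c) + r)"
  using polar_half(1)[of r] pexp_of_real[of "of_int (nextn m c) + r"] by (simp add: corner_def)
 show ?thesis unfolding 1 2 side_partner[OF assms(1,2)] ..
qed

text \<open>Both maps make the same identifications: all tips coincide, and the positive ray of each
  corner is laid on the negative ray of the next.\<close>

lemma corner_fibre:
 assumes r: "m < deg c" "0 <= r" "r <= 3/4" "\<bar>x\<bar> <= 1/2" and s: "n < deg c" "0 <= s" "s <= 3/4" "\<bar>y\<bar> <= 1/2"
 shows "q (corner c (m, r, x)) = q (corner c (n, s, y)) \<longleftrightarrow> cone c (m, r, x) = cone c (n, s, y)"
proof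
 have par: "even (nextn i c) \<longleftrightarrow> even (nextn j c)" for i j by (simp add: nextv_parity)
 have nr: "0 <= Im (polar r x)" "norm (polar r x) < 1" "norm (polar s y) < 1"
  using r s polar_Im_nonneg by (auto simp: norm_polar)
 assume eq: "q (corner c (m, r, x)) = q (corner c (n, s, y))"
 have "norm (corner c (n, s, y)) <= 1" using s polar_Im_nonneg by (simp add: corner_def norm_pexp_le_1)
 thus "cone c (m, r, x) = cone c (n, s, y)"
 proof (rule q_eq_corner[where \<zeta> = "polar r x" and m = m and c = c])
  assume "corner c (n, s, y) = pexp (of_int (nextn m c) + polar r x)"
  hence "pexp (of_int (nextn n c) + polar s y) = pexp (of_int (nextn m c) + polar r x)"
   by (simp add: corner_def)
  from corner_unique[OF this par nr(3,2)] obtain k where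
   k: "polar r x = polar s y" "nextn m c = nextn n c + k * L" by auto
  have "m = n" using deg_unique[OF s(1) r(1) k(2)] by simp
  thus ?thesis using polar_inj[OF r(2) s(2) r(4) s(4) k(1)] by (auto simp: cone_def)
 next
  fix j assume j: "polar r x = 0" "corner c (n, s, y) = pexp (of_int (nextn j c))"
  hence "pexp (of_int (nextn j c) + 0) = pexp (of_int (nextn n c) + polar s y)" by (simp add: corner_def)
  from corner_unique[OF this par _ nr(3)] have "polar s y = 0" by simp
  thus ?thesis using j(1) norm_polar[OF r(2), of x] norm_polar[OF s(2), of y] by (simp add: cone_def)
 next
  fix t assume t: "0 < t" "t < 1" "polar r x = of_real t"
   "corner c (n, s, y) = pexp (of_int ((nextv ^^ Suc m) c) - of_real t)"
  hence "pexp (of_int ((nextv ^^ Suc m) c) + - of_real t) = pexp (of_int (nextn n c) + polar s y)"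
   by (simp add: corner_def)
  from corner_unique[OF this par _ nr(3)] obtain k where
   k: "polar s y = - of_real t" "nextn n c = (nextv ^^ Suc m) c + k * L" using t(1,2) by auto
  have rx: "r = t" "x = - (1/2)" "s = t" "y = 1/2"
   using polar_of_real(1)[OF t(1) r(2,4) t(3)] polar_of_real(2)[OF t(1) s(2,4) k(1)] by blast+
  show ?thesis unfolding rx cone_def split_conv cone_adjacent[OF r(1) s(1) k(2)] ..
 next
  fix t j k assume t: "0 < t" "t < 1" "polar r x = - of_real t" "nextn m c = (nextv ^^ Suc j) c + k * L"
   "corner c (n, s, y) = pexp (of_int (nextn j c) + of_real t)"
  hence "pexp (of_int (nextn j c) + of_real t) = pexp (of_int (nextn n c) + polar s y)"
   by (simp add: corner_def)
  from corner_unique[OF this par _ nr(3)] obtain l where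
   l: "polar s y = of_real t" "nextn n c = nextn j c + l * L" using t(1,2) by auto
  have rx: "r = t" "x = 1/2" "s = t" "y = - (1/2)"
   using polar_of_real(2)[OF t(1) r(2,4) t(3)] polar_of_real(1)[OF t(1) s(2,4) l(1)] by blast+
  have mn: "nextn m c = (nextv ^^ Suc n) c + (k - l) * L"
   using t(4) unfolding nextv_Suc l(2) \<tau>_shift by (simp add: algebra_simps)
  show ?thesis unfolding rx cone_def split_conv cone_adjacent[OF s(1) r(1) mn] ..
 qed (use nr eq in \<open>auto simp: corner_def\<close>)
next
 assume eq: "cone c (m, r, x) = cone c (n, s, y)"
 have d: "0 < real (deg c)" using deg(1) by simp
 have rs: "r = s" using arg_cong[OF eq, of norm] powr_inj_nonneg[OF _ r(2) s(2), of "2 / real (deg c)"] d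
  by (simp add: norm_cone)
 show "q (corner c (m, r, x)) = q (corner c (n, s, y))"
 proof (cases "r = 0")
  case True
  have "corner c (i, 0, y) = e (of_int (nextn i c))" for i y
   using pexp_of_real[of "of_int (nextn i c)"] by (simp add: corner_def polar_def)
  thus ?thesis using True rs boundary_class_nextv by (simp add: q_e)
 next
  case False
  hence "circ ((x - real m) / real (deg c)) = circ ((y - real n) / real (deg c))"
   using eq r(2) by (simp add: cone_def rs)
  then obtain k where "(y - real n) / real (deg c) - (x - real m) / real (deg c) = of_int k"
   unfolding circ_eq_iff by (auto elim: Ints_cases)
  hence "((y - real n) - (x - real m)) / real (deg c) = of_int k" by (simp only: diff_divide_distrib)
  hence "(y - real n) - (x - real m) = of_int k * real (deg c)" using d by (simp add: divide_eq_eq)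
  \<comment> \<open>Equal directions differ by whole turns, so y - x is an integer. Being at most 1
    in absolute value, it leaves only the same corner or two adjacent ones.\<close>
  hence k: "y - x = of_int (int n - int m + k * int (deg c))" by (simp add: algebra_simps)
  have y1: "\<bar>y - x\<bar> <= 1" using r(4) s(4) by linarith
  hence "\<bar>int n - int m + k * int (deg c)\<bar> <= 1" unfolding k by linarith
  have adj: "\<exists>l. nextn j c = (nextv ^^ Suc i) c + l * L"
   if "i < deg c" "j < deg c" "int j - int i + t * int (deg c) = 1" for i j t
  proof -
   have "int j - int i - 1 = (- t) * int (deg c)" using that(3) by simp
   hence "(int j - (int i + 1)) mod int (deg c) = 0" by (metis diff_diff_eq mod_mult_self2_is_0)
   hence mm: "int j mod int (deg c) = (int i + 1) mod int (deg c)" by (simp add: mod_eq_dvd_iff dvd_eq_mod_eq_0)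
   have j: "int j mod int (deg c) = int j" using that(2) by simp
   show ?thesis
   proof (cases "Suc i < deg c")
    case True
    hence "j = Suc i" using mm j by simp
    thus ?thesis by (intro exI[of _ 0]) simp
   next
    case False
    hence id: "Suc i = deg c" using that(1) by simp
    hence "int i + 1 = int (deg c)" by simp
    hence "j = 0" using mm j by simp
    moreover obtain l where "(nextv ^^ Suc i) c = c + l * L" using deg(2)[of c] id by auto
    ultimately show ?thesis by (intro exI[of _ "- l"]) simp
   qed
  qed
  consider "int n - int m + k * int (deg c) = 0" | "int n - int m + k * int (deg c) = 1"
   | "int m - int n + (- k) * int (deg c) = 1" using \<open>\<bar>int n - int m + k * int (deg c)\<bar> <= 1\<close> by linarith
  thus ?thesis
  proof cases
   case 1
   hence "int m = int n + k * int (deg c)" by simp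
   hence "int m mod int (deg c) = int n mod int (deg c)" by simp
   hence "m = n" using r(1) s(1) by simp
   moreover have "y = x" using k 1 by (simp only: of_int_0)
   ultimately show ?thesis using rs by simp
  next
   case 2
   hence "y - x = 1" using k by simp
   hence xy: "y = 1/2" "x = - (1/2)" using r(4) s(4) by linarith+
   obtain l where l: "nextn n c = (nextv ^^ Suc m) c + l * L" using adj[OF r(1) s(1) 2] by blast
   have "s <= 1" using s(3) by simp
   from corner_adjacent[OF s(2) this l] show ?thesis unfolding xy rs .
  next
   case 3
   hence "int n - int m + k * int (deg c) = - 1" by simp
   hence "y - x = - 1" using k by simp
   hence xy: "x = 1/2" "y = - (1/2)" using r(4) s(4) by linarith+
   obtain l where l: "nextn m c = (nextv ^^ Suc n) c + l * L" using adj[OF s(1) r(1) 3] by blast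
   have "s <= 1" using s(3) by simp
   from corner_adjacent[OF s(2) this l] show ?thesis unfolding xy rs by (rule sym)
  qed
 qed
qed

end

context polygon_gluing
begin

definition cone_domain :: "int => (nat \<times> real \<times> real) set" where
 "cone_domain c = {..<deg c} \<times> {0..3/4} \<times> {- (1/2)..1/2}"

lemma corner_in_cball: "p \<in> cone_domain c ==> corner c p \<in> cball 0 1"
 using polar_Im_nonneg by (auto simp: cone_domain_def corner_def norm_pexp_le_1 abs_le_iff)

lemma continuous_map_corner: "continuous_map (top_of_set (cone_domain c)) X (q \<circ> corner c)"
proof (rule continuous_map_compose[OF _ continuous_q])
 have "continuous_on (cone_domain c) (\<lambda>p. complex_of_int ((nextv ^^ fst p) c))"
  by (rule continuous_on_compose2[OF Topological_Spaces.continuous_on_discrete[of UNIV "\<lambda>m. complex_of_int (nextn m c)"]])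
    (auto intro: continuous_intros)
 moreover have "continuous_on (cone_domain c) (\<lambda>p. polar (fst (snd p)) (snd (snd p)))"
  unfolding polar_def cis_conv_exp by (intro continuous_intros)
 ultimately have "continuous_on (cone_domain c) (\<lambda>p. pexp (complex_of_int ((nextv ^^ fst p) c) + polar (fst (snd p)) (snd (snd p))))"
  by (rule continuous_on_pexp[OF continuous_on_add])
 hence "continuous_on (cone_domain c) (corner c)" by (simp add: corner_def case_prod_beta')
 thus "continuous_map (top_of_set (cone_domain c)) (top_of_set (cball 0 1)) (corner c)"
  using corner_in_cball by (auto simp: continuous_map_in_subtopology)
qed

lemma continuous_map_cone: "continuous_map (top_of_set (cone_domain c)) euclidean (cone c)"
proof -
 have d: "0 < 2 / real (deg c)" using deg(1)[of c] by simp
 have "continuous_on (cone_domain c) (\<lambda>p. real (fst p))"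
  by (rule continuous_on_compose2[OF Topological_Spaces.continuous_on_discrete[of UNIV real]]) (auto intro: continuous_intros)
 moreover have "continuous_on (cone_domain c) (\<lambda>p. fst (snd p) powr (2 / real (deg c)))"
  using d by (intro continuous_on_powr' continuous_intros) (auto simp: cone_domain_def)
 moreover have "continuous_on (cone_domain c) (\<lambda>p. snd (snd p))" by (intro continuous_intros)
 ultimately have "continuous_on (cone_domain c) (\<lambda>p. of_real (fst (snd p) powr (2 / real (deg c))) *
   circ ((snd (snd p) - real (fst p)) / real (deg c)))" using deg(1)[of c]
  by (intro continuous_on_mult continuous_on_circ continuous_on_of_real continuous_on_divide continuous_on_diff) simp_all
 thus ?thesis by (simp add: cone_def case_prod_beta')
qed

lemma cone_surj: "ball 0 (cone_radius c) <= cone c ` cone_domain c"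
proof
 fix w :: complex assume w: "w \<in> ball 0 (cone_radius c)"
 have d: "0 < real (deg c)" using deg(1)[of c] by simp
 define r where "r = norm w powr (real (deg c) / 2)"
 have r: "r powr (2 / real (deg c)) = norm w" using d by (cases "w = 0") (simp_all add: r_def powr_powr)
 have "r <= 3/4"
 proof (rule ccontr)
  assume "\<not> r <= 3/4"
  hence "(3/4) powr (2 / real (deg c)) < r powr (2 / real (deg c))" using d by (intro powr_less_mono2) auto
  thus False using w unfolding r cone_radius_def by simp
 qed
 obtain t where t: "w = of_real (norm w) * circ t"
 proof (cases "w = 0")
  case False
  hence "norm (w / of_real (norm w)) = 1" by (simp add: norm_divide)
  then obtain t where "w / of_real (norm w) = circ t" by (metis circ_surj)
  thus thesis using that[of t] False by (simp add: field_simps)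
 qed (use that in auto)
 obtain m x where "m < deg c" "\<bar>x\<bar> <= 1/2" "circ t = circ ((x - real m) / real (deg c))"
  by (rule finite_covered_surj[OF deg(1)])
 moreover from this(3) have "w = cone c (m, r, x)" using t by (simp add: cone_def r)
 ultimately show "w \<in> cone c ` cone_domain c"
  using \<open>r <= 3/4\<close> by (intro image_eqI[of _ _ "(m, r, x)"]) (auto simp: cone_domain_def r_def abs_le_iff)
qed

lemma star_corner:
 assumes "z \<in> star c"
 obtains m \<zeta> where "m < deg c" "0 <= Im \<zeta>" "norm \<zeta> < 3/4" "z = pexp (of_int (nextn m c) + \<zeta>)"
proof -
 obtain j \<zeta> where j: "z = pexp (of_int (nextn j c) + \<zeta>)" "0 <= Im \<zeta>" "norm \<zeta> < 3/4"
  using assms unfolding star_def by blast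
 obtain m k where m: "m < deg c" "nextn j c = nextn m c + k * L" using nextv_mod_deg by blast
 have "of_int (nextn j c) + \<zeta> = (of_int (nextn m c) + \<zeta>) + of_int (k * L)" by (simp add: m(2))
 hence "z = pexp (of_int (nextn m c) + \<zeta>)" unfolding j(1) by (simp only: pexp_shift)
 thus thesis using that[OF m(1) j(2,3)] by simp
qed

text \<open>Away from the tip \<open>cone\<close> is a branch of the power with exponent 2 / deg c;
  the logarithmic form is the one from which holomorphy can be read off.\<close>

lemma half_disc_corner:
 assumes m: "m < deg c" and \<zeta>: "0 <= Im \<zeta>" "norm \<zeta> < 3/4"
 shows "\<exists>x. (m, norm \<zeta>, x) \<in> cone_domain c \<and> corner c (m, norm \<zeta>, x) = pexp (of_int (nextn m c) + \<zeta>) \<and>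
  (\<zeta> ~= 0 \<longrightarrow> cone c (m, norm \<zeta>, x) = exp (2 / of_nat (deg c) * Ln (- \<i> * \<zeta>)) * circ (- real m / real (deg c)))"
proof (cases "\<zeta> = 0")
 case True
 thus ?thesis using m by (intro exI[of _ 0]) (simp add: cone_domain_def corner_def polar_def)
next
 case False
 let ?x = "Im (Ln (- \<i> * \<zeta>)) / pi"
 note hp = half_plane_polar[OF \<zeta>(1) False]
 have "Ln (- \<i> * \<zeta>) = of_real (ln (norm \<zeta>)) + \<i> * of_real (pi * ?x)"
 proof (rule complex_eqI)
  have "- \<i> * \<zeta> ~= 0" using False by simp
  hence "Re (Ln (- \<i> * \<zeta>)) = ln (norm (- \<i> * \<zeta>))" by (rule Re_Ln)
  thus "Re (Ln (- \<i> * \<zeta>)) = Re (of_real (ln (norm \<zeta>)) + \<i> * of_real (pi * ?x))" by (simp add: norm_mult)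
 qed simp
 moreover have "2 / of_nat (deg c) * (of_real a + \<i> * of_real (pi * x)) =
   of_real (2 / real (deg c) * a) + of_real (2 * pi * (x / real (deg c))) * \<i>" for a x
  by (simp add: algebra_simps)
 ultimately have "2 / of_nat (deg c) * Ln (- \<i> * \<zeta>) =
   of_real (2 / real (deg c) * ln (norm \<zeta>)) + of_real (2 * pi * (?x / real (deg c))) * \<i>" by metis
 hence "exp (2 / of_nat (deg c) * Ln (- \<i> * \<zeta>)) = of_real (norm \<zeta> powr (2 / real (deg c))) * circ (?x / real (deg c))"
  using False by (simp only: exp_add exp_of_real circ_eq_exp powr_def) simp
 moreover have "circ ((?x - real m) / real (deg c)) = circ (?x / real (deg c)) * circ (- real m / real (deg c))"
  by (simp add: diff_divide_distrib flip: circ_add)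
 ultimately have "cone c (m, norm \<zeta>, ?x) = exp (2 / of_nat (deg c) * Ln (- \<i> * \<zeta>)) * circ (- real m / real (deg c))"
  unfolding cone_def split_conv by (simp only: mult.assoc)
 moreover have "- (1/2) <= ?x" "?x <= 1/2" using hp(1) unfolding abs_le_iff by linarith+
 hence "(m, norm \<zeta>, ?x) \<in> cone_domain c" using m \<zeta>(2) unfolding cone_domain_def by (simp del: divide_le_eq_numeral1)
 moreover have "corner c (m, norm \<zeta>, ?x) = pexp (of_int (nextn m c) + \<zeta>)"
  unfolding corner_def split_conv hp(2)[symmetric] ..
 ultimately show ?thesis by blast
qed

lemma star_image: "q ` star c = (q \<circ> corner c) ` {p \<in> cone_domain c. cone c p \<in> ball 0 (cone_radius c)}"
proof (intro subset_antisym subsetI)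
 have d: "0 < 2 / real (deg c)" using deg(1)[of c] by simp
 fix y assume "y \<in> q ` star c"
 then obtain z where z: "z \<in> star c" "y = q z" by blast
 obtain m \<zeta> where m: "m < deg c" "0 <= Im \<zeta>" "norm \<zeta> < 3/4" "z = pexp (of_int (nextn m c) + \<zeta>)"
  by (rule star_corner[OF z(1)])
 obtain x where x: "(m, norm \<zeta>, x) \<in> cone_domain c" "corner c (m, norm \<zeta>, x) = z"
  using half_disc_corner[OF m(1-3)] m(4) by blast
 have "norm \<zeta> powr (2 / real (deg c)) < (3/4) powr (2 / real (deg c))"
  using m(3) d by (intro powr_less_mono2) auto
 hence "cone c (m, norm \<zeta>, x) \<in> ball 0 (cone_radius c)" by (simp add: norm_cone cone_radius_def)
 thus "y \<in> (q \<circ> corner c) ` {p \<in> cone_domain c. cone c p \<in> ball 0 (cone_radius c)}"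
  using x z(2) by (intro image_eqI[of _ _ "(m, norm \<zeta>, x)"]) auto
next
 have d: "0 < 2 / real (deg c)" using deg(1)[of c] by simp
 fix y assume "y \<in> (q \<circ> corner c) ` {p \<in> cone_domain c. cone c p \<in> ball 0 (cone_radius c)}"
 then obtain m r x where p: "(m, r, x) \<in> cone_domain c" "cone c (m, r, x) \<in> ball 0 (cone_radius c)" "y = q (corner c (m, r, x))"
  by auto
 hence r: "0 <= r" "\<bar>x\<bar> <= 1/2" "r powr (2 / real (deg c)) < (3/4) powr (2 / real (deg c))"
  by (auto simp: cone_domain_def norm_cone cone_radius_def)
 have "r < 3/4"
 proof (rule ccontr)
  assume "\<not> r < 3/4"
  hence "(3/4) powr (2 / real (deg c)) <= r powr (2 / real (deg c))" using d by (intro powr_mono2) auto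
  thus False using r(3) by simp
 qed
 hence "corner c (m, r, x) \<in> star c" using polar_Im_nonneg[OF r(1,2)] norm_polar[OF r(1)]
  unfolding star_def corner_def split_conv mem_Collect_eq by (intro exI[of _ m] exI[of _ "polar r x"]) simp
 thus "y \<in> q ` star c" using p(3) by blast
qed

text \<open>\<open>corner\<close> and \<open>cone\<close> have the same fibres and so define a
  chart. In the open face it is locally a power function after an inverse of \<open>pexp\<close>;
  points off the face lie on the borders of the sectors, which are finitely many rays.\<close>

lemma vertex_chart:
 obtains \<phi> V where "complex_chart X (q ` star c, \<phi>)" "\<phi> ` q ` star c = ball 0 (cone_radius c)"
  "(\<phi> \<circ> q) holomorphic_on {z \<in> ball 0 1. q z \<in> q ` star c}"
  "finite V" "0 \<notin> V" "!!y. y \<in> q ` star c ==> y \<notin> face ==> \<exists>v\<in>V. v \<bullet> \<phi> y = 0"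
proof -
 have d: "0 < real (deg c)" using deg(1)[of c] by simp
 have P: "compact_space (top_of_set (cone_domain c))" unfolding cone_domain_def
  by (intro compact_space_subtopology) (auto intro!: compact_Times simp: finite_imp_compact)
 have fib: "(q \<circ> corner c) p = (q \<circ> corner c) p' \<longleftrightarrow> cone c p = cone c p'"
  if "p \<in> topspace (top_of_set (cone_domain c))" "p' \<in> topspace (top_of_set (cone_domain c))" for p p'
 proof -
  obtain m r x n s y where p: "p = (m, r, x)" "p' = (n, s, y)" by (metis surj_pair)
  have "m < deg c" "0 <= r" "r <= 3/4" "\<bar>x\<bar> <= 1/2" "n < deg c" "0 <= s" "s <= 3/4" "\<bar>y\<bar> <= 1/2"
   using that unfolding p cone_domain_def by (auto simp: abs_le_iff)
  from corner_fibre[OF this] show ?thesis unfolding p o_apply .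
 qed
 obtain \<phi> where \<phi>: "complex_chart X (q ` star c, \<phi>)"
  "!!p. p \<in> topspace (top_of_set (cone_domain c)) ==> \<phi> ((q \<circ> corner c) p) = cone c p"
  "\<phi> ` q ` star c = ball 0 (cone_radius c)"
 proof (rule complex_chart_common_fibres[OF Hausdorff_X P continuous_map_corner continuous_map_cone fib open_ball _ openin_star])
  show "ball 0 (cone_radius c) <= cone c ` topspace (top_of_set (cone_domain c))" using cone_surj by simp
  show "q ` star c = (q \<circ> corner c) ` {x \<in> topspace (top_of_set (cone_domain c)). cone c x \<in> ball 0 (cone_radius c)}"
   using star_image by simp
 qed (assumption, assumption, rule that, assumption+)
 have \<phi>c: "\<phi> (q (corner c p)) = cone c p" if "p \<in> cone_domain c" for p using \<phi>(2)[of p] that by simp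
 define g where "g m \<zeta> = exp (2 / of_nat (deg c) * Ln (- \<i> * \<zeta>)) * circ (- real m / real (deg c))" for m \<zeta>
 have \<phi>g: "\<phi> (q (pexp (of_int (nextn m c) + \<zeta>))) = g m \<zeta>"
  if m: "m < deg c" and \<zeta>: "0 <= Im \<zeta>" "norm \<zeta> < 3/4" "\<zeta> ~= 0" for m \<zeta>
  using half_disc_corner[OF m \<zeta>(1,2)] \<phi>c \<zeta>(3) unfolding g_def by metis
 have hol: "(\<phi> \<circ> q) holomorphic_on {z \<in> ball 0 1. q z \<in> q ` star c}" unfolding holomorphic_on_def
 proof
  fix z0 assume z0: "z0 \<in> {z \<in> ball 0 1. q z \<in> q ` star c}"
  hence n0: "norm z0 < 1" "z0 \<in> star c" using star_saturated[of z0 c] by auto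
  obtain m \<zeta>0 where m: "m < deg c" "0 <= Im \<zeta>0" "norm \<zeta>0 < 3/4" "z0 = pexp (of_int (nextn m c) + \<zeta>0)"
   by (rule star_corner[OF n0(2)])
  have \<zeta>0: "0 < Im \<zeta>0" using n0(1) m(4) by (simp add: norm_pexp_less_1)
  have z00: "z0 ~= 0" by (simp add: m(4) pexp_def)
  \<comment> \<open>A local inverse of \<open>pexp\<close> at z0, measured from the corner:
    \<open>pexp\<close> of the corner plus h z is z again.\<close>
  define h where "h z = \<zeta>0 + Ln (z / z0) / (\<i> * of_real (2 * pi / of_int L))" for z
  have K: "\<i> * of_real (2 * pi / of_int L) ~= 0" using L_pos by simp
  have h0: "h z0 = \<zeta>0" using z00 by (simp add: h_def)
  have hd: "h field_differentiable (at z0)"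
  proof -
   have "((\<lambda>z. Ln (z / z0)) has_field_derivative 1 / z0) (at z0)"
    using z00 by (auto intro!: derivative_eq_intros)
   hence "(h has_field_derivative 0 + (1 / z0) / (\<i> * of_real (2 * pi / of_int L))) (at z0)"
    unfolding h_def by (intro DERIV_add DERIV_const DERIV_cdivide)
   thus ?thesis unfolding field_differentiable_def by blast
  qed
  have hc: "isCont h z0" using hd by (rule field_differentiable_imp_continuous_at)
  have "\<forall>\<^sub>F z in nhds z0. 0 < Im (h z) \<and> norm (h z) < 3/4 \<and> z ~= 0"
  proof (intro eventually_conj)
   have t: "(h \<longlongrightarrow> \<zeta>0) (nhds z0)" using hc[unfolded isCont_def tendsto_at_iff_tendsto_nhds] unfolding h0 .
   have "\<forall>\<^sub>F z in nhds z0. h z \<in> {w. 0 < Im w}"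
    by (rule topological_tendstoD[OF t]) (use \<zeta>0 in \<open>auto simp: open_halfspace_Im_gt\<close>)
   thus "\<forall>\<^sub>F z in nhds z0. 0 < Im (h z)" by simp
   have "\<forall>\<^sub>F z in nhds z0. h z \<in> ball 0 (3/4)" by (rule topological_tendstoD[OF t]) (use m(3) in auto)
   thus "\<forall>\<^sub>F z in nhds z0. norm (h z) < 3/4" by simp
   show "\<forall>\<^sub>F z in nhds z0. z ~= 0" using z00 by (intro t1_space_nhds)
  qed
  hence ev: "\<forall>\<^sub>F z in nhds z0. g m (h z) = (\<phi> \<circ> q) z"
  proof (rule eventually_mono)
   fix z assume z: "0 < Im (h z) \<and> norm (h z) < 3/4 \<and> z ~= 0"
   have "pexp (of_int (nextn m c) + h z) = pexp (of_int (nextn m c) + \<zeta>0) * exp (Ln (z / z0))"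
    using K unfolding pexp_def h_def by (simp add: distrib_left exp_add)
   hence "pexp (of_int (nextn m c) + h z) = z" using z z00 m(4) by simp
   thus "g m (h z) = (\<phi> \<circ> q) z" using \<phi>g[OF m(1), of "h z"] z by (metis less_imp_le o_apply zero_complex.sel(2) less_irrefl)
  qed
  have "- \<i> * h z0 \<notin> \<real>\<^sub>\<le>\<^sub>0" using \<zeta>0 by (auto simp: h0 complex_nonpos_Reals_iff)
  moreover have "((\<lambda>\<zeta>. g m \<zeta>) field_differentiable (at \<zeta>))" if "- \<i> * \<zeta> \<notin> \<real>\<^sub>\<le>\<^sub>0" for \<zeta>
  proof -
   have "(Ln has_field_derivative inverse (- \<i> * \<zeta>)) (at (- \<i> * \<zeta>))"
    by (rule has_field_derivative_Ln[OF that])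
   moreover have "((\<lambda>\<zeta>. - \<i> * \<zeta>) has_field_derivative - \<i> * 1) (at \<zeta>)" by (intro DERIV_cmult DERIV_ident)
   ultimately have "((\<lambda>\<zeta>. Ln (- \<i> * \<zeta>)) has_field_derivative inverse (- \<i> * \<zeta>) * (- \<i> * 1)) (at \<zeta>)"
    by (rule DERIV_chain2)
   hence "((\<lambda>\<zeta>. Ln (- \<i> * \<zeta>)) field_differentiable (at \<zeta>))" unfolding field_differentiable_def by blast
   thus ?thesis
    unfolding g_def by (intro field_differentiable_mult field_differentiable_const field_differentiable_within_exp
      field_differentiable_compose[of "\<lambda>\<zeta>. 2 / of_nat (deg c) * Ln (- \<i> * \<zeta>)" _ exp, unfolded o_def])
  qed
  ultimately have "(\<lambda>z. g m (h z)) field_differentiable (at z0)"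
   using field_differentiable_compose[OF hd, of "g m"] by (simp add: o_def)
  hence "(\<phi> \<circ> q) field_differentiable (at z0)"
   unfolding field_differentiable_def using DERIV_cong_ev[OF refl ev refl] by blast
  thus "(\<phi> \<circ> q) field_differentiable (at z0 within {z \<in> ball 0 1. q z \<in> q ` star c})"
   by (rule field_differentiable_at_within)
 qed
 \<comment> \<open>Normals to the bordering rays: at corner m, x = 1/2 and x = -1/2 give the
   directions (1 - 2 m) / (2 deg c) and (-1 - 2 m) / (2 deg c) of a turn, and the factor of the
   imaginary unit makes them orthogonal.\<close>
 define V where "V = (\<lambda>j. \<i> * circ (real_of_int j / (2 * real (deg c)))) ` {- 2 * int (deg c) - 1..1}"
 have lines: "\<exists>v\<in>V. v \<bullet> \<phi> y = 0" if y: "y \<in> q ` star c" "y \<notin> face" for y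
 proof -
  obtain m r x where p: "(m, r, x) \<in> cone_domain c" "y = q (corner c (m, r, x))"
   using y(1) unfolding star_image by auto
  have m: "m < deg c" "0 <= r" "\<bar>x\<bar> <= 1/2" using p(1) by (auto simp: cone_domain_def)
  have "\<not> norm (corner c (m, r, x)) < 1" using y(2) p(2) unfolding face_def by auto
  hence "\<not> 0 < r * cos (pi * x)" by (simp add: corner_def norm_pexp_less_1 polar_simps)
  hence rx: "r = 0 \<or> x = 1/2 \<or> x = - (1/2)"
  proof (rule contrapos_np)
   assume n: "\<not> (r = 0 \<or> x = 1/2 \<or> x = - (1/2))"
   hence "\<bar>x\<bar> < 1/2" using m(3) by auto
   hence "\<bar>pi * x\<bar> < pi / 2" using mult_strict_left_mono[of "\<bar>x\<bar>" "1/2" pi] by (simp add: abs_mult)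
   hence "0 < cos (pi * x)" by (intro cos_gt_zero_pi) linarith+
   thus "0 < r * cos (pi * x)" using n m(2) by simp
  qed
  have orth: "(\<i> * circ t) \<bullet> (of_real s * circ t) = 0" for s t by (simp add: inner_complex_def algebra_simps)
  have "\<exists>j\<in>{- 2 * int (deg c) - 1..1}. \<phi> y = of_real (r powr (2 / real (deg c))) * circ (real_of_int j / (2 * real (deg c)))"
  proof -
   have y': "\<phi> y = of_real (r powr (2 / real (deg c))) * circ ((x - real m) / real (deg c))"
    using \<phi>c[OF p(1)] p(2) by (simp add: cone_def)
   from rx consider "r = 0" | "x = 1/2" | "x = - (1/2)" by blast
   thus ?thesis
   proof cases
    case 1
    thus ?thesis using y' by (intro bexI[of _ 0]) auto
   next
    case 2
    hence "(x - real m) / real (deg c) = real_of_int (1 - 2 * int m) / (2 * real (deg c))" using d by (simp add: field_simps)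
    thus ?thesis using y' m(1) by (intro bexI[of _ "1 - 2 * int m"]) auto
   next
    case 3
    hence "(x - real m) / real (deg c) = real_of_int (- 1 - 2 * int m) / (2 * real (deg c))" using d by (simp add: field_simps)
    thus ?thesis using y' m(1) by (intro bexI[of _ "- 1 - 2 * int m"]) auto
   qed
  qed
  then obtain j where j: "j \<in> {- 2 * int (deg c) - 1..1}"
   "\<phi> y = of_real (r powr (2 / real (deg c))) * circ (real_of_int j / (2 * real (deg c)))" by blast
  have "(\<i> * circ (real_of_int j / (2 * real (deg c)))) \<bullet> \<phi> y = 0" unfolding j(2) by (rule orth)
  thus ?thesis using j(1) unfolding V_def by blast
 qed
 have V0: "0 \<notin> V"
 proof
  assume "0 \<in> V"
  then obtain t where "\<i> * circ t = 0" unfolding V_def by auto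
  thus False using norm_circ[of t] by simp
 qed
 show thesis by (rule that[OF \<phi>(1,3) hol _ V0 lines]) (simp add: V_def)
qed

end

text \<open>The lines are treated one at a time: off one line the induction hypothesis applies, and
  continuity extends holomorphy across it.\<close>

lemma holomorphic_on_paste_across_lines:
 fixes f :: "complex => complex"
 assumes "finite V" "0 \<notin> V" "open S" "continuous_on S f" "f holomorphic_on S - (\<Union>v\<in>V. {z. v \<bullet> z = 0})"
 shows "f holomorphic_on S" using assms
proof (induction V arbitrary: S rule: finite_induct)
 case (insert v V)
 let ?T = "S - {z. v \<bullet> z = 0}"
 have o: "open ?T" using insert.prems(2) by (intro open_Diff closed_hyperplane)
 have "?T - (\<Union>v\<in>V. {z. v \<bullet> z = 0}) = S - (\<Union>v\<in>insert v V. {z. v \<bullet> z = 0})" by auto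
 hence h: "f holomorphic_on ?T - (\<Union>v\<in>V. {z. v \<bullet> z = 0})" using insert.prems(4) by (simp only:)
 have "0 \<notin> V" "continuous_on ?T f" using insert.prems(1) continuous_on_subset[OF insert.prems(3)] by auto
 from insert.IH[OF this(1) o this(2) h] have T: "f holomorphic_on ?T" .
 show ?case
 proof (rule holomorphic_on_paste_across_line[of _ v _ 0])
  show "f holomorphic_on S \<inter> {z. v \<bullet> z < 0}" "f holomorphic_on S \<inter> {z. 0 < v \<bullet> z}"
   by (rule holomorphic_on_subset[OF T]; force)+
 qed (use insert.prems in auto)
qed simp

lemma complex_chart_continuous:
 assumes "complex_chart X (U, \<phi>)"
 shows "continuous_map (X on U) euclidean \<phi>" "continuous_map (top_of_set (\<phi> ` U)) X (inv_into U \<phi>)"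
  and "inj_on \<phi> U" "U <= topspace X"
proof -
 have U: "openin X U" and h: "homeomorphic_map (X on U) (top_of_set (\<phi> ` U)) \<phi>"
  using assms by (simp_all add: complex_chart_def)
 have tU: "topspace (X on U) = U" using openin_subset[OF U] by auto
 show "U <= topspace X" using U by (rule openin_subset)
 show inj: "inj_on \<phi> U" using homeomorphic_imp_injective_map[OF h] tU by simp
 show "continuous_map (X on U) euclidean \<phi>"
  using homeomorphic_imp_continuous_map[OF h] by (simp add: continuous_map_in_subtopology)
 obtain g where g: "homeomorphic_maps (X on U) (top_of_set (\<phi> ` U)) \<phi> g"
  using h by (auto simp: homeomorphic_map_maps)
 hence "continuous_map (top_of_set (\<phi> ` U)) X g"
  by (simp add: homeomorphic_maps_def continuous_map_in_subtopology)
 moreover have "g w = inv_into U \<phi> w" if w: "w \<in> topspace (top_of_set (\<phi> ` U))" for w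
 proof -
  obtain y where "y \<in> U" "w = \<phi> y" using w by auto
  thus ?thesis using g tU inj by (simp add: homeomorphic_maps_def)
 qed
 ultimately show "continuous_map (top_of_set (\<phi> ` U)) X (inv_into U \<phi>)" by (rule continuous_map_eq)
qed

section \<open>The atlas of a glued polygon and its rotations\<close>

context polygon_gluing
begin

text \<open>The charts are the maps that are holomorphic on the open face and send the rest of their domain
 to finitely many lines, so that continuity suffices for holomorphy along the sides and at the vertices.\<close>

definition atlas :: "complex set chart set" where
 "atlas = {(U, \<phi>). complex_chart X (U, \<phi>) \<and> (\<phi> \<circ> q) holomorphic_on {z \<in> ball 0 1. q z \<in> U} \<and>
   (\<exists>V. finite V \<and> 0 \<notin> V \<and> (\<forall>y\<in>U - face. \<exists>v\<in>V. v \<bullet> \<phi> y = 0))}"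

lemma open_face_preimage:
 assumes "openin X U"
 shows "open {z \<in> ball 0 1. q z \<in> U}"
proof -
 have "openin (top_of_set (cball 0 1)) {z \<in> cball 0 1. q z \<in> U}" using assms unfolding openin_X_iff by (rule conjunct2)
 then obtain T where T: "open T" "{z \<in> cball 0 1. q z \<in> U} = cball 0 1 \<inter> T" by (auto simp: openin_open)
 have "{z \<in> ball 0 1. q z \<in> U} = ball 0 1 \<inter> {z \<in> cball 0 1. q z \<in> U}" by auto
 also have "... = ball 0 1 \<inter> T" unfolding T(2) by auto
 finally show ?thesis using T(1) by (simp add: open_Int)
qed

text \<open>On the face the expression is \<open>\<psi> \<circ> q\<close> after multiplication by a
  after the inverse of \<open>\<phi> \<circ> q\<close>; the rest of the domain lies on lines. The
  identity with a = 1 gives the transition maps, a rotation gives an automorphism.\<close>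

lemma atlas_holomorphic:
 assumes U: "(U, \<phi>) \<in> atlas" and W: "(W, \<psi>) \<in> atlas" and h: "continuous_map X X h"
  and a: "norm a = 1" "!!z. norm z < 1 ==> h (q z) = q (a * z)"
 shows "(\<psi> \<circ> h \<circ> inv_into U \<phi>) holomorphic_on \<phi> ` {y \<in> U. h y \<in> W}"
proof -
 define U' where "U' = {y \<in> U. h y \<in> W}"
 have cU: "complex_chart X (U, \<phi>)" "(\<phi> \<circ> q) holomorphic_on {z \<in> ball 0 1. q z \<in> U}"
  and cW: "complex_chart X (W, \<psi>)" "(\<psi> \<circ> q) holomorphic_on {z \<in> ball 0 1. q z \<in> W}"
  using U W by (auto simp: atlas_def)
 obtain V where V: "finite V" "0 \<notin> V" "!!y. y \<in> U - face ==> \<exists>v\<in>V. v \<bullet> \<phi> y = 0" using U by (auto simp: atlas_def)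
 note cc = complex_chart_continuous[OF cU(1)]
 have oU: "openin X U" and oW: "openin X W" using cU(1) cW(1) by (simp_all add: complex_chart_def)
 have "openin X {y \<in> topspace X. h y \<in> W}" using h oW by (rule openin_continuous_map_preimage)
 hence "openin X (U \<inter> {y \<in> topspace X. h y \<in> W})" using oU by (intro openin_Int)
 moreover have "U \<inter> {y \<in> topspace X. h y \<in> W} = U'" using cc(4) unfolding U'_def by auto
 ultimately have oU': "openin X U'" by simp
 have "complex_chart X (U', \<phi>)" by (rule complex_chart_restrict[OF cU(1) oU']) (auto simp: U'_def)
 hence oS: "open (\<phi> ` U')" by (simp add: complex_chart_def)
 have inv: "inv_into U \<phi> (\<phi> y) = y" if "y \<in> U" for y using cc(3) that by simp
 show ?thesis unfolding U'_def[symmetric]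
 proof (rule holomorphic_on_paste_across_lines[OF V(1,2) oS])
  have sub: "\<phi> ` U' <= \<phi> ` U" unfolding U'_def by auto
  have "continuous_map (top_of_set (\<phi> ` U')) X (inv_into U \<phi>)"
   by (rule continuous_map_from_subtopology_mono[OF cc(2) sub])
  hence "continuous_map (top_of_set (\<phi> ` U')) (X on W) (h \<circ> inv_into U \<phi>)"
   using continuous_map_compose[OF _ h] inv unfolding continuous_map_in_subtopology by (auto simp: U'_def)
  from continuous_map_compose[OF this complex_chart_continuous(1)[OF cW(1)]]
  show "continuous_on (\<phi> ` U') (\<psi> \<circ> h \<circ> inv_into U \<phi>)" by (simp add: o_assoc)
  define Z where "Z = {z \<in> ball 0 1. q z \<in> U'}"
  have oZ: "open Z" unfolding Z_def by (rule open_face_preimage[OF oU'])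
  have Z1: "z \<in> ball 0 1" "q z \<in> U" "q (a * z) \<in> W" "a * z \<in> ball 0 1" if "z \<in> Z" for z
   using that a unfolding Z_def U'_def by (auto simp: norm_mult)
  have hZ: "(\<phi> \<circ> q) holomorphic_on Z" using Z1 by (intro holomorphic_on_subset[OF cU(2)]) auto
  have iZ: "inj_on (\<phi> \<circ> q) Z"
  proof (rule inj_onI)
   fix z w assume "z \<in> Z" "w \<in> Z" "(\<phi> \<circ> q) z = (\<phi> \<circ> q) w"
   hence "q z = q w" using cc(3) Z1(2) by (auto dest: inj_onD)
   thus "z = w" using inj_onD[OF q_inj_interior] Z1(1) \<open>z \<in> Z\<close> \<open>w \<in> Z\<close> by blast
  qed
  obtain k where k: "k holomorphic_on (\<phi> \<circ> q) ` Z" "!!z. z \<in> Z ==> k ((\<phi> \<circ> q) z) = z"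
   using holomorphic_has_inverse[OF hZ oZ iZ] by metis
  have "(\<lambda>w. a * k w) holomorphic_on (\<phi> \<circ> q) ` Z" using k(1) by (intro holomorphic_intros)
  moreover have "(\<lambda>w. a * k w) ` (\<phi> \<circ> q) ` Z <= {z \<in> ball 0 1. q z \<in> W}"
  proof
   fix x assume "x \<in> (\<lambda>w. a * k w) ` (\<phi> \<circ> q) ` Z"
   then obtain z where "z \<in> Z" "x = a * k ((\<phi> \<circ> q) z)" by blast
   thus "x \<in> {z \<in> ball 0 1. q z \<in> W}" using k(2) Z1 by simp
  qed
  ultimately have "((\<psi> \<circ> q) \<circ> (\<lambda>w. a * k w)) holomorphic_on (\<phi> \<circ> q) ` Z"
   by (rule holomorphic_on_compose_gen[OF _ cW(2)])
  hence "(\<psi> \<circ> h \<circ> inv_into U \<phi>) holomorphic_on (\<phi> \<circ> q) ` Z"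
  proof (rule holomorphic_transform)
   fix w assume "w \<in> (\<phi> \<circ> q) ` Z"
   then obtain z where z: "z \<in> Z" "w = (\<phi> \<circ> q) z" by blast
   thus "((\<psi> \<circ> q) \<circ> (\<lambda>w. a * k w)) w = (\<psi> \<circ> h \<circ> inv_into U \<phi>) w"
    using k(2)[OF z(1)] inv[OF Z1(2)[OF z(1)]] a(2)[of z] Z1(1)[OF z(1)] by simp
  qed
  moreover have "\<phi> ` U' - (\<Union>v\<in>V. {z. v \<bullet> z = 0}) <= (\<phi> \<circ> q) ` Z"
  proof
   fix w assume w: "w \<in> \<phi> ` U' - (\<Union>v\<in>V. {z. v \<bullet> z = 0})"
   obtain y where y: "y \<in> U'" "w = \<phi> y" using DiffD1[OF w] by (rule imageE)
   have "y \<in> face"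
   proof (rule ccontr)
    assume "y \<notin> face"
    then obtain v where "v \<in> V" "v \<bullet> w = 0" using V(3)[of y] y unfolding U'_def by auto
    hence "w \<in> (\<Union>v\<in>V. {z. v \<bullet> z = 0})" by (intro UN_I[of v V]) (assumption, rule CollectI, assumption)
    from DiffD2[OF w this] show False .
   qed
   then obtain z where "z \<in> ball 0 1" "y = q z" unfolding face_def by (rule imageE)
   thus "w \<in> (\<phi> \<circ> q) ` Z" using y unfolding Z_def by auto
  qed
  ultimately show "(\<psi> \<circ> h \<circ> inv_into U \<phi>) holomorphic_on \<phi> ` U' - (\<Union>v\<in>V. {z. v \<bullet> z = 0})"
   by (rule holomorphic_on_subset)
 qed
qed

lemma face_in_atlas: "(face, face_chart) \<in> atlas"
proof -
 have "(face_chart \<circ> q) holomorphic_on {z \<in> ball 0 1. q z \<in> face}"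
  by (rule holomorphic_transform[OF holomorphic_on_ident]) (simp add: face_chart_q)
 thus ?thesis using complex_chart_face unfolding atlas_def by (auto intro!: exI[of _ "{}"])
qed

lemma star_in_atlas: "\<exists>\<phi>. (q ` star c, \<phi>) \<in> atlas \<and> \<phi> ` q ` star c = ball 0 (cone_radius c)"
proof -
 obtain \<phi> V where v: "complex_chart X (q ` star c, \<phi>)" "\<phi> ` q ` star c = ball 0 (cone_radius c)"
  "(\<phi> \<circ> q) holomorphic_on {z \<in> ball 0 1. q z \<in> q ` star c}"
  "finite V" "0 \<notin> V" "!!y. y \<in> q ` star c ==> y \<notin> face ==> \<exists>v\<in>V. v \<bullet> \<phi> y = 0"
  by (rule vertex_chart) (rule that, assumption+)
 have "\<forall>y\<in>q ` star c - face. \<exists>v\<in>V. v \<bullet> \<phi> y = 0" using v(6) by blast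
 hence "(q ` star c, \<phi>) \<in> atlas" unfolding atlas_def using v(1,3,4,5) by (simp only: mem_Collect_eq split_conv) blast
 thus ?thesis using v(2) by blast
qed

lemma e_in_star: "\<bar>t - of_int c\<bar> < 3/4 ==> e t \<in> star c"
proof -
 assume t: "\<bar>t - of_int c\<bar> < 3/4"
 have "e t = pexp (of_int (nextn 0 c) + of_real (t - of_int c))" using pexp_of_real[of t] by simp
 moreover have "norm (of_real (t - of_int c) :: complex) < 3/4" using t by (simp only: norm_of_real)
 ultimately show ?thesis unfolding star_def mem_Collect_eq
  by (intro exI[of _ 0] exI[of _ "of_real (t - of_int c)"]) (simp only: Im_complex_of_real, simp)
qed

lemma cball_cover:
 assumes "norm z <= 1"
 shows "norm z < 1 \<or> (\<exists>c. z \<in> star c)"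
proof (cases "norm z < 1")
 case False
 then obtain t where t: "z = e t" using assms e_surj[of z] by (metis order_le_less)
 have "\<bar>t - of_int \<lfloor>t + 1/2\<rfloor>\<bar> < 3/4" using floor_correct[of "t + 1/2"] by linarith
 thus ?thesis using e_in_star t by blast
qed simp

lemma complex_atlas_X: "complex_atlas X atlas" unfolding complex_atlas_def
proof (intro conjI)
 show "\<forall>c\<in>atlas. complex_chart X c" by (auto simp: atlas_def)
 show "(\<Union>(U, \<phi>)\<in>atlas. U) = topspace X"
 proof
  show "(\<Union>(U, \<phi>)\<in>atlas. U) <= topspace X" using complex_chart_continuous(4) by (force simp: atlas_def)
  show "topspace X <= (\<Union>(U, \<phi>)\<in>atlas. U)"
  proof
   fix y assume "y \<in> topspace X"
   then obtain z where z: "norm z <= 1" "y = q z" unfolding topspace_X by auto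
   show "y \<in> (\<Union>(U, \<phi>)\<in>atlas. U)"
   proof (cases "norm z < 1")
    case True
    hence "y \<in> face" using z(2) by (auto simp: face_def)
    thus ?thesis using face_in_atlas by blast
   next
    case False
    then obtain c where "z \<in> star c" using cball_cover[OF z(1)] by blast
    thus ?thesis using star_in_atlas[of c] z(2) by blast
   qed
  qed
 qed
 show "\<forall>(U, \<phi>)\<in>atlas. \<forall>(V, \<psi>)\<in>atlas. (\<psi> \<circ> inv_into U \<phi>) holomorphic_on \<phi> ` (U \<inter> V)"
 proof (intro ballI, clarify)
  fix U \<phi> V \<psi> assume "(U, \<phi>) \<in> atlas" "(V, \<psi>) \<in> atlas"
  from atlas_holomorphic[OF this continuous_map_id, of 1]
  show "(\<psi> \<circ> inv_into U \<phi>) holomorphic_on \<phi> ` (U \<inter> V)" by (simp add: Int_def)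
 qed
qed

lemma compact_riemann_surface_X: "compact_riemann_surface X atlas" unfolding compact_riemann_surface_def
 using complex_atlas_X compact_X connected_X Hausdorff_X by (auto simp: topspace_X)

text \<open>Points of X are sets of complex numbers, so a rotation of the disc acts by taking
  images; \<open>rotation_q\<close> shows that it respects classes when the gluing commutes with the
  shift by s.\<close>

definition rotation :: "int => complex set => complex set" where "rotation s y = (\<lambda>w. e (of_int s) * w) ` y"

lemma e_add: "e (s + t) = e s * e t" by (simp add: e_def add_divide_distrib circ_add)

lemma rotation_q:
 assumes s: "!!i. \<tau> (i + s) = \<tau> i + s" and z: "norm z <= 1"
 shows "rotation s (q z) = q (e (of_int s) * z)"
proof (cases "norm z < 1")
 case True
 thus ?thesis by (simp add: rotation_def q_interior norm_mult)
next
 case False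
 then obtain t where t: "z = e t" using z e_surj[of z] by (metis order_le_less)
 have "e (of_int s) * z = e (t + of_int s)" by (simp add: t e_add mult.commute)
 moreover have "rotation s (boundary_class t) = boundary_class (t + of_int s)"
 proof (cases "t \<in> \<int>")
  case True
  then obtain i where i: "t = of_int i" by (auto elim: Ints_cases)
  have n: "nextn m (i + s) = nextn m i + s" for m
  proof (induction m)
   case (Suc m)
   thus ?case unfolding nextv_Suc using s by simp
  qed simp
  have "e (of_int (nextn m (i + s))) = e (of_int s) * e (of_int (nextn m i))" for m
   unfolding n by (simp add: e_add mult.commute)
  thus ?thesis unfolding i rotation_def using boundary_class_vertex[of i] boundary_class_vertex[of "i + s"] by auto
 next
  case False
  hence "t + of_int s \<notin> \<int>" by (simp only: Ints_shift not_False_eq_True)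
  moreover have "partner (t + of_int s) = partner t + of_int s"
   unfolding partner_def floor_add_int by (simp add: s)
  ultimately show ?thesis using False by (simp add: rotation_def boundary_class_def e_add mult.commute)
 qed
 ultimately show ?thesis by (simp only: t q_e)
qed

lemma holomorphic_map_rotation:
 assumes s: "!!i. \<tau> (i + s) = \<tau> i + s"
 shows "holomorphic_map X atlas X atlas (rotation s)"
proof -
 have "continuous_map (top_of_set (cball 0 1)) X (q \<circ> (\<lambda>z. e (of_int s) * z))"
  by (rule continuous_map_compose[OF _ continuous_q])
    (auto simp: continuous_map_in_subtopology norm_mult intro!: continuous_intros)
 hence "continuous_map (top_of_set (cball 0 1)) X (rotation s \<circ> q)"
  by (rule continuous_map_eq) (simp add: rotation_q[OF s])
 hence c: "continuous_map X X (rotation s)" unfolding X_def by (rule continuous_map_from_quot_top)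
 moreover have "rotation s (q z) = q (e (of_int s) * z)" if "norm z < 1" for z using rotation_q[OF s] that by simp
 ultimately show ?thesis
  unfolding holomorphic_map_def using atlas_holomorphic[OF _ _ c norm_e, of _ _ _ _ "of_int s"] by auto
qed

lemma rotation_acts:
 assumes s: "!!i. \<tau> (i + s) = \<tau> i + s" and n: "n > 0" "L = int n * s"
 shows "acts_on_surface (Zmod n) X atlas"
proof (rule cyclic_acts_on_surface[OF complex_atlas_X n(1), of "\<lambda>i. rotation (i * s)"])
 have com: "\<tau> (j + i * s) = \<tau> j + i * s" for i j
 proof (induction i rule: int_induct[where k = 0])
  case (step1 i)
  thus ?case using s[of "j + i * s"] by (simp add: algebra_simps)
 next
  case (step2 i)
  thus ?case using s[of "j + (i - 1) * s"] by (simp add: algebra_simps)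
 qed simp
 show "holomorphic_map X atlas X atlas (rotation (i * s))" for i by (rule holomorphic_map_rotation[OF com])
 show "rotation ((i + j) * s) x = rotation (i * s) (rotation (j * s) x)" for i j x
  unfolding rotation_def image_image distrib_right of_int_add e_add mult.assoc ..
 have e0: "e 0 = 1" by (simp add: e_def)
 show "rotation (0 * s) x = x" for x by (simp add: rotation_def e0)
 have "e (of_int L) = e 0" using e_eq_iff[of 0 "of_int L"] by (metis add_0 mult_1)
 thus "rotation (int n * s) x = x" for x by (simp add: rotation_def e0 n(2)[symmetric] del: of_int_mult)
 show "\<exists>x\<in>topspace X. rotation (i * s) x ~= x" if i: "0 < i" "i < int n" for i
 proof
  have s0: "s > 0" using n L(1) by (metis less_le_trans mult_le_0_iff not_le of_nat_0_le_iff zero_less_numeral linorder_not_less)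
  have "e (of_int (i * s)) ~= e 0"
  proof
   assume "e (of_int (i * s)) = e 0"
   then obtain k where "0 = real_of_int (i * s) + of_int (k * L)" unfolding e_eq_iff by blast
   hence "0 = i * s + k * L" by (metis of_int_0 of_int_add of_int_eq_iff)
   hence "(i + k * int n) * s = 0" unfolding n(2) by (simp add: algebra_simps)
   hence "i + k * int n = 0" using s0 by simp
   hence "int n dvd i" by (metis add.commute add.inverse_unique dvd_minus_iff dvd_triv_right)
   thus False using i zdvd_imp_le by fastforce
  qed
  hence ne: "e (of_int (i * s)) * (1/2) ~= 1/2" by (simp add: e0)
  have h: "norm (1/2 :: complex) <= 1" by (simp add: norm_divide)
  have "q (e (of_int (i * s)) * (1/2)) ~= q (1/2)"
   using ne q_eq_interior[of "e (of_int (i * s)) * (1/2)" "1/2"] by (simp add: norm_mult norm_divide)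
  thus "rotation (i * s) (q (1/2)) ~= q (1/2)" unfolding rotation_q[OF com h] .
 qed (auto simp: topspace_X)
qed

end

section \<open>Winding numbers along the sides\<close>

definition clamp01 :: "real => real" where "clamp01 x = max 0 (min 1 x)"

lemma clamp01_simps: "x <= 0 ==> clamp01 x = 0" "1 <= x ==> clamp01 x = 1" "0 <= x ==> x <= 1 ==> clamp01 x = x"
 by (auto simp: clamp01_def)

context polygon_gluing
begin

text \<open>The copy of the side glued to side i that lies in the turn starting at corner i.\<close>

definition opposite :: "int => int" where "opposite i = i + (\<tau> i - i) mod L"

lemma opposite: "i < opposite i" "opposite i + 1 <= i + L" "\<exists>k. opposite i = \<tau> i + k * L" "odd (opposite i) \<longleftrightarrow> even i"
proof -
 have m: "(\<tau> i - i) mod L = \<tau> i - i + (- ((\<tau> i - i) div L)) * L" by (simp add: minus_div_mult_eq_mod[symmetric])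
 have r: "0 <= (\<tau> i - i) mod L" "(\<tau> i - i) mod L < L" using L(1) by simp_all
 have "odd ((\<tau> i - i) mod L)" unfolding m using \<tau>_parity[of i] L(2) by auto
 hence "(\<tau> i - i) mod L ~= 0" by (metis even_zero)
 thus "i < opposite i" "opposite i + 1 <= i + L" using r by (simp_all add: opposite_def)
 show "\<exists>k. opposite i = \<tau> i + k * L" unfolding opposite_def m by (intro exI[of _ "- ((\<tau> i - i) div L)"]) simp
 show "odd (opposite i) \<longleftrightarrow> even i" using \<open>odd ((\<tau> i - i) mod L)\<close> by (simp add: opposite_def)
qed

text \<open>Along the turn from i to i + L it climbs from 0 to 1 on side i, stays at 1, and falls
  back to 0 on the glued side. Its image under \<open>circ\<close> respects the gluing and winds
  along this pair of sides only.\<close>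

definition height :: "int => real => real" where
 "height i t = clamp01 (t - of_int i) - clamp01 (t - of_int (opposite i))"

lemma height_first: "of_int i <= t ==> t <= of_int i + 1 ==> height i t = t - of_int i"
proof -
 assume t: "of_int i <= t" "t <= of_int i + 1"
 have "of_int i + 1 <= real_of_int (opposite i)" using opposite(1)[of i] by linarith
 thus ?thesis using t unfolding height_def by (simp add: clamp01_simps)
qed

lemma height_opposite:
 "of_int (opposite i) <= t ==> t <= of_int (opposite i) + 1 ==> height i t = of_int (opposite i) + 1 - t"
proof -
 assume t: "of_int (opposite i) <= t" "t <= of_int (opposite i) + 1"
 have "of_int i + 1 <= real_of_int (opposite i)" using opposite(1)[of i] by linarith
 thus ?thesis using t unfolding height_def by (simp add: clamp01_simps)
qed

lemma circ_height_other:
 assumes "of_int j <= t" "t <= of_int j + 1" "j ~= i" "j ~= opposite i"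
 shows "circ (height i t) = 1"
proof -
 have c: "clamp01 (t - of_int k) = of_int (if j < k then 0 else 1)" if "j ~= k" for k
 proof (cases "j < k")
  case True
  hence "of_int j + 1 <= real_of_int k" by linarith
  thus ?thesis using True assms(2) by (simp add: clamp01_simps)
 next
  case False
  hence "of_int k + 1 <= real_of_int j" using that by linarith
  thus ?thesis using False assms(1) by (simp add: clamp01_simps)
 qed
 show ?thesis unfolding height_def c[OF assms(3)] c[OF assms(4)] of_int_diff[symmetric] by (rule circ_of_int)
qed

lemma circ_height_int: "circ (height i (of_int j)) = 1"
proof -
 consider "j = i" | "j = opposite i" | "j ~= i" "j ~= opposite i" by blast
 thus ?thesis
 proof cases
  case 3
  thus ?thesis by (intro circ_height_other[of j]) simp_all
 qed (simp_all add: height_first height_opposite)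
qed

lemma circ_height_boundary_class:
 assumes t: "of_int i <= t" "t <= of_int (i + L)" and t': "of_int i <= t'" "t' <= of_int (i + L)"
  and eq: "boundary_class t = boundary_class t'"
 shows "circ (height i t) = circ (height i t')"
proof (cases "t \<in> \<int>")
 case True
 then obtain j where j: "t = of_int j" by (auto elim: Ints_cases)
 have "\<exists>m k. t' = of_int (nextn m j + k * L)" using eq unfolding j boundary_class_eq_vertex .
 then obtain k where "t' = of_int k" by blast
 thus ?thesis using j circ_height_int by simp
next
 case False
 let ?j = "\<lfloor>t\<rfloor>"
 have j: "of_int ?j < t" "t < of_int ?j + 1"
  using False floor_correct[of t] Ints_of_int[of ?j] by (auto simp: order_le_less)
 have jr: "i <= ?j" "?j < i + L" using t j by linarith+
 from eq consider k where "t' = t + of_int (k * L)" | k where "t' = partner t + of_int (k * L)"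
  unfolding boundary_class_eq_nonint[OF False] by (metis e_eq_iff)
 thus ?thesis
 proof cases
  case 1
  have "t ~= of_int i" "t ~= of_int (i + L)" using False by (metis Ints_of_int)+
  hence "of_int i < t" "t < of_int (i + L)" using t by linarith+
  hence "\<bar>of_int (k * L)\<bar> < real_of_int L" using 1 t' by auto
  hence "\<bar>k * L\<bar> < L" by linarith
  hence "k = 0" using L(1) by (simp add: abs_mult mult_less_cancel_right1)
  thus ?thesis using 1 by simp
 next
  case 2
  have t'e: "t' = of_int (\<tau> ?j + k * L) + 1 + of_int ?j - t" using 2 by (simp add: partner_def)
  have t'f: "of_int (\<tau> ?j + k * L) < t'" "t' < of_int (\<tau> ?j + k * L) + 1" using t'e j by linarith+
  have r: "i <= \<tau> ?j + k * L" "\<tau> ?j + k * L < i + L" using t'f t' by linarith+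
  obtain l where l: "opposite i = \<tau> i + l * L" using opposite(3) by blast
  have uniq: "x = y" if "x = y + m * L" "i <= x" "x < i + L" "i <= y" "y < i + L" for x y m
  proof -
   have "\<bar>m * L\<bar> < L" using that by auto
   hence "m = 0" using L(1) by (simp add: abs_mult mult_less_cancel_right1)
   thus ?thesis using that(1) by simp
  qed
  have or: "i <= opposite i" "opposite i < i + L" using opposite(1,2)[of i] by linarith+
  consider "?j = i" | "?j = opposite i" | "?j ~= i" "?j ~= opposite i" by blast
  thus ?thesis
  proof cases
   case 1
   have "\<tau> ?j + k * L = opposite i + (k - l) * L" unfolding 1 l by (simp add: algebra_simps)
   hence o: "\<tau> ?j + k * L = opposite i" by (rule uniq) (use r or in auto)
   have "height i t' = of_int (opposite i) + 1 - t'" using t'f unfolding o by (intro height_opposite) auto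
   also have "... = t - of_int i" using t'e[unfolded o] 1 by simp
   finally show ?thesis using height_first[of i t] j 1 by simp
  next
   case 2
   have "\<tau> (opposite i) = i + l * L" unfolding l \<tau>_shift \<tau>_invol ..
   hence "\<tau> ?j + k * L = i + (l + k) * L" unfolding 2 by (simp add: algebra_simps)
   hence o: "\<tau> ?j + k * L = i" by (rule uniq) (use r L(1) in auto)
   have "height i t' = t' - of_int i" using t'f unfolding o by (intro height_first) auto
   also have "... = of_int (opposite i) + 1 - t" using t'e[unfolded o] 2 by simp
   finally show ?thesis using height_opposite[of i t] j 2 by simp
  next
   case 3
   have a: "\<tau> ?j + k * L ~= i"
   proof
    assume "\<tau> ?j + k * L = i"
    hence "\<tau> i = ?j + k * L" using \<tau>_shift[of "\<tau> ?j" k] \<tau>_invol by simp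
    hence "?j = opposite i + (- k - l) * L" unfolding l by (simp add: algebra_simps)
    hence "?j = opposite i" by (rule uniq) (use jr or in auto)
    thus False using 3 by simp
   qed
   have b: "\<tau> ?j + k * L ~= opposite i"
   proof
    assume "\<tau> ?j + k * L = opposite i"
    hence "\<tau> (\<tau> ?j + k * L) = \<tau> (\<tau> i + l * L)" using l by simp
    hence "?j + k * L = i + l * L" unfolding \<tau>_shift \<tau>_invol .
    hence "?j = i + (l - k) * L" by (simp add: algebra_simps)
    hence "?j = i" by (rule uniq) (use jr L(1) in auto)
    thus False using 3 by simp
   qed
   show ?thesis
    using circ_height_other[of ?j t i] circ_height_other[of "\<tau> ?j + k * L" t' i] j t'f 3 a b by simp
  qed
 qed
qed

text \<open>Scaling the height by the radius extends the map over the disc: it is constant at the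
  centre, and since the height is 0 at both ends of the turn no cut appears.\<close>

lemma side_winding_map:
 obtains g where "continuous_map X unit_circle g"
  "!!r t. 0 <= r ==> r <= 1 ==> of_int i <= t ==> t <= of_int (i + L) ==> g (q (of_real r * e t)) = circ (r * height i t)"
proof -
 define R where "R = {0..1::real} \<times> {of_int i..real_of_int (i + L)}"
 define \<pi> where "\<pi> = (\<lambda>(r, t). q (of_real r * e t))"
 define h where "h = (\<lambda>(r, t). circ (r * height i t))"
 have "continuous_on R (\<lambda>p. of_real (fst p) * e (snd p))" by (intro continuous_intros)
 hence "continuous_map (top_of_set R) X (q \<circ> (\<lambda>p. of_real (fst p) * e (snd p)))"
  by (intro continuous_map_compose[OF _ continuous_q]) (auto simp: continuous_map_in_subtopology R_def norm_mult)
 hence c\<pi>: "continuous_map (top_of_set R) X \<pi>" by (simp add: \<pi>_def o_def case_prod_beta')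
 have "continuous_on R (\<lambda>p. circ (fst p * height i (snd p)))"
  unfolding height_def clamp01_def by (intro continuous_intros)
 hence ch: "continuous_map (top_of_set R) unit_circle h"
  by (auto simp: continuous_map_in_subtopology h_def case_prod_beta')
 have surj: "\<pi> ` R = topspace X"
 proof
  show "\<pi> ` R <= topspace X" unfolding topspace_X R_def \<pi>_def by (auto simp: norm_mult)
  show "topspace X <= \<pi> ` R"
  proof
   fix y assume "y \<in> topspace X"
   then obtain z where z: "norm z <= 1" "y = q z" unfolding topspace_X by auto
   have "\<exists>t. of_int i <= t \<and> t <= of_int (i + L) \<and> z = of_real (norm z) * e t"
   proof (cases "z = 0")
    case True
    thus ?thesis using L(1) by (intro exI[of _ "of_int i"]) simp
   next
    case False
    hence "norm (z / (of_real (norm z) * e (of_int i))) = 1" by (simp add: norm_divide norm_mult)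
    then obtain s where s: "0 <= s" "s < of_int L" "z / (of_real (norm z) * e (of_int i)) = e s" by (rule e_surj)
    have "e (of_int i) ~= 0" using norm_e[of "of_int i"] by force
    hence "z = of_real (norm z) * e (of_int i + s)" using s(3) False by (simp add: e_add field_simps)
    thus ?thesis using s(1,2) by (intro exI[of _ "of_int i + s"]) simp
   qed
   then obtain t where t: "of_int i <= t" "t <= of_int (i + L)" "z = of_real (norm z) * e t" by blast
   have "y = \<pi> (norm z, t)" unfolding \<pi>_def split_conv z(2) using t(3) by simp
   thus "y \<in> \<pi> ` R" using z(1) t(1,2) by (intro image_eqI[of _ _ "(norm z, t)"]) (auto simp: R_def)
  qed
 qed
 have fib: "h p = h p'" if "p \<in> R" "p' \<in> R" "\<pi> p = \<pi> p'" for p p'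
 proof -
  obtain r t r' t' where p: "p = (r, t)" "p' = (r', t')" by (metis surj_pair)
  have r: "0 <= r" "r <= 1" "0 <= r'" "r' <= 1" and t: "of_int i <= t" "t <= of_int (i + L)" "of_int i <= t'" "t' <= of_int (i + L)"
   using that(1,2) unfolding p R_def by auto
  have n: "norm (of_real r * e t) = r" "norm (of_real r' * e t') = r'" using r by (simp_all add: norm_mult)
  have qq: "q (of_real r * e t) = q (of_real r' * e t')" using that(3) unfolding p \<pi>_def by simp
  show ?thesis
  proof (cases "r < 1 \<or> r' < 1")
   case True
   have z: "of_real r * e t = of_real r' * e t'"
   proof (cases "r < 1")
    case True
    thus ?thesis using qq q_eq_interior[of "of_real r * e t" "of_real r' * e t'"] n r by simp
   next
    case False
    hence "r' < 1" using True by simp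
    thus ?thesis using qq q_eq_interior[of "of_real r' * e t'" "of_real r * e t"] n r by (metis (no_types))
   qed
   hence rr: "r = r'" using n by metis
   show ?thesis
   proof (cases "r = 0")
    case False
    hence "e t = e t'" using z rr by simp
    hence "boundary_class t = boundary_class t'" using q_e by metis
    hence "circ (height i t) = circ (height i t')" by (rule circ_height_boundary_class[OF t])
    moreover obtain k where k: "t' = t + of_int (k * L)" using \<open>e t = e t'\<close> unfolding e_eq_iff by blast
    have "height i t = height i t'"
    proof (cases "k = 0")
     case False
     hence "\<bar>real_of_int (k * L)\<bar> \<ge> of_int L" using L(1) by (simp add: abs_mult mult_le_cancel_right1)
     hence "(t = of_int i \<and> t' = of_int (i + L)) \<or> (t' = of_int i \<and> t = of_int (i + L))"
      using k t by (auto simp: abs_le_iff le_minus_iff abs_if split: if_splits)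
     moreover have "height i (of_int i) = 0" using height_first[of i "of_int i"] by simp
     moreover have "height i (of_int (i + L)) = 0"
     proof -
      have "of_int (opposite i) + 1 <= real_of_int (i + L)" using opposite(2)[of i] by linarith
      moreover have "of_int i + 1 <= real_of_int (i + L)" using L(1) by linarith
      ultimately show ?thesis unfolding height_def by (simp add: clamp01_simps)
     qed
     ultimately show ?thesis by auto
    qed (use k in simp)
    ultimately show ?thesis unfolding p h_def using rr by simp
   qed (use rr in \<open>simp add: p h_def\<close>)
  next
   case False
   hence "r = 1" "r' = 1" using r by auto
   thus ?thesis using circ_height_boundary_class[OF t] qq unfolding p h_def by (simp add: q_e)
  qed
 qed
 define g where "g y = h (SOME p. p \<in> R \<and> \<pi> p = y)" for y
 have g: "g (\<pi> p) = h p" if "p \<in> R" for p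
 proof -
  have "\<exists>p'. p' \<in> R \<and> \<pi> p' = \<pi> p" using that by blast
  from someI_ex[OF this] show ?thesis unfolding g_def using fib[OF _ that] by blast
 qed
 have "quotient_map (top_of_set R) X \<pi>"
 proof (rule T1_Spaces.continuous_imp_quotient_map[OF c\<pi> _ Hausdorff_X])
  show "compact_space (top_of_set R)" unfolding R_def by (intro compact_space_subtopology) (simp add: compact_Times)
 qed (use surj in simp)
 moreover have "continuous_map (top_of_set R) unit_circle (g \<circ> \<pi>)"
  by (rule continuous_map_eq[OF ch]) (simp add: g)
 ultimately have cg: "continuous_map X unit_circle g" by (rule continuous_compose_quotient_map)
 show thesis
 proof (rule that[OF cg])
  fix r t :: real assume "0 <= r" "r <= 1" "of_int i <= t" "t <= of_int (i + L)"
  hence "(r, t) \<in> R" by (simp add: R_def)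
  from g[OF this] show "g (q (of_real r * e t)) = circ (r * height i t)" by (simp add: \<pi>_def h_def)
 qed
qed

end

section \<open>Generators of the first homology of a glued polygon\<close>

context polygon_gluing
begin

definition side_chain :: "int => complex set chain" where
 "side_chain i = path_chain (\<lambda>u. q (e (of_int i + u)))"

text \<open>Even sides are glued to odd ones, so this picks exactly one side from each glued
  pair.\<close>

definition edges :: "int set" where "edges = {i \<in> {0..<L}. even i}"

definition edge_span :: "complex set chain set" where
 "edge_span = {c. \<exists>n. boundary 1 X (c - (\<Sum>i\<in>edges. (n i) *. (side_chain i)))}"

lemma finite_edges: "finite edges" by (rule finite_subset[of _ "{0..<L}"]) (auto simp: edges_def)

lemma edge_span_diff: "c \<in> edge_span ==> d \<in> edge_span ==> c - d \<in> edge_span"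
proof -
 assume "c \<in> edge_span" "d \<in> edge_span"
 then obtain m n where "boundary 1 X (c - (\<Sum>i\<in>edges. (m i) *. (side_chain i)))"
  "boundary 1 X (d - (\<Sum>i\<in>edges. (n i) *. (side_chain i)))" unfolding edge_span_def by blast
 from singular_relboundary_diff[OF this]
 have "boundary 1 X ((c - d) - (\<Sum>i\<in>edges. (m i - n i) *. (side_chain i)))"
  by (simp add: frag_cmul_diff_distrib sum_subtractf algebra_simps)
 thus ?thesis unfolding edge_span_def by (intro CollectI exI[of _ "\<lambda>i. m i - n i"])
qed

lemma edge_span_boundary: "boundary 1 X b ==> b \<in> edge_span"
 unfolding edge_span_def by (intro CollectI exI[of _ "\<lambda>_. 0"]) simp

lemma edge_span_add: "c \<in> edge_span ==> d \<in> edge_span ==> c + d \<in> edge_span"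
 using edge_span_diff[of c "0 - d"] edge_span_diff[OF edge_span_boundary[of 0], of d] by simp

lemma push_boundary:
 assumes "chain 1 (top_of_set (cball 0 1)) c" "bdry 1 c = 0"
 shows "boundary 1 X (chain_map 1 q c)"
 by (rule contractible_image_boundary[OF _ continuous_q assms])
   (simp add: contractible_space_top_of_set convex_imp_contractible)

lemma cball_path_chain:
 assumes "continuous_on {0..1} p" "!!u. 0 <= u ==> u <= 1 ==> norm (p u) <= 1"
 shows "chain 1 (top_of_set (cball 0 1)) (path_chain p)"
 using assms by (intro singular_chain_path_chain) (auto simp: continuous_map_in_subtopology)

lemma side_chain_push: "side_chain i = chain_map 1 q (path_chain (\<lambda>u. e (of_int i + u)))"
 unfolding chain_map_path_chain side_chain_def by (simp add: o_def)

lemma side_continuous: "continuous_map unit_interval X (\<lambda>u. q (e (of_int i + u)))"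
proof -
 have "continuous_map unit_interval (top_of_set (cball 0 1)) (\<lambda>u. e (of_int i + u))"
  by (auto simp: continuous_map_in_subtopology intro!: continuous_intros)
 from continuous_map_compose[OF this continuous_q] show ?thesis by (simp add: o_def)
qed

lemma side_chain_in_edge_span: "side_chain i \<in> edge_span"
proof -
 have ev: "side_chain j \<in> edge_span" if "even j" for j
 proof -
  have jm: "j mod L = j + (- (j div L)) * L" by (simp add: minus_div_mult_eq_mod[symmetric])
  have "e (of_int (j mod L) + u) = e (of_int j + u)" for u
   unfolding e_eq_iff by (intro exI[of _ "j div L"]) (simp add: jm)
  hence eq: "side_chain (j mod L) = side_chain j" unfolding side_chain_def by simp
  have "even (j mod L)" unfolding jm using that L(2) by simp
  hence jE: "j mod L \<in> edges" using L(1) unfolding edges_def by simp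
  have "(\<Sum>i\<in>edges. (if i = j mod L then 1 else 0) *. (side_chain i)) = (\<Sum>i\<in>edges. if i = j mod L then side_chain i else 0)"
   by (rule sum.cong) auto
  also have "... = side_chain j" using jE finite_edges eq by simp
  finally show ?thesis unfolding edge_span_def
   by (intro CollectI exI[of _ "\<lambda>i. if i = j mod L then 1 else 0"]) simp
 qed
 show ?thesis
 proof (cases "even i")
  case False
  have "path_simplex (\<lambda>u. q (e (of_int i + (1 - u)))) = path_simplex (\<lambda>u. q (e (of_int (\<tau> i) + u)))"
  proof (rule path_simplex_cong)
   fix u :: real assume "0 <= u" "u <= 1"
   thus "q (e (of_int i + (1 - u))) = q (e (of_int (\<tau> i) + u))"
    using side_reversed[of "1 - u" i] by (simp add: algebra_simps)
  qed
  hence "boundary 1 X (side_chain i + side_chain (\<tau> i))"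
   using reverse_path_boundary[OF side_continuous[of i]] unfolding side_chain_def by simp
  moreover have "side_chain (\<tau> i) \<in> edge_span" using ev \<tau>_parity False by simp
  ultimately show ?thesis using edge_span_diff[OF edge_span_boundary] by fastforce
 qed (rule ev)
qed

definition radius_chain :: "complex => complex set chain" where
 "radius_chain z = chain_map 1 q (path_chain (\<lambda>u. of_real u * z))"

lemma radius_path: "norm (z :: complex) <= 1 ==> chain 1 (top_of_set (cball 0 1)) (path_chain (\<lambda>u. of_real u * z))"
 by (rule cball_path_chain) (auto intro!: continuous_intros mult_le_one simp: norm_mult)

lemma radius_add_path:
 assumes "continuous_on {0..1} p" "!!u. 0 <= u ==> u <= 1 ==> norm (p u) <= 1"
 shows "boundary 1 X (radius_chain (p 1) - radius_chain (p 0) - chain_map 1 q (path_chain p))"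
proof -
 let ?c = "path_chain (\<lambda>u. of_real u * p 1) - path_chain (\<lambda>u. of_real u * p 0) - path_chain p"
 have "boundary 1 X (chain_map 1 q ?c)"
 proof (rule push_boundary)
  show "chain 1 (top_of_set (cball 0 1)) ?c"
   using assms by (intro singular_chain_diff radius_path cball_path_chain) auto
  show "bdry 1 ?c = 0" by (simp only: chain_boundary_diff chain_boundary_path_chain) simp
 qed
 thus ?thesis unfolding radius_chain_def chain_map_diff .
qed

lemma radius_diff_in_edge_span: "radius_chain (e (of_int a)) - radius_chain (e (of_int b)) \<in> edge_span"
proof -
 have step: "radius_chain (e (of_int (a + 1))) - radius_chain (e (of_int a)) \<in> edge_span" for a
 proof -
  have "boundary 1 X (radius_chain (e (of_int a + 1)) - radius_chain (e (of_int a + 0)) -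
    chain_map 1 q (path_chain (\<lambda>u. e (of_int a + u))))"
   by (rule radius_add_path) (auto intro!: continuous_intros)
  hence "radius_chain (e (of_int a + 1)) - radius_chain (e (of_int a + 0)) - side_chain a + side_chain a \<in> edge_span"
   unfolding side_chain_push[symmetric] by (intro edge_span_add edge_span_boundary side_chain_in_edge_span)
  thus ?thesis by simp
 qed
 have base: "radius_chain (e (of_int a)) - radius_chain (e (of_int 0)) \<in> edge_span" for a
 proof (induction a rule: int_induct[where k = 0])
  case base
  thus ?case using edge_span_boundary[of 0] by simp
 next
  case (step1 i)
  from edge_span_add[OF step[of i] step1(2)] show ?case by simp
 next
  case (step2 i)
  from edge_span_diff[OF step2(2) step[of "i - 1"]] show ?case by simp
 qed
 from edge_span_diff[OF base[of a] base[of b]] show ?thesis by simp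
qed

text \<open>Every point is joined to the centre along the radius of one chosen preimage. A path in
  the face closes up with two radii. In a star, which is contractible, the detour through the vertex
  is used, and radii to different corners differ by sides.\<close>

lemma cycle_in_edge_span:
 assumes "cycle 1 X c"
 shows "c \<in> edge_span"
proof -
 define lift where "lift y = (SOME z. norm z <= 1 \<and> q z = y)" for y
 have lift: "norm (lift (q z)) <= 1" "q (lift (q z)) = q z" if "norm z <= 1" for z
 proof -
  have "\<exists>z'. norm z' <= 1 \<and> q z' = q z" using that by blast
  from someI_ex[OF this] show "norm (lift (q z)) <= 1" "q (lift (q z)) = q z" unfolding lift_def by blast+
 qed
 show ?thesis
 proof (rule small_paths_generate_cycles[of "insert face (range (\<lambda>c. q ` star c))" X edge_span "\<lambda>y. radius_chain (lift y)"])
  show "openin X U" if "U \<in> insert face (range (\<lambda>c. q ` star c))" for U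
   using that openin_star complex_chart_face by (auto simp: complex_chart_def)
  show "topspace X <= \<Union> (insert face (range (\<lambda>c. q ` star c)))"
  proof
   fix y assume "y \<in> topspace X"
   then obtain z where z: "norm z <= 1" "y = q z" unfolding topspace_X by auto
   from cball_cover[OF z(1)] show "y \<in> \<Union> (insert face (range (\<lambda>c. q ` star c)))"
    using z(2) by (auto simp: face_def)
  qed
  show "path_chain p + radius_chain (lift (p 0)) - radius_chain (lift (p 1)) \<in> edge_span"
   if U: "U \<in> insert face (range (\<lambda>c. q ` star c))" and p: "continuous_map unit_interval (X on U) p" for U p
  proof (cases "U = face")
   case True
   have pf: "p u \<in> face" if "u \<in> {0..1}" for u
    using p that unfolding True continuous_map_in_subtopology by auto
   have "continuous_map unit_interval euclidean (face_chart \<circ> p)"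
    using p complex_chart_continuous(1)[OF complex_chart_face] unfolding True by (rule continuous_map_compose)
   hence c: "continuous_on {0..1} (face_chart \<circ> p)" by simp
   have n: "norm (face_chart (p u)) < 1 \<and> q (face_chart (p u)) = p u \<and> lift (p u) = face_chart (p u)"
    if u: "u \<in> {0..1}" for u
   proof -
    obtain z where z: "norm z < 1" "p u = q z" using pf[OF u] unfolding face_def by auto
    have "lift (q z) = z" using lift[of z] z(1) q_eq_interior[of z "lift (q z)"] by simp
    thus ?thesis using z face_chart_q by simp
   qed
   have "boundary 1 X (radius_chain ((face_chart \<circ> p) 1) - radius_chain ((face_chart \<circ> p) 0)
     - chain_map 1 q (path_chain (face_chart \<circ> p)))" by (rule radius_add_path[OF c]) (use n in force)
   moreover have "path_simplex (q \<circ> (face_chart \<circ> p)) = path_simplex p"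
    by (rule path_simplex_cong) (use n in simp)
   ultimately have "boundary 1 X (radius_chain (lift (p 1)) - radius_chain (lift (p 0)) - path_chain p)"
    unfolding chain_map_path_chain using n[of 0] n[of 1] by simp
   from edge_span_diff[OF edge_span_boundary[of 0] edge_span_boundary[OF this]]
   have "0 - (radius_chain (lift (p 1)) - radius_chain (lift (p 0)) - path_chain p) \<in> edge_span" by simp
   moreover have "0 - (radius_chain (lift (p 1)) - radius_chain (lift (p 0)) - path_chain p) =
     path_chain p + radius_chain (lift (p 0)) - radius_chain (lift (p 1))" by simp
   ultimately show ?thesis by (simp only:)
  next
   case False
   then obtain c where Uc: "U = q ` star c" using U by blast
   obtain \<phi> where "(U, \<phi>) \<in> atlas" "\<phi> ` U = ball 0 (cone_radius c)" using star_in_atlas[of c] Uc by blast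
   moreover have "cone_radius c > 0" by (simp add: cone_radius_def)
   ultimately have ct: "contractible_space (X on U)"
    by (intro complex_chart_ball(1)[of X U \<phi>]) (auto simp: atlas_def)
   \<comment> \<open>Joins the vertex to y by a segment inside one half disc; a is the corner of the
     polygon to which that half disc belongs.\<close>
   have arm: "\<exists>a d. chain 1 (X on U) d \<and>
     bdry 1 d = frag_of (point_simplex y) - frag_of (point_simplex (q (e (of_int c)))) \<and>
     radius_chain (lift y) - radius_chain (e (of_int a)) - d \<in> edge_span" if y: "y \<in> U" for y
   proof -
    obtain z where z: "z \<in> star c" "y = q z" using y unfolding Uc by blast
    have "norm z <= 1" using z(1) unfolding star_def by (auto simp: norm_pexp_le_1)
    hence l: "norm (lift y) <= 1" "q (lift y) = y" using lift[of z] z(2) by simp_all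
    hence "lift y \<in> star c" using star_saturated[of "lift y" c] z by auto
    then obtain m \<zeta> where m: "lift y = pexp (of_int (nextn m c) + \<zeta>)" "0 <= Im \<zeta>" "norm \<zeta> < 3/4"
     unfolding star_def by blast
    define p where "p u = pexp (of_int (nextn m c) + of_real u * \<zeta>)" for u
    have ps: "p u \<in> star c" if "0 <= u" "u <= 1" for u
    proof -
     have "norm (of_real u * \<zeta>) <= norm \<zeta>" using that by (simp add: norm_mult mult_left_le_one_le)
     hence "norm (of_real u * \<zeta>) < 3/4" using m(3) by linarith
     moreover have "0 <= Im (of_real u * \<zeta>)" using that m(2) by simp
     ultimately show ?thesis unfolding p_def star_def by blast
    qed
    have pc: "continuous_on {0..1} p" unfolding p_def by (intro continuous_intros)
    have pn: "norm (p u) <= 1" if "0 <= u" "u <= 1" for u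
     using m(2) that unfolding p_def by (simp add: norm_pexp_le_1)
    have p01: "p 0 = e (of_int (nextn m c))" "p 1 = lift y"
     using pexp_of_real[of "of_int (nextn m c)"] m(1) by (simp_all add: p_def)
    have "continuous_map unit_interval (top_of_set (cball 0 1)) p"
     using pc pn by (auto simp: continuous_map_in_subtopology)
    hence "continuous_map unit_interval X (q \<circ> p)" by (rule continuous_map_compose[OF _ continuous_q])
    hence "continuous_map unit_interval (X on U) (q \<circ> p)"
     using ps unfolding Uc continuous_map_in_subtopology by auto
    hence d1: "chain 1 (X on U) (path_chain (q \<circ> p))" by (rule singular_chain_path_chain)
    have "q (p 0) = q (e (of_int c))" unfolding p01(1) q_e by (rule boundary_class_nextv)
    hence d2: "bdry 1 (path_chain (q \<circ> p)) = frag_of (point_simplex y) - frag_of (point_simplex (q (e (of_int c))))"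
     unfolding chain_boundary_path_chain using p01(2) l(2) by simp
    have "radius_chain (lift y) - radius_chain (e (of_int (nextn m c))) - path_chain (q \<circ> p) \<in> edge_span"
     using edge_span_boundary[OF radius_add_path[OF pc pn]] unfolding p01 chain_map_path_chain .
    thus ?thesis using d1 d2 by blast
   qed
   have pU: "p 0 \<in> U" "p 1 \<in> U" using p unfolding continuous_map_in_subtopology by auto
   obtain a d where d: "chain 1 (X on U) d"
    "bdry 1 d = frag_of (point_simplex (p 0)) - frag_of (point_simplex (q (e (of_int c))))"
    "radius_chain (lift (p 0)) - radius_chain (e (of_int a)) - d \<in> edge_span" using arm[OF pU(1)] by blast
   obtain b f where f: "chain 1 (X on U) f"
    "bdry 1 f = frag_of (point_simplex (p 1)) - frag_of (point_simplex (q (e (of_int c))))"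
    "radius_chain (lift (p 1)) - radius_chain (e (of_int b)) - f \<in> edge_span" using arm[OF pU(2)] by blast
   have "boundary 1 (X on U) (path_chain p + d - f)"
   proof (rule contractible_cycle_boundary[OF ct zero_less_one])
    have "bdry 1 (path_chain p + d - f) = 0"
     by (simp only: chain_boundary_diff chain_boundary_add chain_boundary_path_chain d(2) f(2)) simp
    moreover have "chain 1 (X on U) (path_chain p + d - f)"
     by (intro singular_chain_diff singular_chain_add singular_chain_path_chain p d(1) f(1))
    ultimately show "cycle 1 (X on U) (path_chain p + d - f)" unfolding singular_relcycle_1 by blast
   qed
   hence "boundary 1 X (path_chain p + d - f)"
    using singular_boundary_mono[of U UNIV 1 X "path_chain p + d - f"] by simp
   from edge_span_add[OF edge_span_diff[OF edge_span_add[OF edge_span_boundary[OF this] d(3)] f(3)] radius_diff_in_edge_span[of a b]]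
   show ?thesis by (simp add: algebra_simps)
  qed
 qed (use edge_span_diff edge_span_boundary assms in auto)
qed

end

section \<open>A basis of the first homology\<close>

context polygon_gluing
begin

lemma side_chain_boundary:
 "bdry 1 (side_chain i) =
   frag_of (point_simplex (q (e (of_int (i + 1))))) - frag_of (point_simplex (q (e (of_int i))))"
 unfolding side_chain_def chain_boundary_path_chain by simp

lemma side_chain_singular: "chain 1 X (side_chain i)"
 unfolding side_chain_def by (rule singular_chain_path_chain[OF side_continuous])

lemma point_simplex_inj: "point_simplex a = point_simplex b \<longleftrightarrow> a = b"
proof
 assume "point_simplex a = point_simplex b"
 from fun_cong[OF this, of "\<lambda>i. if i = 0 then 1 else 0"] show "a = b"
  by (simp add: point_simplex_def standard_simplex_0)
qed simp

lemma vertex_parity: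
 assumes "q (e (of_int i)) = q (e (of_int j))"
 shows "even i \<longleftrightarrow> even j"
proof -
 obtain m k where "j = nextn m i + k * L"
  using assms unfolding q_e boundary_class_eq_vertex by (metis of_int_eq_iff)
 thus ?thesis using L(2) nextv_parity by simp
qed

lemma side_winding:
 obtains g where "!!i. continuous_map X unit_circle (g i)"
  "!!i j u. i \<in> edges ==> j \<in> edges ==> 0 <= u ==> u <= 1 ==> g i (q (e (of_int j + u))) = (if i = j then circ u else 1)"
proof -
 have "\<exists>g. continuous_map X unit_circle g \<and> (\<forall>r t. 0 <= r \<longrightarrow> r <= 1 \<longrightarrow> of_int i <= t \<longrightarrow> t <= of_int (i + L) \<longrightarrow>
   g (q (of_real r * e t)) = circ (r * height i t))" for i by (rule side_winding_map[of i]) blast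
 then obtain g where g: "!!i. continuous_map X unit_circle (g i)"
  "!!i r t. 0 <= r ==> r <= 1 ==> of_int i <= t ==> t <= of_int (i + L) ==> g i (q (of_real r * e t)) = circ (r * height i t)"
  by metis
 show thesis
 proof (rule that[OF g(1)])
  fix i j :: int and u :: real assume ij: "i \<in> edges" "j \<in> edges" and u: "0 <= u" "u <= 1"
  \<comment> \<open>Moves side j by a full turn if necessary, since \<open>g i\<close> is described
    on the turn that starts at corner i.\<close>
  define k where "k = (if i <= j then 0 else 1 :: int)"
  have r: "i <= j + k * L" "j + k * L + 1 <= i + L" using ij L(1) unfolding edges_def k_def by auto
  have rr: "real_of_int i <= of_int (j + k * L)" "of_int (j + k * L) + 1 <= real_of_int (i + L)" using r by linarith+
  have "e (of_int j + u) = e (of_int (j + k * L) + u)" unfolding e_eq_iff by (intro exI[of _ k]) simp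
  hence "g i (q (e (of_int j + u))) = circ (height i (of_int (j + k * L) + u))"
   using g(2)[of 1 i "of_int (j + k * L) + u"] rr u by simp
  also have "... = (if i = j then circ u else 1)"
  proof (cases "i = j")
   case True
   thus ?thesis using u by (simp add: k_def height_first)
  next
   case False
   have "even (j + k * L)" "odd (opposite i)" using ij opposite(4)[of i] L(2) unfolding edges_def by auto
   hence "j + k * L ~= opposite i" by metis
   moreover have "j + k * L ~= i" using False ij L(1) unfolding edges_def k_def by auto
   ultimately show ?thesis using circ_height_other[of "j + k * L" "of_int (j + k * L) + u" i] u False by simp
  qed
  finally show "g i (q (e (of_int j + u))) = (if i = j then circ u else 1)" .
 qed
qed

text \<open>The 1-skeleton is a graph with one even vertex; \<open>T\<close> selects one edge for each odd vertex, and the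
 remaining edges, closed up by the selected ones, form a basis of the homology.\<close>

lemma homology_group_polygon:
 assumes one: "!!i. even i ==> q (e (of_int i)) = q (e 0)"
  and T: "!!i. i \<in> edges ==> T i \<in> edges" "!!i. i \<in> edges ==> q (e (of_int (T i + 1))) = q (e (of_int (i + 1)))"
  and T_eq: "!!i j. i \<in> edges ==> j \<in> edges ==> q (e (of_int (i + 1))) = q (e (of_int (j + 1))) ==> T i = T j"
 shows "homology_group 1 X \<cong> free_Abelian_group {i \<in> edges. T i ~= i}"
proof -
 let ?J = "{i \<in> edges. T i ~= i}"
 obtain g where g: "!!i. continuous_map X unit_circle (g i)"
  "!!i j u. i \<in> edges ==> j \<in> edges ==> 0 <= u ==> u <= 1 ==> g i (q (e (of_int j + u))) = (if i = j then circ u else 1)"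
  by (rule side_winding) (rule that, assumption+)
 have TT: "T (T i) = T i" if "i \<in> edges" for i using T_eq[OF T(1)[OF that] that T(2)[OF that]] .
 define z where "z j = side_chain j - side_chain (T j)" for j
 have zc: "cycle 1 X (z j)" if "j \<in> ?J" for j
 proof -
  have j: "j \<in> edges" using that by simp
  have "q (e (of_int j)) = q (e (of_int (T j)))" using one[of j] one[of "T j"] j T(1)[OF j] unfolding edges_def by simp
  hence "bdry 1 (z j) = 0" unfolding z_def chain_boundary_diff side_chain_boundary T(2)[OF j] by simp
  moreover have "chain 1 X (z j)" unfolding z_def by (intro singular_chain_diff side_chain_singular)
  ultimately show ?thesis unfolding singular_relcycle_1 by blast
 qed
 have side: "chain_map 1 (g i) (side_chain j) = path_chain (\<lambda>u. if i = j then circ u else 1)" if ij: "i \<in> edges" "j \<in> edges" for i j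
 proof -
  have "path_simplex (g i \<circ> (\<lambda>u. q (e (of_int j + u)))) = path_simplex (\<lambda>u. if i = j then circ u else 1)"
   by (rule path_simplex_cong) (simp add: g(2)[OF ij])
  thus ?thesis unfolding side_chain_def chain_map_path_chain by simp
 qed
 have sum_edges: "\<exists>n. homologous 1 X c (\<Sum>j\<in>?J. (n j) *. (z j))" if c: "cycle 1 X c" for c
 proof -
  obtain n where n: "boundary 1 X (c - (\<Sum>i\<in>edges. (n i) *. (side_chain i)))"
   using cycle_in_edge_span[OF c] unfolding edge_span_def by blast
  define s where "s = (\<Sum>i\<in>edges. (n i) *. (side_chain i))"
  have "cycle 1 X (c - (c - s))"
   using singular_relcycle_diff[OF c singular_relboundary_imp_relcycle[OF n]] unfolding s_def .
  hence "bdry 1 s = 0" unfolding singular_relcycle_1 by simp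
  moreover have "bdry 1 (\<Sum>i\<in>F. (n i) *. (side_chain i)) =
    (\<Sum>i\<in>F. (n i) *. (bdry 1 (side_chain i)))" if "finite F" for F using that
  proof (induction F rule: finite_induct)
   case (insert i F)
   show ?case unfolding sum.insert[OF insert(1,2)] chain_boundary_add chain_boundary_cmul insert(3) ..
  qed simp
  from this[OF finite_edges] have "bdry 1 s = (\<Sum>i\<in>edges. (n i) *. (bdry 1 (side_chain i)))" unfolding s_def .
  ultimately have b0: "(\<Sum>i\<in>edges. (n i) *. (frag_of (point_simplex (q (e (of_int (i + 1))))) -
    frag_of (point_simplex (q (e (of_int i)))))) = 0" unfolding side_chain_boundary by simp
  \<comment> \<open>This sum is the coefficient of the odd vertex k + 1 in the boundary of s.
    Starting points of even sides do not contribute, because corners of different parity are never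
    identified.\<close>
  have fib: "(\<Sum>i\<in>{i \<in> edges. T i = k}. n i) = 0" if k: "k \<in> T ` edges" for k
  proof -
   obtain j where j: "j \<in> edges" "k = T j" using k by blast
   have kE: "k \<in> edges" "T k = k" using T(1)[OF j(1)] TT[OF j(1)] j(2) by simp_all
   define v where "v = point_simplex (q (e (of_int (k + 1))))"
   have lk: "lookup ((n i) *. (frag_of (point_simplex (q (e (of_int (i + 1))))) -
     frag_of (point_simplex (q (e (of_int i)))))) v = (if T i = k then n i else 0)" if i: "i \<in> edges" for i
   proof -
    have "q (e (of_int (i + 1))) = q (e (of_int (k + 1))) \<longleftrightarrow> T i = k"
     using T_eq[OF i kE(1)] T(2)[OF i] kE(2) by auto
    moreover have "q (e (of_int i)) ~= q (e (of_int (k + 1)))"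
     using vertex_parity[of i "k + 1"] i kE(1) unfolding edges_def by auto
    ultimately show ?thesis unfolding v_def by (auto simp: point_simplex_inj lookup_minus)
   qed
   have "0 = lookup (\<Sum>i\<in>edges. (n i) *. (frag_of (point_simplex (q (e (of_int (i + 1))))) -
     frag_of (point_simplex (q (e (of_int i)))))) v" unfolding b0 by simp
   also have "... = (\<Sum>i\<in>edges. if T i = k then n i else 0)" unfolding lookup_sum by (rule sum.cong[OF refl lk])
   also have "... = (\<Sum>i\<in>{i \<in> edges. T i = k}. n i)" using finite_edges by (simp add: sum.inter_filter)
   finally show ?thesis by simp
  qed
  have "(\<Sum>i\<in>edges. (n i) *. (side_chain (T i))) = (\<Sum>k\<in>T ` edges. \<Sum>i\<in>{i \<in> edges. T i = k}. (n i) *. (side_chain (T i)))"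
   by (rule sum.image_gen[OF finite_edges])
  also have "... = (\<Sum>k\<in>T ` edges. 0)"
  proof (rule sum.cong[OF refl])
   fix k assume k: "k \<in> T ` edges"
   have "(\<Sum>i\<in>{i \<in> edges. T i = k}. (n i) *. (side_chain (T i))) = (\<Sum>i\<in>{i \<in> edges. T i = k}. (n i) *. (side_chain k))"
    by (rule sum.cong) auto
   also have "... = (\<Sum>i\<in>{i \<in> edges. T i = k}. n i) *. (side_chain k)"
    by (rule poly_mapping_eqI) (simp add: lookup_sum sum_distrib_right)
   finally show "(\<Sum>i\<in>{i \<in> edges. T i = k}. (n i) *. (side_chain (T i))) = 0" using fib[OF k] by simp
  qed
  finally have t0: "(\<Sum>i\<in>edges. (n i) *. (side_chain (T i))) = 0" by simp
  have "(n i) *. (z i) = (n i) *. (side_chain i) - (n i) *. (side_chain (T i))" for i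
   unfolding z_def by (rule poly_mapping_eqI) (simp add: lookup_minus right_diff_distrib)
  hence "s = (\<Sum>i\<in>edges. (n i) *. (z i))" unfolding s_def using t0 by (simp add: sum_subtractf)
  also have "... = (\<Sum>i\<in>?J. (n i) *. (z i))" by (rule sum.mono_neutral_right[OF finite_edges]) (auto simp: z_def)
  finally show ?thesis using n unfolding s_def[symmetric] homologous_rel_iff by (intro exI[of _ n]) simp
 qed
 show ?thesis
 proof (rule homology_group_winding_basis[of _ _ z g])
  show "homologous 1 unit_circle (chain_map 1 (g i) (z j)) ((if i = j then 1 else 0) *. circle_loop)"
   if ij: "i \<in> ?J" "j \<in> ?J" for i j
  proof -
   have E: "i \<in> edges" "j \<in> edges" "T j \<in> edges" using ij T(1) by auto
   have "i ~= T j" using ij TT by auto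
   thus ?thesis
    using homologous_rel_diff[OF circle_loop_or_constant[of "i = j"] circle_loop_or_constant[of "i = T j"]]
    unfolding z_def chain_map_diff side[OF E(1,2)] side[OF E(1,3)] by simp
  qed
 qed (use zc sum_edges g(1) finite_edges in auto)
qed

end

section \<open>Polygons with cyclic symmetry\<close>

text \<open>Corner \<open>2u\<close> of the polygon starts block \<open>u div k\<close> at position \<open>j = u mod k\<close>; the even side of block
 \<open>b\<close> at position \<open>j\<close> is glued to the odd side of block \<open>b + c j\<close> at the same position. Rotation by one block
 is an automorphism of order \<open>n\<close>.\<close>

locale cyclic_polygon =
 fixes n k :: int and c :: "int => int"
 assumes nk: "n > 0" "k > 0" "n * k \<ge> 2" and coprime_step: "coprime (1 + (\<Sum>j\<in>{0..<k}. c j)) n"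
begin

definition tau :: "int => int" where
 "tau i = (if even i then i + 2 * k * c (i div 2 mod k) + 1 else i - 2 * k * c (i div 2 mod k) - 1)"

lemma tau_even: "tau (2 * u) = 2 * (u + k * c (u mod k)) + 1"
 and tau_odd: "tau (2 * u + 1) = 2 * (u - k * c (u mod k))" by (simp_all add: tau_def algebra_simps)

lemma tau_shift: "tau (i + 2 * k * x) = tau i + 2 * k * x"
proof -
 have "(i + 2 * k * x) div 2 = i div 2 + k * x" by (simp add: mult.assoc)
 thus ?thesis by (simp add: tau_def)
qed

sublocale polygon_gluing "2 * n * k" tau
proof
 show "2 * n * k \<ge> 4" unfolding mult.assoc using nk(3) by linarith
 show "even (2 * n * k)" by simp
 show "tau (tau i) = i" for i
 proof (cases "even i")
  case True
  then obtain u where u: "i = 2 * u" by (elim evenE)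
  show ?thesis unfolding u tau_even tau_odd by simp
 next
  case False
  then obtain u where "i = 2 * u + 1" by (elim oddE)
  moreover have "tau (2 * (u - k * c (u mod k))) = 2 * u + 1"
  proof -
   have "(u - k * c (u mod k)) mod k = u mod k" by (metis mod_mult_self2 diff_conv_add_uminus mult_minus_right)
   thus ?thesis unfolding tau_even by simp
  qed
  ultimately show ?thesis by (simp add: tau_odd)
 qed
 show "tau (i + 2 * n * k) = tau i + 2 * n * k" for i using tau_shift[of i n] by (simp add: mult_ac)
 show "even (tau i) \<longleftrightarrow> odd i" for i by (simp add: tau_def)
qed

lemma nextv_even: "nextn m (2 * k * b) = 2 * (k * b + int m + k * (\<Sum>j\<in>{0..<int m}. c j))" if "int m <= k"
 using that
proof (induction m)
 case (Suc m)
 have m: "(k * b + int m + k * (\<Sum>j\<in>{0..<int m}. c j)) mod k = int m"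
 proof -
  have "(int m + k * (b + (\<Sum>j\<in>{0..<int m}. c j))) mod k = int m" using Suc.prems by simp
  thus ?thesis by (simp add: distrib_left add_ac)
 qed
 have s: "{0..<int (Suc m)} = insert (int m) {0..<int m}" by auto
 have IH: "nextn m (2 * k * b) = 2 * (k * b + int m + k * (\<Sum>j\<in>{0..<int m}. c j))" using Suc by simp
 show ?case unfolding nextv_Suc IH tau_even m s by (simp add: algebra_simps)
qed simp

lemma nextv_odd: "nextn m (2 * u + 1) = 2 * (u - k * (c (u mod k) * int m)) + 1"
proof (induction m)
 case (Suc m)
 have "(u - k * (c (u mod k) * int m)) mod k = u mod k" by (metis mod_mult_self2 diff_conv_add_uminus mult_minus_right)
 thus ?case unfolding nextv_Suc Suc tau_odd by (simp add: algebra_simps)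
qed simp

text \<open>Going k steps around the vertex leads from block b to block b + s, with s the sum in
  \<open>coprime_step\<close>, and passes every position on the way. As s is a unit modulo n, all
  blocks are reached.\<close>

lemma even_vertices: "q (e (of_int (2 * u))) = q (e 0)"
proof -
 define s where "s = 1 + (\<Sum>j\<in>{0..<k}. c j)"
 have blocks: "q (e (of_int (2 * k * (b + s * int m)))) = q (e (of_int (2 * k * b)))" for b m
 proof (induction m)
  case (Suc m)
  have "(nextv ^^ nat k) (2 * k * (b + s * int m)) = 2 * k * (b + s * int (Suc m))"
   using nextv_even[of "nat k" "b + s * int m"] nk(2) by (simp add: s_def algebra_simps)
  hence "q (e (of_int (2 * k * (b + s * int (Suc m))))) = q (e (of_int (2 * k * (b + s * int m))))"
   using boundary_class_nextv[of "nat k" "2 * k * (b + s * int m)"] unfolding q_e by simp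
  thus ?case using Suc by simp
 qed simp
 define j where "j = nat (u mod k)"
 have j: "int j = u mod k" "int j < k" using nk(2) by (simp_all add: j_def)
 define b where "b = u div k - (\<Sum>l\<in>{0..<int j}. c l)"
 have "nextn j (2 * k * b) = 2 * u"
 proof -
  have "k * (u div k) + int j = u" using j(1) by simp
  thus ?thesis using nextv_even[of j b] j(2) by (simp add: b_def algebra_simps)
 qed
 hence 1: "q (e (of_int (2 * u))) = q (e (of_int (2 * k * b)))"
  using boundary_class_nextv[of j "2 * k * b"] unfolding q_e by simp
 obtain x where x: "[s * x = b] (mod n)"
  using cong_solve_coprime_int[of s n] coprime_step unfolding s_def[symmetric]
  by (metis cong_scalar_right mult.assoc mult.left_neutral mult.commute)
 define m where "m = nat (x mod n)"
 have m: "int m = x mod n" using nk(1) by (simp add: m_def)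
 have "[s * int m = b] (mod n)" unfolding m using x by (simp add: cong_def mod_mult_right_eq)
 then obtain t where t: "s * int m = b + t * n" by (metis cong_iff_lin cong_sym mult.commute)
 have "2 * k * (0 + s * int m) = 2 * k * b + t * (2 * n * k)" unfolding t by (simp add: algebra_simps)
 hence "q (e (of_int (2 * k * (0 + s * int m)))) = q (e (of_int (2 * k * b)))"
  using boundary_class_shift[of "of_int (2 * k * b)" t] unfolding q_e by (metis of_int_add)
 thus ?thesis using 1 blocks[of 0 m] by simp
qed

text \<open>At position j the odd corners of the n blocks are identified in steps of
  \<open>c j\<close> modulo n, which leaves \<open>gcd (c j) n\<close> distinct vertices.\<close>

definition period :: "int => int" where "period u = gcd (c (u mod k)) n"

text \<open>The edge of the same position in the least block representing its odd vertex.\<close>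

definition tree_edge :: "int => int" where
 "tree_edge i = 2 * (k * (i div 2 div k mod period (i div 2)) + i div 2 mod k)"

lemma odd_vertices:
 "q (e (of_int (2 * u + 1))) = q (e (of_int (2 * v + 1))) \<longleftrightarrow>
   u mod k = v mod k \<and> u div k mod period u = v div k mod period v"
proof
 assume "q (e (of_int (2 * u + 1))) = q (e (of_int (2 * v + 1)))"
 then obtain m t where "real_of_int (2 * v + 1) = of_int (nextn m (2 * u + 1) + t * (2 * n * k))"
  unfolding q_e boundary_class_eq_vertex by blast
 hence "2 * v + 1 = 2 * (u - k * (c (u mod k) * int m)) + 1 + t * (2 * n * k)"
  unfolding nextv_odd of_int_eq_iff .
 hence v: "v = u + k * (t * n - c (u mod k) * int m)" by (simp add: algebra_simps)
 have jj: "v mod k = u mod k" unfolding v by simp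
 have "v div k = u div k + (t * n - c (u mod k) * int m)" unfolding v using nk(2) by simp
 moreover have "period u dvd t * n - c (u mod k) * int m" unfolding period_def by (intro dvd_diff dvd_mult dvd_mult2) auto
 ultimately have "v div k mod period u = u div k mod period u" by (simp add: mod_add_right_eq[symmetric] dvd_imp_mod_0)
 moreover have "period v = period u" unfolding period_def jj ..
 ultimately show "u mod k = v mod k \<and> u div k mod period u = v div k mod period v" using jj by simp
next
 assume "u mod k = v mod k \<and> u div k mod period u = v div k mod period v"
 hence j: "u mod k = v mod k" and "u div k mod period u = v div k mod period v" by blast+
 moreover have "period v = period u" unfolding period_def j ..
 ultimately have d: "u div k mod period u = v div k mod period u" by simp
 obtain x y where "x * c (u mod k) + y * n = period u" unfolding period_def using bezout_int by blast
 moreover have "period u dvd v div k - u div k" using d[symmetric] unfolding mod_eq_dvd_iff .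
 then obtain w where w: "v div k - u div k = period u * w" by (elim dvdE)
 ultimately have "v div k - u div k = (x * c (u mod k) + y * n) * w" by simp
 hence w': "v div k - u div k = c (u mod k) * (x * w) + n * (y * w)" by (simp add: algebra_simps)
 define m where "m = nat ((- (x * w)) mod n)"
 have "int m = (- (x * w)) mod n" using nk(1) by (simp add: m_def)
 then obtain z where z: "- (x * w) = int m + n * z" by (metis mod_mult_div_eq)
 have "v = k * (v div k) + u mod k" using j by simp
 also have "v div k = u div k - c (u mod k) * int m + n * (y * w - c (u mod k) * z)"
 proof -
  have "x * w = - int m - n * z" using z by simp
  hence "v div k - u div k = c (u mod k) * (- int m - n * z) + n * (y * w)" using w' by simp
  thus ?thesis by (simp add: algebra_simps)
 qed
 finally have "v = (k * (u div k) + u mod k) - k * (c (u mod k) * int m) + n * k * (y * w - c (u mod k) * z)"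
  by (simp only: algebra_simps)
 hence "v = u - k * (c (u mod k) * int m) + n * k * (y * w - c (u mod k) * z)"
  by (simp only: mult_div_mod_eq)
 hence "2 * v + 1 = nextn m (2 * u + 1) + (y * w - c (u mod k) * z) * (2 * n * k)"
  unfolding nextv_odd by (simp add: algebra_simps)
 from arg_cong[OF this, of real_of_int] show "q (e (of_int (2 * u + 1))) = q (e (of_int (2 * v + 1)))"
  unfolding q_e boundary_class_eq_vertex by (intro exI)
qed

lemma edges_iff: "i \<in> edges \<longleftrightarrow> (\<exists>u. i = 2 * u \<and> 0 <= u \<and> u < n * k)"
 unfolding edges_def by (auto elim!: evenE simp: mult.assoc)

lemma period_bounds: "0 < period u" "period u <= n" using nk(1) unfolding period_def by (auto intro: zdvd_imp_le)

text \<open>Position j has n edges and \<open>gcd (c j) n\<close> odd vertices, and one edge is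
  selected for each odd vertex.\<close>

lemma card_non_tree_edges: "int (card {i \<in> edges. tree_edge i ~= i}) = (\<Sum>j\<in>{0..<k}. n - gcd (c j) n)"
proof -
 have te: "tree_edge (2 * u) = 2 * u \<longleftrightarrow> u div k < period u" if u: "0 <= u" for u
 proof -
  have "tree_edge (2 * u) = 2 * u \<longleftrightarrow> k * (u div k mod period u) = k * (u div k)"
  proof -
   have "2 * u = 2 * (k * (u div k) + u mod k)" by simp
   moreover have "tree_edge (2 * u) = 2 * (k * (u div k mod period u) + u mod k)" by (simp add: tree_edge_def)
   moreover have "(t = a) = (y = x)" if "a = 2 * (x + r)" "t = 2 * (y + r)" for a t x y r :: int
    using that by auto
   ultimately show ?thesis by blast
  qed
  also have "... \<longleftrightarrow> u div k mod period u = u div k" using nk(2) by simp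
  also have "... \<longleftrightarrow> u div k < period u"
   using period_bounds(1)[of u] u nk(2) by (metis mod_pos_pos_trivial pos_imp_zdiv_nonneg_iff pos_mod_bound)
  finally show ?thesis .
 qed
 have "{i \<in> edges. tree_edge i ~= i} = (\<lambda>(j, b). 2 * (k * b + j)) ` (SIGMA j:{0..<k}. {gcd (c j) n..<n})" (is "?A = ?f ` ?B")
 proof (intro subset_antisym subsetI)
  fix i assume "i \<in> ?A"
  then obtain u where u: "i = 2 * u" "0 <= u" "u < n * k" "\<not> u div k < period u" using te by (auto simp: edges_iff)
  have "u div k < n"
  proof (rule ccontr)
   assume "\<not> u div k < n"
   hence "k * n <= k * (u div k)" using nk(2) by (intro mult_left_mono) auto
   also have "... <= u" using mult_div_mod_eq[of k u] pos_mod_sign[OF nk(2), of u] by linarith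
   finally show False using u(3) by (simp add: mult.commute)
  qed
  hence "(u mod k, u div k) \<in> ?B" using u(4) nk(2) by (simp add: period_def)
  moreover have "i = ?f (u mod k, u div k)" unfolding u(1) split_conv mult_div_mod_eq ..
  ultimately show "i \<in> ?f ` ?B" by blast
 next
  fix i assume "i \<in> ?f ` ?B"
  then obtain j b where jb: "0 <= j" "j < k" "gcd (c j) n <= b" "b < n" "i = 2 * (k * b + j)" by auto
  have b0: "0 <= b" using jb(3) gcd_ge_0_int[of "c j" n] by linarith
  have dm: "(k * b + j) div k = b" "(k * b + j) mod k = j" using jb(1,2) by simp_all
  have "k * b + j < n * k"
  proof -
   have "k * (b + 1) <= k * n" using jb(4) nk(2) by (intro mult_left_mono) auto
   thus ?thesis using jb(2) by (simp add: algebra_simps)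
  qed
  moreover have "0 <= k * b + j" using b0 jb(1) nk(2) by simp
  moreover from this have "tree_edge i ~= i" using te[of "k * b + j"] jb(3,5) dm by (simp add: period_def)
  ultimately show "i \<in> ?A" using jb(5) unfolding edges_iff by blast
 qed
 moreover have "inj_on ?f ?B"
 proof (rule inj_onI)
  fix p p' assume p: "p \<in> ?B" "p' \<in> ?B" "?f p = ?f p'"
  obtain j b j' b' where pp: "p = (j, b)" "p' = (j', b')" by (metis surj_pair)
  have eq: "k * b + j = k * b' + j'" using p(3) unfolding pp by simp
  have "j = (k * b + j) mod k" "j' = (k * b' + j') mod k" "b = (k * b + j) div k" "b' = (k * b' + j') div k"
   using p(1,2) unfolding pp by auto
  thus "p = p'" unfolding pp using eq by metis
 qed
 ultimately have "card ?A = card ?B" by (simp add: card_image)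
 also have "... = (\<Sum>j\<in>{0..<k}. card {gcd (c j) n..<n})" by (simp add: card_SigmaI)
 finally have "int (card ?A) = (\<Sum>j\<in>{0..<k}. int (card {gcd (c j) n..<n}))" by simp
 also have "... = (\<Sum>j\<in>{0..<k}. n - gcd (c j) n)" using nk(1) by (intro sum.cong refl) (simp add: gcd_le2_int)
 finally show ?thesis .
qed

text \<open>The formula agrees with the Euler characteristic: one face, n k edges, and one even
  vertex besides the odd ones counted by the gcds.\<close>

lemma has_genus_X:
 assumes "2 * int g = (\<Sum>j\<in>{0..<k}. n - gcd (c j) n)"
 shows "has_genus X g"
proof -
 let ?J = "{i \<in> edges. tree_edge i ~= i}"
 have "homology_group 1 X \<cong> free_Abelian_group ?J"
 proof (rule homology_group_polygon)
  show "q (e (of_int i)) = q (e 0)" if "even i" for i using that even_vertices by (auto elim: evenE)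
  show T: "tree_edge i \<in> edges" "q (e (of_int (tree_edge i + 1))) = q (e (of_int (i + 1)))" if i: "i \<in> edges" for i
  proof -
   obtain u where u: "i = 2 * u" "0 <= u" "u < n * k" using i unfolding edges_iff by blast
   define b where "b = u div k mod period u"
   have b: "0 <= b" "b < period u" using period_bounds(1) by (simp_all add: b_def)
   have t: "tree_edge i = 2 * (k * b + u mod k)" unfolding tree_edge_def u(1) b_def by simp
   have um: "0 <= u mod k" "u mod k < k" using nk(2) by simp_all
   have "k * (b + 1) <= k * n" using b(2) period_bounds(2)[of u] nk(2) by (intro mult_left_mono) auto
   hence "k * b + u mod k < n * k" using um by (simp add: algebra_simps)
   moreover have "0 <= k * b + u mod k" using b(1) um nk(2) by simp
   ultimately show "tree_edge i \<in> edges" unfolding edges_iff t by blast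
   have "(k * b + u mod k) mod k = u mod k" "(k * b + u mod k) div k = b" using um by simp_all
   moreover have "b mod period u = u div k mod period u" by (simp add: b_def)
   ultimately have "q (e (of_int (2 * (k * b + u mod k) + 1))) = q (e (of_int (2 * u + 1)))"
    unfolding odd_vertices by (simp add: period_def)
   thus "q (e (of_int (tree_edge i + 1))) = q (e (of_int (i + 1)))" unfolding t unfolding u(1) .
  qed
  show "tree_edge i = tree_edge j" if "i \<in> edges" "j \<in> edges" "q (e (of_int (i + 1))) = q (e (of_int (j + 1)))" for i j
  proof -
   obtain u v where uv: "i = 2 * u" "j = 2 * v" using \<open>i \<in> edges\<close> \<open>j \<in> edges\<close> unfolding edges_iff by blast
   show ?thesis using that(3) unfolding uv odd_vertices tree_edge_def by simp
  qed
 qed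
 moreover have "card ?J = 2 * g" using card_non_tree_edges assms by simp
 hence "?J \<approx> {..<2 * g}" by (simp add: eqpoll_iff_card finite_edges)
 hence "free_Abelian_group ?J \<cong> free_Abelian_group {..<2 * g}" by (simp add: isomorphic_free_Abelian_groups)
 ultimately show ?thesis unfolding has_genus_def by (rule iso_trans)
qed

lemma genus_in_spectrum:
 assumes "2 * int g = (\<Sum>j\<in>{0..<k}. n - gcd (c j) n)"
 shows "g \<in> spectrum (Zmod (nat n))"
proof (rule spectrumI[OF compact_riemann_surface_X has_genus_X[OF assms]])
 show "acts_on_surface (Zmod (nat n)) X atlas"
  by (rule rotation_acts[of "2 * k"]) (use nk tau_shift[of _ 1] in auto)
qed

end

section \<open>Spectra of cyclic groups\<close>

lemma spectrum_antimono:
 assumes "f \<in> hom G H" "inj_on f (carrier G)"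
 shows "spectrum H <= spectrum G"
proof
 fix g assume "g \<in> spectrum H"
 then obtain X :: "complex topology" and A where X: "compact_riemann_surface X A" "has_genus X g" "acts_on_surface H X A"
  unfolding spectrum_def by blast
 obtain \<psi> where \<psi>: "\<psi> \<in> hom H (biholomorphism_group X A)" "inj_on \<psi> (carrier H)"
  using X(3) by (auto simp: acts_on_surface_def mon_def)
 have "f ` carrier G <= carrier H" using assms(1) by (auto simp: hom_def)
 hence "inj_on (\<psi> \<circ> f) (carrier G)" using assms(2) \<psi>(2) by (intro comp_inj_on) (auto intro: inj_on_subset)
 moreover have "\<psi> \<circ> f \<in> hom G (biholomorphism_group X A)" by (rule hom_compose[OF assms(1) \<psi>(1)])
 ultimately have "acts_on_surface G X A" unfolding acts_on_surface_def mon_def by blast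
 thus "g \<in> spectrum G" using X(1,2) unfolding spectrum_def by blast
qed

lemma spectrum_iso:
 assumes "group G" "G \<cong> H"
 shows "spectrum G = spectrum H"
proof
 obtain f where "f \<in> iso G H" using assms(2) by (auto simp: is_iso_def)
 thus "spectrum H <= spectrum G" by (intro spectrum_antimono[of f]) (auto simp: iso_def bij_betw_def)
 have "H \<cong> G" by (rule group.iso_sym[OF assms])
 then obtain f where "f \<in> iso H G" by (auto simp: is_iso_def)
 thus "spectrum G <= spectrum H" by (intro spectrum_antimono[of f]) (auto simp: iso_def bij_betw_def)
qed

text \<open>Multiplication by n / m embeds the smaller cyclic group, and a subgroup acts wherever
  the whole group does.\<close>

lemma spectrum_integer_mod_group_dvd:
 assumes "m dvd n" "n > 0"
 shows "spectrum (Zmod n) <= spectrum (Zmod m)"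
proof -
 obtain d where d: "n = m * d" using assms(1) by blast
 have pos: "m > 0" "d > 0" using assms(2) d by auto
 have "(\<lambda>x. x * int d) \<in> hom (Zmod m) (Zmod n)"
  using pos by (intro homI) (auto simp: carrier_integer_mod_group d distrib_right mult_mod_left)
 moreover have "inj_on (\<lambda>x. x * int d) (carrier (Zmod m))" using pos by (auto intro!: inj_onI)
 ultimately show ?thesis by (rule spectrum_antimono)
qed

lemma cyclic_group_iso_integer_mod_group:
 assumes "group G" "cyclic_group G" "order G = n" "n > 0"
 shows "G \<cong> Zmod n"
proof -
 interpret group G by (rule assms(1))
 obtain a where a: "a \<in> carrier G" "carrier G = range (\<lambda>i::int. a [^]\<^bsub>G\<^esub> i)" using assms(2) unfolding cyclic_group by blast
 have "generate G {a} = carrier G" using generate_pow[OF a(1)] a(2) by auto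
 hence ord: "ord a = n" using generate_pow_card[OF a(1)] assms(3) by (simp add: order_def)
 have eq: "a [^]\<^bsub>G\<^esub> i = a [^]\<^bsub>G\<^esub> j \<longleftrightarrow> i mod int n = j mod int n" for i j :: int
  using int_pow_eq[OF a(1), of i j] ord by (metis mod_eq_dvd_iff)
 have "(\<lambda>i. a [^]\<^bsub>G\<^esub> i) \<in> iso (Zmod n) G"
 proof (rule isoI)
  show "(\<lambda>i. a [^]\<^bsub>G\<^esub> i) \<in> hom (Zmod n) G"
  proof (rule homI)
   show "a [^]\<^bsub>G\<^esub> (i \<otimes>\<^bsub>Zmod n\<^esub> j) = a [^]\<^bsub>G\<^esub> i \<otimes>\<^bsub>G\<^esub> a [^]\<^bsub>G\<^esub> j" for i j
    using eq[of "(i + j) mod int n" "i + j"] int_pow_mult[OF a(1), of i j] by simp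
  qed (use a(1) in simp)
  show "bij_betw (\<lambda>i. a [^]\<^bsub>G\<^esub> i) (carrier (Zmod n)) (carrier G)" unfolding bij_betw_def
  proof
   show "inj_on (\<lambda>i. a [^]\<^bsub>G\<^esub> i) (carrier (Zmod n))"
    using assms(4) by (auto intro!: inj_onI simp: eq carrier_integer_mod_group)
   show "(\<lambda>i. a [^]\<^bsub>G\<^esub> i) ` carrier (Zmod n) = carrier G"
   proof
    show "carrier G <= (\<lambda>i. a [^]\<^bsub>G\<^esub> i) ` carrier (Zmod n)"
    proof
     fix x assume "x \<in> carrier G"
     then obtain i :: int where i: "x = a [^]\<^bsub>G\<^esub> i" unfolding a(2) by blast
     have "x = a [^]\<^bsub>G\<^esub> (i mod int n)" unfolding i by (simp add: eq)
     thus "x \<in> (\<lambda>i. a [^]\<^bsub>G\<^esub> i) ` carrier (Zmod n)"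
      using assms(4) by (auto simp: carrier_integer_mod_group)
    qed
   qed (use a(1) in auto)
  qed
 qed
 hence "Zmod n \<cong> G" by (auto simp: is_iso_def)
 thus ?thesis by (rule group.iso_sym[OF group_integer_mod_group])
qed

text \<open>A polygon with one position and step -2: 1 - 2 = -1 is a unit, and twice the genus is 2
  n - gcd(2, 2 n) = 2 (n - 1).\<close>

lemma spectrum_even_cyclic:
 assumes "n > 1"
 shows "n - 1 \<in> spectrum (Zmod (2 * n))"
proof -
 interpret cyclic_polygon "2 * int n" 1 "\<lambda>_. - 2" using assms by unfold_locales auto
 have "n - 1 \<in> spectrum (Zmod (nat (2 * int n)))" using assms by (intro genus_in_spectrum) auto
 thus ?thesis by (simp add: nat_mult_distrib)
qed

text \<open>Take the steps x, 4, ..., 4 with x even: the sum in \<open>coprime_step\<close> is odd,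
  hence prime to 8, and each 4 adds 8 - 4 = 4 to twice the genus. x = 0 starts at genus 0 and x = -2
  at genus 3, which yields all even genera and all odd ones from 3 on; genus 1 is left to the
  torus.\<close>

lemma spectrum_cyclic_8: "spectrum (Zmod 8) = UNIV"
proof -
 have sum: "(\<Sum>j\<in>{0..<int a + 1}. f (if j = 0 then x else 4)) = f x + int a * f 4" for a :: nat and x :: int and f :: "int => int"
 proof -
  have "{0..<int a + 1} = insert 0 {1..<int a + 1}" by auto
  hence "(\<Sum>j\<in>{0..<int a + 1}. f (if j = 0 then x else 4)) = f x + (\<Sum>j\<in>{1..<int a + 1}. f (if j = 0 then x else 4))" by simp
  also have "(\<Sum>j\<in>{1..<int a + 1}. f (if j = 0 then x else 4)) = (\<Sum>j\<in>{1..<int a + 1}. f 4)" by (rule sum.cong) auto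
  finally show ?thesis by simp
 qed
 have odd8: "coprime x (8 :: int)" if "odd x" for x using that coprime_power_right_iff[of x 2 3] by simp
 have gen: "g \<in> spectrum (Zmod 8)"
  if "even x" "2 * int g = 8 - gcd x 8 + int a * 4" for g a :: nat and x :: int
 proof -
  interpret cyclic_polygon 8 "int a + 1" "\<lambda>j. if j = 0 then x else 4"
  proof
   show "coprime (1 + (\<Sum>j\<in>{0..<int a + 1}. if j = 0 then x else 4)) 8"
    using sum[where f = "\<lambda>x. x" and a = a and x = x] that(1) by (intro odd8) simp
  qed auto
  have "2 * int g = (\<Sum>j\<in>{0..<int a + 1}. 8 - gcd (if j = 0 then x else 4) 8)"
   using sum[where f = "\<lambda>x. 8 - gcd x 8" and a = a and x = x] that(2) by simp
  from genus_in_spectrum[OF this] show ?thesis by simp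
 qed
 have "g \<in> spectrum (Zmod 8)" for g
 proof -
  consider a where "g = 2 * a" | "g = 1" | a where "g = 2 * a + 3"
  proof -
   have "g = 2 * (g div 2) \<or> g = 1 \<or> g = 2 * ((g - 3) div 2) + 3" by presburger
   thus thesis using that by blast
  qed
  thus ?thesis
  proof cases
   case (1 a)
   thus ?thesis by (intro gen[of 0 g a]) auto
  next
   case 2
   thus ?thesis using one_in_spectrum_cyclic[of 8] by simp
  next
   case (3 a)
   thus ?thesis by (intro gen[of "- 2" g a]) auto
  qed
 qed
 thus ?thesis by blast
qed

lemma spectrum_cyclic_2_4_8:
 assumes "m \<in> {2, 4, 8}"
 shows "spectrum (Zmod m) = UNIV"
proof -
 have "m dvd 8" using assms by auto
 from spectrum_integer_mod_group_dvd[OF this] show ?thesis using spectrum_cyclic_8 by auto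
qed

section \<open>Smallest genera and their comparison\<close>

lemma min_genus_UNIV: "spectrum G = UNIV ==> min_genus G = 2"
 unfolding min_genus_def by (auto intro: Least_equality)

lemma min_genus_le: "g \<in> spectrum G ==> g \<ge> 2 ==> min_genus G <= g \<and> min_genus G \<in> spectrum G \<and> min_genus G \<ge> 2"
 unfolding min_genus_def using LeastI[of "\<lambda>g. g \<in> spectrum G \<and> g \<ge> 2" g] Least_le[of "\<lambda>g. g \<in> spectrum G \<and> g \<ge> 2" g] by blast

text \<open>Both strict upper bounds come from \<open>spectrum_even_cyclic\<close>. For p = 2 it
  applies to the group itself; for odd p it applies to the cyclic group of twice the order, in which
  the group embeds, at the price of a factor 2.\<close>

lemma min_genus_cyclic_prime_power:
 fixes p k :: nat
 assumes p: "prime p"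
 shows "(p - 1) * p ^ k <= 2 * min_genus (Zmod (p ^ Suc k))"
  and "p = 2 ==> k <= 2 ==> min_genus (Zmod (p ^ Suc k)) = 2"
  and "p = 2 ==> k > 2 ==> min_genus (Zmod (p ^ Suc k)) < 2 ^ k"
  and "p ~= 2 ==> min_genus (Zmod (p ^ Suc k)) < p ^ Suc k"
proof -
 let ?G = "Zmod (p ^ Suc k)"
 have p1: "p > 1" by (rule prime_gt_1_nat[OF p])
 show two: "min_genus ?G = 2" if "p = 2" "k <= 2"
 proof (rule min_genus_UNIV[OF spectrum_cyclic_2_4_8])
  have "k = 0 \<or> k = 1 \<or> k = 2" using that(2) by auto
  thus "p ^ Suc k \<in> {2, 4, 8}" using that(1) by auto
 qed
 have b: "2 ^ k - 1 \<in> spectrum ?G \<and> 2 ^ k - 1 \<ge> (2::nat)" if "p = 2" "k > 2"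
 proof -
  have "(2::nat) ^ 3 <= 2 ^ k" using that(2) by (intro power_increasing) auto
  thus ?thesis using spectrum_even_cyclic[of "2 ^ k"] that(1) by simp
 qed
 have odd: "p ^ Suc k - 1 \<in> spectrum ?G \<and> p ^ Suc k - 1 \<ge> 2" if "p ~= 2"
 proof -
  have "p \<ge> 3" using that p1 by simp
  moreover have "p * 1 <= p ^ Suc k" using p1 by simp
  ultimately have "p ^ Suc k \<ge> 3" by linarith
  moreover from this have "p ^ Suc k - 1 \<in> spectrum (Zmod (2 * p ^ Suc k))"
   by (intro spectrum_even_cyclic) simp
  moreover have "spectrum (Zmod (2 * p ^ Suc k)) <= spectrum ?G"
   using p1 by (intro spectrum_integer_mod_group_dvd) auto
  ultimately show ?thesis by auto
 qed
 show "min_genus ?G < 2 ^ k" if "p = 2" "k > 2"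
  using min_genus_le[of "2 ^ k - 1" ?G] b[OF that] by (metis (no_types) diff_less le_less_trans zero_less_numeral zero_less_one zero_less_power)
 show "min_genus ?G < p ^ Suc k" if "p ~= 2"
  using min_genus_le[of "p ^ Suc k - 1" ?G] odd[OF that] p1 by (metis (no_types) diff_less le_less_trans less_trans zero_less_one zero_less_power)
 have "min_genus ?G \<in> spectrum ?G \<and> min_genus ?G \<ge> 2"
 proof -
  consider "p = 2" "k <= 2" | "p = 2" "k > 2" | "p ~= 2" by linarith
  thus ?thesis
  proof cases
   case 1
   have "k = 0 \<or> k = 1 \<or> k = 2" using 1(2) by auto
   hence "p ^ Suc k \<in> {2, 4, 8}" using 1(1) by auto
   from spectrum_cyclic_2_4_8[OF this] two[OF 1] show ?thesis by simp
  next
   case 2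
   thus ?thesis using min_genus_le b by blast
  next
   case 3
   thus ?thesis using min_genus_le odd by blast
  qed
 qed
 moreover have "cyclic_group ?G"
 proof -
  have "x = 1 [^]\<^bsub>?G\<^esub> x" if "x \<in> carrier ?G" for x
   using that p1 by (simp add: int_pow_integer_mod_group carrier_integer_mod_group)
  moreover have one: "1 \<in> carrier ?G" using p1 one_less_power[of p "Suc k"] by simp
  ultimately show ?thesis unfolding group.cyclic_group[OF group_integer_mod_group]
   by (intro bexI[OF _ one]) (auto intro: group.int_pow_closed[OF group_integer_mod_group])
 qed
 moreover have "order ?G = p ^ Suc k" using p1 by (simp add: order_def carrier_integer_mod_group flip: of_nat_mult of_nat_power)
 ultimately show "(p - 1) * p ^ k <= 2 * min_genus ?G"
  using spectrum_lower_bound[OF group_integer_mod_group _ _ p] by blast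
qed

text \<open>For odd p the bound for k is at least p^k >= p^(j+1), above the genus for j. For p = 2
  it is 2^(k-1) >= 2^j when j > 2, and at least 4 against the value 2 when j <= 2.\<close>

lemma min_genus_less:
 fixes p j k :: nat
 assumes p: "prime p" and jk: "j < k" and not: "\<not> (p = 2 \<and> k <= 2)"
 shows "min_genus (Zmod (p ^ Suc j)) < min_genus (Zmod (p ^ Suc k))"
proof -
 have p1: "p > 1" by (rule prime_gt_1_nat[OF p])
 note lower = min_genus_cyclic_prime_power(1)[OF p, of k]
 show ?thesis
 proof (cases "p = 2")
  case True
  hence k2: "k > 2" using not by simp
  have l: "2 ^ k <= 2 * min_genus (Zmod (p ^ Suc k))" using lower True by simp
  show ?thesis
  proof (cases "j <= 2")
   case True
   have "(2::nat) ^ 3 <= 2 ^ k" using k2 by (intro power_increasing) auto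
   thus ?thesis using l min_genus_cyclic_prime_power(2)[OF p \<open>p = 2\<close> True] by simp
  next
   case False
   have "2 * (2::nat) ^ j <= 2 ^ k" using power_increasing[of "Suc j" k "2::nat"] jk by simp
   moreover have "min_genus (Zmod (p ^ Suc j)) < 2 ^ j"
    using min_genus_cyclic_prime_power(3)[OF p \<open>p = 2\<close>] False by simp
   ultimately show ?thesis using l by linarith
  qed
 next
  case False
  have "p ^ Suc j <= p ^ k" using jk p1 by (intro power_increasing) auto
  moreover have "2 * p ^ k <= (p - 1) * p ^ k" using False p1 by (intro mult_right_mono) auto
  ultimately show ?thesis using lower min_genus_cyclic_prime_power(4)[OF p False, of j] by linarith
 qed
qed

lemma nontrivial_cyclic_p_group_iso:
 assumes p: "prime p" and K: "nontrivial_cyclic_p_group p K"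
 obtains k where "K \<cong> Zmod (p ^ Suc k)"
proof -
 have p1: "p > 1" by (rule prime_gt_1_nat[OF p])
 obtain n where K: "group K" "cyclic_group K" "\<not> trivial_group K" "order K = p ^ n"
  using K unfolding nontrivial_cyclic_p_group_def by blast
 have iso: "K \<cong> Zmod (p ^ n)" using p1 by (intro cyclic_group_iso_integer_mod_group K) simp
 have "n ~= 0"
 proof
  assume "n = 0"
  hence "trivial_group K" using isomorphic_group_triviality[OF iso K(1) group_integer_mod_group]
   by (simp add: trivial_integer_mod_group)
  thus False using K(3) by simp
 qed
 thus thesis using iso that by (cases n) auto
qed

theorem mainTheorem9:
  fixes p :: nat and G :: "'a monoid" and H :: "'b monoid"
  assumes "prime p"
    and "nontrivial_cyclic_p_group p G"
    and "nontrivial_cyclic_p_group p H"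
  shows "(min_genus G = min_genus H \<longleftrightarrow>
            G \<cong> H \<or>
            (\<exists>m\<in>{2, 4, 8}. G \<cong> integer_mod_group m) \<and> (\<exists>m\<in>{2, 4, 8}. H \<cong> integer_mod_group m))
         \<and> (\<forall>m\<in>{2, 4, 8}. spectrum (integer_mod_group m) = UNIV)"
proof
 show "\<forall>m\<in>{2, 4, 8}. spectrum (Zmod m) = UNIV" using spectrum_cyclic_2_4_8 by blast
 have G: "group G" and H: "group H" using assms(2,3) unfolding nontrivial_cyclic_p_group_def by blast+
 obtain j where j: "G \<cong> Zmod (p ^ Suc j)" by (rule nontrivial_cyclic_p_group_iso[OF assms(1,2)])
 obtain k where k: "H \<cong> Zmod (p ^ Suc k)" by (rule nontrivial_cyclic_p_group_iso[OF assms(1,3)])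
 have mg: "min_genus G = min_genus (Zmod (p ^ Suc j))"
  "min_genus H = min_genus (Zmod (p ^ Suc k))"
  using spectrum_iso[OF G j] spectrum_iso[OF H k] unfolding min_genus_def by simp_all
 show "min_genus G = min_genus H \<longleftrightarrow> G \<cong> H \<or> (\<exists>m\<in>{2, 4, 8}. G \<cong> Zmod m) \<and> (\<exists>m\<in>{2, 4, 8}. H \<cong> Zmod m)"
 proof
  assume eq: "min_genus G = min_genus H"
  show "G \<cong> H \<or> (\<exists>m\<in>{2, 4, 8}. G \<cong> Zmod m) \<and> (\<exists>m\<in>{2, 4, 8}. H \<cong> Zmod m)"
  proof (cases "j = k")
   case True
   thus ?thesis using iso_trans[OF j] group.iso_sym[OF H k] by blast
  next
   case False
   \<comment> \<open>Strict growth excludes equal minima for different exponents, except where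
     \<open>min_genus_less\<close> does not apply: p = 2 with the larger exponent at most 2.\<close>
   have small: "p = 2 \<and> j <= 2 \<and> k <= 2"
   proof (cases "j < k")
    case True
    thus ?thesis using min_genus_less[OF assms(1) True] eq mg by fastforce
   next
    case f: False
    hence "k < j" using False by simp
    thus ?thesis using min_genus_less[OF assms(1), of k j] eq mg by fastforce
   qed
   have "p ^ Suc i \<in> {2, 4, 8}" if "i <= 2" for i
   proof -
    have "i = 0 \<or> i = 1 \<or> i = 2" using that by auto
    thus ?thesis using small by auto
   qed
   thus ?thesis using j k small by blast
  qed
 next
  assume "G \<cong> H \<or> (\<exists>m\<in>{2, 4, 8}. G \<cong> Zmod m) \<and> (\<exists>m\<in>{2, 4, 8}. H \<cong> Zmod m)"
  thus "min_genus G = min_genus H"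
  proof
   assume "G \<cong> H"
   from spectrum_iso[OF G this] show ?thesis unfolding min_genus_def by simp
  next
   assume *: "(\<exists>m\<in>{2, 4, 8}. G \<cong> Zmod m) \<and> (\<exists>m\<in>{2, 4, 8}. H \<cong> Zmod m)"
   then obtain m m' where m: "m \<in> {2, 4, 8}" "G \<cong> Zmod m" and m': "m' \<in> {2, 4, 8}" "H \<cong> Zmod m'" by blast
   have "spectrum G = UNIV" using spectrum_iso[OF G m(2)] spectrum_cyclic_2_4_8[OF m(1)] by simp
   moreover have "spectrum H = UNIV" using spectrum_iso[OF H m'(2)] spectrum_cyclic_2_4_8[OF m'(1)] by simp
   ultimately show ?thesis using min_genus_UNIV by metis
  qed
 qed
qed

end
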